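(* Let $p\in(1,\infty)$, $\mu\in(1/p,1]$, and let $X_0,X_1$ be Banach spaces with dense embedding $X_1\hookrightarrow X_0$. Let $X_{\gamma,\mu}:=(X_0,X_1)_{\mu-1/p,p}$, let $V_\mu\subset X_{\gamma,\mu}$ be open and nonempty, let $u_0\in V_\mu$, and let $(A,F):V_\mu\to\mathcal{B}(X_1,X_0)\times X_0$ be locally Lipschitz continuous. Assume in addition that $A(u_0)\in\mathcal{MR}_p(X_1,X_0)$. Then there exist $T=T(u_0)>0$ and $\varepsilon=\varepsilon(u_0)>0$ such that the closed ball $\bar B_\varepsilon^{X_{\gamma,\mu}}(u_0)$ of radius $\varepsilon$ in $X_{\gamma,\mu}$ around $u_0$ is contained in $V_\mu$ and such that, for every initial value $u_1\in\bar B_\varepsilon^{X_{\gamma,\mu}}(u_0)$, the problem $$\dot u+A(u)u=F(u),\ t>0,\qquad u(0)=u_1,$$ has a unique solution $$u(\cdot,u_1)\in H^1_{p,\mu}(0,T;X_0)\cap L_{p,\mu}(0,T;X_1)\cap C([0,T];V_\mu)$$ on $[0,T]$. Furthermore, there exists a constant $c=c(u_0)>0$ such that for all $u_1,u_2\in\bar B_\varepsilon^{X_{\gamma,\mu}}(u_0)$ $$\|u(\cdot,u_1)-u(\cdot,u_2)\|_{\mathbb{E}_{1,\mu}(0,T)}\le c\,|u_1-u_2|_{X_{\gamma,\mu}}.$$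
   Context: $(X_0,X_1)_{\theta,p}$ denotes the real interpolation space of order $\theta$ and exponent $p$; $\mathcal{B}(X_1,X_0)$ is the space of bounded linear operators from $X_1$ to $X_0$. For a Banach space $X$, $J=[0,T]$, $p\in(1,\infty)$, $\mu\in(1/p,1]$: $L_{p,\mu}(J;X):=\{u:J\to X:\ t^{1-\mu}u\in L_p(J;X)\}$ with norm $\|u\|_{L_{p,\mu}}=\|t^{1-\mu}u\|_{L_p}$, and $H^1_{p,\mu}(J;X):=\{u\in L_{p,\mu}(J;X)\cap W^1_1(J;X):\ \dot u\in L_{p,\mu}(J;X)\}$ with norm $\|u\|_{L_{p,\mu}}+\|\dot u\|_{L_{p,\mu}}$. Further, $\mathbb{E}_{1,\mu}(0,T):=H^1_{p,\mu}(0,T;X_0)\cap L_{p,\mu}(0,T;X_1)$ with its natural norm. A solution satisfies the differential equation for almost every $t$. $A_0\in\mathcal{MR}_p(X_1,X_0)$ (maximal $L_p$-regularity) means: $A_0:X_1\to X_0$ is a linear operator (closed in $X_0$ with domain $X_1$) such that for each $f\in L_p(\mathbb{R}_+;X_0)$ there is a unique $u\in H^1_p(\mathbb{R}_+;X_0)\cap L_p(\mathbb{R}_+;X_1)$ with $\dot u+A_0u=f$ for $t>0$, $u(0)=0$. *)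

theory Defs
  imports "HOL-Analysis.Analysis"
begin

section \<open>Bochner integration without separability\<close>

text \<open>The library's \<^const>\<open>has_bochner_integral\<close> requires a second countable codomain. General
  Banach spaces need strong measurability in place of Borel measurability; otherwise the
  definition below is the library's.\<close>

definition strongly_measurable_on :: "real set \<Rightarrow> (real \<Rightarrow> 'x::real_normed_vector) \<Rightarrow> bool" where
  "strongly_measurable_on J f \<longleftrightarrow>
     (\<exists>s. (\<forall>i::nat. simple_function (lebesgue_on J) (s i)) \<and>
          (AE t in lebesgue_on J. (\<lambda>i. s i t) \<longlonglongrightarrow> f t))"

definition has_strong_bochner_integral ::
    "real set \<Rightarrow> (real \<Rightarrow> 'x::real_normed_vector) \<Rightarrow> 'x \<Rightarrow> bool" where
  "has_strong_bochner_integral J f I \<longleftrightarrow>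
     strongly_measurable_on J f \<and>
     (\<exists>s. (\<forall>i::nat. Bochner_Integration.simple_bochner_integrable (lebesgue_on J) (s i)) \<and>
          (\<lambda>i. \<integral>\<^sup>+t. ennreal (norm (f t - s i t)) \<partial>lebesgue_on J) \<longlonglongrightarrow> 0 \<and>
          (\<lambda>i. Bochner_Integration.simple_bochner_integral (lebesgue_on J) (s i)) \<longlonglongrightarrow> I)"

section \<open>Weighted Lebesgue and Sobolev spaces\<close>

text \<open>\<open>J\<close> is an open interval throughout: \<open>{0<..<T}\<close> or \<open>{0<..}\<close>. Functions, rather than
  equivalence classes, are used, and all notions of this section are invariant under changes on
  null sets. For \<open>\<mu> = 1\<close> the weight is \<open>1\<close>, since \<open>t powr 0 = 1\<close> for \<open>t > 0\<close>.\<close>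

definition wLp :: "real set \<Rightarrow> real \<Rightarrow> real \<Rightarrow> (real \<Rightarrow> 'x::real_normed_vector) set" where
  "wLp J p \<mu> = {u. strongly_measurable_on J u \<and>
     (\<integral>\<^sup>+t. ennreal ((norm (t powr (1 - \<mu>) *\<^sub>R u t)) powr p) \<partial>lebesgue_on J) < \<infinity>}"

definition wLp_norm :: "real set \<Rightarrow> real \<Rightarrow> real \<Rightarrow> (real \<Rightarrow> 'x::real_normed_vector) \<Rightarrow> real" where
  "wLp_norm J p \<mu> u =
     enn2real (\<integral>\<^sup>+t. ennreal ((norm (t powr (1 - \<mu>) *\<^sub>R u t)) powr p) \<partial>lebesgue_on J) powr (1 / p)"

abbreviation Lp :: "real set \<Rightarrow> real \<Rightarrow> (real \<Rightarrow> 'x::real_normed_vector) set" where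
  "Lp J p \<equiv> wLp J p 1"

definition test_function :: "real set \<Rightarrow> (real \<Rightarrow> real) \<Rightarrow> bool" where
  "test_function J \<phi> \<longleftrightarrow>
     (\<forall>k::nat. (deriv ^^ k) \<phi> differentiable_on UNIV) \<and>
     (\<exists>K. compact K \<and> K \<subseteq> J \<and> (\<forall>t. t \<notin> K \<longrightarrow> \<phi> t = 0))"

definition has_weak_derivative ::
    "real set \<Rightarrow> (real \<Rightarrow> 'x::real_normed_vector) \<Rightarrow> (real \<Rightarrow> 'x) \<Rightarrow> bool" where
  "has_weak_derivative J u g \<longleftrightarrow>
     (\<forall>\<phi>. test_function J \<phi> \<longrightarrow>
        (\<exists>I. has_strong_bochner_integral J (\<lambda>t. deriv \<phi> t *\<^sub>R u t) I \<and>
             has_strong_bochner_integral J (\<lambda>t. \<phi> t *\<^sub>R g t) (- I)))"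

text \<open>Determined up to null sets where it exists.\<close>
definition weak_derivative ::
    "real set \<Rightarrow> (real \<Rightarrow> 'x::real_normed_vector) \<Rightarrow> real \<Rightarrow> 'x" where
  "weak_derivative J u = (SOME g. has_weak_derivative J u g)"

definition W1 :: "real set \<Rightarrow> real \<Rightarrow> (real \<Rightarrow> 'x::real_normed_vector) set" where
  "W1 J p = {u \<in> Lp J p. \<exists>g \<in> Lp J p. has_weak_derivative J u g}"

definition wH1 :: "real set \<Rightarrow> real \<Rightarrow> real \<Rightarrow> (real \<Rightarrow> 'x::real_normed_vector) set" where
  "wH1 J p \<mu> = {u \<in> wLp J p \<mu> \<inter> W1 J 1. \<exists>g \<in> wLp J p \<mu>. has_weak_derivative J u g}"

definition wH1_norm :: "real set \<Rightarrow> real \<Rightarrow> real \<Rightarrow> (real \<Rightarrow> 'x::real_normed_vector) \<Rightarrow> real" where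
  "wH1_norm J p \<mu> u = wLp_norm J p \<mu> u + wLp_norm J p \<mu> (weak_derivative J u)"

section \<open>Pairs of Banach spaces\<close>

text \<open>The spaces \<open>X\<^sub>0\<close>, \<open>X\<^sub>1\<close> are types \<open>'a\<close>, \<open>'b\<close>, and the embedding is a map \<open>j\<close>. A point of \<open>X\<^sub>0\<close>
  lying in \<open>range j\<close> is regarded as the point \<open>inv j x\<close> of \<open>X\<^sub>1\<close>.\<close>

definition dense_embedding :: "('b::real_normed_vector \<Rightarrow> 'a::real_normed_vector) \<Rightarrow> bool" where
  "dense_embedding j \<longleftrightarrow> bounded_linear j \<and> inj j \<and> closure (range j) = UNIV"

text \<open>\<open>L\<^bsub>p,\<mu>\<^esub>(J; X\<^sub>1)\<close> as a set of \<open>X\<^sub>0\<close>-valued functions.\<close>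
definition wLp_emb :: "('b::real_normed_vector \<Rightarrow> 'a::real_normed_vector) \<Rightarrow>
    real set \<Rightarrow> real \<Rightarrow> real \<Rightarrow> (real \<Rightarrow> 'a) set" where
  "wLp_emb j J p \<mu> = {u. \<exists>v \<in> wLp J p \<mu>. AE t in lebesgue_on J. u t = j (v t)}"

definition E1 :: "('b::real_normed_vector \<Rightarrow> 'a::real_normed_vector) \<Rightarrow>
    real \<Rightarrow> real \<Rightarrow> real \<Rightarrow> (real \<Rightarrow> 'a) set" where
  "E1 j p \<mu> T = wH1 {0<..<T} p \<mu> \<inter> wLp_emb j {0<..<T} p \<mu>"

definition E1_norm :: "('b::real_normed_vector \<Rightarrow> 'a::real_normed_vector) \<Rightarrow>
    real \<Rightarrow> real \<Rightarrow> real \<Rightarrow> (real \<Rightarrow> 'a) \<Rightarrow> real" where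
  "E1_norm j p \<mu> T u =
     wH1_norm {0<..<T} p \<mu> u + wLp_norm {0<..<T} p \<mu> (\<lambda>t. inv j (u t))"

text \<open>Real interpolation by the K-method; \<open>X\<^sub>0 + X\<^sub>1\<close> is \<open>X\<^sub>0\<close> here.\<close>

definition K_functional ::
    "('b::real_normed_vector \<Rightarrow> 'a::real_normed_vector) \<Rightarrow> real \<Rightarrow> 'a \<Rightarrow> real" where
  "K_functional j t x = Inf {norm a + t * norm b | a b. x = a + j b}"

definition interp_integral ::
    "('b::real_normed_vector \<Rightarrow> 'a::real_normed_vector) \<Rightarrow> real \<Rightarrow> real \<Rightarrow> 'a \<Rightarrow> ennreal" where
  "interp_integral j \<theta> p x =
     (\<integral>\<^sup>+t. ennreal ((t powr (- \<theta>) * K_functional j t x) powr p / t) \<partial>lebesgue_on {0<..})"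

definition interp_space ::
    "('b::real_normed_vector \<Rightarrow> 'a::real_normed_vector) \<Rightarrow> real \<Rightarrow> real \<Rightarrow> 'a set" where
  "interp_space j \<theta> p = {x. interp_integral j \<theta> p x < \<infinity>}"

definition interp_norm ::
    "('b::real_normed_vector \<Rightarrow> 'a::real_normed_vector) \<Rightarrow> real \<Rightarrow> real \<Rightarrow> 'a \<Rightarrow> real" where
  "interp_norm j \<theta> p x = enn2real (interp_integral j \<theta> p x) powr (1 / p)"

definition interp_topology ::
    "('b::real_normed_vector \<Rightarrow> 'a::real_normed_vector) \<Rightarrow> real \<Rightarrow> real \<Rightarrow> 'a topology" where
  "interp_topology j \<theta> p =
     Metric_space.mtopology (interp_space j \<theta> p) (\<lambda>x y. interp_norm j \<theta> p (x - y))"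

definition interp_cball ::
    "('b::real_normed_vector \<Rightarrow> 'a::real_normed_vector) \<Rightarrow> real \<Rightarrow> real \<Rightarrow> 'a \<Rightarrow> real \<Rightarrow> 'a set" where
  "interp_cball j \<theta> p =
     Metric_space.mcball (interp_space j \<theta> p) (\<lambda>x y. interp_norm j \<theta> p (x - y))"

definition locally_Lipschitz_interp ::
    "('b::real_normed_vector \<Rightarrow> 'a::real_normed_vector) \<Rightarrow> real \<Rightarrow> real \<Rightarrow> 'a set \<Rightarrow>
     ('a \<Rightarrow> 'y::metric_space) \<Rightarrow> bool" where
  "locally_Lipschitz_interp j \<theta> p V G \<longleftrightarrow>
     (\<forall>v\<in>V. \<exists>r>0. \<exists>L. \<forall>x \<in> V \<inter> interp_cball j \<theta> p v r. \<forall>y \<in> V \<inter> interp_cball j \<theta> p v r.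
        dist (G x) (G y) \<le> L * interp_norm j \<theta> p (x - y))"

section \<open>Maximal regularity and solutions\<close>

text \<open>Initial values refer to the continuous representative, so continuity up to \<open>0\<close> is required
  of the solutions, and uniqueness is equality at every time.\<close>

definition linear_solution :: "('b::real_normed_vector \<Rightarrow> 'a::real_normed_vector) \<Rightarrow> real \<Rightarrow>
    ('b \<Rightarrow> 'a) \<Rightarrow> (real \<Rightarrow> 'a) \<Rightarrow> (real \<Rightarrow> 'a) \<Rightarrow> bool" where
  "linear_solution j p A0 f u \<longleftrightarrow>
     u \<in> W1 {0<..} p \<inter> wLp_emb j {0<..} p 1 \<and> continuous_on {0..} u \<and>
     (AE t in lebesgue_on {0<..}. weak_derivative {0<..} u t + A0 (inv j (u t)) = f t) \<and>
     u 0 = 0"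

definition maximal_regularity :: "('b::real_normed_vector \<Rightarrow> 'a::real_normed_vector) \<Rightarrow> real \<Rightarrow>
    ('b \<Rightarrow> 'a) \<Rightarrow> bool" where
  "maximal_regularity j p A0 \<longleftrightarrow>
     linear A0 \<and> closed (range (\<lambda>x. (j x, A0 x))) \<and>
     (\<forall>f \<in> Lp {0<..} p. \<exists>u. linear_solution j p A0 f u \<and>
        (\<forall>w. linear_solution j p A0 f w \<longrightarrow> (\<forall>t\<ge>0. w t = u t)))"

definition quasilinear_solution ::
    "('b::real_normed_vector \<Rightarrow> 'a::real_normed_vector) \<Rightarrow> real \<Rightarrow> real \<Rightarrow> 'a set \<Rightarrow>
     ('a \<Rightarrow> 'b \<Rightarrow>\<^sub>L 'a) \<Rightarrow> ('a \<Rightarrow> 'a) \<Rightarrow> real \<Rightarrow> 'a \<Rightarrow> (real \<Rightarrow> 'a) \<Rightarrow> bool" where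
  "quasilinear_solution j p \<mu> V A F T u1 u \<longleftrightarrow>
     u \<in> E1 j p \<mu> T \<and>
     continuous_map (top_of_set {0..T}) (subtopology (interp_topology j (\<mu> - 1 / p) p) V) u \<and>
     (AE t in lebesgue_on {0<..<T}.
        weak_derivative {0<..<T} u t + blinfun_apply (A (u t)) (inv j (u t)) = F (u t)) \<and>
     u 0 = u1"

end

theory Submission
 imports Defs
begin

text \<open>
 Write \<open>A\<^sub>0 = A(u\<^sub>0)\<close>. Three facts about the linear problem \<open>u' + A\<^sub>0 u = f\<close>, \<open>u(0) = x\<close> carry the proof.
 (1) Maximal \<open>L\<^sub>p\<close>-regularity implies a norm estimate, by a gliding hump argument with translated
 right-hand sides, and \<open>|u(t)| \<le> M \<integral>\<^sub>0\<^sup>t |f|\<close>, since the integrated semigroup is Lipschitz continuous.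
 (2) For \<open>x = 0\<close> the function \<open>t\<^sup>1\<^sup>-\<^sup>\<mu> u\<close> solves the problem with right-hand side
 \<open>t\<^sup>1\<^sup>-\<^sup>\<mu> f + (1-\<mu>) t\<^sup>-\<^sup>\<mu> u\<close>, whose last term is controlled by the \<open>L\<^sub>1\<close> bound and Hardy's inequality; so maximal
 regularity passes to \<open>L\<^bsub>p,\<mu>\<^esub>\<close>.
 (3) The interpolation space is the space of initial values: averages over \<open>[s,s+\<tau>]\<close> bound the K-functional
 of \<open>u(s)\<close>, and dyadic interpolation of near-optimal decompositions extends \<open>x\<close> to a function in \<open>E\<^bsub>1,\<mu>\<^esub>\<close>.
 The quasilinear problem then is a fixed point problem for the right-hand side
 \<open>f = F(u) + (A\<^sub>0 - A(u)) u\<close> on \<open>(0,T)\<close>, extended by zero. Working with right-hand sides on the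
 half-line keeps all constants independent of \<open>T\<close>; for small \<open>T\<close> and \<open>\<epsilon>\<close> the map contracts, jointly
 with the initial value.
\<close>

text \<open>Maximal regularity enters as bare solvability: no norm bound, no semigroup, no weight. A
  bound of u(t) by the L_p norm of f would not survive multiplication by t^(-mu); the L_1 bound
  does, because the integral of |f| over (0,t), divided by t, is a Hardy mean. It is reached without
  analyticity of a semigroup: solutions for constant right-hand sides determine, by translation,
  those for step functions. The Banach spaces may lack the Radon-Nikodym property, so absolutely
  continuous functions are always carried together with a derivative, and differentiation of norms
  or of vector functions almost everywhere never occurs. Uniqueness is claimed among all solutions
  with values in V, while Lipschitz constants are at hand only near \<open>u0\<close>. This produces
  the radii \<sigma>, 2\<sigma>, 3\<sigma> with \<sigma> = 2 C \<epsilon>: the reference solution of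
  u' + A(u0) u = 0, u(0) = u0 stays within \<sigma> of \<open>u0\<close>, fixed points stay within
  2\<sigma>, and a competing solution that has not left the ball of radius 3\<sigma> coincides with
  the fixed point, hence cannot leave that ball.\<close>

abbreviation smeas :: "real set \<Rightarrow> (real \<Rightarrow> 'x::real_normed_vector) \<Rightarrow> bool" where
 "smeas \<equiv> strongly_measurable_on"
abbreviation "simple_int \<equiv> Bochner_Integration.simple_bochner_integrable"
abbreviation "simple_val \<equiv> Bochner_Integration.simple_bochner_integral"

lemmas HK_integral_add = Henstock_Kurzweil_Integration.integral_add and
 HK_integral_combine = Henstock_Kurzweil_Integration.integral_combine and
 HK_integral_cong = Henstock_Kurzweil_Integration.integral_cong and
 HK_integral_diff = Henstock_Kurzweil_Integration.integral_diff and
 HK_integral_mult_right = Henstock_Kurzweil_Integration.integral_mult_right and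
 HK_integral_norm_bound_integral = Henstock_Kurzweil_Integration.integral_norm_bound_integral and
 HK_integral_spike_set = Henstock_Kurzweil_Integration.integral_spike_set

section \<open>Strong measurability\<close>

lemma AE_lebesgue_on:
 "J \<in> sets lebesgue \<Longrightarrow> (AE t in lebesgue_on J. P t) \<longleftrightarrow> (AE t in lebesgue. t \<in> J \<longrightarrow> P t)"
 by (simp add: AE_restrict_space_iff)

text \<open>Completeness of Lebesgue measure is the reason; extension by zero carries the statement
  from the restricted measure to \<open>lebesgue\<close>.\<close>

lemma borel_measurable_lebesgue_on_cong_AE:
 fixes f g :: "real \<Rightarrow> real"
 assumes J: "J \<in> sets lebesgue" and f: "f \<in> borel_measurable (lebesgue_on J)"
  and eq: "AE t in lebesgue_on J. f t = g t"
 shows "g \<in> borel_measurable (lebesgue_on J)"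
proof -
 have "(\<lambda>t. if t \<in> J then f t else 0) \<in> borel_measurable lebesgue"
  using f J by (simp add: borel_measurable_if)
 moreover have "AE t in lebesgue. (if t \<in> J then f t else 0) = (if t \<in> J then g t else 0)"
  using eq unfolding AE_lebesgue_on[OF J] by eventually_elim auto
 ultimately have "(\<lambda>t. if t \<in> J then g t else 0) \<in> borel_measurable lebesgue"
  by (rule borel_measurable_AE)
 then show ?thesis using J by (simp add: borel_measurable_if)
qed

lemma sm_simple: "simple_function (lebesgue_on J) f \<Longrightarrow> smeas J f"
 unfolding strongly_measurable_on_def by (intro exI[of _ "\<lambda>_. f"]) auto

lemma sm_const [simp]: "smeas J (\<lambda>t. c)"
 by (rule sm_simple) simp

lemma sm_cong_AE:
 assumes "smeas J f" "AE t in lebesgue_on J. f t = g t"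
 shows "smeas J g"
proof -
 obtain s where s: "\<And>i::nat. simple_function (lebesgue_on J) (s i)"
  "AE t in lebesgue_on J. (\<lambda>i. s i t) \<longlonglongrightarrow> f t"
  using assms(1) unfolding strongly_measurable_on_def by blast
 have "AE t in lebesgue_on J. (\<lambda>i. s i t) \<longlonglongrightarrow> g t"
  using s(2) assms(2) by eventually_elim auto
 then show ?thesis unfolding strongly_measurable_on_def using s(1) by blast
qed

lemma sm_cong: "(\<And>t. t \<in> J \<Longrightarrow> f t = g t) \<Longrightarrow> smeas J f = smeas J g"
 by (auto intro!: sm_cong_AE[of J f g] sm_cong_AE[of J g f] AE_I2)

text \<open>A function of two simple functions is simple, so approximating sequences can be composed
  directly and joint continuity gives the limit. Sums, scalar multiples and the application of
  operator-valued functions are instances.\<close>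

lemma sm_compose2:
 assumes h: "continuous_on UNIV (\<lambda>z. h (fst z) (snd z))"
  and "smeas J f" "smeas J g"
 shows "smeas J (\<lambda>t. h (f t) (g t))"
proof -
 obtain s where s: "\<And>i::nat. simple_function (lebesgue_on J) (s i)"
  "AE t in lebesgue_on J. (\<lambda>i. s i t) \<longlonglongrightarrow> f t"
  using assms(2) unfolding strongly_measurable_on_def by blast
 obtain r where r: "\<And>i::nat. simple_function (lebesgue_on J) (r i)"
  "AE t in lebesgue_on J. (\<lambda>i. r i t) \<longlonglongrightarrow> g t"
  using assms(3) unfolding strongly_measurable_on_def by blast
 have "AE t in lebesgue_on J. (\<lambda>i. h (s i t) (r i t)) \<longlonglongrightarrow> h (f t) (g t)"
  using s(2) r(2)
 proof eventually_elim
  case (elim t)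
  then have "(\<lambda>i. (s i t, r i t)) \<longlonglongrightarrow> (f t, g t)" by (rule tendsto_Pair)
  then have "(\<lambda>i. (\<lambda>z. h (fst z) (snd z)) (s i t, r i t)) \<longlonglongrightarrow> (\<lambda>z. h (fst z) (snd z)) (f t, g t)"
   using h by (intro continuous_on_tendsto_compose[OF h]) auto
  then show ?case by simp
 qed
 then show ?thesis unfolding strongly_measurable_on_def
  using s(1) r(1) by (intro exI[of _ "\<lambda>i t. h (s i t) (r i t)"]) (auto intro: simple_function_compose2)
qed

lemma sm_compose:
 assumes "continuous_on UNIV h" "smeas J f"
 shows "smeas J (\<lambda>t. h (f t))"
proof -
 have "continuous_on UNIV (\<lambda>z. h (fst z))"
  using assms(1) by (intro continuous_on_compose2[OF assms(1)] continuous_intros) auto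
 then show ?thesis using sm_compose2[of "\<lambda>x y. h x" J f f] assms(2) by blast
qed

lemma sm_add: "smeas J f \<Longrightarrow> smeas J g \<Longrightarrow>
  smeas J (\<lambda>t. f t + g t)"
 by (rule sm_compose2) (auto intro!: continuous_intros)

lemma sm_diff: "smeas J f \<Longrightarrow> smeas J g \<Longrightarrow>
  smeas J (\<lambda>t. f t - g t)"
 by (rule sm_compose2) (auto intro!: continuous_intros)

lemma sm_scaleR: "smeas J f \<Longrightarrow> smeas J g \<Longrightarrow>
  smeas J (\<lambda>t. f t *\<^sub>R g t)"
 by (rule sm_compose2) (auto intro!: continuous_intros)

lemma sm_norm: "smeas J f \<Longrightarrow> smeas J (\<lambda>t. norm (f t))"
 by (rule sm_compose) (auto intro!: continuous_intros)

lemma sm_blinfun: "smeas J f \<Longrightarrow> smeas J g \<Longrightarrow>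
  smeas J (\<lambda>t. blinfun_apply (f t) (g t))"
 by (rule sm_compose2) (auto intro!: continuous_intros)

lemma sm_linear: "bounded_linear h \<Longrightarrow> smeas J f \<Longrightarrow> smeas J (\<lambda>t. h (f t))"
 by (rule sm_compose) (auto simp: linear_continuous_on)

text \<open>These scalar functions are the data of Pettis' criterion; here they arise as limits of
  the same expressions for the approximating simple functions.\<close>

lemma sm_norm_diff_measurable:
 assumes J: "J \<in> sets lebesgue" and f: "smeas J f"
 shows "(\<lambda>t. norm (f t - d)) \<in> borel_measurable (lebesgue_on J)"
proof -
 obtain s where s: "\<And>i::nat. simple_function (lebesgue_on J) (s i)"
  "AE t in lebesgue_on J. (\<lambda>i. s i t) \<longlonglongrightarrow> f t"
  using f unfolding strongly_measurable_on_def by blast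
 have m: "(\<lambda>t. norm (s i t - d)) \<in> borel_measurable (lebesgue_on J)" for i
  using s(1)[of i] by (intro borel_measurable_simple_function simple_function_compose1[where g="\<lambda>x. norm (x - d)"])
 have "(\<lambda>t. lim (\<lambda>i. norm (s i t - d))) \<in> borel_measurable (lebesgue_on J)"
  using m by (rule borel_measurable_lim_metric)
 moreover have "AE t in lebesgue_on J. lim (\<lambda>i. norm (s i t - d)) = norm (f t - d)"
  using s(2) by eventually_elim (intro limI tendsto_intros)
 ultimately show ?thesis by (rule borel_measurable_lebesgue_on_cong_AE[OF J])
qed

lemma sm_norm_measurable:
 "J \<in> sets lebesgue \<Longrightarrow> smeas J f \<Longrightarrow> (\<lambda>t. norm (f t)) \<in> borel_measurable (lebesgue_on J)"
 using sm_norm_diff_measurable[of J f 0] by simp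

text \<open>Pettis' criterion; the approximating simple functions pick the first of the closest among
 finitely many points of the dense sequence.\<close>

lemma sm_separableI:
 assumes J: "J \<in> sets lebesgue" and m: "\<And>d. (\<lambda>t. norm (f t - d)) \<in> borel_measurable (lebesgue_on J)"
  and D: "countable D" "AE t in lebesgue_on J. f t \<in> closure D"
 shows "smeas J f"
proof (cases "D = {}")
 case True
 then have "AE t in lebesgue_on J. 0 = f t" using D(2) by auto
 then show ?thesis by (rule sm_cong_AE[OF sm_const])
next
 case False
 define d where "d = from_nat_into D"
 have rd: "range d = D" using D(1) False by (simp add: d_def range_from_nat_into)
 define k where "k i t = (LEAST k. k \<le> i \<and> (\<forall>l\<le>i. norm (f t - d k) \<le> norm (f t - d l)))" for i :: nat and t
 have ex: "\<exists>k. k \<le> i \<and> (\<forall>l\<le>i. norm (f t - d k) \<le> norm (f t - d l))" for i t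
 proof -
  have "\<exists>k\<in>{..i}. \<forall>l\<in>{..i}. norm (f t - d k) \<le> norm (f t - d l)"
   using ex_min_if_finite[of "(\<lambda>k. norm (f t - d k)) ` {..i}"] by (force simp: not_less)
  then show ?thesis by auto
 qed
 have k: "k i t \<le> i" "l \<le> i \<Longrightarrow> norm (f t - d (k i t)) \<le> norm (f t - d l)" for i t l
  using LeastI_ex[OF ex[of i t]] unfolding k_def by auto
 have km: "k i \<in> measurable (lebesgue_on J) (count_space UNIV)" for i
 proof -
  note m[measurable]
  show ?thesis unfolding k_def by measurable
 qed
 have "simple_function (lebesgue_on J) (\<lambda>t. d (k i t))" for i
 proof (rule simple_function_compose1[where g=d])
  have "finite (k i ` space (lebesgue_on J))" using k(1) by (auto intro: finite_subset[of _ "{..i}"])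
  then show "simple_function (lebesgue_on J) (k i)" unfolding simple_function_def
   using measurable_sets[OF km] by simp
 qed
 moreover have "AE t in lebesgue_on J. (\<lambda>i. d (k i t)) \<longlonglongrightarrow> f t"
  using D(2)
 proof eventually_elim
  case (elim t)
  show ?case unfolding LIMSEQ_iff
  proof (intro allI impI)
   fix e :: real assume "e > 0"
   then obtain y where "y \<in> D" "dist y (f t) < e" using elim closure_approachable by metis
   then obtain l where l: "dist (d l) (f t) < e" using rd by blast
   have "\<forall>n\<ge>l. norm (d (k n t) - f t) < e"
    using k(2)[of l _ t] l by (force simp: dist_norm norm_minus_commute)
   then show "\<exists>no. \<forall>n\<ge>no. norm (d (k n t) - f t) < e" by blast
  qed
 qed
 ultimately show ?thesis unfolding strongly_measurable_on_def by (intro exI[of _ "\<lambda>i t. d (k i t)"]) auto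
qed

text \<open>The countable set collects the values of all approximating simple functions.\<close>

lemma sm_separableD:
 assumes "smeas J f"
 obtains D where "countable D" "AE t in lebesgue_on J. f t \<in> closure D"
proof -
 obtain s where s: "\<And>i::nat. simple_function (lebesgue_on J) (s i)"
  "AE t in lebesgue_on J. (\<lambda>i. s i t) \<longlonglongrightarrow> f t"
  using assms unfolding strongly_measurable_on_def by blast
 define D where "D = (\<Union>i. s i ` J)"
 have "countable D" unfolding D_def
  using simple_functionD(1)[OF s(1)] by (auto intro!: countable_UN[OF countableI_type] intro: countable_finite)
 moreover have "AE t in lebesgue_on J. f t \<in> closure D"
  using s(2) AE_space
 proof eventually_elim
  case (elim t)
  show ?case unfolding closure_sequential
   using elim by (intro exI[of _ "\<lambda>i. s i t"]) (auto simp: D_def)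
 qed
 ultimately show ?thesis by (rule that)
qed

lemma sm_real_iff:
 fixes f :: "real \<Rightarrow> real"
 assumes J: "J \<in> sets lebesgue"
 shows "smeas J f \<longleftrightarrow> f \<in> borel_measurable (lebesgue_on J)"
proof
 assume f: "f \<in> borel_measurable (lebesgue_on J)"
 show "smeas J f"
 proof (rule sm_separableI[OF J, where D=\<rat>])
  show "AE t in lebesgue_on J. f t \<in> closure \<rat>" by (simp add: Rats_closure_real)
  show "(\<lambda>t. norm (f t - d)) \<in> borel_measurable (lebesgue_on J)" for d using f by measurable
 qed (rule countable_rat)
next
 assume f: "smeas J f"
 obtain s where s: "\<And>i::nat. simple_function (lebesgue_on J) (s i)"
  "AE t in lebesgue_on J. (\<lambda>i. s i t) \<longlonglongrightarrow> f t"
  using f unfolding strongly_measurable_on_def by blast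
 have "(\<lambda>t. lim (\<lambda>i. s i t)) \<in> borel_measurable (lebesgue_on J)"
  using s(1) by (intro borel_measurable_lim_metric borel_measurable_simple_function)
 moreover have "AE t in lebesgue_on J. lim (\<lambda>i. s i t) = f t"
  using s(2) by eventually_elim (intro limI)
 ultimately show "f \<in> borel_measurable (lebesgue_on J)" by (rule borel_measurable_lebesgue_on_cong_AE[OF J])
qed

text \<open>Pettis' criterion replaces a diagonal argument: the distances to a fixed vector pass to
  the limit, and the limit has values in the closure of the union of the countable sets belonging to
  the f n.\<close>

lemma sm_limit:
 fixes f :: "nat \<Rightarrow> real \<Rightarrow> 'x::real_normed_vector"
 assumes J: "J \<in> sets lebesgue" and f: "\<And>n. smeas J (f n)"
  and lim: "AE t in lebesgue_on J. (\<lambda>n. f n t) \<longlonglongrightarrow> g t"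
 shows "smeas J g"
proof -
 have "\<exists>D. countable D \<and> (AE t in lebesgue_on J. f n t \<in> closure D)" for n
  using sm_separableD[OF f[of n]] by blast
 then obtain D where "\<forall>n. countable (D n) \<and> (AE t in lebesgue_on J. f n t \<in> closure (D n))" by metis
 then have D: "\<And>n. countable (D n)" "\<And>n. AE t in lebesgue_on J. f n t \<in> closure (D n)" by auto
 have a: "AE t in lebesgue_on J. \<forall>n. f n t \<in> closure (D n)" using D(2) by (simp add: AE_all_countable)
 show ?thesis
 proof (rule sm_separableI[OF J, of _ "\<Union>n. D n"])
  fix d
  have "(\<lambda>t. lim (\<lambda>i. norm (f i t - d))) \<in> borel_measurable (lebesgue_on J)"
   using sm_norm_diff_measurable[OF J f] by (rule borel_measurable_lim_metric)
  moreover have "AE t in lebesgue_on J. lim (\<lambda>i. norm (f i t - d)) = norm (g t - d)"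
   using lim by eventually_elim (intro limI tendsto_intros)
  ultimately show "(\<lambda>t. norm (g t - d)) \<in> borel_measurable (lebesgue_on J)"
   by (rule borel_measurable_lebesgue_on_cong_AE[OF J])
 next
  show "AE t in lebesgue_on J. g t \<in> closure (\<Union>n. D n)"
   using lim a
  proof eventually_elim
   case (elim t)
   have "f n t \<in> closure (\<Union>n. D n)" for n using elim(2) closure_mono[of "D n" "\<Union>n. D n"] by blast
   then show ?case using closed_sequentially[OF closed_closure _ elim(1)] by blast
  qed
 qed (use D in auto)
qed

lemma sm_subset:
 assumes "smeas J f" "K \<subseteq> J" "K \<in> sets lebesgue" "J \<in> sets lebesgue"
 shows "smeas K f"
proof -
 obtain s where s: "\<And>i::nat. simple_function (lebesgue_on J) (s i)"
  "AE t in lebesgue_on J. (\<lambda>i. s i t) \<longlonglongrightarrow> f t"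
  using assms(1) unfolding strongly_measurable_on_def by blast
 have "simple_function (lebesgue_on K) (s i)" for i
 proof -
  have "(s i) -` {x} \<inter> K \<in> sets (lebesgue_on K)" for x
  proof -
   have "s i -` {x} \<inter> J \<in> sets (lebesgue_on J)" using simple_functionD(2)[OF s(1)[of i], of "{x}"] by simp
   then have "s i -` {x} \<inter> J \<in> sets lebesgue"
    using assms(4) by (simp add: sets_restrict_space_iff)
   then have "(s i -` {x} \<inter> J) \<inter> K \<in> sets lebesgue" using assms(3) by blast
   then show ?thesis using assms(2,3) by (simp add: sets_restrict_space_iff Int_assoc Int_absorb1)
  qed
  moreover have "finite (s i ` K)"
   using simple_functionD(1)[OF s(1)[of i]] assms(2) by (auto intro: finite_subset[OF image_mono])
  ultimately show ?thesis unfolding simple_function_def by simp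
 qed
 moreover have "AE t in lebesgue_on K. (\<lambda>i. s i t) \<longlonglongrightarrow> f t"
  using s(2) unfolding AE_lebesgue_on[OF assms(3)] AE_lebesgue_on[OF assms(4)]
  by eventually_elim (use assms(2) in blast)
 ultimately show ?thesis unfolding strongly_measurable_on_def by blast
qed

text \<open>Both ingredients of Pettis' criterion, scalar measurability and a countable set of
  approximating values, glue along countable covers.\<close>

lemma sm_UN:
 assumes "\<And>n::nat. K n \<in> sets lebesgue" "\<And>n. smeas (K n) f" "J = (\<Union>n. K n)"
 shows "smeas J f"
proof -
 have J: "J \<in> sets lebesgue" using assms by auto
 have "\<exists>D. countable D \<and> (AE t in lebesgue_on (K n). f t \<in> closure D)" for n
  using sm_separableD[OF assms(2)[of n]] by blast
 then obtain D where "\<forall>n. countable (D n) \<and> (AE t in lebesgue_on (K n). f t \<in> closure (D n))" by metis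
 then have D: "\<And>n. countable (D n)" "\<And>n. AE t in lebesgue_on (K n). f t \<in> closure (D n)" by auto
 have a: "AE t in lebesgue. \<forall>n. t \<in> K n \<longrightarrow> f t \<in> closure (D n)"
  using D(2) unfolding AE_lebesgue_on[OF assms(1)] by (simp add: AE_all_countable)
 show ?thesis
 proof (rule sm_separableI[OF J, of _ "\<Union>n. D n"])
  fix d
  show "(\<lambda>t. norm (f t - d)) \<in> borel_measurable (lebesgue_on J)"
  proof (rule measurable_piecewise_restrict[of "range K"])
   fix \<Omega> assume "\<Omega> \<in> range K"
   then obtain n where n: "\<Omega> = K n" by auto
   have KJ: "K n \<subseteq> J" using assms(3) by auto
   show "\<Omega> \<inter> space (lebesgue_on J) \<in> sets (lebesgue_on J)" unfolding n
    using KJ assms(1) J by (simp add: sets_restrict_space_iff Int_absorb2)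
   have "restrict_space (lebesgue_on J) (K n) = lebesgue_on (K n)"
    using KJ J assms(1) by (simp add: restrict_restrict_space Int_absorb1)
   then show "(\<lambda>t. norm (f t - d)) \<in> borel_measurable (restrict_space (lebesgue_on J) \<Omega>)"
    unfolding n using sm_norm_diff_measurable[OF assms(1) assms(2)] by simp
  qed (use assms(3) in auto)
 next
  show "AE t in lebesgue_on J. f t \<in> closure (\<Union>n. D n)"
   unfolding AE_lebesgue_on[OF J] using a
  proof eventually_elim
   case (elim t)
   then show ?case using assms(3) closure_mono[of "D _" "\<Union>n. D n"] by blast
  qed
 qed (use D in auto)
qed

lemma sm_Un:
 assumes "K \<in> sets lebesgue" "L \<in> sets lebesgue" "smeas K f" "smeas L f"
 shows "smeas (K \<union> L) f"
 by (rule sm_UN[of "\<lambda>n. if n = 0 then K else L"]) (use assms in \<open>auto split: if_splits\<close>)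

lemma sm_if:
 assumes "J \<in> sets lebesgue" "K \<in> sets lebesgue" "smeas (J \<inter> K) f" "smeas (J - K) g"
 shows "smeas J (\<lambda>t. if t \<in> K then f t else g t)"
proof -
 have "smeas ((J \<inter> K) \<union> (J - K)) (\<lambda>t. if t \<in> K then f t else g t)"
 proof (rule sm_Un)
  show "smeas (J \<inter> K) (\<lambda>t. if t \<in> K then f t else g t)"
   using assms(3) by (subst sm_cong[of _ _ f]) auto
  show "smeas (J - K) (\<lambda>t. if t \<in> K then f t else g t)"
   using assms(4) by (subst sm_cong[of _ _ g]) auto
 qed (use assms in auto)
 then show ?thesis by (simp add: Int_Diff_Un)
qed

lemma sm_negligible:
 assumes "negligible J" shows "smeas J f"
proof (rule sm_cong_AE[OF sm_const[of J 0]])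
 have J: "J \<in> null_sets lebesgue" using assms by (simp add: negligible_iff_null_sets)
 show "AE t in lebesgue_on J. 0 = f t"
  unfolding AE_lebesgue_on[OF null_setsD2[OF J]] using AE_not_in[OF J] by eventually_elim simp
qed

lemma sm_spike_set:
 assumes "smeas J f" "J \<in> sets lebesgue" "K \<in> sets lebesgue" "negligible (K - J)"
 shows "smeas K f"
proof -
 have "smeas (K \<inter> J \<union> (K - J)) f"
 proof (rule sm_Un)
  show "smeas (K \<inter> J) f" by (rule sm_subset[OF assms(1) Int_lower2 _ assms(2)]) (rule sets.Int[OF assms(3,2)])
  show "smeas (K - J) f" by (rule sm_negligible[OF assms(4)])
 qed (rule sets.Int sets.Diff, fact, fact)+
 then show ?thesis by (simp add: Int_Diff_Un)
qed

text \<open>A subset of the line is separable, and so is its image; this replaces separability of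
  the target space.\<close>

lemma sm_continuous_on:
 assumes J: "J \<in> sets lebesgue" and f: "continuous_on J f"
 shows "smeas J f"
proof -
 obtain T where T: "countable T" "T \<subseteq> J" "J \<subseteq> closure T" using separable by blast
 show ?thesis
 proof (rule sm_separableI[OF J])
  show "(\<lambda>t. norm (f t - d)) \<in> borel_measurable (lebesgue_on J)" for d
   using f by (intro continuous_imp_measurable_on_sets_lebesgue[OF _ J] continuous_intros)
  show "countable (f ` T)" using T by simp
  have "f t \<in> closure (f ` T)" if tJ: "t \<in> J" for t
  proof -
   obtain x where x: "\<And>n::nat. x n \<in> T" "x \<longlonglongrightarrow> t"
    using subsetD[OF T(3) tJ] unfolding closure_sequential by blast
   have "(\<lambda>n. f (x n)) \<longlonglongrightarrow> f t"
    using x T(2) tJ by (intro continuous_on_tendsto_compose[OF f]) (auto intro!: always_eventually)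
   then show ?thesis unfolding closure_sequential
    using x(1) by (intro exI[of _ "\<lambda>n. f (x n)"]) auto
  qed
  then show "AE t in lebesgue_on J. f t \<in> closure (f ` T)" by (intro AE_I2) simp
 qed
qed

lemma lebesgue_shift_sets: "J \<in> sets lebesgue \<Longrightarrow> {t::real. t + a \<in> J} \<in> sets lebesgue"
proof -
 assume J: "J \<in> sets lebesgue"
 have "(\<lambda>t::real. a + 1 * t) \<in> lebesgue \<rightarrow>\<^sub>M lebesgue" using lebesgue_affine_measurable[of "\<lambda>_. 1" a] by simp
 from measurable_sets[OF this J] show ?thesis by (simp add: vimage_def add.commute)
qed

text \<open>Translation invariance, read off from Lebesgue measure being its own image under an
  affine map of slope 1.\<close>

lemma AE_lebesgue_shift:
 assumes "AE t in lebesgue. P t" shows "AE t in lebesgue. P (t + a :: real)"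
proof -
 have m: "(\<lambda>t::real. a + 1 * t) \<in> lebesgue \<rightarrow>\<^sub>M lebesgue" using lebesgue_affine_measurable[of "\<lambda>_. 1" a] by simp
 have "lebesgue = density (distr lebesgue lebesgue (\<lambda>x. a + 1 * x)) (\<lambda>_. ennreal 1)"
  using lebesgue_real_affine[of 1 a] by simp
 also have "\<dots> = distr lebesgue lebesgue (\<lambda>x. a + 1 * x)" by (simp add: density_1)
 finally have "AE t in distr lebesgue lebesgue (\<lambda>x. a + 1 * x). P t" using assms by metis
 then show ?thesis using m AE_distrD[OF m, of P] by (simp add: add.commute)
qed

lemma sm_shift:
 assumes J: "J \<in> sets lebesgue" and f: "smeas J f"
 shows "smeas {t. t + a \<in> J} (\<lambda>t. f (t + a))"
proof -
 note K = lebesgue_shift_sets[OF J, of a]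
 obtain D where D: "countable D" "AE t in lebesgue_on J. f t \<in> closure D" using sm_separableD[OF f] .
 show ?thesis
 proof (rule sm_separableI[OF K _ D(1)])
  fix d
  have m: "(\<lambda>t::real. a + 1 * t) \<in> lebesgue \<rightarrow>\<^sub>M lebesgue" using lebesgue_affine_measurable[of "\<lambda>_. 1" a] by simp
  have "(\<lambda>t. if t \<in> J then norm (f t - d) else 0) \<in> borel_measurable lebesgue"
   using sm_norm_diff_measurable[OF J f] J by (simp add: borel_measurable_if)
  from measurable_compose[OF m this] 
  have "(\<lambda>t. if t \<in> {t. t + a \<in> J} then norm (f (t + a) - d) else 0) \<in> borel_measurable lebesgue"
   by (simp add: add.commute[of a] cong: if_cong)
  then show "(\<lambda>t. norm (f (t + a) - d)) \<in> borel_measurable (lebesgue_on {t. t + a \<in> J})"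
   unfolding borel_measurable_if[OF K, symmetric] .
 next
  have "AE t in lebesgue. t + a \<in> J \<longrightarrow> f (t + a) \<in> closure D"
   using D(2) unfolding AE_lebesgue_on[OF J] by (rule AE_lebesgue_shift)
  then show "AE t in lebesgue_on {t. t + a \<in> J}. f (t + a) \<in> closure D"
   unfolding AE_lebesgue_on[OF K] by simp
 qed
qed

text \<open>The bridge between the two integrals in use: the norms are defined by
  \<open>nn_integral\<close>, whereas the calculus of primitives runs on Henstock-Kurzweil
  integrals.\<close>

lemma
 fixes h :: "real \<Rightarrow> real"
 assumes J: "J \<in> sets lebesgue" and nn: "\<And>t. t \<in> J \<Longrightarrow> 0 \<le> h t"
 shows integrable_on_iff_nn_integral: "h integrable_on J \<longleftrightarrow> h \<in> borel_measurable (lebesgue_on J) \<and> (\<integral>\<^sup>+t. ennreal (h t) \<partial>lebesgue_on J) < \<infinity>"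
  and nn_integral_eq_integral_on: "h integrable_on J \<Longrightarrow> (\<integral>\<^sup>+t. ennreal (h t) \<partial>lebesgue_on J) = ennreal (integral J h)"
proof -
 let ?F = "\<lambda>t. if t \<in> J then h t else 0"
 have F: "\<And>t. 0 \<le> ?F t" using nn by auto
 have eq: "(\<integral>\<^sup>+t. ennreal (h t) \<partial>lebesgue_on J) = (\<integral>\<^sup>+t. ennreal (?F t) \<partial>lebesgue)"
  using J by (subst nn_integral_restrict_space) (auto intro!: nn_integral_cong simp: indicator_def)
 have *: "(h has_integral r) J \<longleftrightarrow> (h \<in> borel_measurable (lebesgue_on J) \<and> (\<integral>\<^sup>+t. ennreal (h t) \<partial>lebesgue_on J) = ennreal r \<and> 0 \<le> r)"  for r :: real
  using has_integral_iff_nn_integral_lebesgue[where f="?F" and r=r, OF F] J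
  by (simp add: has_integral_restrict_UNIV borel_measurable_if eq)
 show "h integrable_on J \<Longrightarrow> (\<integral>\<^sup>+t. ennreal (h t) \<partial>lebesgue_on J) = ennreal (integral J h)"
  using * by (simp add: has_integral_integral)
 show "h integrable_on J \<longleftrightarrow> h \<in> borel_measurable (lebesgue_on J) \<and> (\<integral>\<^sup>+t. ennreal (h t) \<partial>lebesgue_on J) < \<infinity>"
 proof
  assume "h integrable_on J"
  then show "h \<in> borel_measurable (lebesgue_on J) \<and> (\<integral>\<^sup>+t. ennreal (h t) \<partial>lebesgue_on J) < \<infinity>"
   using *[of "integral J h"] by (simp add: has_integral_integral)
 next
  assume h: "h \<in> borel_measurable (lebesgue_on J) \<and> (\<integral>\<^sup>+t. ennreal (h t) \<partial>lebesgue_on J) < \<infinity>"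
  then obtain r where "r \<ge> 0" "(\<integral>\<^sup>+t. ennreal (h t) \<partial>lebesgue_on J) = ennreal r"
   by (metis ennreal_cases infinity_ennreal_def less_irrefl)
  then show "h integrable_on J" using * h by blast
 qed
qed

section \<open>Bochner integrability\<close>

text \<open>Integrals of such functions are taken as Henstock-Kurzweil integrals.\<close>

definition bint :: "real set \<Rightarrow> (real \<Rightarrow> 'x::real_normed_vector) \<Rightarrow> bool" where
 "bint J f \<longleftrightarrow> smeas J f \<and> (\<lambda>t. norm (f t)) integrable_on J"

lemma bintD: "bint J f \<Longrightarrow> smeas J f" "bint J f \<Longrightarrow> (\<lambda>t. norm (f t)) integrable_on J"
 by (auto simp: bint_def)

lemma bint_iff_nn_integral:
 "J \<in> sets lebesgue \<Longrightarrow> bint J f \<longleftrightarrow> smeas J f \<and> (\<integral>\<^sup>+t. ennreal (norm (f t)) \<partial>lebesgue_on J) < \<infinity>"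
 unfolding bint_def by (subst integrable_on_iff_nn_integral) (auto simp: sm_norm_measurable)

text \<open>Discarding the values of the approximants that exceed twice the norm of f supplies the
  majorant 3^p |f|^p, and dominated convergence applies. The exponent 1 serves Bochner
  integrability, the exponent p the approximation of right-hand sides in L_p.\<close>

lemma simple_approx_powr:
 assumes J: "J \<in> sets lebesgue" and f: "smeas J f" and p: "p > 0"
  and fin: "(\<integral>\<^sup>+t. ennreal (norm (f t) powr p) \<partial>lebesgue_on J) < \<infinity>"
 shows "\<exists>s. (\<forall>i::nat. simple_int (lebesgue_on J) (s i) \<and> (\<forall>t. norm (s i t) \<le> 2 * norm (f t))) \<and>
  (\<lambda>i. \<integral>\<^sup>+t. ennreal (norm (f t - s i t) powr p) \<partial>lebesgue_on J) \<longlonglongrightarrow> 0"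
proof -
 let ?M = "lebesgue_on J"
 obtain s0 where s0: "\<And>i::nat. simple_function ?M (s0 i)"
  "AE t in ?M. (\<lambda>i. s0 i t) \<longlonglongrightarrow> f t"
  using f unfolding strongly_measurable_on_def by blast
 define s where "s i t = (if norm (s0 i t) \<le> 2 * norm (f t) then s0 i t else 0)" for i t
 note nf = sm_norm_measurable[OF J f]
 have ns: "norm (s i t) \<le> 2 * norm (f t)" for i t by (simp add: s_def)
 have ss: "simple_function ?M (s i)" for i
 proof -
  have "(\<lambda>t. norm (s0 i t)) \<in> borel_measurable ?M"
   by (intro borel_measurable_simple_function simple_function_compose1[OF s0(1)])
  then have "{t \<in> space ?M. norm (s0 i t) \<le> 2 * norm (f t)} \<in> sets ?M"
   using nf by measurable
  from simple_function_If[OF s0(1)[of i] simple_function_const[of _ 0] this]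
  show ?thesis unfolding s_def .
 qed
 have mf: "(\<lambda>t. norm (f t - s i t) powr p) \<in> borel_measurable ?M" for i
  using sm_norm_measurable[OF J sm_diff[OF f sm_simple[OF ss[of i]]]] by measurable
 have bnd: "norm (f t - s i t) powr p \<le> 3 powr p * norm (f t) powr p" for t i
 proof -
  have "norm (f t - s i t) \<le> 3 * norm (f t)" using norm_triangle_ineq4[of "f t" "s i t"] ns[of i t] by linarith
  then have "norm (f t - s i t) powr p \<le> (3 * norm (f t)) powr p" using p by (intro powr_mono2) auto
  then show ?thesis by (simp add: powr_mult)
 qed
 have lim: "AE t in ?M. (\<lambda>i. s i t) \<longlonglongrightarrow> f t"
  using s0(2)
 proof eventually_elim
  case (elim t)
  show ?case
  proof (cases "f t = 0")
   case True
   then have "s i t = 0" for i using ns[of i t] by simp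
   then show ?thesis using True by simp
  next
   case False
   have "(\<lambda>i. norm (s0 i t)) \<longlonglongrightarrow> norm (f t)" using elim by (rule tendsto_norm)
   then have "eventually (\<lambda>i. norm (s0 i t) < 2 * norm (f t)) sequentially"
    by (rule order_tendstoD) (use False in auto)
   then have "eventually (\<lambda>i. s0 i t = s i t) sequentially" by eventually_elim (simp add: s_def)
   then show ?thesis using elim by (rule Lim_transform_eventually[rotated])
  qed
 qed
 have "(\<lambda>i. \<integral>\<^sup>+t. ennreal (norm (f t - s i t) powr p) \<partial>?M) \<longlonglongrightarrow> (\<integral>\<^sup>+t. 0 \<partial>?M)"
 proof (rule nn_integral_dominated_convergence)
  show "(\<lambda>t. ennreal (norm (f t - s i t) powr p)) \<in> borel_measurable ?M" for i using mf by measurable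
  show "(\<lambda>t. ennreal (3 powr p * norm (f t) powr p)) \<in> borel_measurable ?M" using nf by measurable
  have "(\<integral>\<^sup>+t. ennreal (3 powr p * norm (f t) powr p) \<partial>?M) = ennreal (3 powr p) * (\<integral>\<^sup>+t. ennreal (norm (f t) powr p) \<partial>?M)"
   using nf by (subst nn_integral_cmult[symmetric]) (auto simp: ennreal_mult)
  also have "\<dots> < \<infinity>" using fin by (simp add: ennreal_mult_less_top)
  finally show "(\<integral>\<^sup>+t. ennreal (3 powr p * norm (f t) powr p) \<partial>?M) < \<infinity>" .
  show "AE t in ?M. ennreal (norm (f t - s i t) powr p) \<le> ennreal (3 powr p * norm (f t) powr p)" for i
   using bnd by (intro AE_I2 ennreal_leI)
  show "AE t in ?M. (\<lambda>i. ennreal (norm (f t - s i t) powr p)) \<longlonglongrightarrow> 0"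
   using lim
  proof eventually_elim
   case (elim t)
   have "(\<lambda>i. norm (f t - s i t)) \<longlonglongrightarrow> norm (f t - f t)" using elim by (intro tendsto_intros)
   then have "(\<lambda>i. norm (f t - s i t)) \<longlonglongrightarrow> 0" by simp
   then have "(\<lambda>i. norm (f t - s i t) powr p) \<longlonglongrightarrow> 0" using p by (intro tendsto_zero_powrI[of _ _ _ p]) auto
   then show ?case using tendsto_ennrealI by fastforce
  qed
 qed auto
 moreover have "simple_int ?M (s i)" for i
 proof
  have "(\<integral>\<^sup>+t. ennreal (norm (s i t) powr p) \<partial>?M) \<le> (\<integral>\<^sup>+t. ennreal (2 powr p) * ennreal (norm (f t) powr p) \<partial>?M)"
  proof (intro nn_integral_mono)
   fix t
   have "norm (s i t) powr p \<le> (2 * norm (f t)) powr p" using p ns by (intro powr_mono2) auto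
   then show "ennreal (norm (s i t) powr p) \<le> ennreal (2 powr p) * ennreal (norm (f t) powr p)"
    by (simp add: powr_mult ennreal_mult[symmetric] ennreal_leI)
  qed
  also have "\<dots> = ennreal (2 powr p) * (\<integral>\<^sup>+t. ennreal (norm (f t) powr p) \<partial>?M)"
   using nf by (subst nn_integral_cmult) auto
  also have "\<dots> < \<infinity>" using fin by (simp add: ennreal_mult_less_top)
  finally have "(\<integral>\<^sup>+t. ennreal (norm (s i t) powr p) \<partial>?M) < \<infinity>" .
  moreover have "simple_function ?M (\<lambda>t. ennreal (norm (s i t) powr p))"
   by (rule simple_function_compose1[OF ss, of "\<lambda>x. ennreal (norm x powr p)"])
  ultimately have "emeasure ?M {t \<in> space ?M. ennreal (norm (s i t) powr p) \<noteq> 0} \<noteq> \<infinity>"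
   by (intro simple_function_finite_support) auto
  then show "emeasure ?M {t \<in> space ?M. s i t \<noteq> 0} \<noteq> \<infinity>" by (simp add: ennreal_eq_0_iff)
 qed (rule ss)
 ultimately show ?thesis using ns by (intro exI[of _ s]) auto
qed

lemma simple_has_integral:
 fixes s :: "real \<Rightarrow> 'x::banach"
 assumes J: "J \<in> sets lebesgue" and s: "simple_int (lebesgue_on J) s"
 shows "(s has_integral simple_val (lebesgue_on J) s) J"
proof -
 have sf: "simple_function (lebesgue_on J) s" and fin: "emeasure (lebesgue_on J) {y\<in>J. s y \<noteq> 0} \<noteq> \<infinity>"
  using s by (auto simp: Bochner_Integration.simple_bochner_integrable.simps)
 have finite: "finite (s ` J)" using simple_functionD(1)[OF sf] by simp
 define A where "A y = {t \<in> J. s t = y}" for y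
 have A: "A y \<in> sets lebesgue" for y
 proof -
  have "s -` {y} \<inter> J \<in> sets (lebesgue_on J)" using simple_functionD(2)[OF sf, of "{y}"] by simp
  then have "s -` {y} \<inter> J \<in> sets lebesgue" using J by (simp add: sets_restrict_space_iff)
  then show ?thesis by (simp add: A_def vimage_def Int_def conj_commute)
 qed
 have mA: "measure (lebesgue_on J) (A y) = measure lebesgue (A y)" for y
  using J by (intro measure_restrict_space) (auto simp: A_def)
 have "((\<lambda>t. indicator (A y) t *\<^sub>R y) has_integral measure lebesgue (A y) *\<^sub>R y) UNIV" for y
 \<comment> \<open>The level set of 0 may have infinite measure, but it contributes nothing to the
   integral.\<close>
 proof (cases "y = 0")
  case False
  have "emeasure lebesgue (A y) = emeasure (lebesgue_on J) (A y)"
   using J by (intro emeasure_restrict_space[symmetric]) (auto simp: A_def)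
  also have "\<dots> \<le> emeasure (lebesgue_on J) {y\<in>J. s y \<noteq> 0}"
  proof (rule emeasure_mono)
   have "s -` (- {0}) \<inter> space (lebesgue_on J) \<in> sets (lebesgue_on J)"
    using simple_functionD(2)[OF sf] .
   then show "{y \<in> J. s y \<noteq> 0} \<in> sets (lebesgue_on J)" 
    by (simp add: vimage_def Int_def conj_commute)
  qed (use False in \<open>auto simp: A_def\<close>)
  also have "\<dots> < \<infinity>" using fin by (simp add: less_top)
  finally have "A y \<in> lmeasurable" using A by (intro fmeasurableI) auto
  then show ?thesis by (intro has_integral_scaleR_left) (simp add: lmeasurable_iff_has_integral)
 qed simp
 then have "((\<lambda>t. \<Sum>y\<in>s ` J. indicator (A y) t *\<^sub>R y) has_integral (\<Sum>y\<in>s ` J. measure lebesgue (A y) *\<^sub>R y)) UNIV"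
  by (intro has_integral_sum finite)
 moreover have "(\<Sum>y\<in>s ` J. indicator (A y) t *\<^sub>R y) = (if t \<in> J then s t else 0)" for t
 proof -
  have "(\<Sum>y\<in>s ` J. indicator (A y) t *\<^sub>R y) = (\<Sum>y\<in>s ` J. if y = s t then (if t \<in> J then s t else 0) else 0)"
   by (rule sum.cong) (auto simp: A_def indicator_def)
  then show ?thesis using finite by (auto simp: sum.delta)
 qed
 ultimately have "((\<lambda>t. if t \<in> J then s t else 0) has_integral (\<Sum>y\<in>s ` J. measure lebesgue (A y) *\<^sub>R y)) UNIV"
  by simp
 then have "(s has_integral (\<Sum>y\<in>s ` J. measure lebesgue (A y) *\<^sub>R y)) J"
  by (simp add: has_integral_restrict_UNIV)
 then show ?thesis by (simp add: Bochner_Integration.simple_bochner_integral_def mA[unfolded A_def] A_def)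
qed

text \<open>Cauchy's criterion for tagged divisions: the Riemann sums of F and s differ by at most
  the Riemann sum of norm (F - s), which on fine divisions is close to a small integral. Nothing is
  asked of the target space beyond completeness.\<close>

lemma integrable_L1_limit:
 fixes F :: "real \<Rightarrow> 'x::banach"
 assumes "\<And>e. e > 0 \<Longrightarrow> \<exists>s. s integrable_on {a..b} \<and> (\<lambda>t. norm (F t - s t)) integrable_on {a..b} \<and>
   integral {a..b} (\<lambda>t. norm (F t - s t)) < e"
 shows "F integrable_on {a..b}"
proof -
 have "F integrable_on cbox a b"
  unfolding integrable_Cauchy
 proof (intro allI impI)
  fix e :: real assume "e > 0"
  then have e4: "e/4 > 0" by simp
  from assms[OF e4] obtain s where s: "s integrable_on {a..b}"
   "(\<lambda>t. norm (F t - s t)) integrable_on {a..b}" "integral {a..b} (\<lambda>t. norm (F t - s t)) < e/4" by blast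
  let ?I = "integral {a..b} s" and ?E = "integral {a..b} (\<lambda>t. norm (F t - s t))"
  have e8: "0 < e/8" using \<open>e > 0\<close> by simp
  have "(s has_integral ?I) (cbox a b)" "((\<lambda>t. norm (F t - s t)) has_integral ?E) (cbox a b)"
   using integrable_integral[OF s(1)] integrable_integral[OF s(2)] by simp_all
  note this[unfolded has_integral, rule_format, OF e8]
  then obtain \<gamma>1 \<gamma>2 where
   "gauge \<gamma>1 \<and> (\<forall>D. D tagged_division_of cbox a b \<and> \<gamma>1 fine D \<longrightarrow>
    norm ((\<Sum>(x,K)\<in>D. measure lborel K *\<^sub>R s x) - ?I) < e/8)"
   "gauge \<gamma>2 \<and> (\<forall>D. D tagged_division_of cbox a b \<and> \<gamma>2 fine D \<longrightarrow>
    norm ((\<Sum>(x,K)\<in>D. measure lborel K *\<^sub>R norm (F x - s x)) - ?E) < e/8)"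
   by (elim exE) (rule that)
  then have g1: "gauge \<gamma>1" "\<And>D. D tagged_division_of cbox a b \<Longrightarrow> \<gamma>1 fine D \<Longrightarrow>
    norm ((\<Sum>(x,K)\<in>D. measure lborel K *\<^sub>R s x) - ?I) < e/8"
   and g2: "gauge \<gamma>2" "\<And>D. D tagged_division_of cbox a b \<Longrightarrow> \<gamma>2 fine D \<Longrightarrow>
    norm ((\<Sum>(x,K)\<in>D. measure lborel K *\<^sub>R norm (F x - s x)) - ?E) < e/8"
   by simp_all
  have main: "norm ((\<Sum>(x,K)\<in>D. measure lborel K *\<^sub>R F x) - ?I) < e/2"
   if D: "D tagged_division_of cbox a b" "\<gamma>1 fine D" "\<gamma>2 fine D" for D
  proof -
   have "(\<Sum>(x,K)\<in>D. measure lborel K *\<^sub>R F x) - (\<Sum>(x,K)\<in>D. measure lborel K *\<^sub>R s x)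
     = (\<Sum>(x,K)\<in>D. measure lborel K *\<^sub>R (F x - s x))"
    by (simp add: sum_subtractf[symmetric] case_prod_unfold scaleR_diff_right)
   also have "norm \<dots> \<le> (\<Sum>(x,K)\<in>D. measure lborel K *\<^sub>R norm (F x - s x))"
    by (rule sum_norm_le) (auto simp: case_prod_unfold)
   also have "\<dots> < e/4 + e/8" using g2(2)[OF D(1,3)] s(3) unfolding real_norm_def by linarith
   finally have "norm ((\<Sum>(x,K)\<in>D. measure lborel K *\<^sub>R F x) - (\<Sum>(x,K)\<in>D. measure lborel K *\<^sub>R s x)) < e/4 + e/8" .
   moreover note g1(2)[OF D(1,2)]
   ultimately show ?thesis
    using norm_triangle_ineq[of "(\<Sum>(x,K)\<in>D. measure lborel K *\<^sub>R F x) - (\<Sum>(x,K)\<in>D. measure lborel K *\<^sub>R s x)"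
      "(\<Sum>(x,K)\<in>D. measure lborel K *\<^sub>R s x) - ?I"] by simp
  qed
  show "\<exists>\<gamma>. gauge \<gamma> \<and> (\<forall>D1 D2. D1 tagged_division_of cbox a b \<and> \<gamma> fine D1 \<and>
     D2 tagged_division_of cbox a b \<and> \<gamma> fine D2 \<longrightarrow>
     norm ((\<Sum>(x,K)\<in>D1. measure lborel K *\<^sub>R F x) - (\<Sum>(x,K)\<in>D2. measure lborel K *\<^sub>R F x)) < e)"
  proof (intro exI[of _ "\<lambda>x. \<gamma>1 x \<inter> \<gamma>2 x"] conjI allI impI)
   show "gauge (\<lambda>x. \<gamma>1 x \<inter> \<gamma>2 x)" using g1(1) g2(1) by (rule gauge_Int)
   fix D1 D2
   assume as: "D1 tagged_division_of cbox a b \<and> (\<lambda>x. \<gamma>1 x \<inter> \<gamma>2 x) fine D1 \<and>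
     D2 tagged_division_of cbox a b \<and> (\<lambda>x. \<gamma>1 x \<inter> \<gamma>2 x) fine D2"
   have "norm ((\<Sum>(x,K)\<in>D1. measure lborel K *\<^sub>R F x) - ?I) < e/2"
    by (rule main) (use as in \<open>simp_all only: fine_Int\<close>)
   moreover have "norm ((\<Sum>(x,K)\<in>D2. measure lborel K *\<^sub>R F x) - ?I) < e/2"
    by (rule main) (use as in \<open>simp_all only: fine_Int\<close>)
   ultimately show "norm ((\<Sum>(x,K)\<in>D1. measure lborel K *\<^sub>R F x) - (\<Sum>(x,K)\<in>D2. measure lborel K *\<^sub>R F x)) < e"
    using dist_triangle_half_l[of "(\<Sum>(x,K)\<in>D1. measure lborel K *\<^sub>R F x)" ?I e "(\<Sum>(x,K)\<in>D2. measure lborel K *\<^sub>R F x)"]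
    by (simp add: dist_norm)
  qed
 qed
 then show ?thesis by simp
qed

lemma bint_simple_approx:
 assumes J: "J \<in> sets lebesgue" and f: "bint J f"
 shows "\<exists>s. (\<forall>i::nat. simple_int (lebesgue_on J) (s i)) \<and>
  (\<lambda>i. \<integral>\<^sup>+t. ennreal (norm (f t - s i t)) \<partial>lebesgue_on J) \<longlonglongrightarrow> 0"
 using simple_approx_powr[OF J bintD(1)[OF f], of 1] f by (auto simp: bint_iff_nn_integral[OF J])

lemma simple_bint:
 fixes s :: "real \<Rightarrow> 'x::banach"
 assumes J: "J \<in> sets lebesgue" and s: "simple_int (lebesgue_on J) s"
 shows "bint J s"
proof -
 have sf: "simple_function (lebesgue_on J) s" using s by (auto simp: Bochner_Integration.simple_bochner_integrable.simps)
 have "simple_int (lebesgue_on J) (\<lambda>t. norm (s t))"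
  by (rule Bochner_Integration.simple_bochner_integrable_compose2[OF _ s s, of "\<lambda>x _. norm x"]) simp
 then show ?thesis unfolding bint_def using simple_has_integral[OF J] sm_simple[OF sf] by blast
qed

lemma bint_sub:
 assumes "bint J f" "K \<subseteq> J" "K \<in> sets lebesgue" "J \<in> sets lebesgue"
 shows "bint K f"
proof -
 have "(\<integral>\<^sup>+t. ennreal (norm (f t)) \<partial>lebesgue_on K) \<le> (\<integral>\<^sup>+t. ennreal (norm (f t)) \<partial>lebesgue_on J)"
  using assms(2-) by (subst (1 2) nn_integral_restrict_space) (auto intro!: nn_integral_mono simp: indicator_def)
 then show ?thesis using assms sm_subset[of J f K] by (auto simp: bint_iff_nn_integral)
qed

lemma bint_dominated:
 assumes J: "J \<in> sets lebesgue" and f: "smeas J f" and g: "g integrable_on J"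
  and "\<And>t. t \<in> J \<Longrightarrow> norm (f t) \<le> g t"
 shows "bint J f"
proof -
 have g0: "\<And>t. t \<in> J \<Longrightarrow> 0 \<le> g t" using assms(4) norm_ge_zero order_trans by blast
 have "(\<integral>\<^sup>+t. ennreal (norm (f t)) \<partial>lebesgue_on J) \<le> (\<integral>\<^sup>+t. ennreal (g t) \<partial>lebesgue_on J)"
  using assms(4) by (intro nn_integral_mono ennreal_leI) simp
 moreover have "(\<integral>\<^sup>+t. ennreal (g t) \<partial>lebesgue_on J) < \<infinity>"
  using integrable_on_iff_nn_integral[OF J g0] g by auto
 ultimately show ?thesis using f J by (auto simp: bint_iff_nn_integral)
qed

text \<open>Simple functions approximate f in L_1, which gives integrability on compact intervals;
  the integrable majorant \<open>norm (f t)\<close> extends it to all of J.\<close>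

lemma bint_integrable:
 fixes f :: "real \<Rightarrow> 'x::banach"
 assumes J: "J \<in> sets lebesgue" and f: "bint J f"
 shows "f integrable_on J"
proof (rule integrable_on_all_intervals_integrable_bound)
 show "(\<lambda>t. norm (f t)) integrable_on J" by (rule bintD(2)[OF f])
 fix a b :: real
 let ?F = "\<lambda>t. if t \<in> J then f t else 0"
 obtain s where s: "\<And>i::nat. simple_int (lebesgue_on J) (s i)"
  "(\<lambda>i. \<integral>\<^sup>+t. ennreal (norm (f t - s i t)) \<partial>lebesgue_on J) \<longlonglongrightarrow> 0"
  using bint_simple_approx[OF J f] by blast
 have "?F integrable_on {a..b}"
 proof (rule integrable_L1_limit)
  fix e :: real assume e: "e > 0"
  have "eventually (\<lambda>i. (\<integral>\<^sup>+t. ennreal (norm (f t - s i t)) \<partial>lebesgue_on J) < ennreal e) sequentially"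
   using s(2) e by (intro order_tendstoD(2)) auto
  then obtain i where i: "(\<integral>\<^sup>+t. ennreal (norm (f t - s i t)) \<partial>lebesgue_on J) < ennreal e"
   by (auto simp: eventually_sequentially)
  let ?S = "\<lambda>t. if t \<in> J then s i t else 0"
  have S: "?S integrable_on UNIV" using simple_has_integral[OF J s(1)[of i]]
   by (auto simp: integrable_restrict_UNIV)
  have d: "bint J (\<lambda>t. f t - s i t)"
   using i sm_diff[OF bintD(1)[OF f] bintD(1)[OF simple_bint[OF J s(1)[of i]]]]
   by (auto simp: bint_iff_nn_integral[OF J] intro: order.strict_trans[OF _ ennreal_less_top])
  have eqf: "(\<lambda>t. norm (?F t - ?S t)) = (\<lambda>t. if t \<in> J then norm (f t - s i t) else 0)" by auto
  have int: "(\<lambda>t. norm (?F t - ?S t)) integrable_on UNIV"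
   using bintD(2)[OF d] unfolding eqf integrable_restrict_UNIV .
  have "integral UNIV (\<lambda>t. norm (?F t - ?S t)) = integral J (\<lambda>t. norm (f t - s i t))"
   unfolding eqf by (rule integral_restrict_UNIV)
  also have "\<dots> < e"
   using i nn_integral_eq_integral_on[OF J, of "\<lambda>t. norm (f t - s i t)"] bintD(2)[OF d] e
   by (simp add: ennreal_less_iff integral_nonneg)
  finally have lt: "integral UNIV (\<lambda>t. norm (?F t - ?S t)) < e" .
  have sub: "(\<lambda>t. norm (?F t - ?S t)) integrable_on {a..b}" 
   using int by (rule integrable_on_subinterval) auto
  have "integral {a..b} (\<lambda>t. norm (?F t - ?S t)) \<le> integral UNIV (\<lambda>t. norm (?F t - ?S t))"
   by (rule integral_subset_le[OF _ sub int]) auto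
  then show "\<exists>s. s integrable_on {a..b} \<and> (\<lambda>t. norm (?F t - s t)) integrable_on {a..b} \<and>
   integral {a..b} (\<lambda>t. norm (?F t - s t)) < e"
   using integrable_on_subinterval[OF S, of a b] sub lt by (intro exI[of _ ?S]) auto
 qed
 then show "?F integrable_on cbox a b" by simp
qed simp

lemma bint_norm_integral_le:
 fixes f :: "real \<Rightarrow> 'x::banach"
 assumes "J \<in> sets lebesgue" "bint J f"
 shows "norm (integral J f) \<le> integral J (\<lambda>t. norm (f t))"
 by (rule HK_integral_norm_bound_integral[OF bint_integrable[OF assms] bintD(2)[OF assms(2)]]) simp

lemma bint_cong_AE:
 assumes "J \<in> sets lebesgue" "bint J f" "AE t in lebesgue_on J. f t = g t"
 shows "bint J g"
proof -
 have "(\<integral>\<^sup>+t. ennreal (norm (f t)) \<partial>lebesgue_on J) = (\<integral>\<^sup>+t. ennreal (norm (g t)) \<partial>lebesgue_on J)"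
 proof (rule nn_integral_cong_AE)
  show "AE t in lebesgue_on J. ennreal (norm (f t)) = ennreal (norm (g t))"
   using assms(3) by eventually_elim simp
 qed
 then show ?thesis using assms sm_cong_AE[of J f g] by (simp add: bint_iff_nn_integral)
qed

lemma bint_cong: "(\<And>t. t \<in> J \<Longrightarrow> f t = g t) \<Longrightarrow> bint J f = bint J g"
 unfolding bint_def using sm_cong[of J f g] integrable_cong[of J "\<lambda>t. norm (f t)" "\<lambda>t. norm (g t)"] by auto

lemma bint_linear:
 assumes J: "J \<in> sets lebesgue" and h: "bounded_linear h" and f: "bint J f"
 shows "bint J (\<lambda>t. h (f t))"
proof -
 obtain K where K: "\<And>x. norm (h x) \<le> norm x * K" using bounded_linear.bounded[OF h] by blast
 show ?thesis
  by (rule bint_dominated[OF J sm_linear[OF h bintD(1)[OF f]] integrable_on_mult_left[OF bintD(2)[OF f], of K]])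
   (rule K)
qed

lemma bint_add: "J \<in> sets lebesgue \<Longrightarrow> bint J f \<Longrightarrow> bint J g \<Longrightarrow> bint J (\<lambda>t. f t + g t)"
 by (rule bint_dominated[where g="\<lambda>t. norm (f t) + norm (g t)"])
  (auto simp: bint_def sm_add norm_triangle_ineq intro: integrable_add)

lemma bint_diff: "J \<in> sets lebesgue \<Longrightarrow> bint J f \<Longrightarrow> bint J g \<Longrightarrow> bint J (\<lambda>t. f t - g t)"
 by (rule bint_dominated[where g="\<lambda>t. norm (f t) + norm (g t)"])
  (auto simp: bint_def sm_diff norm_triangle_ineq4 intro: integrable_add)

lemma bint_scale: "J \<in> sets lebesgue \<Longrightarrow> bint J f \<Longrightarrow> bint J (\<lambda>t. c *\<^sub>R f t)"
 by (rule bint_linear) (auto intro: bounded_linear_scaleR_right)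

lemma bint_bounded_mult:
 assumes J: "J \<in> sets lebesgue" and \<phi>: "smeas J \<phi>" "\<And>t. t \<in> J \<Longrightarrow> \<bar>\<phi> t\<bar> \<le> B" and f: "bint J f"
 shows "bint J (\<lambda>t. \<phi> t *\<^sub>R f t)"
 by (rule bint_dominated[OF J sm_scaleR[OF \<phi>(1) bintD(1)[OF f]] integrable_on_mult_right[OF bintD(2)[OF f], of B]])
  (use \<phi>(2) in \<open>simp add: mult_right_mono\<close>)

lemma bint_continuous: "continuous_on {a..b} f \<Longrightarrow> bint {a..b} f"
 unfolding bint_def by (auto intro!: sm_continuous_on integrable_continuous_real continuous_intros)

lemma bint_spike_set:
 assumes "bint J f" "J \<in> sets lebesgue" "K \<in> sets lebesgue" "negligible (K - J)" "negligible (J - K)"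
 shows "bint K f"
 unfolding bint_def using sm_spike_set[OF bintD(1)[OF assms(1)] assms(2,3,4)]
  integrable_spike_set[OF bintD(2)[OF assms(1)], of K] assms(4,5)
 by (auto intro: negligible_subset)

lemma bint_Un:
 assumes "K \<in> sets lebesgue" "L \<in> sets lebesgue" "bint K f" "bint L f"
 shows "bint (K \<union> L) f"
proof -
 have "(\<integral>\<^sup>+t. ennreal (norm (f t)) \<partial>lebesgue_on (K \<union> L)) \<le>
   (\<integral>\<^sup>+t. ennreal (norm (f t)) * indicator K t + ennreal (norm (f t)) * indicator L t \<partial>lebesgue)"
  using assms by (subst nn_integral_restrict_space) (auto intro!: nn_integral_mono simp: indicator_def)
 also have "\<dots> = (\<integral>\<^sup>+t. ennreal (norm (f t)) * indicator K t \<partial>lebesgue) + (\<integral>\<^sup>+t. ennreal (norm (f t)) * indicator L t \<partial>lebesgue)"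
 proof (rule nn_integral_add)
  have "(\<lambda>t. ennreal (norm (f t)) * indicator S t) \<in> borel_measurable lebesgue"
   if S: "S \<in> sets lebesgue" and b: "bint S f" for S
   using borel_measurable_restrict_space_iff_ennreal[of S lebesgue "\<lambda>t. ennreal (norm (f t))"]
    sm_norm_measurable[OF S bintD(1)[OF b]] S by (simp add: mult.commute)
  then show "(\<lambda>t. ennreal (norm (f t)) * indicator K t) \<in> borel_measurable lebesgue"
   "(\<lambda>t. ennreal (norm (f t)) * indicator L t) \<in> borel_measurable lebesgue" using assms by auto
 qed
 also have "\<dots> < \<infinity>"
  using assms by (auto simp: bint_iff_nn_integral nn_integral_restrict_space)
 finally show ?thesis using assms sm_Un[of K L f] by (simp add: bint_iff_nn_integral)
qed

text \<open>On simple functions the two integrals agree, and in the limit the error is at most the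
  L_1 distance. Thereby the Bochner integrals of the definitions become Henstock-Kurzweil integrals
  of \<open>bint\<close> functions.\<close>

lemma has_strong_bochner_integral_iff:
 fixes f :: "real \<Rightarrow> 'x::banach"
 assumes J: "J \<in> sets lebesgue"
 shows "has_strong_bochner_integral J f I \<longleftrightarrow> bint J f \<and> I = integral J f"
proof -
 have key: "(\<lambda>i. simple_val (lebesgue_on J) (s i)) \<longlonglongrightarrow> integral J f"
  if f: "bint J f" and s: "\<And>i::nat. simple_int (lebesgue_on J) (s i)"
   "(\<lambda>i. \<integral>\<^sup>+t. ennreal (norm (f t - s i t)) \<partial>lebesgue_on J) \<longlonglongrightarrow> 0" for s
 proof -
  have d: "bint J (\<lambda>t. f t - s i t)" for i by (rule bint_diff[OF J f simple_bint[OF J s(1)]])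
  have "(\<lambda>i. ennreal (integral J (\<lambda>t. norm (f t - s i t)))) \<longlonglongrightarrow> 0"
   using s(2) nn_integral_eq_integral_on[OF J _ bintD(2)[OF d]] by simp
  then have lim: "(\<lambda>i. integral J (\<lambda>t. norm (f t - s i t))) \<longlonglongrightarrow> 0"
   by (subst (asm) ennreal_0[symmetric], subst (asm) tendsto_ennreal_iff)
    (auto intro!: always_eventually integral_nonneg bintD(2)[OF d])
  have "norm (simple_val (lebesgue_on J) (s i) - integral J f) \<le> integral J (\<lambda>t. norm (f t - s i t))" for i
  proof -
   have "integral J (\<lambda>t. f t - s i t) = integral J f - simple_val (lebesgue_on J) (s i)"
    using simple_has_integral[OF J s(1)[of i]] bint_integrable[OF J f]
    by (subst integral_diff) (auto simp: integral_unique)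
   then show ?thesis using bint_norm_integral_le[OF J d[of i]] by (simp add: norm_minus_commute)
  qed
  then have "(\<lambda>i. simple_val (lebesgue_on J) (s i) - integral J f) \<longlonglongrightarrow> 0"
   by (intro Lim_null_comparison[OF _ lim] always_eventually) auto
  then show ?thesis by (rule LIM_zero_cancel)
 qed
 show ?thesis
 proof
  assume "has_strong_bochner_integral J f I"
  then obtain s where sm: "smeas J f" and s: "\<And>i::nat. simple_int (lebesgue_on J) (s i)"
   "(\<lambda>i. \<integral>\<^sup>+t. ennreal (norm (f t - s i t)) \<partial>lebesgue_on J) \<longlonglongrightarrow> 0"
   "(\<lambda>i. simple_val (lebesgue_on J) (s i)) \<longlonglongrightarrow> I"
   unfolding has_strong_bochner_integral_def by blast
  have "eventually (\<lambda>i. (\<integral>\<^sup>+t. ennreal (norm (f t - s i t)) \<partial>lebesgue_on J) < ennreal 1) sequentially"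
   using s(2) by (intro order_tendstoD(2)) auto
  then obtain i where i: "(\<integral>\<^sup>+t. ennreal (norm (f t - s i t)) \<partial>lebesgue_on J) < ennreal 1"
   by (auto simp: eventually_sequentially)
  have "(\<integral>\<^sup>+t. ennreal (norm (f t - s i t)) \<partial>lebesgue_on J) < \<infinity>" using i by (rule order.strict_trans) simp
  then have "bint J (\<lambda>t. f t - s i t)"
   using sm_diff[OF sm bintD(1)[OF simple_bint[OF J s(1)[of i]]]] by (simp add: bint_iff_nn_integral[OF J])
  from bint_add[OF J this simple_bint[OF J s(1)[of i]]] have f: "bint J f" by simp
  then show "bint J f \<and> I = integral J f" using key[OF f s(1,2)] s(3) LIMSEQ_unique by blast
 next
  assume f: "bint J f \<and> I = integral J f"
  then obtain s where s: "\<And>i::nat. simple_int (lebesgue_on J) (s i)"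
   "(\<lambda>i. \<integral>\<^sup>+t. ennreal (norm (f t - s i t)) \<partial>lebesgue_on J) \<longlonglongrightarrow> 0"
   using bint_simple_approx[OF J] by blast
  then show "has_strong_bochner_integral J f I"
   unfolding has_strong_bochner_integral_def using key[of s] f bintD(1)[of J f] by blast
 qed
qed

section \<open>Weighted Lebesgue spaces\<close>

lemma powr_convex_nonneg:
 fixes x y a b p :: real
 assumes "0 \<le> x" "0 \<le> y" "0 < a" "0 < b" "a + b = 1" "1 \<le> p"
 shows "(a * x + b * y) powr p \<le> a * x powr p + b * y powr p"
proof -
 have le: "(c * z) powr p \<le> c * z powr p" if "0 < c" "c \<le> 1" "0 \<le> z" for c z :: real
 proof -
  have "c powr p \<le> c powr 1" using that assms(6) by (intro powr_mono') auto
  then show ?thesis using that by (simp add: powr_mult mult_right_mono)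
 qed
 consider "x = 0" | "y = 0" | "x > 0" "y > 0" using assms by linarith
 then show ?thesis
 proof cases
  case 1 then show ?thesis using le[of b y] assms by simp
 next
  case 2 then show ?thesis using le[of a x] assms by simp
 next
  case 3
  have a: "a = 1 - b" using assms(5) by simp
  show ?thesis using convex_onD[OF powr_convex[OF assms(6)], of b x y] 3 assms(3,4) unfolding a by simp
 qed
qed

lemma ennreal_lincomb:
 "c \<ge> 0 \<Longrightarrow> d \<ge> 0 \<Longrightarrow> x \<ge> 0 \<Longrightarrow> y \<ge> 0 \<Longrightarrow>
  ennreal (c * x + d * y) = ennreal c * ennreal x + ennreal d * ennreal y"
 by (simp add: ennreal_mult)

text \<open>The p-th power of the weighted norm, kept in \<open>ennreal\<close> so that monotone,
  dominated and Fatou arguments apply before finiteness is known.\<close>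

definition wint :: "real set \<Rightarrow> real \<Rightarrow> real \<Rightarrow> (real \<Rightarrow> 'x::real_normed_vector) \<Rightarrow> ennreal" where
 "wint J p \<mu> u = (\<integral>\<^sup>+t. ennreal ((norm (t powr (1 - \<mu>) *\<^sub>R u t)) powr p) \<partial>lebesgue_on J)"

lemma wLp_iff: "u \<in> wLp J p \<mu> \<longleftrightarrow> smeas J u \<and> wint J p \<mu> u < \<infinity>"
 by (simp add: wLp_def wint_def)

lemma wLp_norm_wint: "wLp_norm J p \<mu> u = enn2real (wint J p \<mu> u) powr (1 / p)"
 by (simp add: wLp_norm_def wint_def)

lemma wLp_sm: "u \<in> wLp J p \<mu> \<Longrightarrow> smeas J u" by (simp add: wLp_iff)

lemma wLp_norm_nonneg [simp]: "0 \<le> wLp_norm J p \<mu> u" by (simp add: wLp_norm_wint)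

lemma wint_eq:
 assumes "p \<ge> 1" "u \<in> wLp J p \<mu>"
 shows "wint J p \<mu> u = ennreal (wLp_norm J p \<mu> u powr p)"
proof -
 have "wint J p \<mu> u < top" using assms(2) by (simp add: wLp_iff)
 then show ?thesis using assms(1) by (simp add: wLp_norm_wint powr_powr)
qed

lemma wLpI:
 assumes "p \<ge> 1" "smeas J u" "wint J p \<mu> u \<le> ennreal (c powr p)" "c \<ge> 0"
 shows "u \<in> wLp J p \<mu>" "wLp_norm J p \<mu> u \<le> c"
proof -
 have lt: "wint J p \<mu> u < \<infinity>" using assms(3) by (rule order.strict_trans1) simp
 then show u: "u \<in> wLp J p \<mu>" using assms(2) by (simp add: wLp_iff)
 have "enn2real (wint J p \<mu> u) \<le> c powr p" using assms(3) by (intro enn2real_leI) auto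
 then have "wLp_norm J p \<mu> u \<le> (c powr p) powr (1/p)" unfolding wLp_norm_wint using assms(1) by (intro powr_mono2) auto
 also have "\<dots> = c" using assms(1,4) by (simp add: powr_powr)
 finally show "wLp_norm J p \<mu> u \<le> c" .
qed

lemma sm_powr: "J \<in> sets lebesgue \<Longrightarrow> smeas J (\<lambda>t::real. t powr a)"
proof -
 assume J: "J \<in> sets lebesgue"
 have "(\<lambda>t::real. t powr a) \<in> borel_measurable borel" by measurable
 then have "(\<lambda>t::real. t powr a) \<in> borel_measurable lebesgue" by (intro measurable_completion) simp
 then show ?thesis using J by (simp add: sm_real_iff measurable_restrict_space1)
qed

lemma wint_measurable:
 assumes J: "J \<in> sets lebesgue" and u: "smeas J u"
 shows "(\<lambda>t. ennreal ((norm (t powr (1 - \<mu>) *\<^sub>R u t)) powr p)) \<in> borel_measurable (lebesgue_on J)"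
 using sm_norm_measurable[OF J sm_scaleR[OF sm_powr[OF J, of "1-\<mu>"] u]] by measurable

text \<open>The source of most membership and norm estimates. The two functions may take values in
  different spaces, so that a vector-valued function can be compared with a scalar majorant.\<close>

lemma wLp_mono:
 fixes u :: "real \<Rightarrow> 'x::real_normed_vector" and v :: "real \<Rightarrow> 'y::real_normed_vector"
 assumes p: "p \<ge> 1" and J: "J \<in> sets lebesgue" and u: "smeas J u" and v: "v \<in> wLp J p \<mu>"
  and c: "c \<ge> 0" and le: "AE t in lebesgue_on J. norm (u t) \<le> c * norm (v t)"
 shows "u \<in> wLp J p \<mu>" "wLp_norm J p \<mu> u \<le> c * wLp_norm J p \<mu> v"
proof -
 have "wint J p \<mu> u \<le> (\<integral>\<^sup>+t. ennreal (c powr p) * ennreal ((norm (t powr (1 - \<mu>) *\<^sub>R v t)) powr p) \<partial>lebesgue_on J)"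
  unfolding wint_def
 proof (rule nn_integral_mono_AE)
  show "AE t in lebesgue_on J. ennreal (norm (t powr (1 - \<mu>) *\<^sub>R u t) powr p) \<le>
    ennreal (c powr p) * ennreal ((norm (t powr (1 - \<mu>) *\<^sub>R v t)) powr p)"
   using le
  proof eventually_elim
   case (elim t)
   have "norm (t powr (1 - \<mu>) *\<^sub>R u t) \<le> c * norm (t powr (1 - \<mu>) *\<^sub>R v t)"
    using mult_left_mono[OF elim, of "t powr (1-\<mu>)"] by (simp add: algebra_simps)
   then have "norm (t powr (1 - \<mu>) *\<^sub>R u t) powr p \<le> (c * norm (t powr (1 - \<mu>) *\<^sub>R v t)) powr p"
    using p by (intro powr_mono2) auto
   then show ?case using c by (simp add: powr_mult ennreal_mult[symmetric] ennreal_leI)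
  qed
 qed
 also have "\<dots> = ennreal (c powr p) * wint J p \<mu> v"
  unfolding wint_def by (rule nn_integral_cmult[OF wint_measurable[OF J wLp_sm[OF v]]])
 also have "\<dots> = ennreal ((c * wLp_norm J p \<mu> v) powr p)"
  using wint_eq[OF p v] c by (simp add: ennreal_mult powr_mult)
 finally have "wint J p \<mu> u \<le> ennreal ((c * wLp_norm J p \<mu> v) powr p)" .
 from wLpI[OF p u this] c show "u \<in> wLp J p \<mu>" "wLp_norm J p \<mu> u \<le> c * wLp_norm J p \<mu> v" by auto
qed

lemma wLp_cong_AE:
 assumes p: "p \<ge> 1" and J: "J \<in> sets lebesgue" and u: "u \<in> wLp J p \<mu>" and eq: "AE t in lebesgue_on J. u t = v t"
 shows "v \<in> wLp J p \<mu>" "wLp_norm J p \<mu> v = wLp_norm J p \<mu> u"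
proof -
 note v = sm_cong_AE[OF wLp_sm[OF u] eq]
 have 1: "AE t in lebesgue_on J. norm (v t) \<le> 1 * norm (u t)" using eq by eventually_elim simp
 have 2: "AE t in lebesgue_on J. norm (u t) \<le> 1 * norm (v t)" using eq by eventually_elim simp
 show a: "v \<in> wLp J p \<mu>" by (rule wLp_mono(1)[OF p J v u _ 1]) simp
 have "wLp_norm J p \<mu> v \<le> 1 * wLp_norm J p \<mu> u" by (rule wLp_mono(2)[OF p J v u _ 1]) simp
 moreover have "wLp_norm J p \<mu> u \<le> 1 * wLp_norm J p \<mu> v" by (rule wLp_mono(2)[OF p J wLp_sm[OF u] a _ 2]) simp
 ultimately show "wLp_norm J p \<mu> v = wLp_norm J p \<mu> u" by simp
qed

lemma wLp_linear:
 assumes p: "p \<ge> 1" and J: "J \<in> sets lebesgue" and u: "u \<in> wLp J p \<mu>"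
  and h: "bounded_linear h" and K: "\<And>x. norm (h x) \<le> K * norm x" "K \<ge> 0"
 shows "(\<lambda>t. h (u t)) \<in> wLp J p \<mu>" "wLp_norm J p \<mu> (\<lambda>t. h (u t)) \<le> K * wLp_norm J p \<mu> u"
 using wLp_mono[OF p J sm_linear[OF h wLp_sm[OF u]] u K(2)] K(1) by auto

lemma wLp_scale:
 assumes p: "p \<ge> 1" and J: "J \<in> sets lebesgue" and u: "u \<in> wLp J p \<mu>"
 shows "(\<lambda>t. c *\<^sub>R u t) \<in> wLp J p \<mu>" "wLp_norm J p \<mu> (\<lambda>t. c *\<^sub>R u t) \<le> \<bar>c\<bar> * wLp_norm J p \<mu> u"
 by (rule wLp_linear[OF p J u bounded_linear_scaleR_right, of _ "\<bar>c\<bar>"]; simp)+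

lemma wLp_minus:
 assumes p: "p \<ge> 1" and J: "J \<in> sets lebesgue" and u: "u \<in> wLp J p \<mu>"
 shows "(\<lambda>t. - u t) \<in> wLp J p \<mu>" "wLp_norm J p \<mu> (\<lambda>t. - u t) = wLp_norm J p \<mu> u"
proof -
 show "(\<lambda>t. - u t) \<in> wLp J p \<mu>" using wLp_scale(1)[OF p J u, of "-1"] by simp
qed (simp add: wLp_norm_def)

lemma wLp_norm_norm: "wLp_norm J p \<mu> (\<lambda>t. norm (u t)) = wLp_norm J p \<mu> u"
 by (simp add: wLp_norm_def)

lemma wLp_norm_mem: "p \<ge> 1 \<Longrightarrow> J \<in> sets lebesgue \<Longrightarrow> u \<in> wLp J p \<mu> \<Longrightarrow> (\<lambda>t. norm (u t)) \<in> wLp J p \<mu>"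
 by (rule wLp_mono(1)[of p J _ u _ 1]) (auto simp: sm_norm wLp_sm)

lemma wLp_zero: "p \<ge> 1 \<Longrightarrow> (\<lambda>t. 0) \<in> wLp J p \<mu>" "p \<ge> 1 \<Longrightarrow> wLp_norm J p \<mu> (\<lambda>t. 0) = 0"
 by (auto simp: wLp_def wLp_norm_def)

text \<open>Minkowski's inequality from convexity of x^p: |u| + |v| is (a+b) times the convex
  combination of |u|/a and |v|/b with weights a/(a+b) and b/(a+b). The numbers a and b are taken
  strictly above the norms, which avoids division by zero, and then decrease to them.\<close>

lemma wLp_add:
 assumes p: "p \<ge> 1" and J: "J \<in> sets lebesgue" and u: "u \<in> wLp J p \<mu>" and v: "v \<in> wLp J p \<mu>"
 shows "(\<lambda>t. u t + v t) \<in> wLp J p \<mu>" "wLp_norm J p \<mu> (\<lambda>t. u t + v t) \<le> wLp_norm J p \<mu> u + wLp_norm J p \<mu> v"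
proof -
 let ?w = "\<lambda>t. u t + v t" and ?a0 = "wLp_norm J p \<mu> u" and ?b0 = "wLp_norm J p \<mu> v"
 note sm = sm_add[OF wLp_sm[OF u] wLp_sm[OF v]]
 have main: "wint J p \<mu> ?w \<le> ennreal ((a + b) powr p)" if ab: "a > ?a0" "b > ?b0" for a b
 proof -
  have pos: "a > 0" "b > 0" using ab wLp_norm_nonneg[of J p \<mu>] order.strict_trans1 by blast+
  let ?c = "(a+b) powr p * (a/(a+b)) / a powr p" and ?d = "(a+b) powr p * (b/(a+b)) / b powr p"
  have cd: "?c \<ge> 0" "?d \<ge> 0" using pos by auto
  have "wint J p \<mu> ?w \<le> (\<integral>\<^sup>+t. ennreal ?c * ennreal ((norm (t powr (1 - \<mu>) *\<^sub>R u t)) powr p)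
    + ennreal ?d * ennreal ((norm (t powr (1 - \<mu>) *\<^sub>R v t)) powr p) \<partial>lebesgue_on J)"
   unfolding wint_def
  proof (rule nn_integral_mono)
   fix t
   let ?x = "norm (t powr (1 - \<mu>) *\<^sub>R u t)" and ?y = "norm (t powr (1 - \<mu>) *\<^sub>R v t)"
   have "norm (t powr (1 - \<mu>) *\<^sub>R ?w t) \<le> ?x + ?y"
    by (simp add: scaleR_add_right norm_triangle_le del: norm_scaleR)
   then have "norm (t powr (1 - \<mu>) *\<^sub>R ?w t) powr p \<le> (?x + ?y) powr p" using p by (intro powr_mono2) auto
   also have "?x + ?y = (a+b) * ((a/(a+b)) * (?x/a) + (b/(a+b)) * (?y/b))"
   proof -
    have "(a/(a+b)) * (?x/a) = ?x/(a+b)" "(b/(a+b)) * (?y/b) = ?y/(a+b)" using pos by simp_all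
    moreover have "(a+b) * (?x/(a+b) + ?y/(a+b)) = ?x + ?y"
     using pos by (simp only: distrib_left nonzero_mult_div_cancel_left times_divide_eq_right)
    ultimately show ?thesis by (simp only:)
   qed
   also have "\<dots> powr p = (a+b) powr p * ((a/(a+b)) * (?x/a) + (b/(a+b)) * (?y/b)) powr p"
    using pos by (subst powr_mult) auto
   also have "\<dots> \<le> (a+b) powr p * ((a/(a+b)) * (?x/a) powr p + (b/(a+b)) * (?y/b) powr p)"
    using pos p by (intro mult_left_mono powr_convex_nonneg) (simp_all add: add_divide_distrib[symmetric])
   also have "\<dots> = ?c * ?x powr p + ?d * ?y powr p"
    using pos by (simp add: powr_divide algebra_simps)
   finally have "norm (t powr (1 - \<mu>) *\<^sub>R ?w t) powr p \<le> ?c * ?x powr p + ?d * ?y powr p" .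
   then have "ennreal (norm (t powr (1 - \<mu>) *\<^sub>R ?w t) powr p) \<le> ennreal (?c * ?x powr p + ?d * ?y powr p)"
    by (rule ennreal_leI)
   also have "\<dots> = ennreal ?c * ennreal (?x powr p) + ennreal ?d * ennreal (?y powr p)"
    by (rule ennreal_lincomb[OF cd]) simp_all
   finally show "ennreal (norm (t powr (1 - \<mu>) *\<^sub>R ?w t) powr p) \<le>
     ennreal ?c * ennreal (?x powr p) + ennreal ?d * ennreal (?y powr p)" .
  qed
  also have "\<dots> = ennreal ?c * wint J p \<mu> u + ennreal ?d * wint J p \<mu> v"
   unfolding wint_def
   using wint_measurable[OF J wLp_sm[OF u]] wint_measurable[OF J wLp_sm[OF v]]
   by (subst nn_integral_add) (auto simp: nn_integral_cmult)
  also have "\<dots> = ennreal (?c * ?a0 powr p + ?d * ?b0 powr p)"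
   unfolding wint_eq[OF p u] wint_eq[OF p v]
   by (rule ennreal_lincomb[OF cd, symmetric]) simp_all
  also have "\<dots> \<le> ennreal (?c * a powr p + ?d * b powr p)"
   using cd ab p by (intro ennreal_leI add_mono mult_left_mono powr_mono2) auto
  also have "?c * a powr p + ?d * b powr p = (a+b) powr p"
  proof -
   have "?c * a powr p = (a+b) powr p * (a/(a+b))" "?d * b powr p = (a+b) powr p * (b/(a+b))" using pos by simp_all
   then have "?c * a powr p + ?d * b powr p = (a+b) powr p * (a/(a+b) + b/(a+b))"
    by (simp only: distrib_left)
   also have "a/(a+b) + b/(a+b) = 1" using pos by (simp add: add_divide_distrib[symmetric])
   finally show ?thesis by simp
  qed
  finally show ?thesis .
 qed
 have res: "?w \<in> wLp J p \<mu>" "wLp_norm J p \<mu> ?w \<le> (?a0 + e/2) + (?b0 + e/2)" if "e > 0" for e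
  using wLpI[OF p sm main[of "?a0 + e/2" "?b0 + e/2"]] that by (auto simp: add_nonneg_nonneg)
 show "?w \<in> wLp J p \<mu>" by (rule res(1)[of 1]) simp
 show "wLp_norm J p \<mu> ?w \<le> ?a0 + ?b0"
 proof (rule field_le_epsilon)
  fix e :: real assume "e > 0"
  from res(2)[OF this] show "wLp_norm J p \<mu> ?w \<le> ?a0 + ?b0 + e" by simp
 qed
qed

lemma wLp_diff:
 assumes p: "p \<ge> 1" and J: "J \<in> sets lebesgue" and u: "u \<in> wLp J p \<mu>" and v: "v \<in> wLp J p \<mu>"
 shows "(\<lambda>t. u t - v t) \<in> wLp J p \<mu>" "wLp_norm J p \<mu> (\<lambda>t. u t - v t) \<le> wLp_norm J p \<mu> u + wLp_norm J p \<mu> v"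
 using wLp_add[OF p J u wLp_minus(1)[OF p J v]] wLp_minus(2)[OF p J v] by simp_all

lemma wint_mono_set:
 "K \<subseteq> J \<Longrightarrow> K \<in> sets lebesgue \<Longrightarrow> J \<in> sets lebesgue \<Longrightarrow> wint K p \<mu> u \<le> wint J p \<mu> u"
 unfolding wint_def
 by (subst (1 2) nn_integral_restrict_space) (auto intro!: nn_integral_mono simp: indicator_def)

lemma wLp_subset:
 assumes p: "p \<ge> 1" and K: "K \<subseteq> J" "K \<in> sets lebesgue" "J \<in> sets lebesgue" and u: "u \<in> wLp J p \<mu>"
 shows "u \<in> wLp K p \<mu>" "wLp_norm K p \<mu> u \<le> wLp_norm J p \<mu> u"
 using wLpI[OF p sm_subset[OF wLp_sm[OF u] K], of \<mu> "wLp_norm J p \<mu> u"]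
  wint_mono_set[OF K, of p \<mu> u] wint_eq[OF p u] by auto

lemma wint_restrict:
 assumes "K \<subseteq> J" "K \<in> sets lebesgue" "J \<in> sets lebesgue"
 shows "wint J p \<mu> (\<lambda>t. if t \<in> K then u t else 0) = wint K p \<mu> u"
 unfolding wint_def using assms
 by (subst (1 2) nn_integral_restrict_space) (auto intro!: nn_integral_cong simp: indicator_def)

lemma wLp_restrict:
 assumes p: "p \<ge> 1" and K: "K \<subseteq> J" "K \<in> sets lebesgue" "J \<in> sets lebesgue"
 shows "(\<lambda>t. if t \<in> K then u t else 0) \<in> wLp J p \<mu> \<longleftrightarrow> u \<in> wLp K p \<mu>"
  "wLp_norm J p \<mu> (\<lambda>t. if t \<in> K then u t else 0) = wLp_norm K p \<mu> u"
proof -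
 have "smeas J (\<lambda>t. if t \<in> K then u t else 0) \<longleftrightarrow> smeas K u"
 proof
  assume "smeas J (\<lambda>t. if t \<in> K then u t else 0)"
  from sm_subset[OF this K] show "smeas K u"
   using sm_cong[of K u "\<lambda>t. if t \<in> K then u t else 0"] by auto
 next
  assume "smeas K u"
  then show "smeas J (\<lambda>t. if t \<in> K then u t else 0)"
   using K by (intro sm_if) (auto simp: Int_absorb1)
 qed
 then show "(\<lambda>t. if t \<in> K then u t else 0) \<in> wLp J p \<mu> \<longleftrightarrow> u \<in> wLp K p \<mu>"
  using wint_restrict[OF K, of p \<mu> u] by (simp add: wLp_iff)
 show "wLp_norm J p \<mu> (\<lambda>t. if t \<in> K then u t else 0) = wLp_norm K p \<mu> u"
  using wint_restrict[OF K, of p \<mu> u] by (simp add: wLp_norm_wint)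
qed

lemma wLp_norm_zero_AE:
 assumes p: "p \<ge> 1" and J: "J \<in> sets lebesgue" "J \<subseteq> {0<..}" and u: "u \<in> wLp J p \<mu>" and "wLp_norm J p \<mu> u = 0"
 shows "AE t in lebesgue_on J. u t = 0"
proof -
 have "(\<integral>\<^sup>+t. ennreal ((norm (t powr (1 - \<mu>) *\<^sub>R u t)) powr p) \<partial>lebesgue_on J) = 0"
  using wint_eq[OF p u] assms(5) by (simp add: wint_def)
 then have "AE t in lebesgue_on J. ennreal ((norm (t powr (1 - \<mu>) *\<^sub>R u t)) powr p) = 0"
  using nn_integral_0_iff_AE[OF wint_measurable[OF J(1) wLp_sm[OF u]]] by blast
 then show ?thesis using AE_space
 proof eventually_elim
  case (elim t)
  then have "t > 0" "norm (t powr (1 - \<mu>) *\<^sub>R u t) powr p = 0" using J(2) by (auto simp: ennreal_eq_0_iff)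
  then show ?case by simp
 qed
qed

text \<open>Riesz-Fischer for geometrically decreasing increments, the only form of completeness
  that the iterations produce. Pointwise convergence almost everywhere comes from summing the
  weighted increments, the error bound from Fatou's lemma.\<close>

lemma wLp_complete:
 fixes u :: "nat \<Rightarrow> real \<Rightarrow> 'x::banach"
 assumes p: "p \<ge> 1" and J: "J \<in> sets lebesgue" "J \<subseteq> {0<..}" and u: "\<And>n. u n \<in> wLp J p \<mu>"
  and c: "c \<ge> 0" and d: "\<And>n. wLp_norm J p \<mu> (\<lambda>t. u (Suc n) t - u n t) \<le> c * (1/2)^n"
 obtains w where "w \<in> wLp J p \<mu>" "\<And>n. wLp_norm J p \<mu> (\<lambda>t. u n t - w t) \<le> 2 * c * (1/2)^n"
  "AE t in lebesgue_on J. (\<lambda>n. u n t) \<longlonglongrightarrow> w t"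
proof -
 let ?M = "lebesgue_on J"
 let ?D = "\<lambda>n t. u (Suc n) t - u n t"
 \<comment> \<open>The n-th increment is inflated by 2^(n/2): the integrals are still summable, with
   ratio \<open>q\<close>, and finiteness of the sum at t forces the increments at t to decay like
   2^(-n/2).\<close>
 define h where "h n t = ennreal (2 powr (real n / 2 * p)) * ennreal (norm (t powr (1-\<mu>) *\<^sub>R ?D n t) powr p)" for n t
 have D: "?D n \<in> wLp J p \<mu>" for n by (rule wLp_diff[OF p J(1) u u])
 have hm: "h n \<in> borel_measurable ?M" for n
  unfolding h_def using wint_measurable[OF J(1) wLp_sm[OF D]] by measurable
 define q where "q = 2 powr (-p/2)"
 have q: "0 < q" "q < 1" unfolding q_def using p by (auto simp: powr_less_one)
 have "(\<integral>\<^sup>+t. h n t \<partial>?M) \<le> ennreal (c powr p * q ^ n)" for n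
 proof -
  have "(\<integral>\<^sup>+t. h n t \<partial>?M) = ennreal (2 powr (real n / 2 * p)) * wint J p \<mu> (?D n)"
   unfolding h_def wint_def by (rule nn_integral_cmult[OF wint_measurable[OF J(1) wLp_sm[OF D]]])
  also have "\<dots> = ennreal (2 powr (real n / 2 * p) * wLp_norm J p \<mu> (?D n) powr p)"
   unfolding wint_eq[OF p D] by (simp add: ennreal_mult)
  also have "\<dots> \<le> ennreal (2 powr (real n / 2 * p) * (c * (1/2)^n) powr p)"
   using d p by (intro ennreal_leI mult_left_mono powr_mono2) auto
  also have "2 powr (real n / 2 * p) * (c * (1/2)^n) powr p = c powr p * q ^ n"
  proof -
   have "(1/2::real)^n = 2 powr (- real n)" by (simp add: powr_minus powr_realpow power_one_over inverse_eq_divide)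
   moreover have "q ^ n = 2 powr (- real n * p / 2)" unfolding q_def by (simp add: powr_powr powr_realpow[symmetric] mult.commute)
   ultimately show ?thesis using c by (simp add: powr_mult powr_powr powr_add[symmetric] mult.commute)
  qed
  finally show ?thesis .
 qed
 then have "(\<Sum>n. \<integral>\<^sup>+t. h n t \<partial>?M) \<le> (\<Sum>n. ennreal (c powr p * q ^ n))" by (intro suminf_le) auto
 also have "\<dots> = ennreal (\<Sum>n. c powr p * q ^ n)"
  using q by (intro suminf_ennreal2) (auto intro!: summable_mult summable_geometric)
 also have "\<dots> < \<infinity>" by simp
 finally have fin: "(\<integral>\<^sup>+t. (\<Sum>n. h n t) \<partial>?M) < \<infinity>" by (subst nn_integral_suminf[OF hm])
 have "AE t in ?M. (\<Sum>n. h n t) \<noteq> \<infinity>"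
  using fin hm by (intro nn_integral_PInf_AE) auto
 then have "AE t in ?M. convergent (\<lambda>n. u n t)"
  using AE_space
 proof eventually_elim
  case (elim t)
  then have t: "t > 0" using J(2) by auto
  obtain B where B: "B \<ge> 0" "(\<Sum>n. h n t) = ennreal B" using elim(1) by (cases "\<Sum>n. h n t") auto
  have bd: "norm (?D n t) \<le> (B powr (1/p) / t powr (1-\<mu>)) * (2 powr (-1/2)) ^ n" for n
  proof -
   have "h n t \<le> ennreal B" using sum_le_suminf[of "\<lambda>n. h n t" "{n}"] B(2) by simp
   then have "2 powr (real n / 2 * p) * norm (t powr (1-\<mu>) *\<^sub>R ?D n t) powr p \<le> B"
    unfolding h_def using B(1) by (simp add: ennreal_mult[symmetric])
   then have "(2 powr (real n / 2) * norm (t powr (1-\<mu>) *\<^sub>R ?D n t)) powr p \<le> B"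
    by (simp add: powr_mult powr_powr)
   then have "((2 powr (real n / 2) * norm (t powr (1-\<mu>) *\<^sub>R ?D n t)) powr p) powr (1/p) \<le> B powr (1/p)"
    using p by (intro powr_mono2) auto
   then have *: "2 powr (real n / 2) * (t powr (1-\<mu>) * norm (?D n t)) \<le> B powr (1/p)"
    using p by (simp add: powr_powr)
   have r: "(2 powr (-1/2)) ^ n = 1 / 2 powr (real n / 2)"
   proof -
    have "(2 powr (-1/2)) ^ n = 2 powr (-1/2 * real n)"
     by (simp only: powr_powr[symmetric]) (rule powr_realpow[symmetric], simp)
    also have "-1/2 * real n = - (real n / 2)" by simp
    also have "2 powr (- (real n / 2)) = 1 / 2 powr (real n / 2)" by (simp only: powr_minus inverse_eq_divide)
    finally show ?thesis .
   qed
   show ?thesis unfolding r using * t by (simp add: field_simps)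
  qed
  have "norm (2 powr (-1/2) :: real) < 1" by (simp add: powr_less_one)
  then have "summable (\<lambda>n. (B powr (1/p) / t powr (1-\<mu>)) * (2 powr (-1/2)) ^ n)"
   by (intro summable_mult summable_geometric)
  then have "summable (\<lambda>n. ?D n t)" using bd by (rule summable_comparison_test'[of _ 0])
  then have "convergent (\<lambda>n. \<Sum>i<n. ?D i t)" by (simp add: summable_iff_convergent)
  then have "convergent (\<lambda>n. u n t - u 0 t)" by (simp only: sum_lessThan_telescope[of "\<lambda>n. u n t"])
  then have "convergent (\<lambda>n. (u n t - u 0 t) + u 0 t)" by (intro convergent_add convergent_const)
  then show ?case by simp
 qed
 then have conv: "AE t in ?M. (\<lambda>n. u n t) \<longlonglongrightarrow> lim (\<lambda>n. u n t)"
  by eventually_elim (simp add: convergent_LIMSEQ_iff)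
 define w where "w t = lim (\<lambda>n. u n t)" for t
 have wsm: "smeas J w"
  by (rule sm_limit[OF J(1) wLp_sm[OF u]]) (use conv in \<open>simp add: w_def\<close>)
 \<comment> \<open>The subtracted term makes the induction over m close; only the bound 2 c (1/2)^n
   is used afterwards.\<close>
 have step: "wLp_norm J p \<mu> (\<lambda>t. u n t - u (n + m) t) \<le> 2 * c * (1/2)^n - 2 * c * (1/2)^(n+m)" for n m
 proof (induction m)
  case 0 show ?case by (simp add: wLp_zero[OF p])
 next
  case (Suc m)
  have "wLp_norm J p \<mu> (\<lambda>t. u n t - u (n + Suc m) t) = wLp_norm J p \<mu> (\<lambda>t. (u n t - u (n + m) t) - ?D (n+m) t)" by simp
  also have "\<dots> \<le> wLp_norm J p \<mu> (\<lambda>t. u n t - u (n + m) t) + wLp_norm J p \<mu> (?D (n+m))"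
   by (rule wLp_diff(2)[OF p J(1) wLp_diff(1)[OF p J(1) u u] D])
  also have "\<dots> \<le> (2 * c * (1/2)^n - 2 * c * (1/2)^(n+m)) + c * (1/2)^(n+m)" using Suc d[of "n+m"] by linarith
  also have "\<dots> = 2 * c * (1/2)^n - 2 * c * (1/2)^(n+Suc m)" by simp
  finally show ?case .
 qed
 have fatou: "wint J p \<mu> (\<lambda>t. u n t - w t) \<le> ennreal ((2 * c * (1/2)^n) powr p)" for n
 proof -
  have "wint J p \<mu> (\<lambda>t. u n t - w t) = (\<integral>\<^sup>+t. liminf (\<lambda>m. ennreal ((norm (t powr (1 - \<mu>) *\<^sub>R (u n t - u (n+m) t))) powr p)) \<partial>?M)"
   unfolding wint_def
  proof (rule nn_integral_cong_AE)
   show "AE t in ?M. ennreal (norm (t powr (1 - \<mu>) *\<^sub>R (u n t - w t)) powr p) =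
     liminf (\<lambda>m. ennreal (norm (t powr (1 - \<mu>) *\<^sub>R (u n t - u (n + m) t)) powr p))"
    using conv
   proof eventually_elim
    case (elim t)
    have "(\<lambda>m. u (m + n) t) \<longlonglongrightarrow> w t" using elim unfolding w_def by (rule LIMSEQ_ignore_initial_segment)
    then have "(\<lambda>m. ennreal (norm (t powr (1 - \<mu>) *\<^sub>R (u n t - u (n + m) t)) powr p)) \<longlonglongrightarrow>
      ennreal (norm (t powr (1 - \<mu>) *\<^sub>R (u n t - w t)) powr p)"
     using p by (intro tendsto_ennrealI tendsto_powr' tendsto_intros) (auto simp: add.commute)
    then show ?case by (intro lim_imp_Liminf[symmetric]) auto
   qed
  qed
  also have "\<dots> \<le> liminf (\<lambda>m. wint J p \<mu> (\<lambda>t. u n t - u (n+m) t))"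
   unfolding wint_def
   by (rule nn_integral_liminf[OF wint_measurable[OF J(1) sm_diff[OF wLp_sm[OF u] wLp_sm[OF u]]]])
  also have "\<dots> \<le> limsup (\<lambda>m. wint J p \<mu> (\<lambda>t. u n t - u (n+m) t))" by (rule Liminf_le_Limsup) simp
  also have "\<dots> \<le> ennreal ((2 * c * (1/2)^n) powr p)"
  proof (rule Limsup_bounded, intro always_eventually allI)
   fix m
   have "wLp_norm J p \<mu> (\<lambda>t. u n t - u (n + m) t) \<le> 2 * c * (1/2)^n"
    using step[of n m] c by (smt (verit) mult_nonneg_nonneg zero_le_power divide_nonneg_nonneg)
   then show "wint J p \<mu> (\<lambda>t. u n t - u (n+m) t) \<le> ennreal ((2 * c * (1/2)^n) powr p)"
    unfolding wint_eq[OF p wLp_diff(1)[OF p J(1) u u]] using p by (intro ennreal_leI powr_mono2) auto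
  qed
  finally show ?thesis .
 qed
 have dn: "(\<lambda>t. u n t - w t) \<in> wLp J p \<mu>" "wLp_norm J p \<mu> (\<lambda>t. u n t - w t) \<le> 2 * c * (1/2)^n" for n
  by (rule wLpI[OF p sm_diff[OF wLp_sm[OF u] wsm] fatou]; use c in simp)+
 have "w \<in> wLp J p \<mu>" using wLp_diff(1)[OF p J(1) u[of 0] dn(1)[of 0]] by simp
 then show ?thesis using dn(2) conv unfolding w_def[symmetric] by (rule that)
qed

section \<open>The inequalities of Hoelder and Hardy\<close>

lemma nn_integral_powr_from_0:
 fixes T a :: real assumes "T \<ge> 0" "a > -1"
 shows "(\<integral>\<^sup>+t. ennreal (t powr a) \<partial>lebesgue_on {0<..<T}) = ennreal (T powr (a+1) / (a+1))"
proof -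
 have "((\<lambda>t. t powr a) has_integral (T powr (a+1) / (a+1))) {0..T}" by (rule has_integral_powr_from_0) (use assms in auto)
 then have h: "((\<lambda>t. t powr a) has_integral (T powr (a+1) / (a+1))) {0<..<T}"
  by (rule has_integral_spike_set_eq[THEN iffD1, rotated 2]) (rule negligible_subset[of "{0,T}"]; force)+
 then show ?thesis
  by (subst nn_integral_eq_integral_on) (auto simp: integral_unique)
qed

lemma nn_integral_powr_to_inf:
 fixes s b :: real assumes "s > 0" "b > 1"
 shows "(\<integral>\<^sup>+t. ennreal (t powr (-b)) * indicator {s<..} t \<partial>lborel) = ennreal (s powr (1-b) / (b-1))"
proof -
 have "((\<lambda>t. t powr (-b)) has_integral (- (s powr (-b+1)) / (-b+1))) {s..}"
  by (rule has_integral_powr_to_inf) (use assms in auto)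
 then have "((\<lambda>t. t powr (-b)) has_integral (- (s powr (-b+1)) / (-b+1))) {s<..}"
  by (rule has_integral_spike_set_eq[THEN iffD1, rotated 2]) (rule negligible_subset[of "{s}"]; force)+
 moreover have "- (s powr (-b+1)) / (-b+1) = s powr (1-b) / (b-1)" using assms by (simp add: field_simps)
 ultimately have "((\<lambda>t. t powr (-b)) has_integral (s powr (1-b) / (b-1))) {s<..}" by simp
 from nn_integral_has_integral_lebesgue'[OF _ this] show ?thesis by simp
qed

text \<open>Hoelder's inequality against t^(-a), via Young's inequality for normalised factors.
  \<open>K\<close> is the L_q norm of t^(-a) on (0,T) for the conjugate exponent q, finite since a q
  < 1; the number J normalises the other factor and exceeds I strictly, so that it is
  positive.\<close>

lemma holder_weight:
 fixes p a T I :: real and \<phi> :: "real \<Rightarrow> real"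
 assumes p: "p > 1" and a: "a < 1 - 1/p" and T: "T > 0" and \<phi>: "\<phi> \<in> borel_measurable (lebesgue_on {0<..<T})"
  "\<And>t. \<phi> t \<ge> 0" and I: "I \<ge> 0" "(\<integral>\<^sup>+t. ennreal ((t powr a * \<phi> t) powr p) \<partial>lebesgue_on {0<..<T}) \<le> ennreal (I powr p)"
 shows "(\<integral>\<^sup>+t. ennreal (\<phi> t) \<partial>lebesgue_on {0<..<T})
  \<le> ennreal ((1 - a * (p/(p-1))) powr (-(1-1/p)) * T powr (1 - 1/p - a) * I)"
proof -
 let ?M = "lebesgue_on {0<..<T}"
 define q where "q = p/(p-1)"
 have q: "q > 1" "1/p + 1/q = 1" using p by (auto simp: q_def field_simps)
 then have iq: "1/q = 1 - 1/p" by simp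
 have "a * q < (1/q) * q" using a q unfolding iq[symmetric] by (intro mult_strict_right_mono) auto
 then have aq: "a * q < 1" using q by simp
 define K where "K = (T powr (1 - a*q) / (1 - a*q)) powr (1/q)"
 have K: "K > 0" unfolding K_def using T aq by simp
 have Kq: "K powr q = T powr (1 - a*q) / (1 - a*q)" unfolding K_def using q T aq by (simp add: powr_powr)
 have Keq: "K = (1 - a*q) powr (-(1-1/p)) * T powr (1 - 1/p - a)"
 proof -
  have "(1 - a*q) * (1/q) = 1 - 1/p - a" using q iq by (simp add: field_simps)
  then have "K = T powr (1 - 1/p - a) / (1 - a*q) powr (1/q)"
   unfolding K_def using aq T by (simp add: powr_divide powr_powr)
  then show ?thesis unfolding iq by (simp only: powr_minus divide_inverse mult.commute)
 qed
 have main: "(\<integral>\<^sup>+t. ennreal (\<phi> t) \<partial>?M) \<le> ennreal (K * J)" if J: "J > I" for J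
 proof -
  have Jp: "J > 0" using J I by simp
  have "(\<integral>\<^sup>+t. ennreal (\<phi> t) \<partial>?M) \<le> (\<integral>\<^sup>+t. ennreal (K * J / (q * K powr q)) * ennreal (t powr (-(a*q)))
    + ennreal (K * J / (p * J powr p)) * ennreal ((t powr a * \<phi> t) powr p) \<partial>?M)"
  proof (rule nn_integral_mono)
   fix t assume "t \<in> space ?M"
   then have t: "t > 0" by simp
   have "(t powr (-a) / K) * (t powr a * \<phi> t / J) \<le> (t powr (-a) / K) powr q / q + (t powr a * \<phi> t / J) powr p / p"
    by (rule Youngs_inequality) (use q p K Jp \<phi>(2)[of t] in auto)
   moreover have "(t powr (-a) / K) * (t powr a * \<phi> t / J) = (t powr (-a) * t powr a) * \<phi> t / (K * J)" by simp
   moreover have "t powr (-a) * t powr a = 1" using t by (simp add: powr_add[symmetric])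
   moreover have "(t powr (-a) / K) powr q / q = t powr (-(a*q)) / (q * K powr q)"
    using K by (simp add: powr_divide powr_powr)
   moreover have "(t powr a * \<phi> t / J) powr p / p = (t powr a * \<phi> t) powr p / (p * J powr p)"
    using Jp \<phi>(2)[of t] by (simp add: powr_divide)
   ultimately have "1 * \<phi> t / (K * J) \<le> t powr (-(a*q)) / (q * K powr q) + (t powr a * \<phi> t) powr p / (p * J powr p)" by (simp only:)
   then have "\<phi> t \<le> (K * J) * (t powr (-(a*q)) / (q * K powr q) + (t powr a * \<phi> t) powr p / (p * J powr p))"
    using K Jp by (simp add: pos_divide_le_eq mult.commute)
   also have "\<dots> = (K * J / (q * K powr q)) * t powr (-(a*q)) + (K * J / (p * J powr p)) * (t powr a * \<phi> t) powr p"
    by (simp add: distrib_left)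
   finally have "ennreal (\<phi> t) \<le> ennreal (\<dots>)" by (rule ennreal_leI)
   also have "\<dots> = ennreal (K * J / (q * K powr q)) * ennreal (t powr (-(a*q)))
    + ennreal (K * J / (p * J powr p)) * ennreal ((t powr a * \<phi> t) powr p)"
    by (rule ennreal_lincomb) (use K Jp q p in auto)
   finally show "ennreal (\<phi> t) \<le> \<dots>" .
  qed
  also have "\<dots> = ennreal (K * J / (q * K powr q)) * (\<integral>\<^sup>+t. ennreal (t powr (-(a*q))) \<partial>?M)
    + ennreal (K * J / (p * J powr p)) * (\<integral>\<^sup>+t. ennreal ((t powr a * \<phi> t) powr p) \<partial>?M)"
  proof -
   have m: "(\<lambda>t. t powr c) \<in> borel_measurable ?M" for c
    using sm_powr[of "{0<..<T}" c] by (simp add: sm_real_iff)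
   show ?thesis
    using m[of "-(a*q)"] m[of a] \<phi>(1) by (subst nn_integral_add) (auto simp: nn_integral_cmult)
  qed
  also have "\<dots> \<le> ennreal (K * J / (q * K powr q)) * ennreal (K powr q) + ennreal (K * J / (p * J powr p)) * ennreal (J powr p)"
  proof (intro add_mono mult_left_mono)
   show "(\<integral>\<^sup>+t. ennreal (t powr (-(a*q))) \<partial>?M) \<le> ennreal (K powr q)"
    unfolding Kq using nn_integral_powr_from_0[of T "-(a*q)"] T aq by simp
   show "(\<integral>\<^sup>+t. ennreal ((t powr a * \<phi> t) powr p) \<partial>?M) \<le> ennreal (J powr p)"
    using I J p by (intro order_trans[OF I(2)] ennreal_leI powr_mono2) auto
  qed auto
  also have "\<dots> = ennreal ((K * J / (q * K powr q)) * K powr q + (K * J / (p * J powr p)) * J powr p)"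
   by (rule ennreal_lincomb[symmetric]) (use K Jp q p in auto)
  also have "(K * J / (q * K powr q)) * K powr q + (K * J / (p * J powr p)) * J powr p = K * J * (1/p + 1/q)"
   using K Jp by (simp add: field_simps)
  finally show ?thesis using q by simp
 qed
 have "(\<integral>\<^sup>+t. ennreal (\<phi> t) \<partial>?M) \<le> ennreal (K * I)"
 proof (rule ennreal_le_epsilon)
  fix e :: real assume e: "e > 0"
  have "(\<integral>\<^sup>+t. ennreal (\<phi> t) \<partial>?M) \<le> ennreal (K * (I + e/K))" by (rule main) (use e K in simp)
  also have "K * (I + e/K) = K * I + e" using K by (simp add: distrib_left)
  also have "ennreal (K * I + e) = ennreal (K * I) + ennreal e" using K I e by (intro ennreal_plus) auto
  finally show "(\<integral>\<^sup>+t. ennreal (\<phi> t) \<partial>?M) \<le> ennreal (K * I) + ennreal e" .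
 qed
 then show ?thesis unfolding Keq q_def .
qed

lemma Ioo_subset_Ioi: "0 \<le> s \<Longrightarrow> {s<..<t} \<subseteq> {0::real<..}"
 by auto

lemma negligible_endpoints: "negligible ({0..T} - {0<..<T::real})" "negligible ({0<..<T} - {0..T::real})"
proof -
 have "{0..T} - {0<..<T} \<subseteq> {0, T}" by auto
 then show "negligible ({0..T} - {0<..<T})" by (rule negligible_subset[rotated]) simp
 have "{0<..<T} - {0..T} = {}" by auto
 then show "negligible ({0<..<T} - {0..T})" by simp
qed

lemma bint_interior: "bint {0..T} f \<longleftrightarrow> bint {0<..<T} f"
 using negligible_endpoints[of T] by (auto intro: bint_spike_set)

lemma integral_interior:
 fixes f :: "real \<Rightarrow> 'x::banach"
 shows "integral {0..T} f = integral {0<..<T::real} f"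
 by (rule HK_integral_spike_set) (rule negligible_subset[of "{0,T}"]; force)+

lemma AE_interior: "(AE t in lebesgue_on {0..T}. P t) \<longleftrightarrow> (AE t in lebesgue_on {0<..<T::real}. P t)"
proof -
 have "AE t in lebesgue. t \<noteq> 0 \<and> t \<noteq> T"
  using AE_not_in[of "{0, T}" lebesgue] negligible_iff_null_sets[of "{0,T}"] by simp
 then have "AE t in lebesgue. (t \<in> {0..T} \<longrightarrow> P t) \<longleftrightarrow> (t \<in> {0<..<T} \<longrightarrow> P t)"
  by eventually_elim (auto simp: less_le)
 then have "(AE t in lebesgue. t \<in> {0..T} \<longrightarrow> P t) \<longleftrightarrow> (AE t in lebesgue. t \<in> {0<..<T} \<longrightarrow> P t)"
  by (rule eventually_subst)
 then show ?thesis by (simp add: AE_lebesgue_on)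
qed

text \<open>The constant of \<open>holder_weight\<close> for the exponent a = 1 - \<mu>; it equals 1
  for \<mu> = 1.\<close>

definition hoelder_const :: "real \<Rightarrow> real \<Rightarrow> real" where
 "hoelder_const p \<mu> = (1 - (1-\<mu>) * (p/(p-1))) powr (-(1-1/p))"

text \<open>The condition \<mu> > 1/p says exactly that 1 - \<mu> is an admissible exponent in
  \<open>holder_weight\<close>, so that weighted functions are integrable up to time 0.\<close>

lemma wLp_bint:
 fixes u :: "real \<Rightarrow> 'x::banach"
 assumes p: "1 < p" and \<mu>: "1/p < \<mu>" "\<mu> \<le> 1" and T: "T > 0" and u: "u \<in> wLp {0<..<T} p \<mu>"
 shows "bint {0..T} u"
  "integral {0..T} (\<lambda>t. norm (u t)) \<le> hoelder_const p \<mu> * T powr (\<mu> - 1/p) * wLp_norm {0<..<T} p \<mu> u"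
proof -
 let ?C = "hoelder_const p \<mu> * T powr (\<mu> - 1/p) * wLp_norm {0<..<T} p \<mu> u"
 have C0: "?C \<ge> 0" by (auto simp: hoelder_const_def)
 have "(\<integral>\<^sup>+t. ennreal (norm (u t)) \<partial>lebesgue_on {0<..<T}) \<le>
   ennreal ((1 - (1-\<mu>) * (p/(p-1))) powr (-(1-1/p)) * T powr (1 - 1/p - (1-\<mu>)) * wLp_norm {0<..<T} p \<mu> u)"
 proof (rule holder_weight[OF p _ T])
  show "(\<integral>\<^sup>+t. ennreal ((t powr (1-\<mu>) * norm (u t)) powr p) \<partial>lebesgue_on {0<..<T}) \<le> ennreal (wLp_norm {0<..<T} p \<mu> u powr p)"
   using wint_eq[OF _ u] p by (simp add: wint_def)
  show "(\<lambda>t. norm (u t)) \<in> borel_measurable (lebesgue_on {0<..<T})"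
   by (rule sm_norm_measurable[OF _ wLp_sm[OF u]]) simp
 qed (use \<mu> in auto)
 then have le: "(\<integral>\<^sup>+t. ennreal (norm (u t)) \<partial>lebesgue_on {0<..<T}) \<le> ennreal ?C" by (simp add: hoelder_const_def)
 also have "\<dots> < \<infinity>" by simp
 finally have b: "bint {0<..<T} u" using wLp_sm[OF u] by (simp add: bint_iff_nn_integral)
 then show "bint {0..T} u" by (simp add: bint_interior)
 have "ennreal (integral {0<..<T} (\<lambda>t. norm (u t))) \<le> ennreal ?C"
  using le nn_integral_eq_integral_on[of "{0<..<T}" "\<lambda>t. norm (u t)"] bintD(2)[OF b] by simp
 then show "integral {0..T} (\<lambda>t. norm (u t)) \<le> ?C"
  using C0 by (simp add: integral_interior)
qed

lemma wLp_bint_0inf: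
 fixes u :: "real \<Rightarrow> 'x::banach"
 assumes p: "1 < p" and \<mu>: "1/p < \<mu>" "\<mu> \<le> 1" and u: "u \<in> wLp {0<..} p \<mu>"
 shows "bint {0..T} u"
proof (cases "T > 0")
 case True
 have "u \<in> wLp {0<..<T} p \<mu>" using p by (intro wLp_subset(1)[OF _ _ _ _ u]) auto
 then show ?thesis by (rule wLp_bint(1)[OF p \<mu> True])
next
 case False
 then have "{0..T} \<subseteq> {0}" by auto
 then have "negligible {0..T}" by (rule negligible_subset[rotated]) simp
 then show ?thesis unfolding bint_def by (auto intro: sm_negligible integrable_negligible)
qed

text \<open>Hardy's inequality, by Hoelder's inequality with an exponent \<open>a\<close> strictly between \<open>1 - \<mu>\<close>
 and \<open>1 - 1/p\<close> and an exchange of the order of integration.\<close>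

lemma hardy_ex:
 assumes p: "1 < p" and \<mu>: "1/p < \<mu>" "\<mu> \<le> 1"
 shows "\<exists>C>0. \<forall>\<phi>::real \<Rightarrow> real. \<phi> \<in> wLp {0<..} p \<mu> \<longrightarrow> (\<forall>t. \<phi> t \<ge> 0) \<longrightarrow>
  (\<lambda>t. integral {0..t} \<phi> / t) \<in> wLp {0<..} p \<mu> \<and>
  wLp_norm {0<..} p \<mu> (\<lambda>t. integral {0..t} \<phi> / t) \<le> C * wLp_norm {0<..} p \<mu> \<phi>"
proof -
 define a where "a = ((1-\<mu>) + (1-1/p)) / 2"
 have a: "1 - \<mu> < a" "a < 1 - 1/p" using \<mu> by (auto simp: a_def)
 \<comment> \<open>Here -b is the exponent of t that remains from the weight, the division by t and
   Hoelder's power of t, all raised to the power p. The lower bound on a gives b > 1, which makes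
   t^(-b) integrable at infinity.\<close>
 define b where "b = \<mu> * p - p + 1 + a * p"
 have "p * (a - (1 - \<mu>)) > 0" using a p by simp
 then have b: "b > 1" by (simp add: b_def algebra_simps)
 define H where "H = (1 - a * (p/(p-1))) powr (-(1-1/p))"
 have "p * a < p * (1 - 1/p)" using a p by (intro mult_strict_left_mono) auto
 then have "a * p < p - 1" using p by (simp add: algebra_simps)
 then have "a * p / (p - 1) < 1" using p by (subst pos_divide_less_eq) auto
 then have "a * (p/(p-1)) < 1" by (simp only: times_divide_eq_right)
 then have "1 - a * (p/(p-1)) \<noteq> 0" by linarith
 then have H: "H > 0" unfolding H_def by (simp only: powr_gt_zero not_False_eq_True)
 define C where "C = (H powr p / (b - 1)) powr (1/p)"
 have C: "C > 0" using H b by (simp add: C_def)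
 have Cp: "C powr p = H powr p / (b - 1)" using H b p by (simp add: C_def powr_powr)
 show ?thesis
 proof (intro exI[of _ C] conjI allI impI C)
  fix \<phi> :: "real \<Rightarrow> real" assume \<phi>: "\<phi> \<in> wLp {0<..} p \<mu>" and nn: "\<forall>t. \<phi> t \<ge> 0"
  define \<Phi> where "\<Phi> t = integral {0..t} \<phi>" for t
  have mon: "mono_on {0..} \<Phi>"
  proof (rule mono_onI)
   fix r s :: real assume "r \<in> {0..}" "s \<in> {0..}" "r \<le> s"
   moreover have "\<phi> integrable_on {0..s}" for s
    using bintD(2)[OF wLp_bint_0inf[OF p \<mu> \<phi>, of s]] nn by simp
   ultimately show "\<Phi> r \<le> \<Phi> s" unfolding \<Phi>_def using nn by (intro integral_subset_le) auto
  qed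
  have nonneg: "\<Phi> t \<ge> 0" for t unfolding \<Phi>_def
   using bintD(2)[OF wLp_bint_0inf[OF p \<mu> \<phi>, of t]] nn by (intro integral_nonneg) auto
  have sm: "smeas {0<..} (\<lambda>t. \<Phi> t / t)"
  proof -
   have "\<Phi> \<in> borel_measurable (restrict_space borel {0..})" by (rule borel_measurable_mono_on_fnc[OF mon])
   then have "(\<lambda>t. indicator {0..} t *\<^sub>R \<Phi> t) \<in> borel_measurable borel"
    by (subst (asm) borel_measurable_restrict_space_iff) auto
   then have "(\<lambda>t. indicator {0..} t *\<^sub>R \<Phi> t / t) \<in> borel_measurable borel" by measurable
   then have "(\<lambda>t. indicator {0..} t *\<^sub>R \<Phi> t / t) \<in> borel_measurable lebesgue" by (intro measurable_completion) simp
   then have "(\<lambda>t. indicator {0..} t *\<^sub>R \<Phi> t / t) \<in> borel_measurable (lebesgue_on {0<..})"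
    by (rule measurable_restrict_space1)
   then have "smeas {0<..} (\<lambda>t. indicator {0..} t *\<^sub>R \<Phi> t / t)" by (simp add: sm_real_iff)
   then show ?thesis by (subst (asm) sm_cong[of _ _ "\<lambda>t. \<Phi> t / t"]) auto
  qed
  define \<psi> where "\<psi> s = ennreal ((s powr a * \<phi> s) powr p) * indicator {0<..} s" for s
  have \<phi>m: "\<phi> \<in> borel_measurable (lebesgue_on {0<..})" using wLp_sm[OF \<phi>] by (simp add: sm_real_iff)
  have pm: "(\<lambda>t. t powr c) \<in> borel_measurable (lebesgue_on {0<..})" for c :: real
   using sm_powr[of "{0<..}" c] by (simp add: sm_real_iff)
  have "(\<lambda>s. ennreal ((s powr a * \<phi> s) powr p)) \<in> borel_measurable (lebesgue_on {0<..})"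
   using pm[of a] \<phi>m by measurable
  then have "\<psi> \<in> borel_measurable lebesgue"
   unfolding \<psi>_def by (subst (asm) borel_measurable_restrict_space_iff_ennreal) auto
  then obtain \<psi>' where \<psi>': "\<psi>' \<in> borel_measurable lborel" "AE s in lborel. \<psi> s = \<psi>' s"
   using completion_ex_borel_measurable by blast
  note [measurable] = \<psi>'(1)
  have bound: "ennreal (norm (t powr (1 - \<mu>) *\<^sub>R (\<Phi> t / t)) powr p) \<le>
    ennreal (H powr p) * (\<integral>\<^sup>+s. ennreal (t powr (-b)) * indicator {s<..} t * \<psi>' s \<partial>lborel)" if t: "t > 0" for t
  proof -
   have fin: "(\<integral>\<^sup>+s. ennreal ((s powr a * \<phi> s) powr p) \<partial>lebesgue_on {0<..<t}) = (\<integral>\<^sup>+s. indicator {s<..} t * \<psi>' s \<partial>lborel)"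
   proof -
    have "(\<integral>\<^sup>+s. ennreal ((s powr a * \<phi> s) powr p) \<partial>lebesgue_on {0<..<t}) = (\<integral>\<^sup>+s. indicator {s<..} t * \<psi> s \<partial>lebesgue)"
     by (subst nn_integral_restrict_space) (auto simp: \<psi>_def indicator_def intro!: nn_integral_cong)
    also have "\<dots> = (\<integral>\<^sup>+s. indicator {s<..} t * \<psi>' s \<partial>lebesgue)"
     using AE_completion[OF \<psi>'(2)] by (intro nn_integral_cong_AE) (elim eventually_mono, simp)
    also have "\<dots> = (\<integral>\<^sup>+s. indicator {s<..} t * \<psi>' s \<partial>lborel)" by (rule nn_integral_completion)
    finally show ?thesis .
   qed
   show ?thesis
   proof (cases "(\<integral>\<^sup>+s. indicator {s<..} t * \<psi>' s \<partial>lborel)")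
    case (real I)
    define I' where "I' = I powr (1/p)"
    have I': "I' \<ge> 0" "I' powr p = I" using real p by (auto simp: I'_def powr_powr)
    have "(\<integral>\<^sup>+s. ennreal (\<phi> s) \<partial>lebesgue_on {0<..<t}) \<le> ennreal (H * t powr (1 - 1/p - a) * I')"
     unfolding H_def
    proof (rule holder_weight[OF p a(2) t])
     show "\<phi> \<in> borel_measurable (lebesgue_on {0<..<t})"
      using sm_subset[OF wLp_sm[OF \<phi>] Ioo_subset_Ioi[OF order_refl, of t]] by (simp add: sm_real_iff)
    qed (use nn I' fin real in auto)
    moreover have "(\<integral>\<^sup>+s. ennreal (\<phi> s) \<partial>lebesgue_on {0<..<t}) = ennreal (\<Phi> t)"
     unfolding \<Phi>_def integral_interior
     using bintD(2)[OF wLp_bint_0inf[OF p \<mu> \<phi>, of t, unfolded bint_interior]] nn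
     by (intro nn_integral_eq_integral_on) auto
    ultimately have "\<Phi> t \<le> H * t powr (1 - 1/p - a) * I'" using H I' by simp
    then have "t powr (1-\<mu>) * (\<Phi> t / t) \<le> t powr (1-\<mu>) * (H * t powr (1 - 1/p - a) * I' / t)"
     using t by (intro mult_left_mono divide_right_mono) auto
    also have "\<dots> = H * I' * t powr (1 - \<mu> - 1/p - a)"
     using t by (simp add: field_simps powr_diff powr_add)
    finally have "(t powr (1-\<mu>) * (\<Phi> t / t)) powr p \<le> (H * I' * t powr (1 - \<mu> - 1/p - a)) powr p"
     using t nonneg[of t] p by (intro powr_mono2) auto
    also have "\<dots> = H powr p * (t powr (-b) * I)"
    proof -
     have "(1 - \<mu> - 1/p - a) * p = - b" using p by (simp add: b_def algebra_simps)
     then show ?thesis using H I' by (simp add: powr_mult powr_powr)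
    qed
    finally have "ennreal ((t powr (1-\<mu>) * (\<Phi> t / t)) powr p) \<le> ennreal (H powr p * (t powr (-b) * I))" by (rule ennreal_leI)
    also have "\<dots> = ennreal (H powr p) * (ennreal (t powr (-b)) * ennreal I)" using real by (simp add: ennreal_mult)
    also have "\<dots> = ennreal (H powr p) * (ennreal (t powr (-b)) * (\<integral>\<^sup>+s. indicator {s<..} t * \<psi>' s \<partial>lborel))" using real by simp
    also have "\<dots> = ennreal (H powr p) * (\<integral>\<^sup>+s. ennreal (t powr (-b)) * (indicator {s<..} t * \<psi>' s) \<partial>lborel)"
     by (subst nn_integral_cmult) (auto simp: indicator_def)
    finally show ?thesis using t nonneg[of t] by (simp add: mult.assoc)
   next
    case top
    have "(\<integral>\<^sup>+s. ennreal (t powr (-b)) * indicator {s<..} t * \<psi>' s \<partial>lborel) = ennreal (t powr (-b)) * \<infinity>"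
     unfolding mult.assoc using top by (subst nn_integral_cmult) (auto simp: indicator_def)
    then show ?thesis using t H by (simp add: ennreal_mult_top)
   qed
  qed
  have "wint {0<..} p \<mu> (\<lambda>t. \<Phi> t / t) = (\<integral>\<^sup>+t. ennreal (norm (t powr (1 - \<mu>) *\<^sub>R (\<Phi> t / t)) powr p) * indicator {0<..} t \<partial>lebesgue)"
   unfolding wint_def by (subst nn_integral_restrict_space) auto
  also have "\<dots> \<le> (\<integral>\<^sup>+t. ennreal (H powr p) * (\<integral>\<^sup>+s. ennreal (t powr (-b)) * indicator {s<..} t * \<psi>' s \<partial>lborel) \<partial>lebesgue)"
   using bound by (intro nn_integral_mono) (auto simp: indicator_def)
  also have "\<dots> = (\<integral>\<^sup>+t. ennreal (H powr p) * (\<integral>\<^sup>+s. ennreal (t powr (-b)) * indicator {s<..} t * \<psi>' s \<partial>lborel) \<partial>lborel)"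
   by (rule nn_integral_completion)
  also have "\<dots> = ennreal (H powr p) * (\<integral>\<^sup>+t. (\<integral>\<^sup>+s. ennreal (t powr (-b)) * indicator {s<..} t * \<psi>' s \<partial>lborel) \<partial>lborel)"
   by (subst nn_integral_cmult) (auto simp: greaterThan_def)
  also have "(\<integral>\<^sup>+t. (\<integral>\<^sup>+s. ennreal (t powr (-b)) * indicator {s<..} t * \<psi>' s \<partial>lborel) \<partial>lborel)
    = (\<integral>\<^sup>+s. (\<integral>\<^sup>+t. ennreal (t powr (-b)) * indicator {s<..} t * \<psi>' s \<partial>lborel) \<partial>lborel)"
   by (rule lborel_pair.Fubini') (auto simp: greaterThan_def case_prod_unfold)
  also have "\<dots> = (\<integral>\<^sup>+s. (\<integral>\<^sup>+t. ennreal (t powr (-b)) * indicator {s<..} t \<partial>lborel) * \<psi>' s \<partial>lborel)"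
   by (subst nn_integral_multc) auto
  also have "\<dots> = (\<integral>\<^sup>+s. (\<integral>\<^sup>+t. ennreal (t powr (-b)) * indicator {s<..} t \<partial>lborel) * \<psi> s \<partial>lborel)"
   using \<psi>'(2) by (intro nn_integral_cong_AE) (elim eventually_mono, simp)
  also have "\<dots> = (\<integral>\<^sup>+s. ennreal (1/(b-1)) * (ennreal (norm (s powr (1 - \<mu>) *\<^sub>R \<phi> s) powr p) * indicator {0<..} s) \<partial>lborel)"
  proof (rule nn_integral_cong)
   fix s :: real
   show "(\<integral>\<^sup>+t. ennreal (t powr (-b)) * indicator {s<..} t \<partial>lborel) * \<psi> s =
    ennreal (1/(b-1)) * (ennreal (norm (s powr (1 - \<mu>) *\<^sub>R \<phi> s) powr p) * indicator {0<..} s)"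
   proof (cases "s > 0")
    case True
    have "s powr (1-b) / (b-1) * (s powr a * \<phi> s) powr p = 1/(b-1) * (s powr (1-\<mu>) * \<phi> s) powr p"
    proof -
     have "s powr (1-b) * (s powr a * \<phi> s) powr p = s powr (1 - b + a * p) * \<phi> s powr p"
      using nn by (simp add: powr_mult powr_powr powr_add)
     \<comment> \<open>The auxiliary exponent a cancels, leaving the weight of the space.\<close>
     also have "1 - b + a * p = (1-\<mu>) * p" by (simp add: b_def algebra_simps)
     finally show ?thesis using nn by (simp add: powr_mult powr_powr)
    qed
    then show ?thesis using True b nn nn_integral_powr_to_inf[OF True b]
     by (simp add: \<psi>_def ennreal_mult[symmetric] abs_of_nonneg)
   qed (simp add: \<psi>_def)
  qed
  also have "\<dots> = (\<integral>\<^sup>+s. ennreal (1/(b-1)) * (ennreal (norm (s powr (1 - \<mu>) *\<^sub>R \<phi> s) powr p) * indicator {0<..} s) \<partial>lebesgue)"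
   by (rule nn_integral_completion[symmetric])
  also have "\<dots> = ennreal (1/(b-1)) * wint {0<..} p \<mu> \<phi>"
  proof -
   have "(\<lambda>t. ennreal (norm (t powr (1 - \<mu>) *\<^sub>R \<phi> t) powr p)) \<in> borel_measurable (lebesgue_on {0<..})"
    by (rule wint_measurable[OF _ wLp_sm[OF \<phi>]]) simp
   then have m: "(\<lambda>t. ennreal (norm (t powr (1 - \<mu>) *\<^sub>R \<phi> t) powr p) * indicator {0<..} t) \<in> borel_measurable lebesgue"
    by (subst (asm) borel_measurable_restrict_space_iff_ennreal) auto
   have eq: "wint {0<..} p \<mu> \<phi> = (\<integral>\<^sup>+t. ennreal (norm (t powr (1 - \<mu>) *\<^sub>R \<phi> t) powr p) * indicator {0<..} t \<partial>lebesgue)"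
    unfolding wint_def by (rule nn_integral_restrict_space) simp
   show ?thesis unfolding eq by (rule nn_integral_cmult[OF m])
  qed
  also have "\<dots> = ennreal (1/(b-1) * wLp_norm {0<..} p \<mu> \<phi> powr p)"
   using wint_eq[OF _ \<phi>] p b by (simp add: ennreal_mult[symmetric])
  also have "ennreal (H powr p) * \<dots> = ennreal ((C * wLp_norm {0<..} p \<mu> \<phi>) powr p)"
   using C b by (simp add: powr_mult Cp ennreal_mult[symmetric])
  finally have "wint {0<..} p \<mu> (\<lambda>t. \<Phi> t / t) \<le> ennreal ((C * wLp_norm {0<..} p \<mu> \<phi>) powr p)" .
  from wLpI[OF _ sm this] p C
  show "(\<lambda>t. integral {0..t} \<phi> / t) \<in> wLp {0<..} p \<mu>"
   "wLp_norm {0<..} p \<mu> (\<lambda>t. integral {0..t} \<phi> / t) \<le> C * wLp_norm {0<..} p \<mu> \<phi>" by (auto simp: \<Phi>_def)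
 qed
qed

section \<open>Calculus of indefinite Bochner integrals\<close>

lemma AE_lebesgue_on_negligible:
 "J \<in> sets lebesgue \<Longrightarrow> (AE t in lebesgue_on J. P t) \<longleftrightarrow> negligible {t \<in> J. \<not> P t}"
proof -
 assume J: "J \<in> sets lebesgue"
 have "(AE t in lebesgue. t \<in> J \<longrightarrow> P t) \<longleftrightarrow> {t \<in> J. \<not> P t} \<in> null_sets lebesgue"
  using completion.AE_iff_null_sets[where M=lborel and P="\<lambda>t. t \<in> J \<longrightarrow> P t"] by simp
 then show ?thesis unfolding AE_lebesgue_on[OF J] by (simp add: negligible_iff_null_sets)
qed

lemma integral_AE_eq:
 fixes f g :: "real \<Rightarrow> 'x::banach"
 assumes "J \<in> sets lebesgue" "AE t in lebesgue_on J. f t = g t"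
 shows "integral J f = integral J g"
 by (rule integral_spike[of "{t \<in> J. f t \<noteq> g t}"])
  (use assms AE_lebesgue_on_negligible[of J "\<lambda>t. f t = g t"] in auto)

lemma AE_lebesgue_on_subset:
 "J \<in> sets lebesgue \<Longrightarrow> K \<in> sets lebesgue \<Longrightarrow> K \<subseteq> J \<Longrightarrow> AE t in lebesgue_on J. P t \<Longrightarrow> AE t in lebesgue_on K. P t"
 unfolding AE_lebesgue_on by (elim eventually_mono) auto

lemma integral_diff_Icc:
 fixes f :: "real \<Rightarrow> 'x::banach"
 assumes "bint {a..b} f" "a \<le> s" "s \<le> t" "t \<le> b"
 shows "integral {a..t} f - integral {a..s} f = integral {s..t} f"
proof -
 have "f integrable_on {a..t}"
  using bint_integrable[OF _ bint_sub[OF assms(1), of "{a..t}"]] assms(4) by auto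
 from HK_integral_combine[OF assms(2,3) this] show ?thesis by (simp add: algebra_simps)
qed

text \<open>Absolutely continuous functions, as indefinite Bochner integrals.\<close>

definition prim :: "real \<Rightarrow> real \<Rightarrow> (real \<Rightarrow> 'x::banach) \<Rightarrow> (real \<Rightarrow> 'x) \<Rightarrow> bool" where
 "prim a b g u \<longleftrightarrow> bint {a..b} g \<and> (\<forall>t\<in>{a..b}. u t = u a + integral {a..t} g)"

lemma prim_bint: "prim a b g u \<Longrightarrow> bint {a..b} g" by (simp add: prim_def)

lemma prim_eq:
 assumes "prim a b g u" "a \<le> t" "t \<le> b" shows "u t = u a + integral {a..t} g"
 by (rule bspec[OF conjunct2[OF assms(1)[unfolded prim_def]]]) (use assms in simp)

lemma primI:
 assumes "bint {a..b} g" "\<And>t. a \<le> t \<Longrightarrow> t \<le> b \<Longrightarrow> u t = u a + integral {a..t} g"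
 shows "prim a b g u"
 unfolding prim_def
proof (intro conjI ballI assms(1))
 fix t assume "t \<in> {a..b}"
 then have "a \<le> t" "t \<le> b" by auto
 then show "u t = u a + integral {a..t} g" by (rule assms(2))
qed

lemma prim_diff_eq:
 assumes "prim a b g u" "a \<le> s" "s \<le> t" "t \<le> b"
 shows "u t - u s = integral {s..t} g"
proof -
 have "u t = u a + integral {a..t} g" "u s = u a + integral {a..s} g"
  using assms by (auto intro: prim_eq)
 then show ?thesis using integral_diff_Icc[OF prim_bint[OF assms(1)] assms(2-4)] by simp
qed

lemma prim_sub:
 assumes "prim a b g u" "a \<le> a'" "b' \<le> b"
 shows "prim a' b' g u"
 unfolding prim_def
proof
 show "bint {a'..b'} g" using bint_sub[OF prim_bint[OF assms(1)], of "{a'..b'}"] assms(2,3) by auto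
 show "\<forall>t\<in>{a'..b'}. u t = u a' + integral {a'..t} g"
 proof
  fix t assume "t \<in> {a'..b'}"
  then have "u t - u a' = integral {a'..t} g" using assms by (intro prim_diff_eq) auto
  then show "u t = u a' + integral {a'..t} g" by (metis add.commute diff_add_cancel)
 qed
qed

lemma prim_continuous_on:
 assumes "prim a b g u" shows "continuous_on {a..b} u"
proof -
 have "g integrable_on {a..b}" using bint_integrable[OF _ prim_bint[OF assms]] by simp
 then have "continuous_on {a..b} (\<lambda>t. u a + integral {a..t} g)"
  by (intro continuous_intros indefinite_integral_continuous_1)
 moreover have "u a + integral {a..t} g = u t" if "t \<in> {a..b}" for t
  using prim_eq[OF assms, of t] that by simp
 ultimately show ?thesis by (rule continuous_on_eq)
qed

lemma prim_norm_diff_le: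
 assumes "prim a b g u" "a \<le> s" "s \<le> t" "t \<le> b"
 shows "norm (u t - u s) \<le> integral {s..t} (\<lambda>r. norm (g r))"
proof -
 have "bint {s..t} g" using prim_sub[OF assms(1,2,4)] prim_bint by blast
 then show ?thesis unfolding prim_diff_eq[OF assms] by (intro bint_norm_integral_le) auto
qed

lemma prim_join:
 assumes "prim a b g u" "prim b c g u" "a \<le> b" "b \<le> c"
 shows "prim a c g u"
proof -
 have "bint ({a..b} \<union> {b..c}) g" using assms by (intro bint_Un) (auto intro: prim_bint)
 then have bi: "bint {a..c} g" using assms(3,4) by (simp add: ivl_disj_un_two_touch)
 moreover have "u t = u a + integral {a..t} g" if t: "a \<le> t" "t \<le> c" for t
 proof (cases "t \<le> b")
  case True then show ?thesis using prim_eq[OF assms(1), of t] t by simp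
 next
  case False
  then have "u t - u b = integral {b..t} g" "u b - u a = integral {a..b} g"
   using prim_diff_eq[OF assms(2), of b t] prim_diff_eq[OF assms(1), of a b] assms(3) t by auto
  then show ?thesis using integral_diff_Icc[OF bi, of b t] assms(3) t False by (simp add: algebra_simps)
 qed
 ultimately show ?thesis by (rule primI)
qed

lemma prim_cong:
 assumes "prim a b g u" "AE t in lebesgue_on {a..b}. g t = g' t" "\<And>t. t \<in> {a..b} \<Longrightarrow> u t = u' t" "a \<le> b"
 shows "prim a b g' u'"
proof -
 have "integral {a..t} g = integral {a..t} g'" if "t \<in> {a..b}" for t
  using that by (intro integral_AE_eq AE_lebesgue_on_subset[OF _ _ _ assms(2)]) auto
 note ig = this
 show ?thesis
 proof (rule primI)
  show "bint {a..b} g'" by (rule bint_cong_AE[OF _ prim_bint[OF assms(1)] assms(2)]) simp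
  fix t assume t: "a \<le> t" "t \<le> b"
  show "u' t = u' a + integral {a..t} g'"
   using prim_eq[OF assms(1) t] assms(3)[of t] assms(3)[of a] ig[of t] t by simp
 qed
qed

lemma prim_linear:
 assumes h: "bounded_linear h" and u: "prim a b g u"
 shows "prim a b (\<lambda>t. h (g t)) (\<lambda>t. h (u t))"
 unfolding prim_def
proof (intro conjI ballI)
 show "bint {a..b} (\<lambda>t. h (g t))" by (rule bint_linear[OF _ h prim_bint[OF u]]) simp
 fix t assume t: "t \<in> {a..b}"
 interpret bounded_linear h by fact
 have "bint {a..t} g" using prim_sub[OF u order_refl, of t] t by (auto simp: prim_bint)
 then have "g integrable_on {a..t}" by (intro bint_integrable) auto
 then have "integral {a..t} (\<lambda>t. h (g t)) = h (integral {a..t} g)"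
  by (rule integral_linear[OF _ h, unfolded comp_def])
 moreover have "u t = u a + integral {a..t} g" using prim_eq[OF u, of t] t by simp
 ultimately show "h (u t) = h (u a) + integral {a..t} (\<lambda>t. h (g t))" using add[of "u a"] by simp
qed

lemma prim_add:
 assumes "prim a b g u" "prim a b g' u'"
 shows "prim a b (\<lambda>t. g t + g' t) (\<lambda>t. u t + u' t)"
 unfolding prim_def
proof (intro conjI ballI)
 show "bint {a..b} (\<lambda>t. g t + g' t)" using assms by (intro bint_add) (auto intro: prim_bint)
 fix t assume t: "t \<in> {a..b}"
 have "g integrable_on {a..t}" "g' integrable_on {a..t}"
  using prim_sub[OF assms(1) order_refl, of t] prim_sub[OF assms(2) order_refl, of t] t
  by (auto intro!: bint_integrable simp: prim_bint)
 then show "u t + u' t = u a + u' a + integral {a..t} (\<lambda>t. g t + g' t)"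
  using prim_eq[OF assms(1), of t] prim_eq[OF assms(2), of t] t
  by (subst HK_integral_add) (simp_all add: add_ac)
qed

lemma prim_scale: "prim a b g u \<Longrightarrow> prim a b (\<lambda>t. c *\<^sub>R g t) (\<lambda>t. c *\<^sub>R u t)"
 by (rule prim_linear) (auto intro: bounded_linear_scaleR_right)

lemma prim_diff:
 assumes "prim a b g u" "prim a b g' u'"
 shows "prim a b (\<lambda>t. g t - g' t) (\<lambda>t. u t - u' t)"
 using prim_add[OF assms(1) prim_scale[OF assms(2), of "-1"]] by simp

lemma prim_integral: "bint {a..b} g \<Longrightarrow> prim a b g (\<lambda>t. x + integral {a..t} g)"
 by (intro primI) auto

lemma has_integral_shift_Icc:
 fixes f :: "real \<Rightarrow> 'x::banach"
 shows "(f has_integral I) {a..b} \<Longrightarrow> ((\<lambda>t. f (t - c)) has_integral I) {a + c..b + c}"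
 using has_integral_affinity'[of f I a b 1 "-c"] by simp

lemma integral_shift_Icc:
 fixes f :: "real \<Rightarrow> 'x::banach"
 shows "integral {a + c..b + c} (\<lambda>t. f (t - c)) = integral {a..b} f"
proof (cases "f integrable_on {a..b}")
 case True
 show ?thesis by (rule integral_unique[OF has_integral_shift_Icc[OF integrable_integral[OF True]]])
next
 case False
 have "\<not> (\<lambda>t. f (t - c)) integrable_on {a + c..b + c}"
 proof
  assume "(\<lambda>t. f (t - c)) integrable_on {a + c..b + c}"
  then obtain I where "((\<lambda>t. f (t - c)) has_integral I) {a + c..b + c}" by (auto simp: integrable_on_def)
  from has_integral_shift_Icc[OF this, of "-c"] have "(f has_integral I) {a..b}" by simp
  then show False using False by (auto simp: integrable_on_def)
 qed
 with False show ?thesis by (simp add: not_integrable_integral)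
qed

lemma bint_shift_Icc:
 fixes f :: "real \<Rightarrow> 'x::banach"
 assumes "bint {a..b} f" shows "bint {a + c..b + c} (\<lambda>t. f (t - c))"
proof -
 have "{t. t + - c \<in> {a..b}} = {a + c..b + c}" by auto
 then have "smeas {a + c..b + c} (\<lambda>t. f (t - c))"
  using sm_shift[OF _ bintD(1)[OF assms], of "-c"] by simp
 moreover have "(\<lambda>t. norm (f (t - c))) integrable_on {a + c..b + c}"
  using has_integral_shift_Icc[of "\<lambda>t. norm (f t)" _ a b c] bintD(2)[OF assms] unfolding integrable_on_def by blast
 ultimately show ?thesis by (simp add: bint_def)
qed

lemma prim_shift:
 assumes "prim a b g u" shows "prim (a + c) (b + c) (\<lambda>t. g (t - c)) (\<lambda>t. u (t - c))"
 unfolding prim_def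
proof (intro conjI ballI)
 show "bint {a + c..b + c} (\<lambda>t. g (t - c))" by (rule bint_shift_Icc[OF prim_bint[OF assms]])
 fix t assume "t \<in> {a + c..b + c}"
 then show "u (t - c) = u (a + c - c) + integral {a + c..t} (\<lambda>t. g (t - c))"
  using prim_eq[OF assms, of "t - c"] integral_shift_Icc[of a c "t - c" g] by simp
qed

text \<open>Over n equal steps the increments of G telescope and the bounds add up to K (b-a)/n (G b
  - G a), where n is arbitrary.\<close>

lemma constant_if_increments_small:
 fixes H :: "real \<Rightarrow> 'x::real_normed_vector" and G :: "real \<Rightarrow> real"
 assumes ab: "a \<le> b" and "\<And>s t. a \<le> s \<Longrightarrow> s \<le> t \<Longrightarrow> t \<le> b \<Longrightarrow> norm (H t - H s) \<le> K * (t - s) * (G t - G s)"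
 shows "H b = H a"
proof -
 have bound: "norm (H b - H a) \<le> K * ((b - a) / real n) * (G b - G a)" if n: "n > 0" for n :: nat
 proof -
  define h where "h = (b - a) / real n"
  define x where "x i = a + h * real i" for i :: nat
  have x: "x 0 = a" "x n = b" using n by (auto simp: x_def h_def)
  have "norm (H (x k) - H a) \<le> K * h * (G (x k) - G a)" if "k \<le> n" for k
   using that
  proof (induction k)
   case 0 then show ?case using x by simp
  next
   case (Suc k)
   have d: "x (Suc k) - x k = h" by (simp add: x_def algebra_simps)
   have d0: "h \<ge> 0" using ab by (simp add: h_def)
   have 1: "a \<le> x k" unfolding x_def using d0 by simp
   have "x (Suc k) \<le> a + h * real n" unfolding x_def using Suc.prems d0 by (intro add_left_mono mult_left_mono) auto
   then have 2: "x (Suc k) \<le> b" using x(2) by (simp add: x_def)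
   have "norm (H (x (Suc k)) - H a) \<le> norm (H (x (Suc k)) - H (x k)) + norm (H (x k) - H a)"
    by (metis norm_triangle_ineq diff_add_cancel add_diff_eq)
   also have "\<dots> \<le> K * (x (Suc k) - x k) * (G (x (Suc k)) - G (x k)) + K * h * (G (x k) - G a)"
    using Suc d d0 1 2 by (intro add_mono assms(2)) auto
   finally show ?case unfolding d by (simp add: algebra_simps)
  qed
  from this[of n] show ?thesis using x by (simp add: h_def)
 qed
 have "(\<lambda>n. K * ((b - a) / real n) * (G b - G a)) \<longlonglongrightarrow> K * 0 * (G b - G a)"
  by (intro tendsto_intros lim_const_over_n)
 moreover have "eventually (\<lambda>n. norm (H b - H a) \<le> K * ((b - a) / real n) * (G b - G a)) sequentially"
  by (rule eventually_sequentiallyI[of 1], rule bound) simp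
 ultimately have "norm (H b - H a) \<le> K * 0 * (G b - G a)"
  by (rule tendsto_lowerbound) simp
 then show ?thesis by simp
qed

text \<open>The defect of the product formula has increments of the size (t-s) times the increment
  of the integral of |g|, because \<phi> is Lipschitz and u varies by at most that integral. Such a
  defect is constant, and no pointwise derivative of u is taken.\<close>

lemma prim_mult:
 fixes u :: "real \<Rightarrow> 'x::banach"
 assumes u: "prim a b g u" and ab: "a \<le> b"
  and d: "\<And>t. t \<in> {a..b} \<Longrightarrow> (\<phi> has_real_derivative \<phi>' t) (at t within {a..b})" and c: "continuous_on {a..b} \<phi>'"
 shows "prim a b (\<lambda>t. \<phi>' t *\<^sub>R u t + \<phi> t *\<^sub>R g t) (\<lambda>t. \<phi> t *\<^sub>R u t)"
proof -
 have \<phi>c: "continuous_on {a..b} \<phi>" using d by (rule DERIV_continuous_on)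
 have "compact (\<phi>' ` {a..b})" using c by (intro compact_continuous_image) auto
 then obtain K where K: "\<And>t. t \<in> {a..b} \<Longrightarrow> \<bar>\<phi>' t\<bar> \<le> K" 
  using compact_imp_bounded bounded_iff by (metis imageI real_norm_def)
 have "compact (\<phi> ` {a..b})" using \<phi>c by (intro compact_continuous_image) auto
 then obtain B where B: "\<And>t. t \<in> {a..b} \<Longrightarrow> \<bar>\<phi> t\<bar> \<le> B"
  using compact_imp_bounded bounded_iff by (metis imageI real_norm_def)
 note uc = prim_continuous_on[OF u]
 have b1: "bint {a..b} (\<lambda>t. \<phi>' t *\<^sub>R u t)" using c uc by (intro bint_continuous continuous_intros)
 have b2: "bint {a..b} (\<lambda>t. \<phi> t *\<^sub>R g t)"
  by (rule bint_bounded_mult[OF _ sm_continuous_on[OF _ \<phi>c] B prim_bint[OF u]]) auto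
 let ?h = "\<lambda>t. \<phi>' t *\<^sub>R u t + \<phi> t *\<^sub>R g t"
 have bh: "bint {a..b} ?h" by (rule bint_add[OF _ b1 b2]) simp
 let ?G = "\<lambda>t. integral {a..t} (\<lambda>r. norm (g r))"
 let ?H = "\<lambda>t. \<phi> t *\<^sub>R u t - integral {a..t} ?h"
 have inc: "norm (?H t - ?H s) \<le> (2 * K) * (t - s) * (?G t - ?G s)" if st: "a \<le> s" "s \<le> t" "t \<le> b" for s t
 proof -
  have sub: "{s..t} \<subseteq> {a..b}" using st by auto
  have Gd: "?G t - ?G s = integral {s..t} (\<lambda>r. norm (g r))"
   using bintD(2)[OF prim_bint[OF u]] st by (intro integral_diff_Icc[of a b]) (auto simp: bint_def sm_norm[OF bintD(1)[OF prim_bint[OF u]]])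
  have gb: "bint {s..t} g" by (rule bint_sub[OF prim_bint[OF u] sub]) auto
  have gi: "g integrable_on {s..t}" by (rule bint_integrable[OF _ gb]) auto
  have pb: "bint {s..t} (\<lambda>r. \<phi> r *\<^sub>R g r)" "bint {s..t} (\<lambda>r. \<phi>' r *\<^sub>R u r)"
   by (rule bint_sub[OF b2 sub] bint_sub[OF b1 sub]; simp)+
  have c': "continuous_on {s..t} \<phi>'" "continuous_on {s..t} u" using c uc sub continuous_on_subset by blast+
  have ftc: "(\<phi>' has_integral (\<phi> t - \<phi> s)) {s..t}"
  proof (rule fundamental_theorem_of_calculus[OF st(2)])
   fix x assume "x \<in> {s..t}"
   then have "(\<phi> has_real_derivative \<phi>' x) (at x within {s..t})"
    using sub by (intro DERIV_subset[OF d sub]) auto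
   then show "(\<phi> has_vector_derivative \<phi>' x) (at x within {s..t})"
    by (simp add: has_real_derivative_iff_has_vector_derivative)
  qed
  have e1: "\<phi> s *\<^sub>R (u t - u s) = integral {s..t} (\<lambda>r. \<phi> s *\<^sub>R g r)"
   using prim_diff_eq[OF u st] by simp
  have e2: "(\<phi> t - \<phi> s) *\<^sub>R u t = integral {s..t} (\<lambda>r. \<phi>' r *\<^sub>R u t)"
   using has_integral_scaleR_left[OF ftc, of "u t"] by (simp add: integral_unique)
  have e3: "integral {a..t} ?h - integral {a..s} ?h = integral {s..t} ?h"
   by (rule integral_diff_Icc[OF bh st])
  \<comment> \<open>The increment of the product is written with \<phi> frozen at s and u frozen at
    t; subtracting the claimed integrand leaves only differences of \<phi> and of u.\<close>
  let ?k = "\<lambda>r. (\<phi> s - \<phi> r) *\<^sub>R g r + \<phi>' r *\<^sub>R (u t - u r)"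
  have i1: "(\<lambda>r. \<phi> s *\<^sub>R g r) integrable_on {s..t}" by (rule integrable_cmul[OF gi])
  have i2: "(\<lambda>r. \<phi>' r *\<^sub>R u t) integrable_on {s..t}"
   using c'(1) by (intro integrable_continuous_real continuous_intros)
  have i3: "?h integrable_on {s..t}" by (rule bint_integrable[OF _ bint_sub[OF bh sub]]) auto
  note i = i1 i2 i3 integrable_add[OF i1 i2]
  have "?H t - ?H s = \<phi> s *\<^sub>R (u t - u s) + (\<phi> t - \<phi> s) *\<^sub>R u t - (integral {a..t} ?h - integral {a..s} ?h)"
   by (simp add: algebra_simps)
  also have "\<dots> = integral {s..t} (\<lambda>r. (\<phi> s *\<^sub>R g r + \<phi>' r *\<^sub>R u t) - ?h r)"
   unfolding e1 e2 e3 using i by (simp only: HK_integral_diff HK_integral_add)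
  also have "(\<lambda>r. (\<phi> s *\<^sub>R g r + \<phi>' r *\<^sub>R u t) - ?h r) = ?k" by (simp add: fun_eq_iff algebra_simps)
  finally have eq: "?H t - ?H s = integral {s..t} ?k" .
  have ki: "?k integrable_on {s..t}"
   using integrable_diff[OF i(4,3)] by (rule integrable_eq) (simp add: algebra_simps)
  have "norm (integral {s..t} ?k) \<le> integral {s..t} (\<lambda>r. K * (t - s) * norm (g r) + K * (?G t - ?G s))"
  proof (rule HK_integral_norm_bound_integral[OF ki])
   show "(\<lambda>r. K * (t - s) * norm (g r) + K * (?G t - ?G s)) integrable_on {s..t}"
    using bintD(2)[OF gb] by (intro integrable_add integrable_on_mult_right) auto
   fix r assume r: "r \<in> {s..t}"
   then have rb: "r \<in> {a..b}" "s \<in> {a..b}" using sub st by auto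
   have K0: "K \<ge> 0" using K[OF rb(1)] by linarith
   have "\<bar>\<phi> s - \<phi> r\<bar> \<le> K * \<bar>s - r\<bar>"
   proof -
    have "norm (\<phi> s - \<phi> r) \<le> K * norm (s - r)"
     by (rule field_differentiable_bound[of "{a..b}" \<phi> \<phi>']) (use d K rb in auto)
    then show ?thesis by simp
   qed
   also have "\<dots> \<le> K * (t - s)" using r K0 by (intro mult_left_mono) auto
   finally have 1: "norm ((\<phi> s - \<phi> r) *\<^sub>R g r) \<le> K * (t - s) * norm (g r)" by (simp add: mult_right_mono)
   have "norm (u t - u r) \<le> integral {r..t} (\<lambda>r. norm (g r))" using r rb st by (intro prim_norm_diff_le[OF u]) auto
   also have "\<dots> \<le> integral {s..t} (\<lambda>r. norm (g r))"
    using r bintD(2)[OF gb] bintD(2)[OF bint_sub[OF gb, of "{r..t}"]] by (intro integral_subset_le) auto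
   finally have "norm (u t - u r) \<le> ?G t - ?G s" using Gd by simp
   then have 2: "norm (\<phi>' r *\<^sub>R (u t - u r)) \<le> K * (?G t - ?G s)"
    using K[OF rb(1)] by (simp add: mult_mono)
   show "norm (?k r) \<le> K * (t - s) * norm (g r) + K * (?G t - ?G s)"
    by (rule norm_triangle_le[OF add_mono[OF 1 2]])
  qed
  also have "\<dots> = K * (t - s) * integral {s..t} (\<lambda>r. norm (g r)) + (t - s) * (K * (?G t - ?G s))"
   using bintD(2)[OF gb] st by (subst HK_integral_add) (auto intro: integrable_on_mult_right)
  also have "\<dots> = (2 * K) * (t - s) * (?G t - ?G s)" unfolding Gd by (simp add: algebra_simps)
  finally show ?thesis unfolding eq .
 qed
 have "\<phi> t *\<^sub>R u t = \<phi> a *\<^sub>R u a + integral {a..t} ?h" if t: "a \<le> t" "t \<le> b" for t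
 proof -
  have "?H t = ?H a" by (rule constant_if_increments_small[of a t ?H "2*K" ?G]) (use t in \<open>auto intro!: inc\<close>)
  then show ?thesis by (simp add: algebra_simps)
 qed
 then show ?thesis using bh by (rule primI[rotated])
qed

text \<open>An outer cover by countably many nonoverlapping intervals, cut down to a finite
  subfamily; each of the two losses is at most e/3. It reduces statements on measurable sets to
  statements on intervals.\<close>

lemma interval_approx:
 assumes E: "E \<in> lmeasurable" "E \<subseteq> {a..b::real}" and e: "e > 0"
 obtains F where "finite F" "\<And>K. K \<in> F \<Longrightarrow> \<exists>c d. c \<le> d \<and> K = {c..d} \<and> {c..d} \<subseteq> {a..b}"
  "pairwise (\<lambda>K L. negligible (K \<inter> L)) F" "measure lebesgue ((E - \<Union>F) \<union> (\<Union>F - E)) < e"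
proof -
 obtain D where D: "countable D" "\<And>K. K \<in> D \<Longrightarrow> K \<subseteq> cbox a b \<and> K \<noteq> {} \<and> (\<exists>c d. K = cbox c d)"
  "pairwise (\<lambda>A B. interior A \<inter> interior B = {}) D" "E \<subseteq> \<Union>D" "\<Union>D \<in> lmeasurable"
  "measure lebesgue (\<Union>D) \<le> measure lebesgue E + e/3"
  using measurable_outer_intervals_bounded[of E a b "e/3"] E e by (metis box_real(2) divide_pos_pos zero_less_numeral)
 have Dl: "K \<in> lmeasurable" if "K \<in> D" for K using D(2)[OF that] by auto
 have "measure lebesgue (\<Union>D') \<le> measure lebesgue (\<Union>D)" if "D' \<subseteq> D" "finite D'" for D'
  using that D(5) Dl by (intro measure_mono_fmeasurable) (auto intro!: sets.finite_Union fmeasurableD)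
 then obtain F where F: "F \<subseteq> D" "finite F" "measure lebesgue (\<Union>D) - e/3 < measure lebesgue (\<Union>F)"
  using measure_countable_Union_approachable[OF D(1) _ Dl, of "e/3"] e by (metis divide_pos_pos zero_less_numeral)
 have UF: "\<Union>F \<in> lmeasurable" using F Dl by (intro fmeasurable.finite_Union) auto
 have "measure lebesgue ((E - \<Union>F) \<union> (\<Union>F - E)) \<le> measure lebesgue ((\<Union>D - \<Union>F) \<union> (\<Union>D - E))"
  using D(4,5) F(1) UF E(1) by (intro measure_mono_fmeasurable) auto
 also have "\<dots> \<le> measure lebesgue (\<Union>D - \<Union>F) + measure lebesgue (\<Union>D - E)"
  using D(5) UF E(1) by (intro measure_Un_le) auto
 also have "measure lebesgue (\<Union>D - \<Union>F) = measure lebesgue (\<Union>D) - measure lebesgue (\<Union>F)"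
  using D(5) UF F(1) by (intro measurable_measure_Diff) auto
 also have "measure lebesgue (\<Union>D - E) = measure lebesgue (\<Union>D) - measure lebesgue E"
  using D(4,5) E(1) by (intro measurable_measure_Diff) auto
 finally have lt: "measure lebesgue ((E - \<Union>F) \<union> (\<Union>F - E)) < e" using F(3) D(6) e by linarith
 show ?thesis
 proof (rule that[OF F(2) _ _ lt])
  fix K assume "K \<in> F"
  then obtain c d where cd: "K = cbox c d" "K \<noteq> {}" "K \<subseteq> cbox a b" using D(2) F(1) by blast
  then show "\<exists>c d. c \<le> d \<and> K = {c..d} \<and> {c..d} \<subseteq> {a..b}"
   by (intro exI[of _ c] exI[of _ d]) auto
 next
  show "pairwise (\<lambda>K L. negligible (K \<inter> L)) F"
  proof (rule pairwiseI)
   fix K L assume KL: "K \<in> F" "L \<in> F" "K \<noteq> L"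
   then have "interior (K \<inter> L) = {}" using D(3) F(1) by (auto simp: pairwise_def interior_Int)
   moreover have "convex (K \<inter> L)" using D(2) F(1) KL by (metis convex_Int convex_box(1) subsetD)
   ultimately show "negligible (K \<inter> L)" by (simp add: negligible_convex_interior)
  qed
 qed
qed

lemma integral_const_lmeasurable:
 fixes c :: real
 assumes "B \<in> lmeasurable" shows "integral B (\<lambda>_. c) = c * measure lebesgue B"
 using HK_integral_mult_right[of B c "\<lambda>_. 1"] lmeasure_integral[OF assms] by simp

text \<open>Absolute continuity of the integral: k is truncated at a level N with loss below
  \<eta>/2, and the truncated part is at most N times the measure of the set.\<close>

lemma integral_small_on_small_sets:
 fixes k :: "real \<Rightarrow> real"
 assumes k: "k integrable_on {a..b}" "\<And>t. t \<in> {a..b} \<Longrightarrow> k t \<ge> 0" and \<eta>: "\<eta> > 0"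
 obtains \<delta> where "\<delta> > 0" "\<And>B. B \<in> sets lebesgue \<Longrightarrow> B \<subseteq> {a..b} \<Longrightarrow> measure lebesgue B < \<delta> \<Longrightarrow> integral B k < \<eta>"
proof -
 let ?k = "\<lambda>N t. min (k t) (real N)"
 have km: "k \<in> borel_measurable (lebesgue_on {a..b})"
  using integrable_on_iff_nn_integral[of "{a..b}" k] k by auto
 have kbN: "bint {a..b} (?k N)" for N
  by (rule bint_dominated[OF _ _ k(1)]) (use km k(2) in \<open>auto simp: sm_real_iff\<close>)
 have kb0: "bint {a..b} k"
  by (rule bint_dominated[OF _ _ k(1)]) (use km k(2) in \<open>auto simp: sm_real_iff\<close>)
 have ki: "?k N integrable_on {a..b}" for N using bint_integrable[OF _ kbN] by simp
 have "(\<lambda>N. integral {a..b} (?k N)) \<longlonglongrightarrow> integral {a..b} k"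
 proof (rule dominated_convergence(2)[OF ki k(1)])
  show "norm (?k N t) \<le> k t" if "t \<in> {a..b}" for N t using k(2)[OF that] by auto
  show "(\<lambda>N. ?k N t) \<longlonglongrightarrow> k t" if "t \<in> {a..b}" for t
  proof (rule tendsto_eventually)
   obtain M where "k t \<le> real M" using real_arch_simple by blast
   then show "eventually (\<lambda>N. ?k N t = k t) sequentially"
    by (intro eventually_sequentiallyI[of M]) (auto simp: min_def intro: order_trans)
  qed
 qed
 then have "eventually (\<lambda>N. integral {a..b} k - \<eta>/2 < integral {a..b} (?k N)) sequentially"
  using \<eta> by (intro order_tendstoD(1)) auto
 then obtain N where N: "integral {a..b} k - \<eta>/2 < integral {a..b} (?k N)" by (auto simp: eventually_sequentially)
 show ?thesis
 proof (rule that[of "\<eta> / (2 * (real N + 1))"])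
  show "0 < \<eta> / (2 * (real N + 1))" using \<eta> by simp
  fix B assume B: "B \<in> sets lebesgue" "B \<subseteq> {a..b}" "measure lebesgue B < \<eta> / (2 * (real N + 1))"
  have Bl: "B \<in> lmeasurable" using B by (meson bounded_set_imp_lmeasurable bounded_subset bounded_closed_interval)
  note kb = kb0 kbN[of N]
  have kB: "k integrable_on B" "?k N integrable_on B"
   using bint_integrable[OF B(1) bint_sub[OF kb(1) B(2,1)]] bint_integrable[OF B(1) bint_sub[OF kb(2) B(2,1)]] by auto
  have "integral B (\<lambda>t. k t - ?k N t) \<le> integral {a..b} (\<lambda>t. k t - ?k N t)"
   using B(2) kB k(1) ki[of N] by (intro integral_subset_le integrable_diff) auto
  then have "integral B k - integral B (?k N) \<le> integral {a..b} k - integral {a..b} (?k N)"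
   using kB k(1) ki[of N] by (simp add: HK_integral_diff)
  moreover have "integral B (?k N) \<le> integral B (\<lambda>_. real N)"
   using kB Bl by (intro integral_le integrable_on_const) auto
  moreover have "integral B (\<lambda>_. real N) = real N * measure lebesgue B"
   by (rule integral_const_lmeasurable[OF Bl])
  moreover have "real N * measure lebesgue B \<le> (real N + 1) * measure lebesgue B" by (simp add: distrib_right)
  moreover have "(real N + 1) * measure lebesgue B < \<eta>/2" using B(3) by (simp add: field_simps)
  ultimately show "integral B k < \<eta>" using N by linarith
 qed
qed

text \<open>Interval approximation extends the hypothesis to measurable sets. The values of f are
  almost all in the closure of a countable set D; on the set \<open>E d\<close> where f is within
  norm d / 2 of a nonzero d, the integral of f cannot vanish unless \<open>E d\<close> is
  negligible, and the sets \<open>E d\<close> cover the points with f \<noteq> 0.\<close>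

lemma AE_zero_if_integrals_zero:
 fixes f :: "real \<Rightarrow> 'x::banach"
 assumes f: "bint {a..b} f" and z: "\<And>s t. a \<le> s \<Longrightarrow> s \<le> t \<Longrightarrow> t \<le> b \<Longrightarrow> integral {s..t} f = 0"
 shows "AE t in lebesgue_on {a..b}. f t = 0"
proof -
 have set0: "integral E f = 0" if E: "E \<in> lmeasurable" "E \<subseteq> {a..b}" for E
 proof (rule ccontr)
  assume "integral E f \<noteq> 0"
  then have pos: "norm (integral E f) > 0" by simp
  obtain \<delta> where \<delta>: "\<delta> > 0" "\<And>B. B \<in> sets lebesgue \<Longrightarrow> B \<subseteq> {a..b} \<Longrightarrow> measure lebesgue B < \<delta> \<Longrightarrow>
    integral B (\<lambda>t. norm (f t)) < norm (integral E f)"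
   using integral_small_on_small_sets[OF bintD(2)[OF f] _ pos] by auto
  obtain F where F: "finite F" "\<And>K. K \<in> F \<Longrightarrow> \<exists>c d. c \<le> d \<and> K = {c..d} \<and> {c..d} \<subseteq> {a..b}"
   "pairwise (\<lambda>K L. negligible (K \<inter> L)) F" "measure lebesgue ((E - \<Union>F) \<union> (\<Union>F - E)) < \<delta>"
   using interval_approx[OF E \<delta>(1)] by blast
  have "K \<in> sets lebesgue \<and> K \<subseteq> {a..b}" if K: "K \<in> F" for K using F(2)[OF K] by auto
  then have Fm: "\<Union>F \<in> sets lebesgue" "\<Union>F \<subseteq> {a..b}" using F(1) by (auto intro!: sets.finite_Union)
  have "(f has_integral 0) K" if K: "K \<in> F" for K
  proof -
   obtain c d where cd: "c \<le> d" "K = {c..d}" "{c..d} \<subseteq> {a..b}" using F(2)[OF K] by blast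
   then have "f integrable_on {c..d}" by (intro bint_integrable bint_sub[OF f]) auto
   moreover have "integral {c..d} f = 0" using cd by (intro z) auto
   ultimately show ?thesis using cd(2) by (metis integrable_integral)
  qed
  from has_integral_Union[OF F(1) this F(3)] have UF: "(f has_integral 0) (\<Union>F)" by simp
  let ?B = "(E - \<Union>F) \<union> (\<Union>F - E)"
  have B: "?B \<in> sets lebesgue" "?B \<subseteq> {a..b}" using E Fm by auto
  have fE: "(f has_integral integral E f) E"
   using bint_integrable[OF _ bint_sub[OF f E(2)]] E(1) by auto
  have "((\<lambda>t. (if t \<in> E then f t else 0) - (if t \<in> \<Union>F then f t else 0)) has_integral (integral E f - 0)) UNIV"
   using fE UF by (intro has_integral_diff) (simp_all only: has_integral_restrict_UNIV)
  then have hi: "((\<lambda>t. (if t \<in> E then f t else 0) - (if t \<in> \<Union>F then f t else 0)) has_integral integral E f) UNIV" by simp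
  have "norm (integral UNIV (\<lambda>t. (if t \<in> E then f t else 0) - (if t \<in> \<Union>F then f t else 0)))
    \<le> integral UNIV (\<lambda>t. if t \<in> ?B then norm (f t) else 0)"
  proof (rule HK_integral_norm_bound_integral)
   show "(\<lambda>t. if t \<in> ?B then norm (f t) else 0) integrable_on UNIV"
    unfolding integrable_restrict_UNIV by (rule bintD(2)[OF bint_sub[OF f B(2,1)]]) simp
  qed (use hi in auto)
  then have "norm (integral E f) \<le> integral ?B (\<lambda>t. norm (f t))"
   using hi by (simp only: integral_unique integral_restrict_UNIV)
  then show False using \<delta>(2)[OF B F(4)] by simp
 qed
 obtain D where D: "countable D" "AE t in lebesgue_on {a..b}. f t \<in> closure D" using sm_separableD[OF bintD(1)[OF f]] .
 define E where "E d = {t \<in> {a..b}. norm (f t - d) < norm d / 2}" for d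
 have neg: "negligible (E d)" for d
 proof (cases "d = 0")
  case False
  have "{t \<in> space (lebesgue_on {a..b}). norm (f t - d) < norm d / 2} \<in> sets (lebesgue_on {a..b})"
   by (rule borel_measurable_iff_less[THEN iffD1, rule_format, OF sm_norm_diff_measurable[OF _ bintD(1)[OF f]]]) simp
  then have Es: "E d \<in> sets lebesgue" by (simp add: E_def sets_restrict_space_iff)
  have Eab: "E d \<subseteq> {a..b}" by (auto simp: E_def)
  have El: "E d \<in> lmeasurable" using Es Eab by (meson bounded_set_imp_lmeasurable bounded_subset bounded_closed_interval)
  let ?m = "measure lebesgue (E d)"
  have c: "((\<lambda>_. d) has_integral ?m *\<^sub>R d) (E d)"
   using has_integral_scaleR_left[of "\<lambda>_. 1::real" ?m "E d" d] lmeasure_integral[OF El] El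
   by (simp add: has_integral_iff lmeasurable_iff_integrable_on)
  have fE: "f integrable_on E d" by (rule bint_integrable[OF Es bint_sub[OF f Eab Es]]) simp
  have ci: "(\<lambda>_. d) integrable_on E d" by (rule has_integral_integrable[OF c])
  have "norm (integral (E d) (\<lambda>t. f t - d)) \<le> integral (E d) (\<lambda>_. norm d / 2)"
   by (rule HK_integral_norm_bound_integral[OF integrable_diff[OF fE ci] integrable_on_const[OF El]])
    (auto simp: E_def)
  moreover have "integral (E d) (\<lambda>t. f t - d) = - (?m *\<^sub>R d)"
   by (subst HK_integral_diff[OF fE ci]) (simp add: set0[OF El Eab] integral_unique[OF c])
  moreover have "integral (E d) (\<lambda>_. norm d / 2) = norm d / 2 * ?m"
   by (rule integral_const_lmeasurable[OF El])
  ultimately have "?m * norm d \<le> norm d / 2 * ?m" by simp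
  then have "?m * norm d \<le> 0" by (simp add: mult.commute)
  then have "?m = 0" using False by (simp add: mult_le_0_iff) (metis measure_nonneg order_antisym)
  then show ?thesis using El by (simp add: negligible_iff_measure0)
 qed (simp add: E_def)
 have "negligible (\<Union>d\<in>D. E d)" using D(1) neg by (intro negligible_countable_Union) auto
 then have "AE t in lebesgue_on {a..b}. t \<notin> (\<Union>d\<in>D. E d)"
  by (subst AE_lebesgue_on_negligible) (auto elim: negligible_subset)
 then show ?thesis using D(2) AE_space
 proof eventually_elim
  case (elim t)
  show ?case
  proof (rule ccontr)
   assume nz: "f t \<noteq> 0"
   \<comment> \<open>One third leaves norm d > 2/3 norm (f t), so that f t is within norm d / 2 of
     d.\<close>
   then obtain d where d: "d \<in> D" "dist d (f t) < norm (f t) / 3"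
    using elim(2) closure_approachable[of "f t" D] by (metis divide_pos_pos zero_less_norm_iff zero_less_numeral)
   then have "norm (f t - d) < norm (f t) / 3" by (simp add: dist_norm norm_minus_commute)
   moreover have "norm (f t) \<le> norm (f t - d) + norm d" by (metis norm_triangle_ineq diff_add_cancel)
   ultimately have "norm (f t - d) < norm d / 2" by linarith
   then have "t \<in> E d" using elim(3) by (simp add: E_def)
   then show False using elim(1) d(1) by blast
  qed
 qed
qed

lemma prim_unique:
 assumes "prim a b g u" "prim a b g' u'" "\<And>t. t \<in> {a..b} \<Longrightarrow> u t = u' t"
 shows "AE t in lebesgue_on {a..b}. g t = g' t"
proof -
 have d: "prim a b (\<lambda>t. g t - g' t) (\<lambda>t. u t - u' t)" by (rule prim_diff[OF assms(1,2)])
 have "integral {s..t} (\<lambda>t. g t - g' t) = 0" if "a \<le> s" "s \<le> t" "t \<le> b" for s t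
  using prim_diff_eq[OF d that] assms(3) that by simp
 then have "AE t in lebesgue_on {a..b}. g t - g' t = 0" by (rule AE_zero_if_integrals_zero[OF prim_bint[OF d]])
 then show ?thesis by eventually_elim simp
qed

section \<open>Weak derivatives\<close>

text \<open>A recursive form of smoothness that suits induction over products and affine
  substitutions; \<open>td_iterate\<close> translates it into the iterated derivatives of
  \<open>test_function\<close>.\<close>

primrec times_differentiable :: "nat \<Rightarrow> (real \<Rightarrow> real) \<Rightarrow> bool" where
 "times_differentiable 0 f \<longleftrightarrow> True"
| "times_differentiable (Suc n) f \<longleftrightarrow> (\<forall>x. f differentiable at x) \<and> times_differentiable n (deriv f)"

lemma td_SucI:
 assumes "\<And>x. (f has_real_derivative f' x) (at x)" "times_differentiable n f'"
 shows "times_differentiable (Suc n) f"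
proof -
 have "deriv f = f'" using assms(1) DERIV_imp_deriv by blast
 moreover have "\<forall>x. f differentiable at x" using assms(1) real_differentiable_def by blast
 ultimately show ?thesis using assms(2) by simp
qed

lemma td_SucD:
 assumes "times_differentiable (Suc n) f"
 shows "(f has_real_derivative deriv f x) (at x)" "times_differentiable n (deriv f)"
 using assms by (auto simp: DERIV_deriv_iff_real_differentiable)

lemma td_pred: "times_differentiable (Suc n) f \<Longrightarrow> times_differentiable n f"
 by (induction n arbitrary: f) auto

lemma td_add: "times_differentiable n f \<Longrightarrow> times_differentiable n g \<Longrightarrow> times_differentiable n (\<lambda>x. f x + g x)"
proof (induction n arbitrary: f g)
 case (Suc n)
 show ?case
  by (rule td_SucI[OF DERIV_add[OF td_SucD(1)[OF Suc.prems(1)] td_SucD(1)[OF Suc.prems(2)]]])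
   (rule Suc.IH[OF td_SucD(2)[OF Suc.prems(1)] td_SucD(2)[OF Suc.prems(2)]])
qed simp

lemma td_mult: "times_differentiable n f \<Longrightarrow> times_differentiable n g \<Longrightarrow> times_differentiable n (\<lambda>x. f x * g x)"
proof (induction n arbitrary: f g)
 case (Suc n)
 show ?case
  by (rule td_SucI[OF DERIV_mult[OF td_SucD(1)[OF Suc.prems(1)] td_SucD(1)[OF Suc.prems(2)]]])
   (rule td_add[OF Suc.IH[OF td_SucD(2)[OF Suc.prems(1)] td_pred[OF Suc.prems(2)]]
    Suc.IH[OF td_SucD(2)[OF Suc.prems(2)] td_pred[OF Suc.prems(1)]]])
qed simp

lemma td_const: "times_differentiable n (\<lambda>x. c)"
proof (induction n arbitrary: c)
 case (Suc n)
 show ?case by (rule td_SucI[where f'="\<lambda>x. 0"]) (auto intro: Suc.IH)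
qed simp

lemma td_affine: "times_differentiable n f \<Longrightarrow> times_differentiable n (\<lambda>x. f (c * x + d))"
proof (induction n arbitrary: f)
 case (Suc n)
 have D: "((\<lambda>x. f (c * x + d)) has_real_derivative deriv f (c * x + d) * c) (at x)" for x
 proof (rule DERIV_chain2[where f=f and g="\<lambda>x. c * x + d"])
  show "(f has_real_derivative deriv f (c * x + d)) (at (c * x + d))" by (rule td_SucD(1)[OF Suc.prems])
  show "((\<lambda>x. c * x + d) has_real_derivative c) (at x)" by (auto intro!: derivative_eq_intros)
 qed
 show ?case by (rule td_SucI[OF D]) (intro td_mult td_const Suc.IH[OF td_SucD(2)[OF Suc.prems]])
qed simp

lemma td_iterate:
 assumes "\<And>n. times_differentiable n f" shows "(deriv ^^ k) f differentiable_on UNIV"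
proof -
 have "\<forall>x. (deriv ^^ k) f differentiable at x" if "times_differentiable (Suc k) f" for f
  using that
 proof (induction k arbitrary: f)
  case 0 then show ?case by simp
 next
  case (Suc k)
  from Suc.IH[OF td_SucD(2)[OF Suc.prems]] show ?case by (simp add: funpow_swap1)
 qed
 from this[OF assms] show ?thesis by (auto simp: differentiable_on_def)
qed

text \<open>The functions P(1/x) e^(-1/x), continued by 0, form a class closed under
  differentiation: P turns into y^2 (P - P').\<close>

definition expinv :: "real poly \<Rightarrow> real \<Rightarrow> real" where
 "expinv P x = (if x > 0 then poly P (1/x) * exp (-(1/x)) else 0)"

lemma poly_exp_decay: "((\<lambda>y::real. poly P y * exp (-y)) \<longlongrightarrow> 0) at_top"
proof -
 have "((\<lambda>y. \<Sum>i\<le>degree P. coeff P i * (y ^ i / exp y)) \<longlongrightarrow> (\<Sum>i\<le>degree P. coeff P i * 0)) at_top"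
  by (intro tendsto_sum tendsto_mult tendsto_const tendsto_power_div_exp_0)
 moreover have "(\<lambda>y. \<Sum>i\<le>degree P. coeff P i * (y ^ i / exp y)) = (\<lambda>y. poly P y * exp (-y))"
  by (simp add: poly_altdef sum_distrib_right exp_minus divide_inverse mult.assoc fun_eq_iff)
 ultimately show ?thesis by simp
qed

lemma expinv_tendsto_0: "(expinv P \<longlongrightarrow> 0) (at 0)"
proof -
 have "((\<lambda>x. poly P (inverse x) * exp (- inverse x)) \<longlongrightarrow> 0) (at_right 0)"
  by (rule filterlim_compose[OF poly_exp_decay filterlim_inverse_at_top_right])
 then have r: "(expinv P \<longlongrightarrow> 0) (at_right 0)"
  by (rule Lim_transform_eventually) (auto simp: expinv_def eventually_at_right_field divide_inverse intro!: exI[of _ 1])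
 have l: "(expinv P \<longlongrightarrow> 0) (at_left 0)"
  by (rule tendsto_eventually) (auto simp: expinv_def eventually_at_left_field intro!: exI[of _ "-1"])
 from l r show ?thesis by (simp add: filterlim_split_at)
qed

lemma expinv_deriv: "(expinv P has_real_derivative expinv (monom 1 2 * (P - pderiv P)) x) (at x)"
proof -
 consider "x > 0" | "x < 0" | "x = 0" by linarith
 then show ?thesis
 proof cases
  case 1
  have "((\<lambda>x. poly P (1/x) * exp (-(1/x))) has_real_derivative
    poly P (1/x) * (exp (-(1/x)) * (1 / (x * x))) + poly (pderiv P) (1/x) * (- 1 / (x * x)) * exp (-(1/x))) (at x)"
   using 1 by (auto intro!: derivative_eq_intros DERIV_chain2[OF poly_DERIV] simp: field_simps)
  also have "poly P (1/x) * (exp (-(1/x)) * (1 / (x * x))) + poly (pderiv P) (1/x) * (- 1 / (x * x)) * exp (-(1/x))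
   = expinv (monom 1 2 * (P - pderiv P)) x"
   using 1 by (simp add: expinv_def poly_monom algebra_simps power2_eq_square)
  finally show ?thesis
   by (rule has_field_derivative_transform_within_open[of _ _ _ "{0<..}"]) (use 1 in \<open>auto simp: expinv_def\<close>)
 next
  case 2
  have "((\<lambda>x. 0) has_real_derivative expinv (monom 1 2 * (P - pderiv P)) x) (at x)"
   using 2 by (simp add: expinv_def)
  then show ?thesis
   by (rule has_field_derivative_transform_within_open[of _ _ _ "{..<0}"]) (use 2 in \<open>auto simp: expinv_def\<close>)
 next
  case 3
  have "((\<lambda>h. (expinv P (0 + h) - expinv P 0) / h) \<longlongrightarrow> 0) (at 0)"
  \<comment> \<open>The difference quotient at 0 belongs to the same class, with the polynomial y
    P(y).\<close>
  proof (rule Lim_transform_eventually[OF expinv_tendsto_0[of "pCons 0 P"]])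
   show "eventually (\<lambda>h. expinv (pCons 0 P) h = (expinv P (0 + h) - expinv P 0) / h) (at 0)"
    by (auto simp: expinv_def intro!: always_eventually)
  qed
  then show ?thesis unfolding 3 by (simp add: DERIV_def expinv_def)
 qed
qed

lemma td_expinv: "times_differentiable n (expinv P)"
proof (induction n arbitrary: P)
 case (Suc n)
 show ?case by (rule td_SucI[OF expinv_deriv]) (rule Suc.IH)
qed simp

text \<open>A normalised primitive of the bump e^(-1/x) e^(-1/(1-x)). Differences of rescaled steps
  are test functions whose derivatives are differences of bumps; one minus a rescaled step is a
  cut-off in time.\<close>

lemma smooth_step_ex:
 obtains \<Theta> \<beta> :: "real \<Rightarrow> real" where "\<And>n. times_differentiable n \<Theta>" "\<And>x. (\<Theta> has_real_derivative \<beta> x) (at x)"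
  "continuous_on UNIV \<beta>" "\<And>x. \<beta> x \<ge> 0" "\<And>x. x \<le> 0 \<Longrightarrow> \<Theta> x = 0" "\<And>x. x \<ge> 1 \<Longrightarrow> \<Theta> x = 1"
  "\<And>x. x \<le> 0 \<or> x \<ge> 1 \<Longrightarrow> \<beta> x = 0"
proof -
 define b where "b x = expinv 1 x * expinv 1 ((-1) * x + 1)" for x
 have btd: "times_differentiable n b" for n unfolding b_def by (intro td_mult td_affine td_expinv)
 have bD: "(b has_real_derivative deriv b x) (at x)" for x by (rule td_SucD(1)[OF btd])
 have bc: "continuous_on S b" for S
  by (rule DERIV_continuous_on, rule has_field_derivative_at_within, rule bD)
 have b0: "b x \<ge> 0" for x by (simp add: b_def expinv_def)
 have bz: "b x = 0" if "x \<le> 0 \<or> x \<ge> 1" for x using that by (auto simp: b_def expinv_def)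
 define Q where "Q x = integral {0..x} b" for x
 have bi: "b integrable_on {s..t}" for s t by (rule integrable_continuous_real[OF bc])
 \<comment> \<open>For negative arguments Q is an integral over an empty interval. Moving the base
   point to some a further left gives one formula on a neighbourhood of every point, as needed for
   the two-sided derivative.\<close>
 have Qa: "Q y = integral {a..y} b" if "a \<le> 0" "a \<le> y" for a y
 proof (cases "y \<ge> 0")
  case True
  have "integral {a..0} b = integral {a..0} (\<lambda>_. 0)" by (rule integral_cong) (auto simp: bz)
  then show ?thesis using HK_integral_combine[OF that(1) True bi] by (simp add: Q_def)
 next
  case False
  have "integral {a..y} b = integral {a..y} (\<lambda>_. 0)" using False by (intro integral_cong) (auto simp: bz)
  then show ?thesis using False by (simp add: Q_def)
 qed
 have QD: "(Q has_real_derivative b x) (at x)" for x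
 proof -
  let ?a = "-\<bar>x\<bar> - 1"
  have "((\<lambda>y. integral {?a..y} b) has_real_derivative b x) (at x within {?a..\<bar>x\<bar>+1})"
   by (rule integral_has_real_derivative[OF bc]) auto
  then have "((\<lambda>y. integral {?a..y} b) has_real_derivative b x) (at x)"
   by (subst (asm) at_within_interior) auto
  then show ?thesis
   by (rule has_field_derivative_transform_within_open[of _ _ _ "{?a<..}"]) (auto simp: Qa[of ?a])
 qed
 have Qtd: "times_differentiable n Q" for n
  by (cases n) (auto intro: td_SucI[OF QD btd] simp del: times_differentiable.simps(2))
 define c where "c = Q 1"
 have Q1: "Q x = c" if "x \<ge> 1" for x
 proof -
  have "integral {1..x} b = integral {1..x} (\<lambda>_. 0)" by (rule integral_cong) (auto simp: bz)
  then show ?thesis using HK_integral_combine[of 0 1 x b] that bi by (simp add: Q_def c_def)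
 qed
 have "c \<noteq> 0"
 proof
  assume "c = 0"
  then have "\<forall>x\<in>cbox 0 1. b x = 0"
   unfolding c_def Q_def
   by (subst (asm) integral_eq_0_iff[OF bc]) (auto simp: b0)
  then have "b (1/2) = 0" by simp
  then show False by (simp add: b_def expinv_def)
 qed
 moreover have "c \<ge> 0" unfolding c_def Q_def using bi b0 by (intro integral_nonneg) auto
 ultimately have c: "c > 0" by simp
 show ?thesis
 proof (rule that[of "\<lambda>x. inverse c * Q x" "\<lambda>x. inverse c * b x"])
  show "times_differentiable n (\<lambda>x. inverse c * Q x)" for n by (intro td_mult td_const Qtd)
  show "((\<lambda>x. inverse c * Q x) has_real_derivative inverse c * b x) (at x)" for x by (rule DERIV_cmult[OF QD])
  show "continuous_on UNIV (\<lambda>x. inverse c * b x)" by (intro continuous_intros bc)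
  show "inverse c * Q x = 1" if "x \<ge> 1" for x using Q1[OF that] c by simp
  show "inverse c * Q x = 0" if "x \<le> 0" for x
  proof -
   have "{0..x} \<subseteq> {0}" using that by auto
   then have "{0..x} = {} \<or> {0..x} = {0}" by blast
   then show ?thesis unfolding Q_def by auto
  qed
 qed (use b0 bz c in auto)
qed

lemma bint_extend:
 assumes "J \<in> sets lebesgue" "K \<in> sets lebesgue" "K \<subseteq> J" "bint K f" "\<And>t. t \<in> J \<Longrightarrow> t \<notin> K \<Longrightarrow> f t = 0"
 shows "bint J f"
proof -
 have "smeas J (\<lambda>t. if t \<in> K then f t else 0)"
  using assms sm_subset[OF bintD(1)[OF assms(4)], of "J \<inter> K"] by (intro sm_if) (auto simp: Int_absorb1)
 then have 1: "smeas J f" using assms(5) by (subst sm_cong[of _ _ "\<lambda>t. if t \<in> K then f t else 0"]) auto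
 have "(\<lambda>t. if t \<in> K then norm (f t) else 0) integrable_on K"
  by (rule integrable_eq[OF bintD(2)[OF assms(4)]]) simp
 then have "(\<lambda>t. if t \<in> K then norm (f t) else 0) integrable_on J"
  by (rule integrable_on_superset[OF _ _ assms(3)]) simp
 then have "(\<lambda>t. norm (f t)) integrable_on J" by (rule integrable_eq) (use assms(5) in auto)
 with 1 show ?thesis by (simp add: bint_def)
qed

lemma integral_extend:
 fixes f :: "real \<Rightarrow> 'x::banach"
 assumes "K \<subseteq> J" "\<And>t. t \<in> J \<Longrightarrow> t \<notin> K \<Longrightarrow> f t = 0"
 shows "integral J f = integral K f"
proof -
 have "(\<lambda>t. if t \<in> J then f t else 0) = (\<lambda>t. if t \<in> K then f t else 0)" using assms by (auto simp: fun_eq_iff)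
 then have "integral UNIV (\<lambda>t. if t \<in> J then f t else 0) = integral UNIV (\<lambda>t. if t \<in> K then f t else 0)" by (rule arg_cong)
 then show ?thesis by (simp only: integral_restrict_UNIV)
qed

lemma test_function_derivative:
 assumes "test_function J \<phi>"
 shows "(\<phi> has_real_derivative deriv \<phi> t) (at t)" "continuous_on S (deriv \<phi>)"
proof -
 have d: "(deriv ^^ k) \<phi> differentiable at x" for k x
  using assms by (auto simp: test_function_def differentiable_on_def)
 show "(\<phi> has_real_derivative deriv \<phi> t) (at t)" using d[of 0 t] by (simp add: DERIV_deriv_iff_real_differentiable)
 have "deriv \<phi> differentiable at x" for x using d[of 1 x] by simp
 then show "continuous_on S (deriv \<phi>)"
  by (intro continuous_at_imp_continuous_on ballI differentiable_imp_continuous_within)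
qed

text \<open>The support is enlarged by a margin inside the open interval, so that \<phi> and its
  derivative vanish at the end points themselves and integration by parts has no boundary
  terms.\<close>

lemma test_function_support:
 assumes \<phi>: "test_function J \<phi>" and J: "open J" "is_interval J" "J \<noteq> {}"
 obtains a b where "a < b" "{a..b} \<subseteq> J" "\<And>t. t \<le> a \<or> b \<le> t \<Longrightarrow> \<phi> t = 0 \<and> deriv \<phi> t = 0"
proof -
 obtain K where K: "compact K" "K \<subseteq> J" "\<And>t. t \<notin> K \<Longrightarrow> \<phi> t = 0" using \<phi> by (auto simp: test_function_def)
 have d0: "deriv \<phi> t = 0" if "t \<notin> K" for t
 proof -
  have o: "open (-K)" using K(1) by (simp add: compact_imp_closed open_Compl)
  have "(\<phi> has_real_derivative 0) (at t)"
   by (rule has_field_derivative_transform_within_open[OF DERIV_const o]) (use that K(3) in simp_all)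
  then show ?thesis by (rule DERIV_imp_deriv)
 qed
 show ?thesis
 proof (cases "K = {}")
  case True
  obtain x where "x \<in> J" using J(3) by blast
  then obtain e where e: "e > 0" "cball x e \<subseteq> J" using J(1) open_contains_cball by blast
  show ?thesis by (rule that[of x "x + e"]) (use e True K d0 in \<open>auto simp: subset_iff dist_real_def\<close>)
 next
  case False
  obtain m where m: "m \<in> K" "\<And>t. t \<in> K \<Longrightarrow> m \<le> t" using compact_attains_inf[OF K(1) False] by blast
  obtain M where M: "M \<in> K" "\<And>t. t \<in> K \<Longrightarrow> t \<le> M" using compact_attains_sup[OF K(1) False] by blast
  obtain e where e: "e > 0" "cball m e \<subseteq> J" using J(1) open_contains_cball m(1) K(2) by blast
  obtain d where d: "d > 0" "cball M d \<subseteq> J" using J(1) open_contains_cball M(1) K(2) by blast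
  have in1: "m - e \<in> J" using e by (auto simp: subset_iff dist_real_def)
  have in2: "M + d \<in> J" using d by (auto simp: subset_iff dist_real_def)
  have le: "m \<le> M" using m M by blast
  show ?thesis
  proof (rule that[of "m - e" "M + d"])
   show "{m - e..M + d} \<subseteq> J"
    using J(2)[unfolded is_interval_1] in1 in2 by (meson atLeastAtMost_iff subsetI)
   fix t assume t: "t \<le> m - e \<or> M + d \<le> t"
   have "t \<notin> K"
   proof
    assume "t \<in> K"
    with m(2)[of t] M(2)[of t] t e(1) d(1) show False by linarith
   qed
   then show "\<phi> t = 0 \<and> deriv \<phi> t = 0" using K(3) d0 by simp
  qed (use e d le in auto)
 qed
qed

text \<open>Integration by parts through the product rule \<open>prim_mult\<close> on a compact
  interval around the support. Only compact subintervals of J enter, so u may be singular at the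
  ends.\<close>

lemma has_weak_derivativeI_prim:
 fixes u :: "real \<Rightarrow> 'x::banach"
 assumes J: "open J" "is_interval J" "J \<noteq> {}" and u: "\<And>a b. a \<le> b \<Longrightarrow> {a..b} \<subseteq> J \<Longrightarrow> prim a b g u"
 shows "has_weak_derivative J u g"
 unfolding has_weak_derivative_def
proof (intro allI impI)
 fix \<phi> assume \<phi>: "test_function J \<phi>"
 obtain a b where ab: "a < b" "{a..b} \<subseteq> J" "\<And>t. t \<le> a \<or> b \<le> t \<Longrightarrow> \<phi> t = 0 \<and> deriv \<phi> t = 0"
  using test_function_support[OF \<phi> J] by blast
 have Js: "J \<in> sets lebesgue" using J(1) by simp
 have uab: "prim a b g u" using u ab by simp
 have pm: "prim a b (\<lambda>t. deriv \<phi> t *\<^sub>R u t + \<phi> t *\<^sub>R g t) (\<lambda>t. \<phi> t *\<^sub>R u t)"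
  by (rule prim_mult[OF uab less_imp_le[OF ab(1)] has_field_derivative_at_within[OF test_function_derivative(1)[OF \<phi>]]
     test_function_derivative(2)[OF \<phi>]])
 have \<phi>c: "continuous_on {a..b} \<phi>"
  by (rule DERIV_continuous_on[OF has_field_derivative_at_within[OF test_function_derivative(1)[OF \<phi>]]])
 obtain B where "\<forall>x\<in>\<phi> ` {a..b}. norm x \<le> B"
  using compact_imp_bounded[OF compact_continuous_image[OF \<phi>c compact_Icc]] unfolding bounded_iff by blast
 then have B: "\<And>t. t \<in> {a..b} \<Longrightarrow> \<bar>\<phi> t\<bar> \<le> B" by simp
 have b1: "bint {a..b} (\<lambda>t. deriv \<phi> t *\<^sub>R u t)"
  by (intro bint_continuous continuous_intros test_function_derivative[OF \<phi>] prim_continuous_on[OF uab])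
 have b2: "bint {a..b} (\<lambda>t. \<phi> t *\<^sub>R g t)"
  by (rule bint_bounded_mult[OF _ sm_continuous_on[OF _ \<phi>c] B prim_bint[OF uab]]) auto
 have z: "t \<in> J \<Longrightarrow> t \<notin> {a..b} \<Longrightarrow> deriv \<phi> t *\<^sub>R u t = 0" "t \<in> J \<Longrightarrow> t \<notin> {a..b} \<Longrightarrow> \<phi> t *\<^sub>R g t = 0" for t
  using ab(3)[of t] by auto
 have J1: "bint J (\<lambda>t. deriv \<phi> t *\<^sub>R u t)" "bint J (\<lambda>t. \<phi> t *\<^sub>R g t)"
  using bint_extend[OF Js _ ab(2) b1 z(1)] bint_extend[OF Js _ ab(2) b2 z(2)] by auto
 have "\<phi> b *\<^sub>R u b - \<phi> a *\<^sub>R u a = integral {a..b} (\<lambda>t. deriv \<phi> t *\<^sub>R u t + \<phi> t *\<^sub>R g t)"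
  by (rule prim_diff_eq[OF pm]) (use ab in auto)
 also have "\<dots> = integral {a..b} (\<lambda>t. deriv \<phi> t *\<^sub>R u t) + integral {a..b} (\<lambda>t. \<phi> t *\<^sub>R g t)"
  by (rule HK_integral_add[OF bint_integrable[OF _ b1] bint_integrable[OF _ b2]]) auto
 finally have "integral {a..b} (\<lambda>t. deriv \<phi> t *\<^sub>R u t) + integral {a..b} (\<lambda>t. \<phi> t *\<^sub>R g t) = 0" using ab(3)[of a] ab(3)[of b] by simp
 moreover have "integral J (\<lambda>t. deriv \<phi> t *\<^sub>R u t) = integral {a..b} (\<lambda>t. deriv \<phi> t *\<^sub>R u t)"
  by (rule integral_extend[OF ab(2)]) (rule z(1))
 moreover have "integral J (\<lambda>t. \<phi> t *\<^sub>R g t) = integral {a..b} (\<lambda>t. \<phi> t *\<^sub>R g t)"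
  by (rule integral_extend[OF ab(2)]) (rule z(2))
 ultimately have "integral J (\<lambda>t. \<phi> t *\<^sub>R g t) = - integral J (\<lambda>t. deriv \<phi> t *\<^sub>R u t)"
  by (simp add: eq_neg_iff_add_eq_0 add.commute)
 then show "\<exists>I. has_strong_bochner_integral J (\<lambda>t. deriv \<phi> t *\<^sub>R u t) I \<and> has_strong_bochner_integral J (\<lambda>t. \<phi> t *\<^sub>R g t) (- I)"
  using J1 by (intro exI[of _ "integral J (\<lambda>t. deriv \<phi> t *\<^sub>R u t)"]) (simp add: has_strong_bochner_integral_iff[OF Js])
qed

text \<open>The lemma of du Bois-Reymond: an indefinite integral \<open>w\<close> of the weak derivative differs from \<open>u\<close>
 by a function whose averages against a fixed bump do not depend on the location.\<close>

lemma prim_if_has_weak_derivative: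
 fixes u :: "real \<Rightarrow> 'x::banach"
 assumes J: "open J" "is_interval J" and u: "continuous_on J u" and wd: "has_weak_derivative J u g"
  and ab: "a \<le> b" "{a..b} \<subseteq> J"
 shows "prim a b g u"
proof -
 have Js: "J \<in> sets lebesgue" using J(1) by simp
 obtain \<Theta> \<beta> where Th: "\<And>n. times_differentiable n \<Theta>" "\<And>x. (\<Theta> has_real_derivative \<beta> x) (at x)"
  "continuous_on UNIV \<beta>" "\<And>x. \<beta> x \<ge> 0" "\<And>x. x \<le> 0 \<Longrightarrow> \<Theta> x = 0" "\<And>x. x \<ge> 1 \<Longrightarrow> \<Theta> x = 1"
  "\<And>x. x \<le> 0 \<or> x \<ge> 1 \<Longrightarrow> \<beta> x = 0"
  by (rule smooth_step_ex) (rule that)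
 obtain e1 where e1: "e1 > 0" "cball a e1 \<subseteq> J" using J(1) open_contains_cball ab by (metis atLeastAtMost_iff order_refl subsetD)
 obtain e2 where e2: "e2 > 0" "cball b e2 \<subseteq> J" using J(1) open_contains_cball ab by (metis atLeastAtMost_iff order_refl subsetD)
 define \<delta> where "\<delta> = min e1 e2"
 have \<delta>: "\<delta> > 0" using e1 e2 by (simp add: \<delta>_def)
 define s0 where "s0 = a - \<delta>"
 define t0 where "t0 = b + \<delta>"
 have "s0 \<in> J" "t0 \<in> J" using e1 e2 by (auto simp: s0_def t0_def \<delta>_def subset_iff dist_real_def)
 then have J0: "{s0..t0} \<subseteq> J" using J(2)[unfolded is_interval_1] by (meson atLeastAtMost_iff subsetI)
 have st0: "s0 < a" "b < t0" using \<delta> by (auto simp: s0_def t0_def)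
 \<comment> \<open>A smoothed indicator that steps up across [s, s+l] and down across [t, t+l]; its
   derivative is the difference of two translates of the same bump of mass one.\<close>
 define \<phi> where "\<phi> l s t r = \<Theta> ((1/l) * r + (-(s/l))) + (-1) * \<Theta> ((1/l) * r + (-(t/l)))" for l s t r :: real
 define k where "k l s r = \<beta> ((1/l) * r + (-(s/l))) * (1/l)" for l s r :: real
 have step: "((\<lambda>r. \<Theta> ((1/l) * r + (-(s/l)))) has_real_derivative k l s r) (at r)" for l s r
  unfolding k_def
 proof (rule DERIV_chain2[OF Th(2)])
  show "((\<lambda>r. (1/l) * r + (-(s/l))) has_real_derivative 1/l) (at r)"
   using DERIV_add[OF DERIV_cmult_Id[of "1/l" r] DERIV_const[of "-(s/l)"]] by simp
 qed
 have \<phi>D: "(\<phi> l s t has_real_derivative k l s r + (-1) * k l t r) (at r)" for l s t r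
  unfolding \<phi>_def[abs_def] by (rule DERIV_add[OF step DERIV_cmult[OF step]])
 have d\<phi>: "deriv (\<phi> l s t) r = k l s r - k l t r" for l s t r
  using DERIV_imp_deriv[OF \<phi>D[of l s t r]] by simp
 have arg: "(1/l) * r + (-(s/l)) = (r - s)/l" for r s l :: real by (simp add: diff_divide_distrib)
 have kz: "k l s r = 0" if "l > 0" "r \<le> s \<or> s + l \<le> r" for l s r
  unfolding k_def arg using that by (subst Th(7)) (auto simp: field_simps)
 have k0: "k l s r \<ge> 0" if "l > 0" for l s r unfolding k_def using Th(4) that by simp
 have kc: "continuous_on S (k l s)" for S l s
  unfolding k_def[abs_def] by (intro continuous_intros continuous_on_compose2[OF Th(3)]) auto
 have kI: "integral {s0..t0} (k l s) = 1" if "l > 0" "s0 \<le> s" "s + l \<le> t0" for l s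
 proof -
  have "(k l s has_integral \<Theta> ((1/l) * t0 + (-(s/l))) - \<Theta> ((1/l) * s0 + (-(s/l)))) {s0..t0}"
  proof (rule fundamental_theorem_of_calculus[where f="\<lambda>r. \<Theta> ((1/l) * r + (-(s/l)))"])
   show "s0 \<le> t0" using st0 ab by simp
   show "((\<lambda>r. \<Theta> ((1/l) * r + (-(s/l)))) has_vector_derivative k l s x) (at x within {s0..t0})" for x
    using has_field_derivative_at_within[OF step] unfolding has_real_derivative_iff_has_vector_derivative .
  qed
  moreover have "\<Theta> ((1/l) * t0 + (-(s/l))) = 1" unfolding arg using that by (intro Th(6)) (simp add: field_simps)
  moreover have "\<Theta> ((1/l) * s0 + (-(s/l))) = 0" unfolding arg using that by (intro Th(5)) (simp add: field_simps)
  ultimately show ?thesis by (simp add: integral_unique)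
 qed
 have \<phi>z: "\<phi> l s t r = 0" if "l > 0" "s \<le> t" "r \<le> s \<or> t + l \<le> r" for l s t r
  using that(3)
 proof
  assume "r \<le> s"
  then have "(r - s)/l \<le> 0" "(r - t)/l \<le> 0" using that by (auto simp: field_simps)
  then show ?thesis unfolding \<phi>_def arg by (simp add: Th(5))
 next
  assume "t + l \<le> r"
  then have "(r - s)/l \<ge> 1" "(r - t)/l \<ge> 1" using that by (auto simp: field_simps)
  then show ?thesis unfolding \<phi>_def arg by (simp add: Th(6))
 qed
 have test: "test_function J (\<phi> l s t)" if "l > 0" "s0 \<le> s" "s \<le> t" "t + l \<le> t0" for l s t
  unfolding test_function_def
 proof (intro conjI allI exI[of _ "{s..t + l}"])
  show "(deriv ^^ k) (\<phi> l s t) differentiable_on UNIV" for k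
   by (rule td_iterate) (unfold \<phi>_def[abs_def], intro td_add td_mult td_const td_affine Th(1))
  show "{s..t + l} \<subseteq> J" using J0 that by (auto simp: subset_iff)
  show "r \<notin> {s..t + l} \<longrightarrow> \<phi> l s t r = 0" for r using \<phi>z[OF that(1,3), of r] by auto
 qed simp
 have rel: "bint J (\<lambda>r. deriv (\<phi> l s t) r *\<^sub>R u r) \<and> bint J (\<lambda>r. \<phi> l s t r *\<^sub>R g r) \<and>
   integral J (\<lambda>r. \<phi> l s t r *\<^sub>R g r) = - integral J (\<lambda>r. deriv (\<phi> l s t) r *\<^sub>R u r)"
  if prem: "l > 0" "s0 \<le> s" "s \<le> t" "t + l \<le> t0" for l s t
 proof -
  obtain I where "has_strong_bochner_integral J (\<lambda>r. deriv (\<phi> l s t) r *\<^sub>R u r) I"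
   "has_strong_bochner_integral J (\<lambda>r. \<phi> l s t r *\<^sub>R g r) (- I)"
   using wd[unfolded has_weak_derivative_def, rule_format, OF test[OF prem]] by (elim exE conjE)
  then show ?thesis unfolding has_strong_bochner_integral_iff[OF Js] by (elim conjE) (intro conjI; simp)
 qed
 define s1 where "s1 = a - \<delta>/2"
 define t1 where "t1 = b + \<delta>/2"
 have st1: "s0 < s1" "s1 < a" "b < t1" "t1 < t0" using \<delta> by (auto simp: s0_def t0_def s1_def t1_def)
 \<comment> \<open>Integrability of g is extracted from the weak derivative itself: the test
   function used here equals 1 on [s1,t1].\<close>
 have gb: "bint {s1..t1} g"
 proof -
  let ?\<phi> = "\<phi> (\<delta>/2) s0 t1"
  have b: "bint J (\<lambda>r. ?\<phi> r *\<^sub>R g r)" using rel[of "\<delta>/2" s0 t1] \<delta> st1 ab by (auto simp: t1_def t0_def)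
  have sub: "{s1..t1} \<subseteq> J" using J0 st1 by (auto simp: subset_iff)
  have "?\<phi> r = 1" if "r \<in> {s1..t1}" for r
  proof -
   have "(r - s0)/(\<delta>/2) \<ge> 1" "(r - t1)/(\<delta>/2) \<le> 0" using that \<delta> by (auto simp: s0_def s1_def field_simps)
   then show ?thesis unfolding \<phi>_def arg by (simp add: Th(5,6))
  qed
  then have "bint {s1..t1} (\<lambda>r. ?\<phi> r *\<^sub>R g r) = bint {s1..t1} g" by (intro bint_cong) auto
  then show ?thesis using bint_sub[OF b sub _ Js] by simp
 qed
 define w where "w t = integral {s1..t} g" for t
 have w: "prim s1 t1 g w" unfolding w_def using prim_integral[OF gb, of 0] by simp
 define d where "d t = u t - w t" for t
 have sub1: "{s1..t1} \<subseteq> J" using J0 st1 by (auto simp: subset_iff)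
 have dc: "continuous_on {s1..t1} d"
  unfolding d_def by (intro continuous_intros continuous_on_subset[OF u sub1] prim_continuous_on[OF w])
 have avg_eq: "integral {s1..t1} (\<lambda>r. k l s r *\<^sub>R d r) = integral {s1..t1} (\<lambda>r. k l t r *\<^sub>R d r)"
  if l: "l > 0" "s1 \<le> s" "s \<le> t" "t + l \<le> t1" for l s t
 proof -
  have r: "integral J (\<lambda>r. \<phi> l s t r *\<^sub>R g r) = - integral J (\<lambda>r. deriv (\<phi> l s t) r *\<^sub>R u r)"
   using rel[of l s t] l st1 by auto
  have z: "\<phi> l s t r = 0" "deriv (\<phi> l s t) r = 0" if "r \<notin> {s1..t1}" for r
   using \<phi>z[of l s t r] kz[of l r s] kz[of l r t] l that unfolding d\<phi> by auto
  have pm: "prim s1 t1 (\<lambda>r. deriv (\<phi> l s t) r *\<^sub>R w r + \<phi> l s t r *\<^sub>R g r) (\<lambda>r. \<phi> l s t r *\<^sub>R w r)"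
  proof (rule prim_mult[OF w])
   show "(\<phi> l s t has_real_derivative deriv (\<phi> l s t) r) (at r within {s1..t1})" for r
    using has_field_derivative_at_within[OF \<phi>D[of l s t r]] unfolding d\<phi> by simp
   show "continuous_on {s1..t1} (deriv (\<phi> l s t))"
    unfolding d\<phi>[abs_def] by (intro continuous_intros kc)
  qed (use st1 ab in simp)
  have dkc: "continuous_on {s1..t1} (deriv (\<phi> l s t))" unfolding d\<phi>[abs_def] by (intro continuous_intros kc)
  have i1: "(\<lambda>r. deriv (\<phi> l s t) r *\<^sub>R w r) integrable_on {s1..t1}"
   by (intro integrable_continuous_real continuous_intros dkc prim_continuous_on[OF w])
  have i2: "(\<lambda>r. deriv (\<phi> l s t) r *\<^sub>R u r) integrable_on {s1..t1}"
   by (intro integrable_continuous_real continuous_intros dkc continuous_on_subset[OF u sub1])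
  have i3: "(\<lambda>r. deriv (\<phi> l s t) r *\<^sub>R w r + \<phi> l s t r *\<^sub>R g r) integrable_on {s1..t1}"
   using bint_integrable[OF _ prim_bint[OF pm]] by simp
  from integrable_diff[OF i3 i1] have i4: "(\<lambda>r. \<phi> l s t r *\<^sub>R g r) integrable_on {s1..t1}" by simp
  have "0 = integral {s1..t1} (\<lambda>r. deriv (\<phi> l s t) r *\<^sub>R w r + \<phi> l s t r *\<^sub>R g r)"
   using prim_diff_eq[OF pm order_refl _ order_refl] st1 ab \<phi>z[OF l(1,3), of s1] \<phi>z[OF l(1,3), of t1] l by simp
  also have "\<dots> = integral {s1..t1} (\<lambda>r. deriv (\<phi> l s t) r *\<^sub>R w r) + integral {s1..t1} (\<lambda>r. \<phi> l s t r *\<^sub>R g r)"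
   by (rule HK_integral_add[OF i1 i4])
  also have "integral {s1..t1} (\<lambda>r. \<phi> l s t r *\<^sub>R g r) = integral J (\<lambda>r. \<phi> l s t r *\<^sub>R g r)"
   by (rule integral_extend[OF sub1, symmetric]) (use z in simp)
  also have "\<dots> = - integral {s1..t1} (\<lambda>r. deriv (\<phi> l s t) r *\<^sub>R u r)"
   unfolding r by (subst integral_extend[OF sub1]) (use z in simp_all)
  finally have "integral {s1..t1} (\<lambda>r. deriv (\<phi> l s t) r *\<^sub>R u r) - integral {s1..t1} (\<lambda>r. deriv (\<phi> l s t) r *\<^sub>R w r) = 0" by simp
  then have "integral {s1..t1} (\<lambda>r. deriv (\<phi> l s t) r *\<^sub>R u r - deriv (\<phi> l s t) r *\<^sub>R w r) = 0"
   by (simp add: HK_integral_diff[OF i2 i1])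
  moreover have "(\<lambda>r. deriv (\<phi> l s t) r *\<^sub>R u r - deriv (\<phi> l s t) r *\<^sub>R w r) = (\<lambda>r. k l s r *\<^sub>R d r - k l t r *\<^sub>R d r)"
   by (simp add: d\<phi> d_def fun_eq_iff algebra_simps)
  ultimately have "integral {s1..t1} (\<lambda>r. k l s r *\<^sub>R d r - k l t r *\<^sub>R d r) = 0" by simp
  moreover have "(\<lambda>r. k l s r *\<^sub>R d r) integrable_on {s1..t1}" "(\<lambda>r. k l t r *\<^sub>R d r) integrable_on {s1..t1}"
   by (intro integrable_continuous_real continuous_intros kc dc)+
  ultimately show ?thesis by (simp add: HK_integral_diff)
 qed
 \<comment> \<open>The bumps act as an approximate identity: as their width l shrinks, the averages
   converge to the value at s, so equal averages force equal values.\<close>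
 have avg: "\<exists>l0>0. \<forall>l. 0 < l \<longrightarrow> l < l0 \<longrightarrow> norm (integral {s1..t1} (\<lambda>r. k l s r *\<^sub>R d r) - d s) \<le> \<eta>"
  if s: "s1 \<le> s" "s < t1" and \<eta>: "\<eta> > 0" for s \<eta>
 proof -
  obtain l1 where l1: "l1 > 0" "\<And>r. r \<in> {s1..t1} \<Longrightarrow> dist r s < l1 \<Longrightarrow> dist (d r) (d s) < \<eta>"
   using dc[unfolded continuous_on_iff, rule_format, of s \<eta>] s \<eta> by auto
  have "norm (integral {s1..t1} (\<lambda>r. k l s r *\<^sub>R d r) - d s) \<le> \<eta>" if l: "0 < l" "l < min l1 (t1 - s)" for l
  proof -
   have kI1: "integral {s1..t1} (k l s) = 1"
   proof -
    have "integral {s0..t0} (k l s) = integral {s1..t1} (k l s)"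
     by (rule integral_extend) (use st1 s l kz[of l _ s] in auto)
    then show ?thesis using kI[of l s] l s st1 by simp
   qed
   have i1: "(\<lambda>r. k l s r *\<^sub>R d r) integrable_on {s1..t1}" by (intro integrable_continuous_real continuous_intros kc dc)
   have h2: "((\<lambda>r. k l s r *\<^sub>R d s) has_integral 1 *\<^sub>R d s) {s1..t1}"
    using integrable_integral[OF integrable_continuous_real[OF kc[of "{s1..t1}" l s]]] kI1
    by (intro has_integral_scaleR_left) simp
   have "integral {s1..t1} (\<lambda>r. k l s r *\<^sub>R d r) - d s = integral {s1..t1} (\<lambda>r. k l s r *\<^sub>R d r - k l s r *\<^sub>R d s)"
    using HK_integral_diff[OF i1 has_integral_integrable[OF h2]] integral_unique[OF h2] by simp
   also have "norm \<dots> \<le> integral {s1..t1} (\<lambda>r. \<eta> * k l s r)"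
   proof (rule HK_integral_norm_bound_integral)
    show "(\<lambda>r. k l s r *\<^sub>R d r - k l s r *\<^sub>R d s) integrable_on {s1..t1}"
     by (rule integrable_diff[OF i1 has_integral_integrable[OF h2]])
    show "(\<lambda>r. \<eta> * k l s r) integrable_on {s1..t1}" by (intro integrable_continuous_real continuous_intros kc)
    fix r assume r: "r \<in> {s1..t1}"
    show "norm (k l s r *\<^sub>R d r - k l s r *\<^sub>R d s) \<le> \<eta> * k l s r"
    proof (cases "s \<le> r \<and> r \<le> s + l")
     case True
     then have "norm (d r - d s) \<le> \<eta>" using l1(2)[OF r] l by (simp add: dist_norm)
     then have "k l s r * norm (d r - d s) \<le> k l s r * \<eta>" using k0[OF l(1)] by (intro mult_left_mono) auto
     then show ?thesis using k0[OF l(1), of s r] by (simp add: scaleR_diff_right[symmetric] mult.commute)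
    next
     case False
     then show ?thesis using kz[of l r s] l by auto
    qed
   qed
   also have "\<dots> = \<eta>" using kI1 by simp
   finally show ?thesis .
  qed
  then show ?thesis using l1(1) s(2) by (intro exI[of _ "min l1 (t1 - s)"]) auto
 qed
 have dconst: "d s = d t" if st: "s1 \<le> s" "s \<le> t" "t < t1" for s t
 proof (rule ccontr)
  assume "d s \<noteq> d t"
  then have \<eta>: "norm (d s - d t) / 3 > 0" by simp
  obtain l1 where l1: "l1 > 0" "\<forall>l. 0 < l \<longrightarrow> l < l1 \<longrightarrow> norm (integral {s1..t1} (\<lambda>r. k l s r *\<^sub>R d r) - d s) \<le> norm (d s - d t) / 3"
   using avg[OF st(1) order.strict_trans1[OF st(2,3)] \<eta>] by (elim exE conjE)
  obtain l2 where l2: "l2 > 0" "\<forall>l. 0 < l \<longrightarrow> l < l2 \<longrightarrow> norm (integral {s1..t1} (\<lambda>r. k l t r *\<^sub>R d r) - d t) \<le> norm (d s - d t) / 3"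
   using avg[OF order_trans[OF st(1,2)] st(3) \<eta>] by (elim exE conjE)
  define l where "l = min (min l1 l2) (t1 - t) / 2"
  have l: "0 < l" "l < l1" "l < l2" "t + l \<le> t1" using l1(1) l2(1) st by (auto simp: l_def min_def field_simps)
  define X where "X = integral {s1..t1} (\<lambda>r. k l s r *\<^sub>R d r)"
  have "norm (X - d s) \<le> norm (d s - d t) / 3" using l1(2) l by (simp add: X_def)
  moreover have "norm (X - d t) \<le> norm (d s - d t) / 3" using l2(2) l avg_eq[of l s t] st by (simp add: X_def)
  moreover have "norm (d s - d t) \<le> norm (X - d t) + norm (X - d s)"
   using norm_triangle_ineq4[of "X - d t" "X - d s"] by simp
  ultimately show False using \<eta> by linarith
 qed
 have wab: "prim a b g w" by (rule prim_sub[OF w]) (use st1 in auto)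
 show ?thesis
 proof (rule primI[OF prim_bint[OF wab]])
  fix t assume t: "a \<le> t" "t \<le> b"
  have "d a = d t" by (rule dconst) (use t st1 in auto)
  then have "u t = u a + (w t - w a)" by (simp add: d_def algebra_simps)
  then show "u t = u a + integral {a..t} g" using prim_diff_eq[OF wab order_refl t] by simp
 qed
qed

lemma Ioi_sets: "{0::real<..} \<in> sets lebesgue" by simp

lemma is_interval_Ioi [simp]: "is_interval {a::real<..}" by (auto simp: is_interval_1)

lemma continuous_constant_at_0:
 fixes h :: "real \<Rightarrow> 'x::t2_space"
 assumes h: "continuous_on {0..T} h" and c: "\<And>a. 0 < a \<Longrightarrow> a \<le> T \<Longrightarrow> h a = c" and T: "T > 0"
 shows "h 0 = c"
proof -
 have lim: "(\<lambda>n. T / real (Suc n)) \<longlonglongrightarrow> 0" by (rule lim_const_over_n[THEN LIMSEQ_Suc])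
 have mem: "T / real (Suc n) \<in> {0..T}" for n using T by (simp add: field_simps)
 have "(\<lambda>n. h (T / real (Suc n))) \<longlonglongrightarrow> h 0"
  by (rule continuous_on_tendsto_compose[OF h lim]) (use T mem in auto)
 moreover have "h (T / real (Suc n)) = c" for n using T mem[of n] by (intro c) auto
 ultimately show ?thesis by (simp add: LIMSEQ_const_iff)
qed

text \<open>Derivatives that are available away from time 0 only, as for weighted functions and for
  dyadic interpolants, are carried to 0 by continuity of u and integrability of g there.\<close>

lemma prim_extend_0:
 assumes u: "continuous_on {0..T} u" and g: "bint {0..T} g" and pr: "\<And>a. 0 < a \<Longrightarrow> a \<le> T \<Longrightarrow> prim a T g u"
 shows "prim 0 T g u"
proof (rule primI[OF g])
 fix t assume t: "0 \<le> t" "t \<le> T"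
 show "u t = u 0 + integral {0..t} g"
 proof (cases "t = 0")
  case False
  then have t0: "t > 0" using t by simp
  let ?h = "\<lambda>s. u s - integral {0..s} g"
  have "continuous_on {0..t} ?h"
   using continuous_on_subset[OF u, of "{0..t}"] prim_continuous_on[OF prim_integral[OF bint_sub[OF g, of "{0..t}"], of 0]] t
   by (intro continuous_intros) auto
  moreover have "?h a = ?h t" if a: "0 < a" "a \<le> t" for a
   using prim_diff_eq[OF pr[of a] order_refl a(2) t(2)] integral_diff_Icc[OF g _ a(2) t(2)] a t by (simp add: algebra_simps)
  ultimately have "?h 0 = ?h t" using t0 by (rule continuous_constant_at_0)
  then show ?thesis by (simp add: algebra_simps)
 qed simp
qed

text \<open>Uniqueness holds on each compact subinterval; those with rational end points are
  countably many and reach every point of J, so the union of the exceptional sets is still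
  null.\<close>

lemma weak_derivative_AE_eq:
 fixes u :: "real \<Rightarrow> 'x::banach"
 assumes J: "open J" "is_interval J" and u: "continuous_on J u"
  and wd: "has_weak_derivative J u g" "has_weak_derivative J u g'"
 shows "AE t in lebesgue_on J. g t = g' t"
proof -
 have "AE t in lebesgue. t \<in> {a..b} \<longrightarrow> g t = g' t" if "a \<le> b" "{a..b} \<subseteq> J" for a b
  using prim_unique[OF prim_if_has_weak_derivative[OF J u wd(1) that] prim_if_has_weak_derivative[OF J u wd(2) that] refl]
  by (simp add: AE_lebesgue_on)
 then have "AE t in lebesgue. \<forall>q::rat \<times> rat. of_rat (fst q) \<le> (of_rat (snd q) :: real) \<longrightarrow> {of_rat (fst q)..of_rat (snd q)} \<subseteq> J \<longrightarrow>
   t \<in> {of_rat (fst q)..of_rat (snd q)} \<longrightarrow> g t = g' t"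
  unfolding AE_all_countable by (intro allI AE_impI) auto
 then have "AE t in lebesgue. t \<in> J \<longrightarrow> g t = g' t"
 proof eventually_elim
  case (elim t)
  show ?case
  proof
   assume "t \<in> J"
   then obtain e where e: "e > 0" "cball t e \<subseteq> J" using J(1) open_contains_cball by blast
   obtain a where a: "t - e < of_rat a" "of_rat a < t" using of_rat_dense[of "t - e" t] e by auto
   obtain b where b: "t < of_rat b" "of_rat b < t + e" using of_rat_dense[of t "t + e"] e by auto
   have "{of_rat a..of_rat b} \<subseteq> cball t e" using a b by (auto simp: dist_real_def)
   then show "g t = g' t" using elim[rule_format, of "(a, b)"] a b e(2) by auto
  qed
 qed
 then show ?thesis using J(1) by (simp add: AE_lebesgue_on)
qed

lemma has_weak_derivative_some: "has_weak_derivative J u g \<Longrightarrow> has_weak_derivative J u (weak_derivative J u)"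
 unfolding weak_derivative_def by (rule someI[of "has_weak_derivative J u"])

section \<open>Translations on the half-line\<close>

definition shift :: "real \<Rightarrow> (real \<Rightarrow> 'x::zero) \<Rightarrow> real \<Rightarrow> 'x" where
 "shift a h t = (if t \<in> {a<..} then h (t - a) else 0)"

lemma wint_one:
 assumes "S \<subseteq> {0<..}" "S \<in> sets lebesgue"
 shows "wint S p 1 h = (\<integral>\<^sup>+t. ennreal (norm (h t) powr p) * indicator S t \<partial>lebesgue)"
 unfolding wint_def using assms
 by (subst nn_integral_restrict_space) (auto intro!: nn_integral_cong simp: indicator_def)

lemma wint_shift:
 assumes S: "S \<subseteq> {0<..}" "S \<in> sets lebesgue" and a: "a \<ge> 0" and h: "smeas S h"
 shows "wint {t. t - a \<in> S} p 1 (\<lambda>t. h (t - a)) = wint S p 1 h"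
proof -
 have Sa: "{t. t - a \<in> S} \<in> sets lebesgue" using lebesgue_shift_sets[OF S(2), of "-a"] by simp
 have "(\<lambda>t. ennreal (norm (h t) powr p)) \<in> borel_measurable (lebesgue_on S)"
  using sm_norm_measurable[OF S(2) h] by measurable
 then have "(\<lambda>t. ennreal (norm (h t) powr p) * indicator S t) \<in> borel_measurable lebesgue"
  using S(2) by (subst (asm) borel_measurable_restrict_space_iff_ennreal) auto
 from nn_integral_real_affine_lebesgue[OF this, of 1 "-a"]
 have "(\<integral>\<^sup>+t. ennreal (norm (h t) powr p) * indicator S t \<partial>lebesgue)
   = (\<integral>\<^sup>+t. ennreal (norm (h (t - a)) powr p) * indicator {t. t - a \<in> S} t \<partial>lebesgue)"
  by (simp add: indicator_def)
 then show ?thesis using S Sa a by (subst (1 2) wint_one) auto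
qed

lemma shift_wLp:
 assumes p: "p \<ge> 1" and a: "a \<ge> 0" and h: "h \<in> Lp {0<..} p"
 shows "shift a h \<in> Lp {0<..} p" "wLp_norm {0<..} p 1 (shift a h) = wLp_norm {0<..} p 1 h"
  "wLp_norm {a<..<a+T} p 1 (shift a h) = wLp_norm {0<..<T} p 1 h"
proof -
 have S: "{t. t - a \<in> {0<..}} = {a<..}" "{t. t - a \<in> {0<..<T}} = {a<..<a+T}" by auto
 have sm: "smeas {a<..} (\<lambda>t. h (t - a))"
  using sm_shift[OF _ wLp_sm[OF h], of "-a"] by (simp add: greaterThan_def)
 have w: "wint {a<..} p 1 (\<lambda>t. h (t - a)) = wint {0<..} p 1 h"
  using wint_shift[OF order_refl _ a wLp_sm[OF h], of p] unfolding S by simp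
 have sub: "{a<..} \<subseteq> {0<..}" using a by auto
 have mem: "(\<lambda>t. h (t - a)) \<in> wLp {a<..} p 1" using sm w h by (simp add: wLp_iff)
 have eq: "shift a h = (\<lambda>t. if t \<in> {a<..} then h (t - a) else 0)" by (simp add: shift_def fun_eq_iff)
 show "shift a h \<in> Lp {0<..} p" unfolding eq using mem by (subst wLp_restrict(1)[OF p sub]) auto
 show "wLp_norm {0<..} p 1 (shift a h) = wLp_norm {0<..} p 1 h"
  unfolding eq by (subst wLp_restrict(2)[OF p sub]) (auto simp: wLp_norm_wint w)
 have "wint {a<..<a+T} p 1 (shift a h) = wint {a<..<a+T} p 1 (\<lambda>t. h (t - a))"
  unfolding wint_def by (rule nn_integral_cong) (simp add: shift_def)
 also have "\<dots> = wint {0<..<T} p 1 h"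
  using wint_shift[OF _ _ a sm_subset[OF wLp_sm[OF h], of "{0<..<T}"], of p] unfolding S by (simp add: Ioo_subset_Ioi)
 finally show "wLp_norm {a<..<a+T} p 1 (shift a h) = wLp_norm {0<..<T} p 1 h" by (simp add: wLp_norm_wint)
qed

lemma unshift_wLp:
 assumes p: "p \<ge> 1" and a: "a \<ge> 0" and h: "h \<in> Lp {0<..} p"
 shows "(\<lambda>t. h (t + a)) \<in> Lp {0<..} p"
proof -
 have ha: "h \<in> wLp {a<..} p 1" by (rule wLp_subset(1)[OF p _ _ _ h]) (use a in auto)
 have "{t. t + a \<in> {a<..}} = {0<..}" by auto
 then have sm: "smeas {0<..} (\<lambda>t. h (t + a))"
  using sm_shift[OF _ wLp_sm[OF ha], of a] by simp
 have "{t. t - a \<in> {0<..}} = {a<..}" by auto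
 then have "wint {0<..} p 1 (\<lambda>t. h (t + a)) = wint {a<..} p 1 h"
  using wint_shift[OF order_refl _ a sm, of p] by simp
 then show ?thesis using ha sm by (simp add: wLp_iff)
qed

lemma one_Lp: "(\<lambda>r. 1::real) \<in> Lp {0<..<T} p"
proof (cases "T \<ge> 0")
 case True
 then show ?thesis unfolding wLp_iff by (subst wint_one) (auto simp: Ioo_subset_Ioi)
next
 case False
 then have "{0<..<T} = {}" by auto
 then show ?thesis unfolding wLp_iff by (subst wint_one) auto
qed

lemma prim_zero: "prim a b (\<lambda>t. 0) (\<lambda>t. 0)"
 by (rule primI) (simp_all add: bint_def integrable_0)

lemma prim_shift_zero:
 fixes u :: "real \<Rightarrow> 'x::banach"
 assumes a: "a \<ge> 0" and u: "prim 0 T g u" "u 0 = 0" and T': "T' \<le> a + T"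
 shows "prim 0 T' (shift a g) (shift a u)"
proof -
 have 1: "prim 0 b (shift a g) (shift a u)" if "0 \<le> b" "b \<le> a" for b
  by (rule prim_cong[OF prim_zero]) (use that in \<open>auto simp: shift_def intro!: AE_I2\<close>)
 show ?thesis
 proof (cases "0 \<le> T'")
  case True
  show ?thesis
  proof (cases "T' \<le> a")
   case False
   have "prim (0 + a) (T + a) (\<lambda>t. g (t - a)) (\<lambda>t. u (t - a))" by (rule prim_shift[OF u(1)])
   then have "prim a T' (\<lambda>t. g (t - a)) (\<lambda>t. u (t - a))" by (rule prim_sub) (use T' in auto)
   then have 2: "prim a T' (shift a g) (shift a u)"
   proof (rule prim_cong)
    show "AE t in lebesgue_on {a..T'}. g (t - a) = shift a g t"
    proof (subst AE_lebesgue_on_negligible)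
     show "negligible {t \<in> {a..T'}. g (t - a) \<noteq> shift a g t}"
      by (rule negligible_subset[of "{a}"]) (auto simp: shift_def)
    qed simp
    show "u (t - a) = shift a u t" if "t \<in> {a..T'}" for t using that u(2) by (auto simp: shift_def)
   qed (use False in simp)
   show ?thesis by (rule prim_join[OF 1[OF a order_refl] 2]) (use a False in auto)
  qed (use 1 True in auto)
 next
  case False
  then have "{0..T'} = {}" by auto
  then show ?thesis by (intro primI) (auto simp: bint_def sm_negligible)
 qed
qed

lemma AE_shift_lebesgue_on:
 fixes a T T' :: real
 assumes P: "AE t in lebesgue_on {0..T}. P t" and a: "a \<ge> 0" and T': "T' \<le> a + T"
  and Q: "\<And>t. t \<le> a \<Longrightarrow> Q t" "\<And>t. t > a \<Longrightarrow> P (t - a) \<Longrightarrow> Q t"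
 shows "AE t in lebesgue_on {0..T'}. Q t"
proof -
 have "AE t in lebesgue. t + - a \<in> {0..T} \<longrightarrow> P (t + - a)"
  using P by (intro AE_lebesgue_shift[where P="\<lambda>t. t \<in> {0..T} \<longrightarrow> P t"]) (simp add: AE_lebesgue_on)
 then have "AE t in lebesgue. t \<in> {0..T'} \<longrightarrow> Q t"
 proof eventually_elim
  case (elim t)
  show ?case
  proof
   assume t: "t \<in> {0..T'}"
   show "Q t"
   proof (cases "t \<le> a")
    case False
    then have "P (t - a)" using elim t T' by simp
    then show ?thesis using Q(2) False by simp
   qed (rule Q(1))
  qed
 qed
 then show ?thesis by (simp add: AE_lebesgue_on)
qed

lemma bint_shift:
 fixes v :: "real \<Rightarrow> 'x::banach"
 assumes v: "bint {0..T} v" and a: "a \<ge> 0" and T': "T' \<le> a + T"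
 shows "bint {0..T'} (shift a v)"
proof (cases "0 \<le> T'")
 case True
 show ?thesis
  using prim_bint[OF prim_shift_zero[OF a prim_integral[OF v, of 0] _ T']] by simp
next
 case False
 then have "{0..T'} = {}" by auto
 then show ?thesis by (auto simp: bint_def sm_negligible)
qed

lemma AE_Ioi_if_Icc:
 assumes "\<And>T::real. AE t in lebesgue_on {0..T}. P t" shows "AE t in lebesgue_on {0<..}. P t"
proof -
 have "AE t in lebesgue. t \<in> {0..real n} \<longrightarrow> P t" for n
  using assms[of "real n"] by (simp add: AE_lebesgue_on)
 then have "AE t in lebesgue. \<forall>n::nat. t \<in> {0..real n} \<longrightarrow> P t"
  by (subst AE_all_countable) (rule allI)
 then have "AE t in lebesgue. t \<in> {0<..} \<longrightarrow> P t"
 proof eventually_elim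
  case (elim t)
  obtain n where "t \<le> real n" using real_arch_simple by blast
  then show ?case using elim[rule_format, of n] by auto
 qed
 then show ?thesis by (simp add: AE_lebesgue_on)
qed

lemma AE_Icc_if_Ioi:
 assumes "AE t in lebesgue_on {0::real<..}. P t" shows "AE t in lebesgue_on {0..T}. P t"
proof -
 have "AE t in lebesgue_on {0<..<T}. P t"
  by (rule AE_lebesgue_on_subset[OF _ _ _ assms]) auto
 then show ?thesis by (simp add: AE_interior)
qed

section \<open>Maximal regularity on the half-line\<close>

locale mr_setting =
 fixes j :: "'b::banach \<Rightarrow> 'a::banach" and p :: real and A0 :: "'b \<Rightarrow> 'a"
 assumes p: "1 < p" and j: "bounded_linear j" "inj j" and A0: "bounded_linear A0"
  and mr: "maximal_regularity j p A0"
begin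

abbreviation nT :: "real \<Rightarrow> (real \<Rightarrow> 'x::real_normed_vector) \<Rightarrow> real" where "nT T \<equiv> wLp_norm {0<..<T} p 1"

lemma p1: "p \<ge> 1" using p by simp
lemma ip1: "1/p < 1" using p by simp

lemma Lp_bint: "(u :: real \<Rightarrow> 'x::banach) \<in> Lp {0<..} p \<Longrightarrow> bint {0..T} u"
 by (rule wLp_bint_0inf[OF p ip1]) auto

text \<open>\<open>g\<close> is the derivative of \<open>u\<close>, and \<open>v\<close> its \<open>X\<^sub>1\<close>-valued representative.\<close>

definition lsol :: "real \<Rightarrow> (real \<Rightarrow> 'a) \<Rightarrow> (real \<Rightarrow> 'a) \<Rightarrow> (real \<Rightarrow> 'b) \<Rightarrow> (real \<Rightarrow> 'a) \<Rightarrow> bool" where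
 "lsol T f g v u \<longleftrightarrow> prim 0 T g u \<and> u 0 = 0 \<and> bint {0..T} v \<and>
  (AE t in lebesgue_on {0..T}. u t = j (v t)) \<and> (AE t in lebesgue_on {0..T}. g t + A0 (v t) = f t)"

text \<open>The class in which maximal regularity gives existence and uniqueness. In contrast,
  \<open>lsol\<close> asks only for integrability on a bounded interval and therefore also covers
  solutions in weighted spaces.\<close>

definition gsol :: "(real \<Rightarrow> 'a) \<Rightarrow> (real \<Rightarrow> 'a) \<Rightarrow> (real \<Rightarrow> 'b) \<Rightarrow> (real \<Rightarrow> 'a) \<Rightarrow> bool" where
 "gsol f g v u \<longleftrightarrow> (\<forall>T. lsol T f g v u) \<and> g \<in> Lp {0<..} p \<and> v \<in> Lp {0<..} p"

lemma lsolD: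
 assumes "lsol T f g v u"
 shows "prim 0 T g u" "u 0 = 0" "bint {0..T} v" "AE t in lebesgue_on {0..T}. u t = j (v t)"
  "AE t in lebesgue_on {0..T}. g t + A0 (v t) = f t"
 using assms by (auto simp: lsol_def)

lemma gsolD:
 assumes "gsol f g v u"
 shows "lsol T f g v u" "g \<in> Lp {0<..} p" "v \<in> Lp {0<..} p"
 using assms by (auto simp: gsol_def)

lemma A0_bound: obtains K where "K \<ge> 0" "\<And>x. norm (A0 x) \<le> K * norm x"
 using bounded_linear.nonneg_bounded[OF A0] by (metis mult.commute)

lemma j_bound: obtains K where "K \<ge> 0" "\<And>x. norm (j x) \<le> K * norm x"
 using bounded_linear.nonneg_bounded[OF j(1)] by (metis mult.commute)

lemma A0_Lp: "v \<in> wLp J q \<mu> \<Longrightarrow> q \<ge> 1 \<Longrightarrow> J \<in> sets lebesgue \<Longrightarrow> (\<lambda>t. A0 (v t)) \<in> wLp J q \<mu>"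
 by (rule A0_bound, rule wLp_linear(1)[OF _ _ _ A0])

lemma j_Lp: "v \<in> wLp J q \<mu> \<Longrightarrow> q \<ge> 1 \<Longrightarrow> J \<in> sets lebesgue \<Longrightarrow> (\<lambda>t. j (v t)) \<in> wLp J q \<mu>"
 by (rule j_bound, rule wLp_linear(1)[OF _ _ _ j(1)])

lemma inv_j [simp]: "inv j (j x) = x" using j(2) by simp

lemma gsol_exists:
 assumes f: "f \<in> Lp {0<..} p" shows "\<exists>g v u. gsol f g v u"
proof -
 obtain u where u: "linear_solution j p A0 f u" using mr f unfolding maximal_regularity_def by blast
 let ?g = "weak_derivative {0<..} u"
 obtain v where v: "v \<in> Lp {0<..} p" "AE t in lebesgue_on {0<..}. u t = j (v t)"
  using u by (auto simp: linear_solution_def wLp_emb_def)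
 have uc: "continuous_on {0..} u" and u0: "u 0 = 0" using u by (auto simp: linear_solution_def)
 have wd: "has_weak_derivative {0<..} u ?g"
  using u by (auto simp: linear_solution_def W1_def intro: has_weak_derivative_some)
 have eq: "AE t in lebesgue_on {0<..}. ?g t + A0 (inv j (u t)) = f t" using u by (auto simp: linear_solution_def)
 have eq': "AE t in lebesgue_on {0<..}. ?g t + A0 (v t) = f t" using eq v(2) by eventually_elim simp
 \<comment> \<open>The chosen weak derivative need not be the one known to be in L_p; the equation
   puts it there.\<close>
 have "AE t in lebesgue_on {0<..}. f t - A0 (v t) = ?g t" using eq' by eventually_elim (simp add: algebra_simps)
 from wLp_cong_AE(1)[OF p1 _ wLp_diff(1)[OF p1 _ f A0_Lp[OF v(1) p1]] this]
 have gL: "?g \<in> Lp {0<..} p" by simp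
 have "lsol T f ?g v u" for T
  unfolding lsol_def
 proof (intro conjI u0 Lp_bint[OF v(1)] AE_Icc_if_Ioi[OF v(2)] AE_Icc_if_Ioi[OF eq'])
  show "prim 0 T ?g u"
  proof (rule prim_extend_0[OF _ Lp_bint[OF gL]])
   show "continuous_on {0..T} u" by (rule continuous_on_subset[OF uc]) auto
   show "prim a T ?g u" if "0 < a" "a \<le> T" for a
    by (rule prim_if_has_weak_derivative[OF _ _ continuous_on_subset[OF uc] wd]) (use that in auto)
  qed
 qed
 then show ?thesis using gL v(1) unfolding gsol_def by blast
qed

lemma gsol_continuous: assumes "\<And>T. lsol T f g v u" shows "continuous_on {0..} u"
proof -
 have "continuous (at t within {0..}) u" if "t \<ge> 0" for t
 proof -
  have "continuous_on {0..t+1} u" by (rule prim_continuous_on[OF lsolD(1)[OF assms]])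
  then have "continuous (at t within {0..t+1}) u" using that by (simp add: continuous_on_eq_continuous_within)
  moreover have "at t within {0..t+1} = at t within {0..}"
   by (rule at_within_nhd[of _ "{t-1<..<t+1}"]) (use that in auto)
  ultimately show ?thesis by simp
 qed
 then show ?thesis by (simp add: continuous_on_eq_continuous_within)
qed

text \<open>The way back to the definition, which makes its uniqueness clause applicable to all
  solutions constructed later.\<close>

lemma gsol_linear_solution:
 assumes s: "gsol f g v u" shows "linear_solution j p A0 f u"
proof -
 have uj: "AE t in lebesgue_on {0<..}. u t = j (v t)" by (rule AE_Ioi_if_Icc[OF lsolD(4)[OF gsolD(1)[OF s]]])
 have uj': "AE t in lebesgue_on {0<..}. j (v t) = u t" using uj by eventually_elim simp
 have uL: "u \<in> Lp {0<..} p" by (rule wLp_cong_AE(1)[OF p1 _ j_Lp[OF gsolD(3)[OF s] p1] uj']) auto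
 have uc: "continuous_on {0..} u" by (rule gsol_continuous[OF gsolD(1)[OF s]])
 have wd: "has_weak_derivative {0<..} u g"
 proof (rule has_weak_derivativeI_prim)
  show "prim a b g u" if "a \<le> b" "{a..b} \<subseteq> {0<..}" for a b
   using prim_sub[OF lsolD(1)[OF gsolD(1)[OF s, of b]]] that by auto
 qed auto
 have "AE t in lebesgue_on {0<..}. weak_derivative {0<..} u t = g t"
  by (rule weak_derivative_AE_eq[OF _ _ continuous_on_subset[OF uc] has_weak_derivative_some[OF wd] wd]) auto
 then have "AE t in lebesgue_on {0<..}. weak_derivative {0<..} u t + A0 (inv j (u t)) = f t"
  using uj AE_Ioi_if_Icc[OF lsolD(5)[OF gsolD(1)[OF s]]] by eventually_elim simp
 then show ?thesis unfolding linear_solution_def W1_def wLp_emb_def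
  using uL gsolD(2,3)[OF s] wd uj uc lsolD(2)[OF gsolD(1)[OF s]] by blast
qed

lemma gsol_unique:
 assumes "gsol f g v u" "gsol f g' v' u'" "f \<in> Lp {0<..} p" "t \<ge> 0"
 shows "u t = u' t"
proof -
 obtain w where w: "\<forall>u. linear_solution j p A0 f u \<longrightarrow> (\<forall>t\<ge>0. u t = w t)"
  using mr assms(3) unfolding maximal_regularity_def by blast
 show ?thesis
  using w[rule_format, OF gsol_linear_solution[OF assms(1)] assms(4)]
   w[rule_format, OF gsol_linear_solution[OF assms(2)] assms(4)] by simp
qed

lemma lsol_shift:
 assumes s: "lsol T f g v u" and a: "a \<ge> 0" and T': "T' \<le> a + T"
 shows "lsol T' (shift a f) (shift a g) (shift a v) (shift a u)"
 unfolding lsol_def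
proof (intro conjI)
 have z: "j 0 = 0" "A0 0 = 0" using j(1) A0 by (auto simp: linear_simps)
 show "prim 0 T' (shift a g) (shift a u)" by (rule prim_shift_zero[OF a lsolD(1,2)[OF s] T'])
 show "shift a u 0 = 0" using a by (simp add: shift_def)
 show "bint {0..T'} (shift a v)" by (rule bint_shift[OF lsolD(3)[OF s] a T'])
 show "AE t in lebesgue_on {0..T'}. shift a u t = j (shift a v t)"
  by (rule AE_shift_lebesgue_on[OF lsolD(4)[OF s] a T']) (auto simp: shift_def z)
 show "AE t in lebesgue_on {0..T'}. shift a g t + A0 (shift a v t) = shift a f t"
  by (rule AE_shift_lebesgue_on[OF lsolD(5)[OF s] a T']) (auto simp: shift_def z)
qed

lemma gsol_shift:
 assumes s: "gsol f g v u" and a: "a \<ge> 0"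
 shows "gsol (shift a f) (shift a g) (shift a v) (shift a u)"
 unfolding gsol_def
proof (intro conjI allI)
 show "lsol T (shift a f) (shift a g) (shift a v) (shift a u)" for T
  by (rule lsol_shift[OF gsolD(1)[OF s, of T] a]) (use a in simp)
qed (intro shift_wLp(1)[OF p1 a] gsolD[OF s])+

lemma lsol_cong:
 assumes s: "lsol T f g v u" and e: "AE t in lebesgue_on {0..T}. f t = f' t"
 shows "lsol T f' g v u"
proof -
 have "AE t in lebesgue_on {0..T}. g t + A0 (v t) = f' t" using lsolD(5)[OF s] e by eventually_elim simp
 then show ?thesis using s by (simp add: lsol_def)
qed

lemma gsol_cong:
 assumes s: "gsol f g v u" and e: "AE t in lebesgue_on {0<..}. f t = f' t"
 shows "gsol f' g v u"
 using gsolD[OF s] lsol_cong[OF gsolD(1)[OF s] AE_Icc_if_Ioi[OF e]] unfolding gsol_def by blast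

text \<open>Solving for the part of f after time T and translating that solution by T gives a
  solution for f that vanishes on [0,T]; uniqueness on the half-line identifies it with u.\<close>

lemma causality:
 assumes s: "gsol f g v u" and f: "f \<in> Lp {0<..} p" and z: "AE t in lebesgue_on {0..T}. f t = 0" and t: "0 \<le> t" "t \<le> T"
 shows "u t = 0"
proof -
 have T: "T \<ge> 0" using t by simp
 obtain g1 v1 u1 where s1: "gsol (\<lambda>t. f (t + T)) g1 v1 u1" using gsol_exists[OF unshift_wLp[OF p1 T f]] by blast
 have "AE t in lebesgue_on {0<..}. shift T (\<lambda>t. f (t + T)) t = f t"
 proof -
  have "AE t in lebesgue. t \<in> {0..T} \<longrightarrow> f t = 0" using z by (simp add: AE_lebesgue_on)
  then have "AE t in lebesgue. t \<in> {0<..} \<longrightarrow> shift T (\<lambda>t. f (t + T)) t = f t"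
   by eventually_elim (auto simp: shift_def)
  then show ?thesis by (simp add: AE_lebesgue_on)
 qed
 from gsol_cong[OF gsol_shift[OF s1 T] this] have "gsol f (shift T g1) (shift T v1) (shift T u1)" .
 from gsol_unique[OF s this f t(1)] show ?thesis using t(2) by (simp add: shift_def)
qed

lemma lsol_zero: "lsol T (\<lambda>t. 0) (\<lambda>t. 0) (\<lambda>t. 0) (\<lambda>t. 0)"
proof -
 have "j 0 = 0" "A0 0 = 0" using j(1) A0 by (auto simp: linear_simps)
 then show ?thesis by (simp add: lsol_def prim_zero) (simp add: bint_def integrable_0)
qed

lemma lsol_lincomb:
 assumes "lsol T f g v u" "lsol T f' g' v' u'"
 shows "lsol T (\<lambda>t. f t + c *\<^sub>R f' t) (\<lambda>t. g t + c *\<^sub>R g' t) (\<lambda>t. v t + c *\<^sub>R v' t) (\<lambda>t. u t + c *\<^sub>R u' t)"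
 unfolding lsol_def
proof (intro conjI)
 interpret j: bounded_linear j by (rule j)
 interpret A0: bounded_linear A0 by (rule A0)
 show "prim 0 T (\<lambda>t. g t + c *\<^sub>R g' t) (\<lambda>t. u t + c *\<^sub>R u' t)"
  by (rule prim_add[OF lsolD(1)[OF assms(1)] prim_scale[OF lsolD(1)[OF assms(2)]]])
 show "u 0 + c *\<^sub>R u' 0 = 0" using lsolD(2)[OF assms(1)] lsolD(2)[OF assms(2)] by simp
 show "bint {0..T} (\<lambda>t. v t + c *\<^sub>R v' t)"
  by (rule bint_add[OF _ lsolD(3)[OF assms(1)] bint_scale[OF _ lsolD(3)[OF assms(2)]]]) auto
 show "AE t in lebesgue_on {0..T}. u t + c *\<^sub>R u' t = j (v t + c *\<^sub>R v' t)"
  using lsolD(4)[OF assms(1)] lsolD(4)[OF assms(2)] by eventually_elim (simp add: j.add j.scaleR)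
 show "AE t in lebesgue_on {0..T}. g t + c *\<^sub>R g' t + A0 (v t + c *\<^sub>R v' t) = f t + c *\<^sub>R f' t"
  using lsolD(5)[OF assms(1)] lsolD(5)[OF assms(2)]
 proof eventually_elim
  case (elim t)
  have "f t + c *\<^sub>R f' t = (g t + A0 (v t)) + c *\<^sub>R (g' t + A0 (v' t))" using elim by simp
  then show ?case by (simp add: A0.add A0.scaleR algebra_simps)
 qed
qed

lemma gsol_lincomb:
 assumes "gsol f g v u" "gsol f' g' v' u'"
 shows "gsol (\<lambda>t. f t + c *\<^sub>R f' t) (\<lambda>t. g t + c *\<^sub>R g' t) (\<lambda>t. v t + c *\<^sub>R v' t) (\<lambda>t. u t + c *\<^sub>R u' t)"
 unfolding gsol_def
proof (intro conjI allI)
 show "lsol T (\<lambda>t. f t + c *\<^sub>R f' t) (\<lambda>t. g t + c *\<^sub>R g' t) (\<lambda>t. v t + c *\<^sub>R v' t) (\<lambda>t. u t + c *\<^sub>R u' t)" for T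
  by (rule lsol_lincomb[OF gsolD(1)[OF assms(1)] gsolD(1)[OF assms(2)]])
 show "(\<lambda>t. g t + c *\<^sub>R g' t) \<in> Lp {0<..} p"
  by (rule wLp_add(1)[OF p1 _ gsolD(2)[OF assms(1)] wLp_scale(1)[OF p1 _ gsolD(2)[OF assms(2)]]]) auto
 show "(\<lambda>t. v t + c *\<^sub>R v' t) \<in> Lp {0<..} p"
  by (rule wLp_add(1)[OF p1 _ gsolD(3)[OF assms(1)] wLp_scale(1)[OF p1 _ gsolD(3)[OF assms(2)]]]) auto
qed

text \<open>Uniqueness on bounded intervals: cut the solution off smoothly and use causality.\<close>

lemma lsol_zero_unique_Lp:
 assumes s: "lsol T (\<lambda>t. 0) g v u" and v: "v \<in> Lp {0<..<T} p" and t: "0 \<le> t" "t < T"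
 shows "u t = 0"
proof -
 obtain \<Theta> \<beta> where Th: "\<And>x. (\<Theta> has_real_derivative \<beta> x) (at x)"
  "continuous_on UNIV \<beta>" "\<And>x. x \<le> 0 \<Longrightarrow> \<Theta> x = 0" "\<And>x. x \<ge> 1 \<Longrightarrow> \<Theta> x = 1" "\<And>x. x \<le> 0 \<or> x \<ge> 1 \<Longrightarrow> \<beta> x = (0::real)"
  by (rule smooth_step_ex) (rule that)
 define c where "c = 1 / (T - t)"
 have c: "c > 0" using t by (simp add: c_def)
 \<comment> \<open>A smooth cut-off that is 1 up to time t and 0 from T on.\<close>
 define \<zeta> where "\<zeta> r = 1 - \<Theta> (c * r + (- c * t))" for r
 define \<zeta>' where "\<zeta>' r = - (\<beta> (c * r + (- c * t)) * c)" for r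
 have \<zeta>D: "(\<zeta> has_real_derivative \<zeta>' r) (at r)" for r
 proof -
  have "((\<lambda>r. c * r + (- c * t)) has_real_derivative c) (at r)"
   using DERIV_add[OF DERIV_cmult_Id[of c r] DERIV_const[of "- c * t"]] by simp
  from DERIV_diff[OF DERIV_const[of 1] DERIV_chain2[OF Th(1) this]] show ?thesis
   by (simp add: \<zeta>_def[abs_def] \<zeta>'_def)
 qed
 have \<zeta>'c: "continuous_on S \<zeta>'" for S
  unfolding \<zeta>'_def[abs_def] by (intro continuous_intros continuous_on_compose2[OF Th(2)]) auto
 have \<zeta>c: "continuous_on S \<zeta>" for S
  by (rule DERIV_continuous_on[OF has_field_derivative_at_within[OF \<zeta>D]])
 have \<zeta>1: "\<zeta> r = 1" "\<zeta>' r = 0" if "r \<le> t" for r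
 proof -
  have "c * r + (- c * t) \<le> 0" using c that by simp
  then show "\<zeta> r = 1" "\<zeta>' r = 0" by (auto simp: \<zeta>_def \<zeta>'_def Th(3,5))
 qed
 have \<zeta>0: "\<zeta> r = 0" if "r \<ge> T" for r
 proof -
  have "c * (r - t) \<ge> c * (T - t)" using c that by (intro mult_left_mono) auto
  then have "c * r + (- c * t) \<ge> 1" using t by (simp add: c_def algebra_simps diff_divide_distrib[symmetric])
  then show ?thesis by (simp add: \<zeta>_def Th(4))
 qed
 define I where "I = {0<..<T}"
 define u' where "u' r = (if r \<in> {0..T} then \<zeta> r *\<^sub>R u r else 0)" for r
 define g' where "g' r = (if r \<in> I then \<zeta>' r *\<^sub>R u r + \<zeta> r *\<^sub>R g r else 0)" for r
 define v' where "v' r = (if r \<in> I then \<zeta> r *\<^sub>R v r else 0)" for r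
 \<comment> \<open>The cut-off function solves the half-line problem with this right-hand side. It
   vanishes on [0,t], where \<zeta> = 1, and is in L_p because v is and because g = - A0 v.\<close>
 define f' where "f' r = g' r + A0 (v' r)" for r
 have T: "T > 0" using t by simp
 have I: "I \<subseteq> {0<..}" "I \<in> sets lebesgue" by (auto simp: I_def)
 have z: "j 0 = 0" "A0 0 = 0" using j(1) A0 by (auto simp: linear_simps)
 have bd: "\<exists>B\<ge>0. \<forall>r\<in>{0..T}. norm (h r) \<le> B" if "continuous_on {0..T} h" for h :: "real \<Rightarrow> 'y::real_normed_vector"
  using compact_imp_bounded[OF compact_continuous_image[OF that compact_Icc]] unfolding bounded_pos
  by (meson imageI less_imp_le)
 obtain B1 where B1: "B1 \<ge> 0" "\<forall>r\<in>{0..T}. norm (\<zeta> r) \<le> B1" using bd[OF \<zeta>c] by blast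
 obtain B2 where B2: "B2 \<ge> 0" "\<forall>r\<in>{0..T}. norm (\<zeta>' r *\<^sub>R u r) \<le> B2"
  using bd[OF continuous_on_scaleR[OF \<zeta>'c prim_continuous_on[OF lsolD(1)[OF s]]]] by blast
 have smc: "smeas I \<zeta>" "smeas I (\<lambda>r. \<zeta>' r *\<^sub>R u r)"
 proof -
  have "continuous_on I u"
   by (rule continuous_on_subset[OF prim_continuous_on[OF lsolD(1)[OF s]]]) (auto simp: I_def)
  then show "smeas I (\<lambda>r. \<zeta>' r *\<^sub>R u r)"
   by (intro sm_continuous_on[OF I(2)] continuous_on_scaleR[OF \<zeta>'c])
  show "smeas I \<zeta>" by (rule sm_continuous_on[OF I(2) \<zeta>c])
 qed
 have vI: "v \<in> wLp I p 1" using v by (simp add: I_def)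
 have vL: "v' \<in> Lp {0<..} p"
  unfolding v'_def wLp_restrict(1)[OF p1 I Ioi_sets]
  by (rule wLp_mono(1)[OF p1 I(2) sm_scaleR[OF smc(1) wLp_sm[OF vI]] vI B1(1)])
   (use B1(2) in \<open>auto intro!: AE_I2 mult_right_mono simp: I_def\<close>)
 have gI: "g \<in> wLp I p 1"
 proof (rule wLp_cong_AE(1)[OF p1 I(2) wLp_minus(1)[OF p1 I(2) A0_Lp[OF vI p1 I(2)]]])
  have "AE r in lebesgue_on I. g r + A0 (v r) = 0" using lsolD(5)[OF s] unfolding I_def AE_interior .
  then show "AE r in lebesgue_on I. - A0 (v r) = g r" by eventually_elim (simp add: eq_neg_iff_add_eq_0[symmetric])
 qed
 have one: "(\<lambda>r. 1::real) \<in> wLp I p 1"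
  unfolding I_def by (rule one_Lp)
 have gL: "g' \<in> Lp {0<..} p"
  unfolding g'_def wLp_restrict(1)[OF p1 I Ioi_sets]
 proof (rule wLp_add(1)[OF p1 I(2)])
  show "(\<lambda>r. \<zeta>' r *\<^sub>R u r) \<in> wLp I p 1"
   by (rule wLp_mono(1)[OF p1 I(2) smc(2) one B2(1)]) (use B2(2) in \<open>auto intro!: AE_I2 simp: I_def\<close>)
  show "(\<lambda>r. \<zeta> r *\<^sub>R g r) \<in> wLp I p 1"
   by (rule wLp_mono(1)[OF p1 I(2) sm_scaleR[OF smc(1) wLp_sm[OF gI]] gI B1(1)])
    (use B1(2) in \<open>auto intro!: AE_I2 mult_right_mono simp: I_def\<close>)
 qed
 have fL: "f' \<in> Lp {0<..} p" unfolding f'_def by (rule wLp_add(1)[OF p1 _ gL A0_Lp[OF vL p1]]) auto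
 have e0: "AE r in lebesgue_on {0..T}. r \<in> I" unfolding I_def AE_interior by (rule AE_I2) simp
 have pm: "prim 0 T (\<lambda>r. \<zeta>' r *\<^sub>R u r + \<zeta> r *\<^sub>R g r) (\<lambda>r. \<zeta> r *\<^sub>R u r)"
  by (rule prim_mult[OF lsolD(1)[OF s] less_imp_le[OF T] has_field_derivative_at_within[OF \<zeta>D] \<zeta>'c])
 have pT: "prim 0 T g' u'"
  by (rule prim_cong[OF pm]) (use e0 T in \<open>auto elim!: eventually_mono simp: g'_def u'_def\<close>)
 have pR: "prim T R g' u'" if "R \<ge> T" for R
  by (rule prim_cong[OF prim_zero]) (use that \<zeta>0[of T] in \<open>auto intro!: AE_I2 simp: g'_def u'_def I_def\<close>)
 have eR: "AE r in lebesgue_on {0<..}. u' r = j (v' r)"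
 proof -
  have "AE r in lebesgue. r \<in> {0..T} \<longrightarrow> u r = j (v r)" using lsolD(4)[OF s] by (simp add: AE_lebesgue_on)
  moreover have "AE r in lebesgue. r \<in> {0..T} \<longrightarrow> r \<in> I" using e0 by (simp add: AE_lebesgue_on)
  ultimately have "AE r in lebesgue. r \<in> {0<..} \<longrightarrow> u' r = j (v' r)"
  proof eventually_elim
   case (elim r)
   then show ?case using j(1) by (auto simp: u'_def v'_def z linear_simps I_def)
  qed
  then show ?thesis by (simp add: AE_lebesgue_on)
 qed
 have "lsol R f' g' v' u'" for R
  unfolding lsol_def
 proof (intro conjI Lp_bint[OF vL] AE_Icc_if_Ioi[OF eR])
  show "prim 0 R g' u'"
   using prim_sub[OF prim_join[OF pT pR[of "max R T"]], of 0 R] T by auto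
  show "u' 0 = 0" using lsolD(2)[OF s] by (simp add: u'_def)
  show "AE r in lebesgue_on {0..R}. g' r + A0 (v' r) = f' r" by (simp add: f'_def)
 qed
 then have gs: "gsol f' g' v' u'" using gL vL by (simp add: gsol_def)
 have "AE r in lebesgue_on {0..t}. f' r = 0"
 proof -
  have "AE r in lebesgue_on {0..t}. g r + A0 (v r) = 0"
   by (rule AE_lebesgue_on_subset[OF _ _ _ lsolD(5)[OF s]]) (use t in auto)
  then show ?thesis using AE_space
  proof eventually_elim
   case (elim r)
   then show ?case using \<zeta>1[of r] by (simp add: f'_def g'_def v'_def z)
  qed
 qed
 from causality[OF gs fL this t(1) order_refl] have "u' t = 0" .
 then show ?thesis using \<zeta>1[of t] t by (simp add: u'_def)
qed

end

text \<open>Dominated convergence with the integrand of u as majorant. It is applied to tails at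
  infinity, to neighbourhoods of 0, to complements of compact windows and to neighbourhoods of a
  single time.\<close>

lemma wLp_norm_vanish:
 assumes p: "p \<ge> 1" and u: "u \<in> wLp {0<..} p \<mu>" and S: "\<And>n::nat. S n \<in> sets lebesgue" "\<And>n. S n \<subseteq> {0<..}"
  and ae: "AE t in lebesgue_on {0<..}. eventually (\<lambda>n. t \<notin> S n) sequentially"
 shows "(\<lambda>n. wLp_norm (S n) p \<mu> u) \<longlonglongrightarrow> 0"
proof -
 let ?h = "\<lambda>t. ennreal ((norm (t powr (1 - \<mu>) *\<^sub>R u t)) powr p)"
 have hm: "?h \<in> borel_measurable (lebesgue_on {0<..})" by (rule wint_measurable[OF Ioi_sets wLp_sm[OF u]])
 have fin: "wint {0<..} p \<mu> u < \<infinity>" using u by (simp add: wLp_iff)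
 have eq: "wint (S n) p \<mu> u = (\<integral>\<^sup>+t. ?h t * indicator (S n) t \<partial>lebesgue_on {0<..})" for n
  unfolding wint_def using S[of n]
  by (subst (1 2) nn_integral_restrict_space) (auto intro!: nn_integral_cong simp: indicator_def)
 have "(\<lambda>n. \<integral>\<^sup>+t. ?h t * indicator (S n) t \<partial>lebesgue_on {0<..}) \<longlonglongrightarrow> (\<integral>\<^sup>+t. 0 \<partial>lebesgue_on {0::real<..})"
 proof (rule nn_integral_dominated_convergence[where w="?h"])
  show "?h \<in> borel_measurable (lebesgue_on {0<..})" by (rule hm)
  have "S n \<inter> {0<..} \<in> sets (lebesgue_on {0<..})" for n
   using S[of n] by (simp add: sets_restrict_space_iff Int_absorb2)
  then have "(indicator (S n) :: real \<Rightarrow> ennreal) \<in> borel_measurable (lebesgue_on {0<..})" for n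
   by (subst borel_measurable_indicator_iff) simp
  then show "(\<lambda>t. ?h t * indicator (S n) t) \<in> borel_measurable (lebesgue_on {0<..})" for n
   using hm by measurable
  show "(\<integral>\<^sup>+t. ?h t \<partial>lebesgue_on {0<..}) < \<infinity>" using fin by (simp add: wint_def)
  show "AE t in lebesgue_on {0<..}. ?h t * indicator (S n) t \<le> ?h t" for n
   by (intro AE_I2) (simp add: indicator_def)
  show "AE t in lebesgue_on {0<..}. (\<lambda>n. ?h t * indicator (S n) t) \<longlonglongrightarrow> 0"
   using ae
  proof eventually_elim
   case (elim t)
   then have "eventually (\<lambda>n. ?h t * indicator (S n) t = 0) sequentially" by eventually_elim simp
   then show ?case by (rule tendsto_eventually)
  qed
 qed simp
 then have "(\<lambda>n. wint (S n) p \<mu> u) \<longlonglongrightarrow> ennreal 0" by (simp add: eq)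
 moreover have "wint (S n) p \<mu> u \<noteq> \<infinity>" for n
  using order.strict_trans1[OF wint_mono_set[OF S(2)[of n] S(1) Ioi_sets] fin] by simp
 ultimately have "(\<lambda>n. enn2real (wint (S n) p \<mu> u)) \<longlonglongrightarrow> enn2real (ennreal 0)"
  by (intro tendsto_enn2real) auto
 then have "(\<lambda>n. enn2real (wint (S n) p \<mu> u)) \<longlonglongrightarrow> 0" by simp
 then show ?thesis unfolding wLp_norm_wint
  using p by (intro tendsto_zero_powrI[of _ _ _ "1/p"]) auto
qed

lemma wLp_norm_split:
 assumes p: "p \<ge> 1" and J: "J \<in> sets lebesgue" and K: "K \<in> sets lebesgue" and u: "u \<in> wLp J p \<mu>"
 shows "wLp_norm J p \<mu> u \<le> wLp_norm (J \<inter> K) p \<mu> u + wLp_norm (J - K) p \<mu> u"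
proof -
 let ?a = "\<lambda>t. if t \<in> J \<inter> K then u t else 0" and ?b = "\<lambda>t. if t \<in> J - K then u t else 0"
 have JK: "J \<inter> K \<in> sets lebesgue" "J - K \<in> sets lebesgue" using J K by auto
 have a: "?a \<in> wLp J p \<mu>" by (subst wLp_restrict(1)[OF p Int_lower1 JK(1) J]) (rule wLp_subset(1)[OF p Int_lower1 JK(1) J u])
 have b: "?b \<in> wLp J p \<mu>" by (subst wLp_restrict(1)[OF p Diff_subset JK(2) J]) (rule wLp_subset(1)[OF p Diff_subset JK(2) J u])
 have "wLp_norm J p \<mu> u = wLp_norm J p \<mu> (\<lambda>t. ?a t + ?b t)"
  by (rule wLp_cong_AE(2)[OF p J wLp_add(1)[OF p J a b]]) (auto intro!: AE_I2)
 also have "\<dots> \<le> wLp_norm J p \<mu> ?a + wLp_norm J p \<mu> ?b" by (rule wLp_add(2)[OF p J a b])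
 finally show ?thesis
  unfolding wLp_restrict(2)[OF p Int_lower1 JK(1) J] wLp_restrict(2)[OF p Diff_subset JK(2) J] .
qed

lemma wLp_norm_exhaust:
 assumes p: "p \<ge> 1" and u: "u \<in> wLp {0<..} p \<mu>" and K: "K < wLp_norm {0<..} p \<mu> u"
 obtains T where "T \<ge> 1" "K < wLp_norm {0<..<T} p \<mu> u"
proof -
 have "(\<lambda>n. wLp_norm {real n + 1..} p \<mu> u) \<longlonglongrightarrow> 0"
 proof (rule wLp_norm_vanish[OF p u])
  show "AE t in lebesgue_on {0<..}. eventually (\<lambda>n. t \<notin> {real n + 1..}) sequentially"
  proof (intro AE_I2)
   fix t :: real
   obtain N where "t \<le> real N" using real_arch_simple by blast
   then show "eventually (\<lambda>n. t \<notin> {real n + 1..}) sequentially" by (intro eventually_sequentiallyI[of N]) auto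
  qed
 qed auto
 then have "eventually (\<lambda>n. wLp_norm {real n + 1..} p \<mu> u < wLp_norm {0<..} p \<mu> u - K) sequentially"
  using K by (intro order_tendstoD(2)) auto
 then obtain n where n: "wLp_norm {real n + 1..} p \<mu> u < wLp_norm {0<..} p \<mu> u - K" by (auto simp: eventually_sequentially)
 have "{0<..} \<inter> {0<..<real n + 1} = {0<..<real n + 1}" "{0<..} - {0<..<real n + 1} = {real n + 1..}" by auto
 then have "wLp_norm {0<..} p \<mu> u \<le> wLp_norm {0<..<real n + 1} p \<mu> u + wLp_norm {real n + 1..} p \<mu> u"
  using wLp_norm_split[OF p Ioi_sets _ u, of "{0<..<real n + 1}"] by simp
 with n have "K < wLp_norm {0<..<real n + 1} p \<mu> u" by linarith
 then show ?thesis by (intro that[of "real n + 1"]) auto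
qed

lemma wLp_norm_scale_eq:
 assumes p: "p \<ge> 1" and J: "J \<in> sets lebesgue" and u: "u \<in> wLp J p \<mu>"
 shows "wLp_norm J p \<mu> (\<lambda>t. c *\<^sub>R u t) = \<bar>c\<bar> * wLp_norm J p \<mu> u"
proof (cases "c = 0")
 case False
 have "wLp_norm J p \<mu> u = wLp_norm J p \<mu> (\<lambda>t. (1/c) *\<^sub>R (c *\<^sub>R u t))" using False by simp
 also have "\<dots> \<le> \<bar>1/c\<bar> * wLp_norm J p \<mu> (\<lambda>t. c *\<^sub>R u t)" by (rule wLp_scale(2)[OF p J wLp_scale(1)[OF p J u]])
 finally have "\<bar>c\<bar> * wLp_norm J p \<mu> u \<le> wLp_norm J p \<mu> (\<lambda>t. c *\<^sub>R u t)"
  using False by (simp add: field_simps)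
 then show ?thesis using wLp_scale(2)[OF p J u, of c] by simp
qed (simp add: wLp_zero[OF p])

lemma continuous_Lp:
 assumes p: "p \<ge> 1" and u: "continuous_on {0..T} u"
 shows "u \<in> Lp {0<..<T} p"
proof -
 obtain B where B: "\<forall>x\<in>u ` {0..T}. norm x \<le> B"
  using compact_imp_bounded[OF compact_continuous_image[OF u compact_Icc]] unfolding bounded_iff by blast
 have sm: "smeas {0<..<T} u"
  by (intro sm_continuous_on continuous_on_subset[OF u]) auto
 show ?thesis
 proof (rule wLp_mono(1)[OF p _ sm one_Lp, of "\<bar>B\<bar>"])
  show "AE t in lebesgue_on {0<..<T}. norm (u t) \<le> \<bar>B\<bar> * norm (1::real)"
  proof (rule AE_I2)
   fix t assume "t \<in> space (lebesgue_on {0<..<T})"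
   then have "norm (u t) \<le> B" using B by auto
   then show "norm (u t) \<le> \<bar>B\<bar> * norm (1::real)" by simp
  qed
 qed auto
qed

context mr_setting
begin

lemma lsol_mono: "lsol T f g v u \<Longrightarrow> T' \<le> T \<Longrightarrow> lsol T' f g v u"
proof -
 assume s: "lsol T f g v u" and T: "T' \<le> T"
 have sub: "{0..T'} \<subseteq> {0..T}" using T by auto
 show ?thesis unfolding lsol_def
  using prim_sub[OF lsolD(1)[OF s] order_refl T] lsolD(2)[OF s] bint_sub[OF lsolD(3)[OF s] sub]
   AE_lebesgue_on_subset[OF _ _ sub lsolD(4)[OF s]] AE_lebesgue_on_subset[OF _ _ sub lsolD(5)[OF s]] by simp
qed

text \<open>Integration in time improves v from integrable to continuous, hence to L_p on bounded
  intervals, and turns the two almost everywhere identities into identities at every time.\<close>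

lemma lsol_integral:
 assumes s: "lsol T f g v u" and f: "bint {0..T} f"
 shows "lsol T (\<lambda>r. integral {0..r} f) u (\<lambda>r. integral {0..r} v) (\<lambda>r. integral {0..r} u)"
  "0 \<le> r \<Longrightarrow> r \<le> T \<Longrightarrow> integral {0..r} u = j (integral {0..r} v)"
  "0 \<le> r \<Longrightarrow> r \<le> T \<Longrightarrow> u r + A0 (integral {0..r} v) = integral {0..r} f"
proof -
 define V where "V r = integral {0..r} v" for r
 note uc = prim_continuous_on[OF lsolD(1)[OF s]]
 have ub: "bint {0..T} u" by (rule bint_continuous[OF uc])
 have U: "prim 0 T u (\<lambda>r. integral {0..r} u)" using prim_integral[OF ub, of 0] by simp
 have Vp: "prim 0 T v V" unfolding V_def using prim_integral[OF lsolD(3)[OF s], of 0] by simp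
 note Vc = prim_continuous_on[OF Vp]
 have vi: "v integrable_on {0..r}" if "r \<le> T" for r
  by (rule bint_integrable[OF _ bint_sub[OF lsolD(3)[OF s]]]) (use that in auto)
 have UV: "integral {0..r} u = j (V r)" if r: "0 \<le> r" "r \<le> T" for r
 proof -
  have "integral {0..r} u = integral {0..r} (\<lambda>t. j (v t))"
   by (rule integral_AE_eq[OF _ AE_lebesgue_on_subset[OF _ _ _ lsolD(4)[OF s]]]) (use r in auto)
  also have "\<dots> = j (V r)" unfolding V_def by (rule integral_linear[OF vi[OF r(2)] j(1), unfolded comp_def])
  finally show ?thesis .
 qed
 have uV: "u r + A0 (V r) = integral {0..r} f" if r: "0 \<le> r" "r \<le> T" for r
 proof -
  have "integral {0..r} (\<lambda>t. g t + A0 (v t)) = integral {0..r} f"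
   by (rule integral_AE_eq[OF _ AE_lebesgue_on_subset[OF _ _ _ lsolD(5)[OF s]]]) (use r in auto)
  moreover have "integral {0..r} (\<lambda>t. g t + A0 (v t)) = integral {0..r} g + integral {0..r} (\<lambda>t. A0 (v t))"
   by (rule HK_integral_add[OF bint_integrable[OF _ bint_sub[OF prim_bint[OF lsolD(1)[OF s]]]]
      bint_integrable[OF _ bint_linear[OF _ A0 bint_sub[OF lsolD(3)[OF s]]]]]) (use r in auto)
  moreover have "integral {0..r} (\<lambda>t. A0 (v t)) = A0 (V r)"
   unfolding V_def by (rule integral_linear[OF vi[OF r(2)] A0, unfolded comp_def])
  moreover have "u r = integral {0..r} g" using prim_eq[OF lsolD(1)[OF s] r] lsolD(2)[OF s] by simp
  ultimately show ?thesis by simp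
 qed
 show "lsol T (\<lambda>r. integral {0..r} f) u (\<lambda>r. integral {0..r} v) (\<lambda>r. integral {0..r} u)"
  unfolding lsol_def V_def[symmetric]
 proof (intro conjI U bint_continuous[OF Vc] AE_I2)
  show "integral {0..0} u = 0" by simp
 qed (use UV uV in auto)
 show "0 \<le> r \<Longrightarrow> r \<le> T \<Longrightarrow> integral {0..r} u = j (integral {0..r} v)"
  "0 \<le> r \<Longrightarrow> r \<le> T \<Longrightarrow> u r + A0 (integral {0..r} v) = integral {0..r} f"
  using UV uV unfolding V_def by auto
qed

text \<open>Here v is merely integrable. The time integral of the solution has a continuous
  X_1-valued representative V, so it vanishes by the L_p case; injectivity of j gives V = 0, and the
  integrated equation u + A0 V = 0 gives u = 0.\<close>

lemma lsol_zero_unique: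
 assumes s: "lsol T (\<lambda>t. 0) g v u" and t: "0 \<le> t" "t \<le> T"
 shows "u t = 0"
proof -
 define U where "U r = integral {0..r} u" for r
 define V where "V r = integral {0..r} v" for r
 note uc = prim_continuous_on[OF lsolD(1)[OF s]]
 have b0: "bint {0..T} (\<lambda>t. 0 :: 'a)" by (simp add: bint_def integrable_0)
 have sU: "lsol T (\<lambda>t. 0) u V U" unfolding U_def V_def using lsol_integral(1)[OF s b0] by simp
 have UV: "U r = j (V r)" "u r + A0 (V r) = 0" if r: "0 \<le> r" "r \<le> T" for r
  unfolding U_def V_def using lsol_integral(2,3)[OF s b0 r] by simp_all
 have Vc: "continuous_on {0..T} V"
  unfolding V_def using prim_continuous_on[OF prim_integral[OF lsolD(3)[OF s], of 0]] by simp
 have z0: "u r = 0" if r: "0 \<le> r" "r < T" for r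
 proof -
  have "U r = 0" by (rule lsol_zero_unique_Lp[OF sU continuous_Lp[OF p1 Vc] r])
  then have "j (V r) = j 0" using UV(1)[of r] r linear_0[OF bounded_linear.linear[OF j(1)]] by simp
  then have "V r = 0" by (rule injD[OF j(2)])
  then show ?thesis using UV(2)[of r] r linear_0[OF bounded_linear.linear[OF A0]] by simp
 qed
 show ?thesis
 proof (cases "t = T \<and> T > 0")
  case True
  have "(\<lambda>s. u (T - s)) 0 = 0"
  proof (rule continuous_constant_at_0[of T])
   show "continuous_on {0..T} (\<lambda>s. u (T - s))"
    by (rule continuous_on_compose2[OF uc]) (auto intro!: continuous_intros)
  qed (use True z0 in auto)
  then show ?thesis using True by simp
 next
  case False
  then show ?thesis using z0[of t] t lsolD(2)[OF s] by (cases "t < T") auto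
 qed
qed

lemma lsol_unique:
 assumes s: "lsol T f g v u" and s': "lsol T f g' v' u'"
 shows "0 \<le> t \<Longrightarrow> t \<le> T \<Longrightarrow> u t = u' t" "AE t in lebesgue_on {0..T}. v t = v' t"
proof -
 have d: "lsol T (\<lambda>t. 0) (\<lambda>t. g t + (-1) *\<^sub>R g' t) (\<lambda>t. v t + (-1) *\<^sub>R v' t) (\<lambda>t. u t + (-1) *\<^sub>R u' t)"
  using lsol_lincomb[OF s s', of "-1"] by simp
 have eq: "u t = u' t" if "0 \<le> t" "t \<le> T" for t
  using lsol_zero_unique[OF d that] by simp
 then show "0 \<le> t \<Longrightarrow> t \<le> T \<Longrightarrow> u t = u' t" .
 show "AE t in lebesgue_on {0..T}. v t = v' t"
  using lsolD(4)[OF s] lsolD(4)[OF s'] AE_space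
 proof eventually_elim
  case (elim t)
  then have "j (v t) = j (v' t)" using eq[of t] by simp
  then show ?case by (rule injD[OF j(2)])
 qed
qed

lemma gsol_zero: "gsol (\<lambda>t. 0) (\<lambda>t. 0) (\<lambda>t. 0) (\<lambda>t. 0)"
 unfolding gsol_def by (simp add: lsol_zero wLp_zero[OF p1])

abbreviation "N \<equiv> wLp_norm {0<..} p 1"

text \<open>The closed graph theorem for the solution operator is replaced by a gliding hump: if the
 operator were unbounded, translates of bad right-hand sides could be superposed.\<close>

lemma mr_bound: "\<exists>C>0. \<forall>f g v u. f \<in> Lp {0<..} p \<longrightarrow> gsol f g v u \<longrightarrow> N v \<le> C * N f"
proof (rule ccontr)
 assume neg: "\<not> ?thesis"
 define M where "M F = N (SOME v. \<exists>g u. gsol F g v u)" for F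
 have M: "\<exists>g v u. gsol F g v u \<and> N v = M F" if "F \<in> Lp {0<..} p" for F
 proof -
  have "\<exists>v g u. gsol F g v u" using gsol_exists[OF that] by blast
  from someI_ex[OF this] show ?thesis unfolding M_def by blast
 qed
 have hump: "\<exists>f T. f \<in> Lp {0<..} p \<and> N f \<le> \<delta> \<and> T \<ge> 1 \<and> (\<forall>t\<ge>T. f t = 0) \<and>
   (\<forall>g v u. gsol f g v u \<longrightarrow> K < nT T v)" if K: "K \<ge> 0" and \<delta>: "\<delta> > 0" for K \<delta>
 proof -
  have "(K+1)/\<delta> > 0" using K \<delta> by simp
  with neg obtain f0 g0 v0 u0 where f0: "f0 \<in> Lp {0<..} p" and s0: "gsol f0 g0 v0 u0"
   and lt: "N v0 > (K+1)/\<delta> * N f0" by (meson not_le)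
  have N0: "N f0 > 0"
  proof (rule ccontr)
   assume "\<not> 0 < N f0"
   then have "N f0 = 0" using wLp_norm_nonneg[of "{0<..}" p 1 f0] by linarith
   then have "AE t in lebesgue_on {0<..}. f0 t = 0" by (intro wLp_norm_zero_AE[OF p1 _ _ f0]) auto
   from gsol_cong[OF s0 this] have s: "gsol (\<lambda>t. 0) g0 v0 u0" .
   have "AE t in lebesgue_on {0<..}. v0 t = 0"
    by (rule AE_Ioi_if_Icc) (rule lsol_unique(2)[OF gsolD(1)[OF s] lsol_zero])
   then have "AE t in lebesgue_on {0<..}. 0 = v0 t" by eventually_elim simp
   from wLp_cong_AE(2)[OF p1 _ wLp_zero(1)[OF p1] this] have "N v0 = 0" by (simp add: wLp_zero[OF p1])
   then show False using lt \<open>N f0 = 0\<close> by simp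
  qed
  define c where "c = \<delta> / N f0"
  have c: "c > 0" using \<delta> N0 by (simp add: c_def)
  define f1 where "f1 t = c *\<^sub>R f0 t" for t
  define v1 where "v1 t = c *\<^sub>R v0 t" for t
  have s1: "gsol f1 (\<lambda>t. c *\<^sub>R g0 t) v1 (\<lambda>t. c *\<^sub>R u0 t)"
   using gsol_lincomb[OF gsol_zero s0, of c] by (simp add: f1_def[abs_def] v1_def[abs_def])
  have f1: "f1 \<in> Lp {0<..} p" unfolding f1_def by (rule wLp_scale(1)[OF p1 _ f0]) simp
  have Nf1: "N f1 = \<delta>" unfolding f1_def using wLp_norm_scale_eq[OF p1 _ f0, of c] N0 c \<delta> by (simp add: c_def)
  have "N v1 = c * N v0" unfolding v1_def using wLp_norm_scale_eq[OF p1 _ gsolD(3)[OF s0], of c] c by simp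
  moreover have "c * N v0 > c * ((K+1)/\<delta> * N f0)" by (rule mult_strict_left_mono[OF lt c])
  moreover have "c * ((K+1)/\<delta> * N f0) = K + 1" using N0 \<delta> by (simp add: c_def)
  ultimately have "K < N v1" by linarith
  then obtain T where T: "T \<ge> 1" "K < nT T v1"
   by (rule wLp_norm_exhaust[OF p1 gsolD(3)[OF s1]])
  \<comment> \<open>Cutting off the right-hand side at T leaves the solution on [0,T] unchanged,
    where its norm already exceeds K; a right-hand side of bounded support leaves room for later
    humps.\<close>
  define f2 where "f2 t = (if t \<in> {0<..<T} then f1 t else 0)" for t
  have sub: "{0<..<T} \<subseteq> {0<..}" "{0<..<T} \<in> sets lebesgue" by (auto simp: Ioo_subset_Ioi)
  have f2: "f2 \<in> Lp {0<..} p"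
   unfolding f2_def wLp_restrict(1)[OF p1 sub Ioi_sets] by (rule wLp_subset(1)[OF p1 sub Ioi_sets f1])
  have Nf2: "N f2 \<le> \<delta>"
   unfolding f2_def wLp_restrict(2)[OF p1 sub Ioi_sets]
   using wLp_subset(2)[OF p1 sub Ioi_sets f1] Nf1 by simp
  have "K < nT T v" if s: "gsol f2 g v u" for g v u
  proof -
   have "AE t in lebesgue_on {0..T}. f2 t = f1 t"
    unfolding AE_interior by (intro AE_I2) (simp add: f2_def)
   from lsol_unique(2)[OF gsolD(1)[OF s1] lsol_cong[OF gsolD(1)[OF s] this]]
   have "AE t in lebesgue_on {0<..<T}. v1 t = v t" unfolding AE_interior .
   from wLp_cong_AE(2)[OF p1 sub(2) wLp_subset(1)[OF p1 sub Ioi_sets gsolD(3)[OF s1]] this]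
   show ?thesis using T(2) by simp
  qed
  then show ?thesis using f2 Nf2 T(1) by (intro exI[of _ f2] exI[of _ T]) (auto simp: f2_def)
 qed
 \<comment> \<open>The state is the superposition so far together with the time at which the next
   hump starts. \<open>Q\<close> demands that the n-th hump beat the solution for its predecessors
   by n, on its own window.\<close>
 define P where "P n x \<longleftrightarrow> fst x \<in> Lp {0<..} p \<and> snd x \<ge> real n" for n and x :: "(real \<Rightarrow> 'a) \<times> real"
 define Q where "Q n x y \<longleftrightarrow> (\<exists>f T. y = (\<lambda>t. fst x t + shift (snd x) f t, snd x + T) \<and> f \<in> Lp {0<..} p \<and>
   N f \<le> (1/2)^n \<and> T \<ge> 1 \<and> (\<forall>g v u. gsol f g v u \<longrightarrow> real n + M (fst x) < nT T v))"
  for n and x y :: "(real \<Rightarrow> 'a) \<times> real"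
 have "\<exists>F. \<forall>n. P n (F n) \<and> Q n (F n) (F (Suc n))"
 proof (rule dependent_nat_choice)
  show "\<exists>x. P 0 x" by (rule exI[of _ "(\<lambda>t. 0, 0)"]) (simp add: P_def wLp_zero[OF p1])
  fix x n assume x: "P n x"
  have "real n + M (fst x) \<ge> 0" by (simp add: M_def)
  then obtain f T where f: "f \<in> Lp {0<..} p" "N f \<le> (1/2)^n" "T \<ge> 1"
   "\<forall>g v u. gsol f g v u \<longrightarrow> real n + M (fst x) < nT T v"
   using hump[of "real n + M (fst x)" "(1/2)^n"] by auto
  have x0: "snd x \<ge> 0" using x by (simp add: P_def)
  have "P (Suc n) (\<lambda>t. fst x t + shift (snd x) f t, snd x + T)"
   using x f(3) wLp_add(1)[OF p1 Ioi_sets _ shift_wLp(1)[OF p1 x0 f(1)]] by (simp add: P_def)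
  then show "\<exists>y. P (Suc n) y \<and> Q n x y" unfolding Q_def using f by blast
 qed
 then obtain X where X: "\<And>n. P n (X n)" "\<And>n. Q n (X n) (X (Suc n))" by blast
 define F where "F n = fst (X n)" for n
 define \<tau> where "\<tau> n = snd (X n)" for n
 have F: "F n \<in> Lp {0<..} p" and \<tau>: "\<tau> n \<ge> real n" for n using X(1)[of n] by (auto simp: P_def F_def \<tau>_def)
 define R where "R n f T \<longleftrightarrow> F (Suc n) = (\<lambda>t. F n t + shift (\<tau> n) f t) \<and> \<tau> (Suc n) = \<tau> n + T \<and> f \<in> Lp {0<..} p \<and>
   N f \<le> (1/2)^n \<and> T \<ge> 1 \<and> (\<forall>g v u. gsol f g v u \<longrightarrow> real n + M (F n) < nT T v)" for n f T
 have "\<exists>f T. R n f T" for n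
 proof -
  obtain f T where "X (Suc n) = (\<lambda>t. F n t + shift (\<tau> n) f t, \<tau> n + T)" and r: "f \<in> Lp {0<..} p"
   "N f \<le> (1/2)^n" "T \<ge> 1" "\<forall>g v u. gsol f g v u \<longrightarrow> real n + M (F n) < nT T v"
   using X(2)[of n] unfolding Q_def F_def \<tau>_def by (elim exE conjE)
  then have "F (Suc n) = (\<lambda>t. F n t + shift (\<tau> n) f t)" "\<tau> (Suc n) = \<tau> n + T" by (simp_all add: F_def \<tau>_def)
  with r show ?thesis unfolding R_def by (intro exI conjI)
 qed
 then have "\<exists>f. \<forall>n. \<exists>T. R n (f n) T" by (intro choice allI)
 then obtain f where "\<forall>n. \<exists>T. R n (f n) T" ..
 then have "\<exists>T. \<forall>n. R n (f n) (T n)" by (rule choice)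
 then obtain T where "\<forall>n. R n (f n) (T n)" ..
 then have "R n (f n) (T n)" for n by blast
 note Rn = this[unfolded R_def]
 have fT: "\<And>n. F (Suc n) = (\<lambda>t. F n t + shift (\<tau> n) (f n) t)" "\<And>n. \<tau> (Suc n) = \<tau> n + T n"
  "\<And>n. f n \<in> Lp {0<..} p" "\<And>n. N (f n) \<le> (1/2)^n" "\<And>n. T n \<ge> (1::real)"
  "\<And>n g v u. gsol (f n) g v u \<Longrightarrow> real n + M (F n) < wLp_norm {0<..<T n} p 1 v"
  using Rn by (fast, fast, fast, fast, fast, fast)
 have \<tau>0: "\<tau> n \<ge> 0" for n using \<tau>[of n] by linarith
 have \<tau>m: "\<tau> n \<le> \<tau> (n + k)" for n k
 proof (induction k)
  case (Suc k) then show ?case using fT(2)[of "n+k"] fT(5)[of "n+k"] by simp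
 qed simp
 obtain w where w: "w \<in> Lp {0<..} p" "AE t in lebesgue_on {0<..}. (\<lambda>n. F n t) \<longlonglongrightarrow> w t"
 proof (rule wLp_complete[OF p1 Ioi_sets order_refl F, of 1])
  show "N (\<lambda>t. F (Suc n) t - F n t) \<le> 1 * (1/2)^n" for n
   using fT(4)[of n] shift_wLp(2)[OF p1 \<tau>0 fT(3), of n n] unfolding fT(1) by simp
 qed auto
 obtain g v u where s: "gsol w g v u" using gsol_exists[OF w(1)] by blast
 obtain n where n: "N v < real n" using reals_Archimedean2 by blast
 obtain gn vn un where sn: "gsol (F n) gn vn un" "N vn = M (F n)" using M[OF F] by blast
 obtain gf vf uf where sf: "gsol (f n) gf vf uf" using gsol_exists[OF fT(3)] by blast
 have s': "gsol (F (Suc n)) (\<lambda>t. gn t + 1 *\<^sub>R shift (\<tau> n) gf t) (\<lambda>t. vn t + 1 *\<^sub>R shift (\<tau> n) vf t) (\<lambda>t. un t + 1 *\<^sub>R shift (\<tau> n) uf t)"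
  using gsol_lincomb[OF sn(1) gsol_shift[OF sf \<tau>0], of 1 n] unfolding fT(1)[of n] by simp
 \<comment> \<open>Later humps start after \<open>\<tau> (Suc n)\<close>, so up to that time the
   limit w is a finite superposition.\<close>
 have eqF: "F (Suc n + k) t = F (Suc n) t" if "t \<le> \<tau> (Suc n)" for k t
 proof (induction k)
  case (Suc k)
  have "t \<le> \<tau> (Suc n + k)" using that \<tau>m[of "Suc n" k] by simp
  then have "shift (\<tau> (Suc n + k)) (f (Suc n + k)) t = 0" by (simp add: shift_def)
  then show ?case using Suc fT(1)[of "Suc n + k"] by simp
 qed simp
 have "AE t in lebesgue_on {0..\<tau> (Suc n)}. F (Suc n) t = w t"
  using AE_Icc_if_Ioi[OF w(2), of "\<tau> (Suc n)"] AE_space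
 proof eventually_elim
  case (elim t)
  then have t: "t \<le> \<tau> (Suc n)" by simp
  have "eventually (\<lambda>m. F (Suc n) t = F m t) sequentially"
  proof (rule eventually_sequentiallyI[of "Suc n"])
   fix m assume "Suc n \<le> m"
   then show "F (Suc n) t = F m t" using eqF[OF t, of "m - Suc n"] by simp
  qed
  then have "(\<lambda>m. F m t) \<longlonglongrightarrow> F (Suc n) t" by (intro tendsto_eventually) (auto elim: eventually_mono)
  then show ?case using elim(1) LIMSEQ_unique by blast
 qed
 from lsol_unique(2)[OF gsolD(1)[OF s] lsol_cong[OF gsolD(1)[OF s'] this]]
 have ae: "AE t in lebesgue_on {0..\<tau> (Suc n)}. v t = vn t + shift (\<tau> n) vf t" by simp
 \<comment> \<open>On the window of hump n its solution is v - vn, hence of norm at most N v + M (F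
   n). By construction the norm exceeds n + M (F n), although n > N v.\<close>
 let ?J = "{\<tau> n<..<\<tau> n + T n}"
 have J: "?J \<subseteq> {0<..}" "?J \<in> sets lebesgue" using \<tau>0 by (auto simp: Ioo_subset_Ioi)
 have "AE t in lebesgue_on ?J. v t = vn t + shift (\<tau> n) vf t"
  by (rule AE_lebesgue_on_subset[OF _ J(2) _ ae]) (use \<tau>0[of n] fT(2)[of n] in auto)
 then have "AE t in lebesgue_on ?J. v t - vn t = shift (\<tau> n) vf t" by eventually_elim simp
 from wLp_cong_AE(2)[OF p1 J(2) wLp_diff(1)[OF p1 J(2) wLp_subset(1)[OF p1 J Ioi_sets gsolD(3)[OF s]]
    wLp_subset(1)[OF p1 J Ioi_sets gsolD(3)[OF sn(1)]]] this]
 have "wLp_norm {0<..<T n} p 1 vf = wLp_norm ?J p 1 (\<lambda>t. v t - vn t)"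
  using shift_wLp(3)[OF p1 \<tau>0 gsolD(3)[OF sf], of n "T n"] by simp
 also have "\<dots> \<le> wLp_norm ?J p 1 v + wLp_norm ?J p 1 vn"
  by (rule wLp_diff(2)[OF p1 J(2) wLp_subset(1)[OF p1 J Ioi_sets gsolD(3)[OF s]]
    wLp_subset(1)[OF p1 J Ioi_sets gsolD(3)[OF sn(1)]]])
 also have "\<dots> \<le> N v + N vn"
  using wLp_subset(2)[OF p1 J Ioi_sets gsolD(3)[OF s]] wLp_subset(2)[OF p1 J Ioi_sets gsolD(3)[OF sn(1)]] by simp
 finally show False using fT(6)[OF sf] n sn(2) by simp
qed

end

lemma wLp_norm_indicator:
 fixes x :: "'x::real_normed_vector"
 assumes p: "p \<ge> 1" and E: "E \<in> lmeasurable" "E \<subseteq> J" and J: "J \<subseteq> {0<..}" "J \<in> sets lebesgue"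
 shows "(\<lambda>t. indicator E t *\<^sub>R x) \<in> Lp J p"
  "wLp_norm J p 1 (\<lambda>t. indicator E t *\<^sub>R x) = norm x * measure lebesgue E powr (1/p)"
proof -
 have "indicator E \<in> borel_measurable (lebesgue_on J)"
  using E by (auto intro!: measurable_restrict_space1)
 then have sm: "smeas J (\<lambda>t. indicator E t *\<^sub>R x)"
  by (intro sm_scaleR sm_const) (simp add: sm_real_iff[OF J(2)])
 have "wint J p 1 (\<lambda>t. indicator E t *\<^sub>R x) = (\<integral>\<^sup>+t. ennreal (norm x powr p) * indicator E t \<partial>lebesgue)"
  unfolding wint_one[OF J] using E(2) p by (intro nn_integral_cong) (auto simp: indicator_def)
 also have "\<dots> = ennreal (norm x powr p) * emeasure lebesgue E"
  using E(1) by (intro nn_integral_cmult_indicator) auto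
 also have "\<dots> = ennreal (norm x powr p * measure lebesgue E)"
  using E(1) by (simp add: emeasure_eq_measure2 ennreal_mult)
 finally have w: "wint J p 1 (\<lambda>t. indicator E t *\<^sub>R x) = ennreal (norm x powr p * measure lebesgue E)" .
 show "(\<lambda>t. indicator E t *\<^sub>R x) \<in> Lp J p" using sm w by (simp add: wLp_iff)
 show "wLp_norm J p 1 (\<lambda>t. indicator E t *\<^sub>R x) = norm x * measure lebesgue E powr (1/p)"
  unfolding wLp_norm_wint w using p by (simp add: powr_mult powr_powr)
qed

context mr_setting
begin

lemma Lp_extend:
 assumes f: "f \<in> Lp {0<..<T} p"
 shows "(\<lambda>t. if t \<in> {0<..<T} then f t else 0) \<in> Lp {0<..} p"
  "N (\<lambda>t. if t \<in> {0<..<T} then f t else 0) = nT T f"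
 using wLp_restrict[OF p1 Ioo_subset_Ioi[OF order_refl, of T] _ Ioi_sets, where u=f and \<mu>=1] f by auto

lemma Lp_integral_norm_le:
 fixes h :: "real \<Rightarrow> 'x::banach"
 assumes h: "h \<in> Lp {0<..<T} p" and T: "T > 0"
 shows "bint {0..T} h" "integral {0..T} (\<lambda>t. norm (h t)) \<le> T powr (1 - 1/p) * nT T h"
 using wLp_bint[OF p ip1 order_refl T h] by (auto simp: hoelder_const_def)

text \<open>Extending f by zero to the half-line makes the constant independent of T. The derivative
  is bounded through the equation g = f - A0 v.\<close>

lemma lsol_exists_bound:
 "\<exists>C>0. \<forall>T>0. \<forall>f \<in> Lp {0<..<T} p. \<exists>g v u. lsol T f g v u \<and>
   nT T g \<le> C * nT T f \<and> g \<in> Lp {0<..<T} p"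
proof -
 obtain C where C: "C > 0" "\<And>f g v u. f \<in> Lp {0<..} p \<Longrightarrow> gsol f g v u \<Longrightarrow> N v \<le> C * N f" using mr_bound by blast
 obtain K where K: "K \<ge> 0" "\<And>x. norm (A0 x) \<le> K * norm x" by (rule A0_bound) (rule that)
 show ?thesis
 proof (intro exI[of _ "1 + K * C"] conjI allI impI ballI)
  show "0 < 1 + K * C" using C(1) K(1) by (simp add: add_pos_nonneg)
  fix T :: real and f :: "real \<Rightarrow> 'a" assume T: "T > 0" and f: "f \<in> Lp {0<..<T} p"
  let ?f = "\<lambda>t. if t \<in> {0<..<T} then f t else 0"
  obtain g v u where s: "gsol ?f g v u" using gsol_exists[OF Lp_extend(1)[OF f]] by blast
  have "AE t in lebesgue_on {0<..}. ?f t - A0 (v t) = g t"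
   using AE_Ioi_if_Icc[OF lsolD(5)[OF gsolD(1)[OF s]]] by eventually_elim (simp add: algebra_simps)
  from wLp_cong_AE(2)[OF p1 Ioi_sets wLp_diff(1)[OF p1 Ioi_sets Lp_extend(1)[OF f] A0_Lp[OF gsolD(3)[OF s] p1 Ioi_sets]] this]
  have "N g = N (\<lambda>t. ?f t - A0 (v t))" .
  also have "\<dots> \<le> N ?f + N (\<lambda>t. A0 (v t))"
   by (rule wLp_diff(2)[OF p1 Ioi_sets Lp_extend(1)[OF f] A0_Lp[OF gsolD(3)[OF s] p1 Ioi_sets]])
  also have "N (\<lambda>t. A0 (v t)) \<le> K * N v"
   by (rule wLp_linear(2)[OF p1 Ioi_sets gsolD(3)[OF s] A0 K(2,1)])
  also have "K * N v \<le> K * (C * N ?f)" using C(2)[OF Lp_extend(1)[OF f] s] K(1) by (rule mult_left_mono)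
  finally have "N g \<le> (1 + K * C) * N ?f" by (simp add: algebra_simps)
  moreover have "nT T g \<le> N g" "g \<in> Lp {0<..<T} p"
   using wLp_subset[OF p1 Ioo_subset_Ioi[OF order_refl] _ Ioi_sets gsolD(2)[OF s], of T] by auto
  moreover have "lsol T f g v u"
   by (rule lsol_cong[OF gsolD(1)[OF s]]) (unfold AE_interior, rule AE_I2, simp)
  ultimately show "\<exists>g v u. lsol T f g v u \<and> nT T g \<le> (1 + K * C) * nT T f \<and> g \<in> Lp {0<..<T} p"
   unfolding Lp_extend(2)[OF f] by (meson order_trans)
 qed
qed

text \<open>The integrated semigroup \<open>W(t)x\<close>, the solution with constant right-hand side \<open>x\<close>, is Lipschitz
 continuous: applying maximal regularity twice controls \<open>z = S(W')\<close>, and \<open>z(t) = t W'(t)\<close>.\<close>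

lemma constant_rhs_lipschitz:
 "\<exists>M\<ge>0. \<forall>R x g v w s t. lsol R (\<lambda>t. x) g v w \<longrightarrow> 0 \<le> s \<longrightarrow> s \<le> t \<longrightarrow> t \<le> R \<longrightarrow> norm (w t - w s) \<le> M * (t - s) * norm x"
proof -
 obtain C where C: "C > 0" "\<And>T f. T > 0 \<Longrightarrow> f \<in> Lp {0<..<T} p \<Longrightarrow> \<exists>g v u. lsol T f g v u \<and>
   nT T g \<le> C * nT T f \<and> g \<in> Lp {0<..<T} p"
  using lsol_exists_bound by blast
 \<comment> \<open>One factor C for each of the two applications of maximal regularity; the 2 comes
   from t \<le> 2 r on the interval [s,t].\<close>
 define M where "M = 2 * C\<^sup>2"
 have M0: "M \<ge> 0" by (simp add: M_def)
 interpret A0: bounded_linear A0 by (rule A0)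
 interpret j: bounded_linear j by (rule j)
 have near: "norm (w t - w s) \<le> M * (t - s) * norm x"
  if w: "lsol t (\<lambda>t. x) g v w" and st: "0 < s" "s \<le> t" "t \<le> 2 * s" for t s x g v w
 proof -
  have t: "t > 0" using st by simp
  have xL: "(\<lambda>r. x) \<in> Lp {0<..<t} p" by (rule continuous_Lp[OF p1]) simp
  have I: "{0<..<t} \<in> lmeasurable" "measure lebesgue {0<..<t} = t" using t by auto
  have "wLp_norm {0<..<t} p 1 (\<lambda>r. x) = wLp_norm {0<..<t} p 1 (\<lambda>r. indicator {0<..<t} r *\<^sub>R x)"
   by (rule wLp_cong_AE(2)[OF p1 _ wLp_norm_indicator(1)[OF p1 I(1) order_refl Ioo_subset_Ioi[OF order_refl]]]) (auto intro!: AE_I2)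
  also have "\<dots> = norm x * t powr (1/p)"
   using wLp_norm_indicator(2)[OF p1 I(1) order_refl Ioo_subset_Ioi[OF order_refl], of x] I(2) by simp
  finally have xN: "wLp_norm {0<..<t} p 1 (\<lambda>r. x) = norm x * t powr (1/p)" .
  obtain g1 v1 w1 where s1: "lsol t (\<lambda>r. x) g1 v1 w1" "wLp_norm {0<..<t} p 1 g1 \<le> C * (norm x * t powr (1/p))" "g1 \<in> Lp {0<..<t} p"
   using C(2)[OF t xL] unfolding xN by blast
  obtain gz vz z where s2: "lsol t g1 gz vz z" "wLp_norm {0<..<t} p 1 gz \<le> C * wLp_norm {0<..<t} p 1 g1" "gz \<in> Lp {0<..<t} p"
   using C(2)[OF t s1(3)] by blast
  have "C * wLp_norm {0<..<t} p 1 g1 \<le> C * (C * (norm x * t powr (1/p)))" by (rule mult_left_mono[OF s1(2)]) (use C in simp)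
  then have Ngz: "wLp_norm {0<..<t} p 1 gz \<le> C\<^sup>2 * norm x * t powr (1/p)" using s2(2) by (simp add: power2_eq_square mult.assoc)
  note g1b = prim_bint[OF lsolD(1)[OF s1(1)]]
  have w1: "w1 r = integral {0..r} g1" if "0 \<le> r" "r \<le> t" for r
   using prim_eq[OF lsolD(1)[OF s1(1)] that] lsolD(2)[OF s1(1)] by simp
  define Z where "Z r = integral {0..r} z" for r
  have sZ: "lsol t w1 z (\<lambda>r. integral {0..r} vz) Z"
   unfolding Z_def
  proof (rule lsol_cong[OF lsol_integral(1)[OF s2(1) g1b]], rule AE_I2)
   show "integral {0..r} g1 = w1 r" if "r \<in> space (lebesgue_on {0..t})" for r using w1[of r] that by simp
  qed
  \<comment> \<open>Both \<open>Y\<close> and the time integral \<open>Z\<close> of z solve the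
    problem with right-hand side \<open>w1\<close>. Equality of the two and comparison of their
    derivatives yield z = r g1 almost everywhere, without differentiating g1.\<close>
  define Y where "Y r = r *\<^sub>R w1 r - integral {0..r} w1" for r
  have xb: "bint {0..t} (\<lambda>r. x)" by (rule bint_continuous) simp
  note i1 = lsol_integral[OF s1(1) xb]
  have sY: "lsol t w1 (\<lambda>r. r *\<^sub>R g1 r) (\<lambda>r. r *\<^sub>R v1 r - integral {0..r} v1) Y"
   unfolding lsol_def
  proof (intro conjI)
   have "prim 0 t (\<lambda>r. 1 *\<^sub>R w1 r + r *\<^sub>R g1 r) (\<lambda>r. r *\<^sub>R w1 r)"
    by (rule prim_mult[OF lsolD(1)[OF s1(1)]]) (use t in \<open>auto intro!: derivative_eq_intros\<close>)
   from prim_diff[OF this lsolD(1)[OF i1(1)]]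
   show "prim 0 t (\<lambda>r. r *\<^sub>R g1 r) Y" by (simp add: Y_def[abs_def])
   show "Y 0 = 0" by (simp add: Y_def)
   show "bint {0..t} (\<lambda>r. r *\<^sub>R v1 r - integral {0..r} v1)"
   proof (rule bint_diff)
    show "bint {0..t} (\<lambda>r. r *\<^sub>R v1 r)"
     by (rule bint_bounded_mult[OF _ sm_continuous_on _ lsolD(3)[OF s1(1)], of _ t]) (auto intro!: continuous_intros)
    show "bint {0..t} (\<lambda>r. integral {0..r} v1)" by (rule lsolD(3)[OF i1(1)])
   qed simp
   show "AE r in lebesgue_on {0..t}. Y r = j (r *\<^sub>R v1 r - integral {0..r} v1)"
    using lsolD(4)[OF s1(1)] AE_space
   proof eventually_elim
    case (elim r)
    then show ?case using i1(2)[of r] by (simp add: Y_def j.diff j.scaleR)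
   qed
   show "AE r in lebesgue_on {0..t}. r *\<^sub>R g1 r + A0 (r *\<^sub>R v1 r - integral {0..r} v1) = w1 r"
    using lsolD(5)[OF s1(1)] AE_space
   proof eventually_elim
    case (elim r)
    have "w1 r + A0 (integral {0..r} v1) = r *\<^sub>R x" using i1(3)[of r] elim(2) by simp
    moreover have "r *\<^sub>R g1 r + r *\<^sub>R A0 (v1 r) = r *\<^sub>R x" using elim(1) by (metis scaleR_add_right)
    ultimately have "r *\<^sub>R g1 r + r *\<^sub>R A0 (v1 r) - A0 (integral {0..r} v1) = w1 r" by (simp add: algebra_simps)
    then show ?case by (simp add: A0.diff A0.scaleR add_diff_eq)
   qed
  qed
  have zg: "AE r in lebesgue_on {0..t}. z r = r *\<^sub>R g1 r"
   by (rule prim_unique[OF lsolD(1)[OF sZ] lsolD(1)[OF sY]]) (use lsol_unique(1)[OF sZ sY] in auto)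
  \<comment> \<open>Since z(0) = 0, Hoelder's inequality turns the L_p bound on z' into a pointwise
    bound on z; division by r then bounds g1 as long as r is comparable to t.\<close>
  have zb: "norm (z r) \<le> r powr (1 - 1/p) * (C\<^sup>2 * norm x * t powr (1/p))" if r: "0 < r" "r \<le> t" for r
  proof -
   have sub: "{0<..<r} \<subseteq> {0<..<t}" using r by auto
   have gr: "gz \<in> Lp {0<..<r} p" "wLp_norm {0<..<r} p 1 gz \<le> wLp_norm {0<..<t} p 1 gz"
    using wLp_subset[OF p1 sub _ _ s2(3)] by auto
   have "norm (z r) \<le> integral {0..r} (\<lambda>q. norm (gz q))"
    using prim_norm_diff_le[OF lsolD(1)[OF s2(1)], of 0 r] lsolD(2)[OF s2(1)] r by simp
   also have "\<dots> \<le> r powr (1 - 1/p) * wLp_norm {0<..<r} p 1 gz" by (rule Lp_integral_norm_le(2)[OF gr(1) r(1)])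
   also have "\<dots> \<le> r powr (1 - 1/p) * (C\<^sup>2 * norm x * t powr (1/p))"
    using gr(2) Ngz by (intro mult_left_mono) auto
   finally show ?thesis .
  qed
  have gb: "norm (g1 r) \<le> M * norm x" if r: "s \<le> r" "r \<le> t" "z r = r *\<^sub>R g1 r" for r
  proof -
   have r0: "r > 0" using r st by simp
   have "t powr (1/p) \<le> (2 * r) powr (1/p)" using r st p by (intro powr_mono2) auto
   also have "\<dots> = 2 powr (1/p) * r powr (1/p)" using r0 by (simp add: powr_mult)
   also have "\<dots> \<le> 2 powr 1 * r powr (1/p)" using p by (intro mult_right_mono powr_mono) auto
   finally have tr: "t powr (1/p) \<le> 2 * r powr (1/p)" by simp
   have "r * norm (g1 r) = norm (z r)" using r(3) r0 by simp
   also have "\<dots> \<le> r powr (1 - 1/p) * (C\<^sup>2 * norm x * t powr (1/p))" by (rule zb[OF r0 r(2)])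
   also have "\<dots> \<le> r powr (1 - 1/p) * (C\<^sup>2 * norm x * (2 * r powr (1/p)))"
    using tr by (intro mult_left_mono) auto
   also have "\<dots> = r * (M * norm x)" using r0 by (simp add: M_def powr_diff)
   finally have "r * norm (g1 r) \<le> r * (M * norm x)" .
   then show ?thesis using r0 by simp
  qed
  have sub: "{s..t} \<subseteq> {0..t}" using st by auto
  have g1s: "bint {s..t} g1" by (rule bint_sub[OF g1b sub]) auto
  have zg': "AE r in lebesgue_on {s..t}. z r = r *\<^sub>R g1 r" by (rule AE_lebesgue_on_subset[OF _ _ sub zg]) auto
  have ae: "AE r in lebesgue_on {s..t}. norm (g1 r) = min (norm (g1 r)) (M * norm x)"
   using zg' AE_space
  proof eventually_elim
   case (elim r)
   then show ?case using gb[of r] by (simp add: min_def)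
  qed
  have "norm (w1 t - w1 s) \<le> integral {s..t} (\<lambda>r. norm (g1 r))"
   by (rule prim_norm_diff_le[OF lsolD(1)[OF s1(1)]]) (use st in auto)
  also have "\<dots> = integral {s..t} (\<lambda>r. min (norm (g1 r)) (M * norm x))" by (rule integral_AE_eq[OF _ ae]) simp
  also have "\<dots> \<le> integral {s..t} (\<lambda>r. M * norm x)"
  proof (rule integral_le)
   have "bint {s..t} (\<lambda>r. min (norm (g1 r)) (M * norm x))"
    by (rule bint_cong_AE[OF _ _ ae]) (use g1s in \<open>auto simp: bint_def sm_norm\<close>)
   then show "(\<lambda>r. min (norm (g1 r)) (M * norm x)) integrable_on {s..t}" by (intro bint_integrable) auto
  qed auto
  also have "\<dots> = M * (t - s) * norm x" using st by simp
  finally have "norm (w1 t - w1 s) \<le> M * (t - s) * norm x" .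
  moreover have "w1 t = w t" "w1 s = w s" using lsol_unique(1)[OF s1(1) w] st by auto
  ultimately show ?thesis by simp
 qed
 have pos: "norm (w t - w s) \<le> M * (t - s) * norm x"
  if w: "lsol R (\<lambda>t. x) g v w" and st: "0 < s" "s \<le> t" "t \<le> R" for R t s x g v w
 proof -
  \<comment> \<open>The estimate is known when t \<le> 2 s. For a larger ratio t is halved
    repeatedly; the bound is additive over adjacent intervals, so no constant accumulates.\<close>
  obtain n where n: "t \<le> 2 ^ n * s"
  proof -
   obtain n where "t / s < 2 ^ n" using real_arch_pow[of 2 "t/s"] by auto
   then show ?thesis using st by (intro that[of n]) (simp add: field_simps)
  qed
  have "s \<le> t \<Longrightarrow> t \<le> R \<Longrightarrow> t \<le> 2 ^ n * s \<Longrightarrow> norm (w t - w s) \<le> M * (t - s) * norm x" for t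
  proof (induction n arbitrary: t)
   case 0
   then have "t = s" by simp
   then show ?case by simp
  next
   case (Suc n)
   show ?case
   proof (cases "t \<le> 2 * s")
    case True
    show ?thesis by (rule near[OF lsol_mono[OF w Suc.prems(2)] st(1) Suc.prems(1) True])
   next
    case False
    have 1: "norm (w (t/2) - w s) \<le> M * (t/2 - s) * norm x" by (rule Suc.IH) (use Suc.prems False st in auto)
    have 2: "norm (w t - w (t/2)) \<le> M * (t - t/2) * norm x"
     by (rule near[OF lsol_mono[OF w Suc.prems(2)]]) (use False st in auto)
    have "norm (w t - w s) \<le> norm (w t - w (t/2)) + norm (w (t/2) - w s)"
     using norm_triangle_ineq[of "w t - w (t/2)" "w (t/2) - w s"] by simp
    also have "\<dots> \<le> M * (t - t/2) * norm x + M * (t/2 - s) * norm x" using 1 2 by simp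
    also have "\<dots> = M * (t - s) * norm x" by (simp add: algebra_simps)
    finally show ?thesis .
   qed
  qed
  from this[OF st(2,3) n] show ?thesis .
 qed
 show ?thesis
 proof (intro exI[of _ M] conjI allI impI M0)
  fix R x g v w s t assume w: "lsol R (\<lambda>t. x) g v w" and st: "0 \<le> s" "s \<le> t" "t \<le> R"
  show "norm (w t - w s) \<le> M * (t - s) * norm x"
  proof (cases "s = 0 \<and> t > 0")
   case False
   then show ?thesis using pos[OF w _ st(2,3)] st by (cases "s = 0") auto
  next
   case True
   then have t: "t > 0" and s: "s = 0" by auto
   have lim: "(\<lambda>n. t / real (Suc n)) \<longlonglongrightarrow> 0" by (rule lim_const_over_n[THEN LIMSEQ_Suc])
   have mem: "0 < t / real (Suc n)" "t / real (Suc n) \<le> t" for n using t by (auto simp: field_simps)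
   have "(\<lambda>n. w (t / real (Suc n))) \<longlonglongrightarrow> w 0"
    by (rule continuous_on_tendsto_compose[OF prim_continuous_on[OF lsolD(1)[OF w]] lim])
     (use t st mem order_trans[OF mem(2) st(3)] in \<open>auto simp: less_imp_le\<close>)
   then have "(\<lambda>n. norm (w t - w (t / real (Suc n)))) \<longlonglongrightarrow> norm (w t - w 0)" by (intro tendsto_intros)
   moreover have "norm (w t - w (t / real (Suc n))) \<le> M * (t - 0) * norm x" for n
   proof -
    have "norm (w t - w (t / real (Suc n))) \<le> M * (t - t / real (Suc n)) * norm x" by (rule pos[OF w mem st(3)])
    also have "\<dots> \<le> M * (t - 0) * norm x" using M0 mem(1)[of n] by (intro mult_right_mono mult_left_mono) auto
    finally show ?thesis .
   qed
   ultimately show ?thesis unfolding s by (intro LIMSEQ_le_const2) auto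
  qed
 qed
qed

lemma lsol_sum:
 assumes "finite F" "\<And>k. k \<in> F \<Longrightarrow> lsol T (f k) (g k) (v k) (u k)"
 shows "lsol T (\<lambda>t. \<Sum>k\<in>F. f k t) (\<lambda>t. \<Sum>k\<in>F. g k t) (\<lambda>t. \<Sum>k\<in>F. v k t) (\<lambda>t. \<Sum>k\<in>F. u k t)"
 using assms
proof (induction F rule: finite_induct)
 case empty then show ?case by (simp add: lsol_zero)
next
 case (insert k F)
 have "lsol T (\<lambda>t. (\<Sum>k\<in>F. f k t) + 1 *\<^sub>R f k t) (\<lambda>t. (\<Sum>k\<in>F. g k t) + 1 *\<^sub>R g k t) (\<lambda>t. (\<Sum>k\<in>F. v k t) + 1 *\<^sub>R v k t) (\<lambda>t. (\<Sum>k\<in>F. u k t) + 1 *\<^sub>R u k t)"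
  by (rule lsol_lincomb[OF insert.IH insert.prems]) (use insert.prems in auto)
 then show ?case using insert.hyps by (simp add: add.commute)
qed

text \<open>For the indicator of an interval, times a vector, the solution is an increment of \<open>W\<close>; superposition
 and approximation turn the Lipschitz bound into an \<open>L\<^sub>1\<close> bound for all right-hand sides.\<close>

lemma solution_L1_bound:
 "\<exists>M\<ge>0. \<forall>T>0. \<forall>f g v u. f \<in> Lp {0<..<T} p \<longrightarrow> lsol T f g v u \<longrightarrow> norm (u T) \<le> M * integral {0..T} (\<lambda>t. norm (f t))"
proof -
 obtain M where M: "M \<ge> 0" "\<And>R x g v w s t. lsol R (\<lambda>t. x) g v w \<Longrightarrow> 0 \<le> s \<Longrightarrow> s \<le> t \<Longrightarrow> t \<le> R \<Longrightarrow>
   norm (w t - w s) \<le> M * (t - s) * norm x"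
  using constant_rhs_lipschitz by blast
 obtain C where C: "C > 0" "\<And>T f. T > 0 \<Longrightarrow> f \<in> Lp {0<..<T} p \<Longrightarrow> \<exists>g v u. lsol T f g v u \<and>
   nT T g \<le> C * nT T f \<and> g \<in> Lp {0<..<T} p"
  using lsol_exists_bound by blast
 have main: "norm (u T) \<le> M * integral {0..T} (\<lambda>t. norm (f t))"
  if T: "T > 0" and f: "f \<in> Lp {0<..<T} p" and s: "lsol T f g v u" for T f g v u
 proof -
  define D where "D = T powr (1 - 1/p) * C"
  have D: "D > 0" using T C by (simp add: D_def)
  \<comment> \<open>A crude L_p bound with a constant depending on T. It only controls errors that
    tend to zero and does not enter the final constant.\<close>
  have small: "norm (u T) \<le> D * nT T f" if f: "f \<in> Lp {0<..<T} p" and s: "lsol T f g v u" for f g v u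
  proof -
   obtain g' v' u' where s': "lsol T f g' v' u'" "nT T g' \<le> C * nT T f" "g' \<in> Lp {0<..<T} p"
    using C(2)[OF T f] by blast
   have "norm (u T) = norm (u' T)" using lsol_unique(1)[OF s s'(1), of T] T by simp
   also have "\<dots> \<le> integral {0..T} (\<lambda>t. norm (g' t))"
    using prim_norm_diff_le[OF lsolD(1)[OF s'(1)], of 0 T] lsolD(2)[OF s'(1)] T by simp
   also have "\<dots> \<le> T powr (1 - 1/p) * nT T g'" by (rule Lp_integral_norm_le(2)[OF s'(3) T])
   also have "\<dots> \<le> T powr (1 - 1/p) * (C * nT T f)" by (rule mult_left_mono[OF s'(2)]) simp
   finally show ?thesis by (simp add: D_def mult.assoc)
  qed
  have ex: "\<exists>g v u. lsol T f g v u" if "f \<in> Lp {0<..<T} p" for f using C(2)[OF T that] by blast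
  have J: "{0<..<T} \<subseteq> {0<..}" "{0<..<T} \<in> sets lebesgue" by (auto simp: Ioo_subset_Ioi)
  have ivl: "\<exists>g v u. lsol T (\<lambda>t. indicator {c..d} t *\<^sub>R x) g v u \<and> norm (u T) \<le> M * (d - c) * norm x"
   if cd: "0 \<le> c" "c \<le> d" "d \<le> T" for c d x
  proof -
   have xL: "(\<lambda>r. x) \<in> Lp {0<..<T} p" by (rule continuous_Lp[OF p1]) simp
   obtain g v w where w: "lsol T (\<lambda>r. x) g v w" using ex[OF xL] by blast
   have c: "lsol T (shift c (\<lambda>r. x)) (shift c g) (shift c v) (shift c w)" by (rule lsol_shift[OF w]) (use cd in auto)
   have d: "lsol T (shift d (\<lambda>r. x)) (shift d g) (shift d v) (shift d w)" by (rule lsol_shift[OF w]) (use cd in auto)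
   have "AE t in lebesgue_on {0..T}. shift c (\<lambda>r. x) t + (-1) *\<^sub>R shift d (\<lambda>r. x) t = indicator {c..d} t *\<^sub>R x"
   proof (subst AE_lebesgue_on_negligible)
    show "negligible {t \<in> {0..T}. shift c (\<lambda>r. x) t + (-1) *\<^sub>R shift d (\<lambda>r. x) t \<noteq> indicator {c..d} t *\<^sub>R x}"
     by (rule negligible_subset[of "{c}"]) (use cd in \<open>auto simp: shift_def indicator_def split: if_splits\<close>)
   qed simp
   from lsol_cong[OF lsol_lincomb[OF c d, of "-1"] this]
   have s: "lsol T (\<lambda>t. indicator {c..d} t *\<^sub>R x) (\<lambda>t. shift c g t + (-1) *\<^sub>R shift d g t)
     (\<lambda>t. shift c v t + (-1) *\<^sub>R shift d v t) (\<lambda>t. shift c w t + (-1) *\<^sub>R shift d w t)" .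
   have "shift a w T = w (T - a)" if "a \<le> T" for a
    using that lsolD(2)[OF w] by (cases "a = T") (auto simp: shift_def)
   then have "shift c w T = w (T - c)" "shift d w T = w (T - d)" using cd by auto
   then have "norm (shift c w T + (-1) *\<^sub>R shift d w T) \<le> M * (d - c) * norm x"
    using M(2)[OF w, of "T - d" "T - c"] cd by simp
   then show ?thesis using s by blast
  qed
  have set: "norm (u T) \<le> M * measure lebesgue E * norm x"
   if E: "E \<in> lmeasurable" "E \<subseteq> {0<..<T}" and s: "lsol T (\<lambda>t. indicator E t *\<^sub>R x) g v u" for E x g v u
  proof (rule field_le_epsilon)
   fix e :: real assume e: "e > 0"
   \<comment> \<open>Two error budgets of e/2 each: the first entry bounds the excess measure of the
     union of intervals in the main term, the second the L_p norm of the remainder in the crude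
     bound. The added 1 avoids division by zero.\<close>
   define \<eta> where "\<eta> = min (e / (2 * (M * norm x + 1))) ((e / (2 * (D * norm x + 1))) powr p)"
   have Mx: "M * norm x \<ge> 0" "D * norm x \<ge> 0" using M(1) D by auto
   have \<eta>: "\<eta> > 0" using e Mx by (simp add: \<eta>_def)
   have EE: "E \<subseteq> {0..T}" using E(2) by auto
   obtain F where F: "finite F" "\<And>K. K \<in> F \<Longrightarrow> \<exists>c d. c \<le> d \<and> K = {c..d} \<and> {c..d} \<subseteq> {0..T}"
    "pairwise (\<lambda>K L. negligible (K \<inter> L)) F" "measure lebesgue ((E - \<Union>F) \<union> (\<Union>F - E)) < \<eta>"
    using interval_approx[OF E(1) EE \<eta>] by blast
   have Fl: "K \<in> lmeasurable" if K: "K \<in> F" for K using F(2)[OF K] by auto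
   have FT: "\<Union>F \<subseteq> {0..T}"
   proof
    fix t assume "t \<in> \<Union>F"
    then obtain K where K: "K \<in> F" "t \<in> K" by blast
    then show "t \<in> {0..T}" using F(2)[OF K(1)] by blast
   qed
   have UF: "\<Union>F \<in> lmeasurable" using F(1) Fl by (intro fmeasurable.finite_Union) auto
   have "\<exists>g v u. lsol T (\<lambda>t. indicator K t *\<^sub>R x) g v u \<and> norm (u T) \<le> M * measure lebesgue K * norm x" if K: "K \<in> F" for K
   proof -
    obtain c d where cd: "c \<le> d" "K = {c..d}" "{c..d} \<subseteq> {0..T}" using F(2)[OF K] by blast
    then have "0 \<le> c" "d \<le> T" by auto
    then show ?thesis using ivl[of c d x] cd by auto
   qed
   then obtain gK vK uK where sK: "\<And>K. K \<in> F \<Longrightarrow> lsol T (\<lambda>t. indicator K t *\<^sub>R x) (gK K) (vK K) (uK K)"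
    "\<And>K. K \<in> F \<Longrightarrow> norm (uK K T) \<le> M * measure lebesgue K * norm x"
    by metis
   have aeF: "AE t in lebesgue_on {0..T}. (\<Sum>K\<in>F. indicator K t *\<^sub>R x) = indicator (\<Union>F) t *\<^sub>R x"
   proof -
    have "AE t in lebesgue_on {0..T}. t \<notin> (\<Union>((\<lambda>(K, L). K \<inter> L) ` {(K, L) \<in> F \<times> F. K \<noteq> L}))"
    proof (subst AE_lebesgue_on_negligible)
     have "negligible (\<Union>((\<lambda>(K, L). K \<inter> L) ` {(K, L) \<in> F \<times> F. K \<noteq> L}))"
      using F(1,3) by (intro negligible_Union finite_imageI finite_subset[of "{(K, L) \<in> F \<times> F. K \<noteq> L}" "F \<times> F"])
       (auto simp: pairwise_def)
     then show "negligible {t \<in> {0..T}. \<not> t \<notin> (\<Union>((\<lambda>(K, L). K \<inter> L) ` {(K, L) \<in> F \<times> F. K \<noteq> L}))}" by (rule negligible_subset) blast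
    qed simp
    then show ?thesis
    proof eventually_elim
     case (elim t)
     show ?case
     proof (cases "t \<in> \<Union>F")
      case True
      then obtain K where K: "K \<in> F" "t \<in> K" by blast
      have "(\<Sum>L\<in>F. indicator L t *\<^sub>R x) = (\<Sum>L\<in>F. if L = K then x else 0)"
       using elim K by (intro sum.cong) (auto simp: indicator_def)
      then show ?thesis using K F(1) True by (simp add: sum.delta)
     next
      case False
      then have "(\<Sum>L\<in>F. indicator L t *\<^sub>R x) = (\<Sum>L\<in>F. 0)" by (intro sum.cong) (auto simp: indicator_def)
      then show ?thesis using False by simp
     qed
    qed
   qed
   note sF = lsol_cong[OF lsol_sum[OF F(1) sK(1)] aeF]
   have "norm (\<Sum>K\<in>F. uK K T) \<le> (\<Sum>K\<in>F. M * measure lebesgue K * norm x)" using sK(2) by (rule sum_norm_le)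
   also have "\<dots> = M * (\<Sum>K\<in>F. measure lebesgue K) * norm x" by (simp add: sum_distrib_left sum_distrib_right)
   also have "(\<Sum>K\<in>F. measure lebesgue K) = measure lebesgue (\<Union>F)"
    using measure_negligible_finite_Union[OF F(1) Fl F(3)] by simp
   finally have uF: "norm (\<Sum>K\<in>F. uK K T) \<le> M * measure lebesgue (\<Union>F) * norm x" .
   let ?d = "\<lambda>t. indicator E t *\<^sub>R x + (-1) *\<^sub>R indicator (\<Union>F) t *\<^sub>R x"
   let ?B = "(E - \<Union>F) \<union> (\<Union>F \<inter> {0<..<T} - E)"
   have B: "?B \<in> lmeasurable" "?B \<subseteq> {0<..<T}" "measure lebesgue ?B \<le> \<eta>"
   proof -
    have "\<Union>F \<inter> {0<..<T} \<in> lmeasurable" by (rule fmeasurable_Int_fmeasurable[OF UF]) simp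
    then show "?B \<in> lmeasurable" by (intro fmeasurable.Un fmeasurable.Diff E(1) UF)
    show "?B \<subseteq> {0<..<T}" using E(2) by auto
    have Dl: "(E - \<Union>F) \<union> (\<Union>F - E) \<in> lmeasurable" by (intro fmeasurable.Un fmeasurable.Diff E(1) UF)
    have "measure lebesgue ?B \<le> measure lebesgue ((E - \<Union>F) \<union> (\<Union>F - E))"
     by (rule measure_mono_fmeasurable[OF _ fmeasurableD[OF \<open>?B \<in> lmeasurable\<close>] Dl]) blast
    then show "measure lebesgue ?B \<le> \<eta>" using F(4) by simp
   qed
   have dN: "?d \<in> Lp {0<..<T} p" "nT T ?d \<le> 1 * nT T (\<lambda>t. indicator ?B t *\<^sub>R x)"
   proof -
    have i: "indicator S \<in> borel_measurable (lebesgue_on {0<..<T})" if "S \<in> lmeasurable" for S :: "real set"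
     using that by (auto intro!: measurable_restrict_space1)
    have sm: "smeas {0<..<T} ?d"
     using i[OF E(1)] i[OF UF] by (intro sm_add sm_scaleR sm_const) (simp_all add: sm_real_iff)
    have le: "AE t in lebesgue_on {0<..<T}. norm (?d t) \<le> 1 * norm (indicator ?B t *\<^sub>R x)"
     by (rule AE_I2) (auto simp: indicator_def)
    note wB = wLp_norm_indicator(1)[OF p1 B(1,2) J, of x]
    show "?d \<in> Lp {0<..<T} p" by (rule wLp_mono(1)[OF p1 J(2) sm wB _ le]) simp
    show "nT T ?d \<le> 1 * nT T (\<lambda>t. indicator ?B t *\<^sub>R x)"
     by (rule wLp_mono(2)[OF p1 J(2) sm wB _ le]) simp
   qed
   have "nT T ?d \<le> norm x * measure lebesgue ?B powr (1/p)"
    using dN(2) wLp_norm_indicator(2)[OF p1 B(1,2) J, of x] by simp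
   also have "\<dots> \<le> norm x * \<eta> powr (1/p)" using B(3) p by (intro mult_left_mono powr_mono2) auto
   finally have N1: "nT T ?d \<le> norm x * \<eta> powr (1/p)" .
   have "\<eta> powr (1/p) \<le> ((e / (2 * (D * norm x + 1))) powr p) powr (1/p)"
    using \<eta> p by (intro powr_mono2) (simp_all add: \<eta>_def)
   also have "\<dots> = e / (2 * (D * norm x + 1))" using e Mx p by (simp add: powr_powr)
   finally have N2: "\<eta> powr (1/p) \<le> e / (2 * (D * norm x + 1))" .
   have "norm (u T + (-1) *\<^sub>R (\<Sum>K\<in>F. uK K T)) \<le> D * nT T ?d"
    by (rule small[OF dN(1) lsol_lincomb[OF s sF, of "-1"]])
   also have "\<dots> \<le> D * (norm x * \<eta> powr (1/p))" using N1 D by (intro mult_left_mono) auto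
   also have "\<dots> \<le> D * (norm x * (e / (2 * (D * norm x + 1))))" using N2 D by (intro mult_left_mono) auto
   also have "\<dots> \<le> e/2"
   proof -
    have "D * norm x * e \<le> (D * norm x + 1) * e" using e by (simp add: distrib_right)
    then show ?thesis using Mx(2) by (simp add: field_simps)
   qed
   finally have 1: "norm (u T + (-1) *\<^sub>R (\<Sum>K\<in>F. uK K T)) \<le> e/2" .
   have Dl: "(E - \<Union>F) \<union> (\<Union>F - E) \<in> lmeasurable" by (intro fmeasurable.Un fmeasurable.Diff E(1) UF)
   have "measure lebesgue (\<Union>F) \<le> measure lebesgue (E \<union> ((E - \<Union>F) \<union> (\<Union>F - E)))"
    by (rule measure_mono_fmeasurable[OF _ fmeasurableD[OF UF] fmeasurable.Un[OF E(1) Dl]]) blast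
   also have "\<dots> \<le> measure lebesgue E + measure lebesgue ((E - \<Union>F) \<union> (\<Union>F - E))"
    by (rule measure_Un_le[OF fmeasurableD[OF E(1)] fmeasurableD[OF Dl]])
   finally have mF: "measure lebesgue (\<Union>F) \<le> measure lebesgue E + \<eta>" using F(4) by simp
   have "M * measure lebesgue (\<Union>F) * norm x \<le> M * (measure lebesgue E + \<eta>) * norm x"
    using mF M(1) by (intro mult_right_mono mult_left_mono) auto
   also have "\<dots> = M * measure lebesgue E * norm x + (M * norm x) * \<eta>" by (simp add: algebra_simps)
   also have "(M * norm x) * \<eta> \<le> (M * norm x) * (e / (2 * (M * norm x + 1)))"
    using Mx by (intro mult_left_mono) (auto simp: \<eta>_def)
   also have "\<dots> \<le> e/2"
   proof -
    have "M * norm x * e \<le> (M * norm x + 1) * e" using e by (simp add: distrib_right)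
    then show ?thesis using Mx(1) by (simp add: field_simps)
   qed
   finally have 2: "norm (\<Sum>K\<in>F. uK K T) \<le> M * measure lebesgue E * norm x + e/2" using uF by linarith
   have "norm (u T) \<le> norm (u T + (-1) *\<^sub>R (\<Sum>K\<in>F. uK K T)) + norm (\<Sum>K\<in>F. uK K T)"
    using norm_triangle_ineq[of "u T + (-1) *\<^sub>R (\<Sum>K\<in>F. uK K T)" "\<Sum>K\<in>F. uK K T"] by simp
   then show "norm (u T) \<le> M * measure lebesgue E * norm x + e" using 1 2 by simp
  qed
  have simple: "h \<in> Lp {0<..<T} p \<and> (\<exists>g v u. lsol T h g v u \<and> norm (u T) \<le> M * integral {0..T} (\<lambda>t. norm (h t)))"
   if h: "simple_int (lebesgue_on {0<..<T}) h" for h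
  proof -
   have sf: "simple_function (lebesgue_on {0<..<T}) h"
    using h by (auto simp: Bochner_Integration.simple_bochner_integrable.simps)
   have fin: "finite (h ` {0<..<T})" using simple_functionD(1)[OF sf] by simp
   define A where "A y = {t \<in> {0<..<T}. h t = y}" for y
   have As: "A y \<in> sets lebesgue" for y
   proof -
    have "h -` {y} \<inter> {0<..<T} \<in> sets (lebesgue_on {0<..<T})" using simple_functionD(2)[OF sf, of "{y}"] by simp
    then have "h -` {y} \<inter> {0<..<T} \<in> sets lebesgue" by (simp add: sets_restrict_space_iff)
    then show ?thesis by (simp add: A_def vimage_def Int_def conj_commute)
   qed
   have Asub: "A y \<subseteq> {0<..<T}" for y by (auto simp: A_def)
   have Al: "A y \<in> lmeasurable" for y
   proof -
    have "A y \<subseteq> {0..T}" using Asub[of y] by auto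
    then have "bounded (A y)" by (rule bounded_subset[OF bounded_closed_interval])
    then show ?thesis using As by (rule bounded_set_imp_lmeasurable)
   qed
   note iL = wLp_norm_indicator(1)[OF p1 Al Asub J]
   have "\<exists>g v u. lsol T (\<lambda>t. indicator (A y) t *\<^sub>R y) g v u" for y by (rule ex[OF iL])
   then obtain gy vy uy where sy: "\<And>y. lsol T (\<lambda>t. indicator (A y) t *\<^sub>R y) (gy y) (vy y) (uy y)" by metis
   have eq: "h t = (\<Sum>y\<in>h ` {0<..<T}. indicator (A y) t *\<^sub>R y)" if t: "t \<in> {0<..<T}" for t
   proof -
    have "(\<Sum>y\<in>h ` {0<..<T}. indicator (A y) t *\<^sub>R y) = (\<Sum>y\<in>h ` {0<..<T}. if y = h t then h t else 0)"
     using t by (intro sum.cong) (auto simp: A_def indicator_def)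
    then show ?thesis using fin t by (simp add: sum.delta)
   qed
   have ae: "AE t in lebesgue_on {0..T}. (\<Sum>y\<in>h ` {0<..<T}. indicator (A y) t *\<^sub>R y) = h t"
    unfolding AE_interior by (rule AE_I2, rule eq[symmetric]) simp
   note sh = lsol_cong[OF lsol_sum[OF fin sy] ae]
   have sumL: "(\<lambda>t. \<Sum>y\<in>Q. indicator (A y) t *\<^sub>R y) \<in> Lp {0<..<T} p" if "finite Q" for Q
    using that
   proof (induction Q rule: finite_induct)
    case empty show ?case by (simp only: sum.empty wLp_zero(1)[OF p1])
   next
    case (insert y Q)
    show ?case unfolding sum.insert[OF insert.hyps] by (rule wLp_add(1)[OF p1 J(2) iL insert.IH])
   qed
   have hL: "h \<in> Lp {0<..<T} p"
    by (rule wLp_cong_AE(1)[OF p1 J(2) sumL[OF fin]]) (use ae in \<open>simp add: AE_interior\<close>)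
   have nh: "simple_int (lebesgue_on {0<..<T}) (\<lambda>t. norm (h t))"
    by (rule Bochner_Integration.simple_bochner_integrable_compose2[OF _ h h, of "\<lambda>x _. norm x"]) simp
   have "integral {0..T} (\<lambda>t. norm (h t)) = simple_val (lebesgue_on {0<..<T}) (\<lambda>t. norm (h t))"
    unfolding integral_interior by (rule integral_unique[OF simple_has_integral[OF J(2) nh]])
   also have "\<dots> = (\<Sum>y\<in>h ` {0<..<T}. measure (lebesgue_on {0<..<T}) (A y) *\<^sub>R norm y)"
    using Bochner_Integration.simple_bochner_integral_partition[OF nh sf, of norm] by (simp add: A_def)
   also have "\<dots> = (\<Sum>y\<in>h ` {0<..<T}. measure lebesgue (A y) * norm y)"
    using Asub J(2) by (intro sum.cong) (auto simp: measure_restrict_space)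
   finally have int: "integral {0..T} (\<lambda>t. norm (h t)) = (\<Sum>y\<in>h ` {0<..<T}. measure lebesgue (A y) * norm y)" .
   have "norm (\<Sum>y\<in>h ` {0<..<T}. uy y T) \<le> (\<Sum>y\<in>h ` {0<..<T}. M * measure lebesgue (A y) * norm y)"
    by (rule sum_norm_le) (rule set[OF Al Asub sy])
   also have "\<dots> = M * integral {0..T} (\<lambda>t. norm (h t))" unfolding int by (simp add: sum_distrib_left mult.assoc)
   finally show ?thesis using sh hL by blast
  qed
  have fin: "(\<integral>\<^sup>+t. ennreal (norm (f t) powr p) \<partial>lebesgue_on {0<..<T}) < \<infinity>"
   using f unfolding wLp_iff wint_one[OF J] using J(2) by (simp add: nn_integral_restrict_space)
  have p0: "p > 0" using p by simp
  obtain h where h: "\<And>i::nat. simple_int (lebesgue_on {0<..<T}) (h i)"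
   "(\<lambda>i. \<integral>\<^sup>+t. ennreal (norm (f t - h i t) powr p) \<partial>lebesgue_on {0<..<T}) \<longlonglongrightarrow> 0"
   using simple_approx_powr[OF J(2) wLp_sm[OF f] p0 fin] by blast
  have dL: "(\<lambda>t. f t - h i t) \<in> Lp {0<..<T} p" for i by (rule wLp_diff(1)[OF p1 J(2) f conjunct1[OF simple[OF h(1)]]])
  have "(\<lambda>i. wint {0<..<T} p 1 (\<lambda>t. f t - h i t)) \<longlonglongrightarrow> ennreal 0"
   using h(2) unfolding wint_one[OF J] using J(2) by (simp add: nn_integral_restrict_space)
  moreover have "wint {0<..<T} p 1 (\<lambda>t. f t - h i t) \<noteq> \<infinity>" for i
   using dL[of i] unfolding wLp_iff by (auto dest: less_imp_neq)
  ultimately have "(\<lambda>i. enn2real (wint {0<..<T} p 1 (\<lambda>t. f t - h i t))) \<longlonglongrightarrow> enn2real (ennreal 0)"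
   by (intro tendsto_enn2real) auto
  then have lim: "(\<lambda>i. nT T (\<lambda>t. f t - h i t)) \<longlonglongrightarrow> 0"
   unfolding wLp_norm_wint using p by (intro tendsto_zero_powrI[of _ _ _ "1/p"]) auto
  \<comment> \<open>Replacing f by a simple function costs the first summand in the integral of |f|
    and the second, the crude bound, in u(T).\<close>
  define E where "E = M * T powr (1 - 1/p) + D"
  have bound: "norm (u T) \<le> M * integral {0..T} (\<lambda>t. norm (f t)) + E * nT T (\<lambda>t. f t - h i t)" for i
  proof -
   obtain gi vi ui where si: "lsol T (h i) gi vi ui" "norm (ui T) \<le> M * integral {0..T} (\<lambda>t. norm (h i t))"
    using simple[OF h(1)[of i]] by blast
   have hL: "h i \<in> Lp {0<..<T} p" using simple[OF h(1)[of i]] by blast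
   have "lsol T (\<lambda>t. f t - h i t) (\<lambda>t. g t - gi t) (\<lambda>t. v t - vi t) (\<lambda>t. u t - ui t)"
    using lsol_lincomb[OF s si(1), of "-1"] by simp
   from small[OF dL this] have 1: "norm (u T - ui T) \<le> D * nT T (\<lambda>t. f t - h i t)" .
   have b: "bint {0..T} f" "bint {0..T} (h i)" "bint {0..T} (\<lambda>t. f t - h i t)"
    using Lp_integral_norm_le(1)[OF _ T] f hL dL by auto
   have "integral {0..T} (\<lambda>t. norm (h i t)) \<le> integral {0..T} (\<lambda>t. norm (f t) + norm (f t - h i t))"
   proof (intro integral_le integrable_add bintD(2)[OF b(1)] bintD(2)[OF b(2)] bintD(2)[OF b(3)])
    show "norm (h i t) \<le> norm (f t) + norm (f t - h i t)" for t
     using norm_triangle_ineq4[of "f t" "f t - h i t"] by simp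
   qed
   also have "\<dots> = integral {0..T} (\<lambda>t. norm (f t)) + integral {0..T} (\<lambda>t. norm (f t - h i t))"
    by (rule HK_integral_add[OF bintD(2)[OF b(1)] bintD(2)[OF b(3)]])
   also have "integral {0..T} (\<lambda>t. norm (f t - h i t)) \<le> T powr (1 - 1/p) * nT T (\<lambda>t. f t - h i t)"
    by (rule Lp_integral_norm_le(2)[OF dL T])
   finally have "M * integral {0..T} (\<lambda>t. norm (h i t)) \<le> M * (integral {0..T} (\<lambda>t. norm (f t)) + T powr (1 - 1/p) * nT T (\<lambda>t. f t - h i t))"
    using M(1) by (simp add: mult_left_mono)
   then have 2: "norm (ui T) \<le> M * integral {0..T} (\<lambda>t. norm (f t)) + M * T powr (1 - 1/p) * nT T (\<lambda>t. f t - h i t)"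
    using si(2) by (simp add: algebra_simps)
   have "norm (u T) \<le> norm (u T - ui T) + norm (ui T)" using norm_triangle_ineq[of "u T - ui T" "ui T"] by simp
   then show ?thesis using 1 2 by (simp add: E_def algebra_simps)
  qed
  have "(\<lambda>i. M * integral {0..T} (\<lambda>t. norm (f t)) + E * nT T (\<lambda>t. f t - h i t)) \<longlonglongrightarrow>
    M * integral {0..T} (\<lambda>t. norm (f t)) + E * 0" by (intro tendsto_intros lim)
  then show ?thesis using bound by (intro LIMSEQ_le_const) auto
 qed
 show ?thesis using main M(1) by blast
qed

end

lemma wLp_weight:
 shows "wLp_norm {0<..} p 1 (\<lambda>t. t powr (1 - \<mu>) *\<^sub>R f t) = wLp_norm {0<..} p \<mu> f"
  "smeas {0<..} f \<Longrightarrow> (\<lambda>t. t powr (1 - \<mu>) *\<^sub>R f t) \<in> Lp {0<..} p \<longleftrightarrow> f \<in> wLp {0<..} p \<mu>"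
proof -
 have w: "wint {0<..} p 1 (\<lambda>t. t powr (1 - \<mu>) *\<^sub>R f t) = wint {0<..} p \<mu> f"
  unfolding wint_def by (rule nn_integral_cong) simp
 then show "wLp_norm {0<..} p 1 (\<lambda>t. t powr (1 - \<mu>) *\<^sub>R f t) = wLp_norm {0<..} p \<mu> f"
  by (simp add: wLp_norm_wint)
 assume "smeas {0<..} f"
 then show "(\<lambda>t. t powr (1 - \<mu>) *\<^sub>R f t) \<in> Lp {0<..} p \<longleftrightarrow> f \<in> wLp {0<..} p \<mu>"
  using w by (simp add: wLp_iff sm_scaleR sm_powr)
qed

section \<open>Maximal regularity in weighted spaces\<close>

locale interpolation_pair =
 fixes j :: "'b::banach \<Rightarrow> 'a::banach" and p \<mu> :: real
 assumes p: "1 < p" and j: "bounded_linear j" "inj j" and \<mu>: "1/p < \<mu>" "\<mu> \<le> 1"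
begin

lemma p1: "p \<ge> 1" using p by simp

abbreviation LW :: "(real \<Rightarrow> 'x::real_normed_vector) set" where "LW \<equiv> wLp {0<..} p \<mu>"
abbreviation nLW :: "(real \<Rightarrow> 'x::real_normed_vector) \<Rightarrow> real" where "nLW \<equiv> wLp_norm {0<..} p \<mu>"

lemma wLp_bint_Icc: "(u :: real \<Rightarrow> 'x::banach) \<in> wLp {0<..} p \<mu> \<Longrightarrow> bint {0..T} u"
 by (rule wLp_bint_0inf[OF p \<mu>])

lemma wLp_integral_le:
 fixes u :: "real \<Rightarrow> 'x::banach"
 assumes u: "u \<in> wLp {0<..} p \<mu>" and T: "T > 0"
 shows "integral {0..T} (\<lambda>t. norm (u t)) \<le> hoelder_const p \<mu> * T powr (\<mu> - 1/p) * wLp_norm {0<..} p \<mu> u"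
proof -
 note sub = wLp_subset[OF p1 Ioo_subset_Ioi[OF order_refl] _ Ioi_sets u, of T]
 have "integral {0..T} (\<lambda>t. norm (u t)) \<le> hoelder_const p \<mu> * T powr (\<mu> - 1/p) * wLp_norm {0<..<T} p \<mu> u"
  by (rule wLp_bint(2)[OF p \<mu> T sub(1)]) simp
 also have "\<dots> \<le> hoelder_const p \<mu> * T powr (\<mu> - 1/p) * wLp_norm {0<..} p \<mu> u"
  by (intro mult_left_mono sub(2)) (auto simp: hoelder_const_def)
 finally show ?thesis .
qed

definition CH where "CH = (SOME C. C > 0 \<and> (\<forall>\<phi>::real \<Rightarrow> real. \<phi> \<in> LW \<longrightarrow> (\<forall>t. \<phi> t \<ge> 0) \<longrightarrow>
  (\<lambda>t. integral {0..t} \<phi> / t) \<in> LW \<and>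
  nLW (\<lambda>t. integral {0..t} \<phi> / t) \<le> C * nLW \<phi>))"

lemma hardy:
 "CH > 0"
 "(\<phi>::real \<Rightarrow> real) \<in> LW \<Longrightarrow> (\<And>t. \<phi> t \<ge> 0) \<Longrightarrow> (\<lambda>t. integral {0..t} \<phi> / t) \<in> LW"
 "(\<phi>::real \<Rightarrow> real) \<in> LW \<Longrightarrow> (\<And>t. \<phi> t \<ge> 0) \<Longrightarrow>
  nLW (\<lambda>t. integral {0..t} \<phi> / t) \<le> CH * nLW \<phi>"
 using someI_ex[OF hardy_ex[OF p \<mu>]] unfolding CH_def by blast+

end

locale weighted_mr = mr_setting j p A0 + interpolation_pair j p \<mu>
 for j :: "'b::banach \<Rightarrow> 'a::banach" and p :: real and A0 :: "'b \<Rightarrow> 'a" and \<mu> :: real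
begin

text \<open>The product rule away from time 0. At 0 the function t^(1-\<mu>) u is continuous because
  u(0) = 0 and the weight is bounded, and \<open>fb\<close> makes the extra term of the derivative
  integrable, so the identity extends to 0.\<close>

lemma lsol_weight:
 assumes s: "lsol T f g v u" and T: "T > 0"
  and fb: "bint {0..T} (\<lambda>t. t powr (-\<mu>) *\<^sub>R u t)"
 shows "\<exists>g'. lsol T (\<lambda>t. t powr (1-\<mu>) *\<^sub>R f t + (1-\<mu>) *\<^sub>R (t powr (-\<mu>) *\<^sub>R u t)) g' (\<lambda>t. t powr (1-\<mu>) *\<^sub>R v t) (\<lambda>t. t powr (1-\<mu>) *\<^sub>R u t)"
proof -
 interpret A0: bounded_linear A0 by (rule A0)
 interpret j: bounded_linear j by (rule j)
 let ?g = "\<lambda>t. (1-\<mu>) *\<^sub>R (t powr (-\<mu>) *\<^sub>R u t) + t powr (1-\<mu>) *\<^sub>R g t"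
 let ?u = "\<lambda>t. t powr (1-\<mu>) *\<^sub>R u t"
 have bound: "\<bar>t powr (1-\<mu>)\<bar> \<le> T powr (1-\<mu>)" if "t \<in> {0..T}" for t
  using that \<mu> by (auto intro: powr_mono2)
 have smp: "smeas {0..T} (\<lambda>t. t powr (1-\<mu>))" by (rule sm_powr) simp
 have gb: "bint {0..T} (\<lambda>t. t powr (1-\<mu>) *\<^sub>R g t)"
  by (rule bint_bounded_mult[OF _ smp bound prim_bint[OF lsolD(1)[OF s]]]) auto
 have vb: "bint {0..T} (\<lambda>t. t powr (1-\<mu>) *\<^sub>R v t)"
  by (rule bint_bounded_mult[OF _ smp bound lsolD(3)[OF s]]) auto
 have g'b: "bint {0..T} ?g" by (rule bint_add[OF _ bint_scale[OF _ fb] gb]) auto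
 note uc = prim_continuous_on[OF lsolD(1)[OF s]]
 have "prim 0 T ?g ?u"
 proof (rule prim_extend_0[OF _ g'b])
  show "prim a T ?g ?u" if a: "0 < a" "a \<le> T" for a
  proof -
   have "prim a T (\<lambda>t. ((1-\<mu>) * t powr (-\<mu>)) *\<^sub>R u t + t powr (1-\<mu>) *\<^sub>R g t) ?u"
   proof (rule prim_mult[OF prim_sub[OF lsolD(1)[OF s]]])
    fix t assume t: "t \<in> {a..T}"
    then have "t > 0" using a by simp
    from has_real_derivative_powr[OF this, of "1-\<mu>"]
    have "((\<lambda>z. z powr (1-\<mu>)) has_real_derivative (1-\<mu>) * t powr (-\<mu>)) (at t)" by simp
    then show "((\<lambda>z. z powr (1-\<mu>)) has_real_derivative (1-\<mu>) * t powr (-\<mu>)) (at t within {a..T})"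
     by (rule has_field_derivative_at_within)
   next
    show "continuous_on {a..T} (\<lambda>t. (1-\<mu>) * t powr (-\<mu>))"
     using a by (intro continuous_intros) auto
   qed (use a in auto)
   then show ?thesis by simp
  qed
  show "continuous_on {0..T} ?u"
   unfolding continuous_on_eq_continuous_within
  proof
   fix t assume t: "t \<in> {0..T}"
   show "continuous (at t within {0..T}) ?u"
   proof (cases "t = 0")
    case False
    then show ?thesis using t uc[unfolded continuous_on_eq_continuous_within]
     by (intro continuous_intros) auto
   next
    case True
    have "((\<lambda>r. T powr (1-\<mu>) * norm (u r)) \<longlongrightarrow> T powr (1-\<mu>) * norm (u 0)) (at 0 within {0..T})"
     using uc[unfolded continuous_on_def, rule_format, of 0] T by (intro tendsto_intros) auto
    then have lim: "((\<lambda>r. T powr (1-\<mu>) * norm (u r)) \<longlongrightarrow> 0) (at 0 within {0..T})"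
     using lsolD(2)[OF s] by simp
    have "(?u \<longlongrightarrow> 0) (at 0 within {0..T})"
    proof (rule Lim_null_comparison[OF _ lim])
     show "eventually (\<lambda>r. norm (?u r) \<le> T powr (1-\<mu>) * norm (u r)) (at 0 within {0..T})"
      unfolding eventually_at_filter
      by (intro always_eventually) (use bound in \<open>auto intro!: mult_right_mono\<close>)
    qed
    then show ?thesis unfolding True continuous_within using lsolD(2)[OF s] by simp
   qed
  qed
 qed
 moreover have "AE t in lebesgue_on {0..T}. ?u t = j (t powr (1-\<mu>) *\<^sub>R v t)"
  using lsolD(4)[OF s] by eventually_elim (simp add: j.scaleR)
 moreover have "AE t in lebesgue_on {0..T}. ?g t + A0 (t powr (1-\<mu>) *\<^sub>R v t) =
   t powr (1-\<mu>) *\<^sub>R f t + (1-\<mu>) *\<^sub>R (t powr (-\<mu>) *\<^sub>R u t)"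
  using lsolD(5)[OF s]
 proof eventually_elim
  case (elim t)
  have "t powr (1-\<mu>) *\<^sub>R f t = t powr (1-\<mu>) *\<^sub>R g t + t powr (1-\<mu>) *\<^sub>R A0 (v t)"
   unfolding elim[symmetric] by (simp add: scaleR_add_right)
  then show ?case by (simp add: A0.scaleR add_ac)
 qed
 ultimately show ?thesis unfolding lsol_def using vb lsolD(2)[OF s] by (intro exI[of _ ?g]) simp
qed

text \<open>An a priori estimate: membership of f in both spaces supplies a solution in L_p to which
  the weight can be applied. Uniqueness identifies t^(1-\<mu>) v with the solution of the
  transformed problem. General weighted f are reached by density afterwards.\<close>

lemma weighted_estimate:
 "\<exists>C>0. \<forall>f g v u. f \<in> Lp {0<..} p \<longrightarrow> f \<in> LW \<longrightarrow> gsol f g v u \<longrightarrow>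
   v \<in> LW \<and> nLW v \<le> C * nLW f"
proof -
 obtain C where C: "C > 0" "\<And>f g v u. f \<in> Lp {0<..} p \<Longrightarrow> gsol f g v u \<Longrightarrow> N v \<le> C * N f" using mr_bound by blast
 obtain M where M: "M \<ge> 0" "\<And>T f g v u. T > 0 \<Longrightarrow> f \<in> Lp {0<..<T} p \<Longrightarrow> lsol T f g v u \<Longrightarrow>
   norm (u T) \<le> M * integral {0..T} (\<lambda>t. norm (f t))"
  using solution_L1_bound by blast
 \<comment> \<open>C stems from maximal regularity without weight. The bracket bounds the
   transformed right-hand side: 1 for t^(1-\<mu>) f, the rest for (1-\<mu>) t^(-\<mu>) u by the L_1
   bound and Hardy's inequality.\<close>
 let ?C = "C * (1 + (1-\<mu>) * (M * CH))"
 have pos: "1 + (1-\<mu>) * (M * CH) > 0" using M(1) hardy(1) \<mu> by (intro add_pos_nonneg mult_nonneg_nonneg) auto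
 show ?thesis
 proof (intro exI[of _ ?C] conjI allI impI)
  show "?C > 0" using C(1) pos by simp
  fix f g v u assume f: "f \<in> Lp {0<..} p" "f \<in> LW" and s: "gsol f g v u"
  let ?nf = "\<lambda>t. norm (f t)"
  let ?k = "\<lambda>t. t powr (-\<mu>) *\<^sub>R u t"
  have nf: "?nf \<in> LW" by (rule wLp_norm_mem[OF p1 Ioi_sets f(2)])
  have H: "(\<lambda>t. integral {0..t} ?nf / t) \<in> LW"
   "nLW (\<lambda>t. integral {0..t} ?nf / t) \<le> CH * nLW f"
   using hardy(2,3)[OF nf] by (simp_all add: wLp_norm_norm)
  let ?H = "\<lambda>t. t powr (1-\<mu>) *\<^sub>R (integral {0..t} ?nf / t)"
  have H1: "?H \<in> Lp {0<..} p" using wLp_weight(2)[OF wLp_sm[OF H(1)]] H(1) by blast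
  have H2: "N ?H \<le> CH * nLW f" using wLp_weight(1)[where p=p and \<mu>=\<mu> and f="\<lambda>t. integral {0..t} ?nf / t"] H(2) by simp
  have uc: "continuous_on {0..} u" by (rule gsol_continuous[OF gsolD(1)[OF s]])
  have ksm: "smeas {0<..} ?k"
   by (intro sm_scaleR sm_powr sm_continuous_on continuous_on_subset[OF uc]) auto
  have kle: "AE t in lebesgue_on {0<..}. norm (?k t) \<le> M * norm (?H t)"
  proof (rule AE_I2)
   fix t :: real assume "t \<in> space (lebesgue_on {0<..})"
   then have t: "t > 0" by simp
   have "f \<in> Lp {0<..<t} p" by (rule wLp_subset(1)[OF p1 Ioo_subset_Ioi[OF order_refl] _ Ioi_sets f(1)]) simp
   from M(2)[OF t this gsolD(1)[OF s]] have "norm (u t) \<le> M * integral {0..t} ?nf" .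
   then have "t powr (-\<mu>) * norm (u t) \<le> t powr (-\<mu>) * (M * integral {0..t} ?nf)" by (rule mult_left_mono) simp
   moreover have e: "t powr (-\<mu>) = t powr (1-\<mu>) / t" using t by (simp add: powr_diff powr_minus field_simps)
   moreover have "integral {0..t} ?nf \<ge> 0" by (rule integral_nonneg[OF bintD(2)[OF Lp_bint[OF f(1)]]]) simp
   ultimately have "t powr (-\<mu>) * norm (u t) \<le> M * (t powr (1-\<mu>) * (integral {0..t} ?nf / t))" "integral {0..t} ?nf / t \<ge> 0"
    using t by (auto simp: mult_ac)
   then show "norm (?k t) \<le> M * norm (?H t)" by (simp add: abs_mult del: times_divide_eq_right abs_divide)
  qed
  note kL = wLp_mono[OF p1 Ioi_sets ksm H1 M(1) kle]
  have kN: "N ?k \<le> M * CH * nLW f"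
   using kL(2) mult_left_mono[OF H2 M(1)] by simp
  let ?wf = "\<lambda>t. t powr (1-\<mu>) *\<^sub>R f t"
  have wf: "?wf \<in> Lp {0<..} p" "N ?wf = nLW f"
   using wLp_weight[where p=p and \<mu>=\<mu> and f=f] wLp_sm[OF f(2)] f(2) by auto
  let ?h = "\<lambda>t. ?wf t + (1-\<mu>) *\<^sub>R ?k t"
  have h: "?h \<in> Lp {0<..} p" by (rule wLp_add(1)[OF p1 Ioi_sets wf(1) wLp_scale(1)[OF p1 Ioi_sets kL(1)]])
  have "N ?h \<le> N ?wf + N (\<lambda>t. (1-\<mu>) *\<^sub>R ?k t)"
   by (rule wLp_add(2)[OF p1 Ioi_sets wf(1) wLp_scale(1)[OF p1 Ioi_sets kL(1)]])
  also have "N (\<lambda>t. (1-\<mu>) *\<^sub>R ?k t) \<le> (1-\<mu>) * N ?k"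
   using wLp_scale(2)[OF p1 Ioi_sets kL(1), of "1-\<mu>"] \<mu> by simp
  also have "(1-\<mu>) * N ?k \<le> (1-\<mu>) * (M * CH * nLW f)" using kN \<mu> by (intro mult_left_mono) auto
  finally have hN: "N ?h \<le> (1 + (1-\<mu>) * (M * CH)) * nLW f" unfolding wf(2) by (simp add: algebra_simps)
  obtain gh vh uh where sh: "gsol ?h gh vh uh" using gsol_exists[OF h] by blast
  have "AE t in lebesgue_on {0..T}. vh t = t powr (1-\<mu>) *\<^sub>R v t" for T
  proof -
   have T1: "max T 1 > 0" by simp
   obtain g' where g': "lsol (max T 1) ?h g' (\<lambda>t. t powr (1-\<mu>) *\<^sub>R v t) (\<lambda>t. t powr (1-\<mu>) *\<^sub>R u t)"
    using lsol_weight[OF gsolD(1)[OF s] T1 Lp_bint[OF kL(1)]] by blast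
   show ?thesis
    by (rule AE_lebesgue_on_subset[OF _ _ _ lsol_unique(2)[OF gsolD(1)[OF sh] g']]) auto
  qed
  then have ae: "AE t in lebesgue_on {0<..}. vh t = t powr (1-\<mu>) *\<^sub>R v t" by (rule AE_Ioi_if_Icc)
  note cg = wLp_cong_AE[OF p1 Ioi_sets gsolD(3)[OF sh] ae]
  show "v \<in> LW" using cg(1) wLp_weight(2)[OF wLp_sm[OF gsolD(3)[OF s]]] by blast
  have "nLW v = N vh" using cg(2) wLp_weight(1)[where p=p and \<mu>=\<mu> and f=v] by simp
  also have "\<dots> \<le> C * N ?h" by (rule C(2)[OF h sh])
  also have "\<dots> \<le> C * ((1 + (1-\<mu>) * (M * CH)) * nLW f)" using hN C(1) by (intro mult_left_mono) auto
  finally show "nLW v \<le> ?C * nLW f" by (simp add: mult.assoc)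
 qed
qed

text \<open>Truncations of f to compact windows in (0,\<infinity>) lie in both spaces; their
  solutions form a Cauchy sequence by \<open>weighted_estimate\<close>, and the limit solves the
  problem for f.\<close>

lemma weighted_solution:
 "\<exists>C>0. \<forall>f \<in> LW. \<exists>g v u. (\<forall>T. lsol T f g v u) \<and> g \<in> LW \<and> v \<in> LW \<and>
   nLW g \<le> C * nLW f \<and> nLW v \<le> C * nLW f"
proof -
 obtain C where C: "C > 0" "\<And>f g v u. f \<in> Lp {0<..} p \<Longrightarrow> f \<in> LW \<Longrightarrow> gsol f g v u \<Longrightarrow>
   v \<in> LW \<and> nLW v \<le> C * nLW f" using weighted_estimate by blast
 obtain K where K: "K \<ge> 0" "\<And>x. norm (A0 x) \<le> K * norm x" by (rule A0_bound) (rule that)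
 interpret A0: bounded_linear A0 by (rule A0)
 have ex: "\<exists>g v u. (\<forall>T. lsol T f g v u) \<and> g \<in> LW \<and> v \<in> LW \<and>
   nLW g \<le> (1 + C + K * C) * nLW f \<and> nLW v \<le> (1 + C + K * C) * nLW f" if f: "f \<in> LW" for f
 proof -
  \<comment> \<open>On \<open>J n\<close> the time is bounded below by 1/(n+1), so the weight is
    bounded below there and the weighted norm controls the unweighted one.\<close>
  define J where "J n = {1 / (real n + 1)<..<real n + 1}" for n :: nat
  have J: "J n \<subseteq> {0<..}" "J n \<in> sets lebesgue" for n
   unfolding J_def by (auto intro!: Ioo_subset_Ioi)
  have "(\<lambda>n. wLp_norm ({0<..} - J n) p \<mu> f) \<longlonglongrightarrow> 0"
  proof (rule wLp_norm_vanish[OF p1 f])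
   show "AE t in lebesgue_on {0<..}. eventually (\<lambda>n. t \<notin> {0<..} - J n) sequentially"
   proof (rule AE_I2)
    fix t :: real assume "t \<in> space (lebesgue_on {0<..})"
    then have t: "t > 0" by simp
    obtain N1 where N1: "max t (1/t) \<le> real N1" using real_arch_simple by blast
    show "eventually (\<lambda>n. t \<notin> {0<..} - J n) sequentially"
    proof (rule eventually_sequentiallyI[of N1])
     fix n assume "N1 \<le> n"
     then have "t < real n + 1" "1/t < real n + 1" using N1 by auto
     then have "t \<in> J n" using t by (simp add: J_def field_simps)
     then show "t \<notin> {0<..} - J n" by simp
    qed
   qed
  qed (use J in auto)
  then have "\<exists>n. wLp_norm ({0<..} - J n) p \<mu> f < (1/2)^k" for k
   using order_tendstoD(2)[of _ 0 sequentially "(1/2)^k"] by (fastforce simp: eventually_sequentially)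
  then have "\<exists>n. \<forall>k. wLp_norm ({0<..} - J (n k)) p \<mu> f < (1/2)^k" by (intro choice allI)
  then obtain n where n: "\<And>k. wLp_norm ({0<..} - J (n k)) p \<mu> f < (1/2)^k" by blast
  define F where "F k t = (if t \<in> J (n k) then f t else 0)" for k t
  have Fw: "F k \<in> LW" for k
   unfolding F_def wLp_restrict(1)[OF p1 J Ioi_sets] by (rule wLp_subset(1)[OF p1 J Ioi_sets f])
  have Fle: "nLW (F k) \<le> nLW f" for k
   unfolding F_def wLp_restrict(2)[OF p1 J Ioi_sets] by (rule wLp_subset(2)[OF p1 J Ioi_sets f])
  have FL: "F k \<in> Lp {0<..} p" for k
  proof (rule wLp_mono(1)[OF p1 Ioi_sets wLp_sm[OF Fw]])
   show "(\<lambda>t. t powr (1 - \<mu>) *\<^sub>R F k t) \<in> Lp {0<..} p" using wLp_weight(2)[OF wLp_sm[OF Fw]] Fw by blast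
   show "AE t in lebesgue_on {0<..}. norm (F k t) \<le> (real (n k) + 1) powr (1-\<mu>) * norm (t powr (1 - \<mu>) *\<^sub>R F k t)"
   proof (rule AE_I2)
    fix t :: real assume "t \<in> space (lebesgue_on {0<..})"
    show "norm (F k t) \<le> (real (n k) + 1) powr (1-\<mu>) * norm (t powr (1 - \<mu>) *\<^sub>R F k t)"
    proof (cases "t \<in> J (n k)")
     case True
     then have t: "t > 0" "1 \<le> (real (n k) + 1) * t" using J(1)[of "n k"] by (auto simp: J_def field_simps)
     have "1 powr (1-\<mu>) \<le> ((real (n k) + 1) * t) powr (1-\<mu>)" using t \<mu> by (intro powr_mono2) auto
     then have "1 \<le> (real (n k) + 1) powr (1-\<mu>) * t powr (1-\<mu>)" using t by (simp add: powr_mult)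
     then have "1 * norm (F k t) \<le> ((real (n k) + 1) powr (1-\<mu>) * t powr (1-\<mu>)) * norm (F k t)" by (rule mult_right_mono) simp
     then show ?thesis by (simp add: mult.assoc)
    qed (simp add: F_def)
   qed
  qed simp
  have Fd: "nLW (\<lambda>t. F k t - f t) \<le> (1/2)^k" for k
  proof -
   have D: "{0<..} - J (n k) \<in> sets lebesgue" using J by auto
   have fm: "(\<lambda>t. if t \<in> {0<..} - J (n k) then f t else 0) \<in> LW"
    unfolding wLp_restrict(1)[OF p1 Diff_subset D Ioi_sets] by (rule wLp_subset(1)[OF p1 Diff_subset D Ioi_sets f])
   have "nLW (\<lambda>t. F k t - f t) = nLW (\<lambda>t. - (if t \<in> {0<..} - J (n k) then f t else 0))"
    by (rule wLp_cong_AE(2)[OF p1 Ioi_sets wLp_minus(1)[OF p1 Ioi_sets fm]], rule AE_I2) (auto simp: F_def)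
   also have "\<dots> = nLW (\<lambda>t. if t \<in> {0<..} - J (n k) then f t else 0)" by (rule wLp_minus(2)[OF p1 Ioi_sets fm])
   finally show ?thesis using n[of k] unfolding wLp_restrict(2)[OF p1 Diff_subset D Ioi_sets] by simp
  qed
  have "\<exists>g v u. gsol (F k) g v u" for k by (rule gsol_exists[OF FL])
  then obtain G V U where S: "\<And>k. gsol (F k) (G k) (V k) (U k)" by metis
  have V: "V k \<in> LW" "nLW (V k) \<le> C * nLW f" for k
  proof -
   note e = C(2)[OF FL Fw S, of k]
   show "V k \<in> LW" using e by blast
   have "C * nLW (F k) \<le> C * nLW f" using Fle[of k] C(1) by simp
   then show "nLW (V k) \<le> C * nLW f" using e by linarith
  qed
  have Vd: "nLW (\<lambda>t. V (Suc k) t - V k t) \<le> 2 * C * (1/2)^k" for k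
  proof -
   have "gsol (\<lambda>t. F (Suc k) t - F k t) (\<lambda>t. G (Suc k) t - G k t) (\<lambda>t. V (Suc k) t - V k t) (\<lambda>t. U (Suc k) t - U k t)"
    using gsol_lincomb[OF S[of "Suc k"] S[of k], of "-1"] by simp
   then have "nLW (\<lambda>t. V (Suc k) t - V k t) \<le> C * nLW (\<lambda>t. F (Suc k) t - F k t)"
    using C(2) wLp_diff(1)[OF p1 Ioi_sets FL FL] wLp_diff(1)[OF p1 Ioi_sets Fw Fw] by blast
   also have "nLW (\<lambda>t. F (Suc k) t - F k t) \<le> nLW (\<lambda>t. F (Suc k) t - f t) + nLW (\<lambda>t. F k t - f t)"
    using wLp_diff(2)[OF p1 Ioi_sets wLp_diff(1)[OF p1 Ioi_sets Fw[of "Suc k"] f] wLp_diff(1)[OF p1 Ioi_sets Fw[of k] f]] by simp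
   also have "\<dots> \<le> 2 * (1/2)^k" using Fd[of k] Fd[of "Suc k"] zero_le_power[of "1/2::real" k] unfolding power_Suc by linarith
   finally show ?thesis using C(1) by (simp add: mult_left_mono)
  qed
  obtain v where v: "v \<in> LW" "\<And>k. nLW (\<lambda>t. V k t - v t) \<le> 2 * (2 * C) * (1/2)^k"
   "AE t in lebesgue_on {0<..}. (\<lambda>k. V k t) \<longlonglongrightarrow> v t"
   by (rule wLp_complete[OF p1 Ioi_sets order_refl V(1) _ Vd]) (use C(1) that in auto)
  have half: "(\<lambda>k. c * (1/2::real)^k) \<longlonglongrightarrow> 0" for c by (rule tendsto_mult_right_zero[OF LIMSEQ_realpow_zero]) auto
  have vC: "nLW v \<le> C * nLW f"
  proof -
   have "nLW v \<le> C * nLW f + 4 * C * (1/2)^k" for k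
    using wLp_diff(2)[OF p1 Ioi_sets V(1)[of k] wLp_diff(1)[OF p1 Ioi_sets V(1)[of k] v(1)]] V(2)[of k] v(2)[of k] by simp
   moreover have "(\<lambda>k. C * nLW f + 4 * C * (1/2)^k) \<longlonglongrightarrow> C * nLW f + 0" by (intro tendsto_intros half)
   ultimately show ?thesis by (intro LIMSEQ_le_const[of _ "C * nLW f"]) auto
  qed
  note A0v = wLp_linear[OF p1 Ioi_sets _ A0 K(2) K(1)]
  \<comment> \<open>The equation defines g and integration defines u, so that only u = j v has to be
    shown. It follows from U k = j (V k), since the V k converge almost everywhere and the U k at
    every time.\<close>
  define g where "g = (\<lambda>t. f t - A0 (v t))"
  have g: "g \<in> LW" "nLW g \<le> nLW f + K * nLW v"
   using wLp_diff[OF p1 Ioi_sets f A0v(1)[OF v(1)]] A0v(2)[OF v(1)] by (auto simp: g_def)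
  define u where "u t = integral {0..t} g" for t
  have Gd: "(\<lambda>t. G k t - g t) \<in> LW" "nLW (\<lambda>t. G k t - g t) \<le> (1 + 4 * K * C) * (1/2)^k" for k
  proof -
   have "AE t in lebesgue_on {0<..}. G k t + A0 (V k t) = F k t" by (rule AE_Ioi_if_Icc[OF lsolD(5)[OF gsolD(1)[OF S]]])
   then have ae: "AE t in lebesgue_on {0<..}. (F k t - f t) - A0 (V k t - v t) = G k t - g t"
    by eventually_elim (simp add: g_def A0.diff algebra_simps)
   note Vv = wLp_diff(1)[OF p1 Ioi_sets V(1)[of k] v(1)] and Ff = wLp_diff(1)[OF p1 Ioi_sets Fw[of k] f]
   note d = wLp_diff[OF p1 Ioi_sets Ff A0v(1)[OF Vv]]
   note cg = wLp_cong_AE[OF p1 Ioi_sets d(1) ae]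
   show "(\<lambda>t. G k t - g t) \<in> LW" by (rule cg(1))
   have "K * nLW (\<lambda>t. V k t - v t) \<le> K * (2 * (2 * C) * (1/2)^k)" by (rule mult_left_mono[OF v(2) K(1)])
   then show "nLW (\<lambda>t. G k t - g t) \<le> (1 + 4 * K * C) * (1/2)^k"
    using cg(2) d(2) A0v(2)[OF Vv] Fd[of k] by (simp add: algebra_simps)
  qed
  have Ulim: "(\<lambda>k. U k t) \<longlonglongrightarrow> u t" if t: "t > 0" for t
  proof -
   have "norm (U k t - u t) \<le> hoelder_const p \<mu> * t powr (\<mu> - 1/p) * (1 + 4 * K * C) * (1/2)^k" for k
   proof -
    have "prim 0 t (G k) (U k)" by (rule lsolD(1)[OF gsolD(1)[OF S]])
    then have "U k t = integral {0..t} (G k)" using prim_eq[of 0 t "G k" "U k" t] lsolD(2)[OF gsolD(1)[OF S]] t by simp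
    moreover have "bint {0..t} (G k)" by (rule Lp_bint[OF gsolD(2)[OF S]])
    ultimately have "U k t - u t = integral {0..t} (\<lambda>s. G k s - g s)"
     using bint_integrable[OF _ wLp_bint_Icc[OF g(1)], of t] bint_integrable[of "{0..t}" "G k"]
     by (simp add: u_def HK_integral_diff)
    also have "norm \<dots> \<le> integral {0..t} (\<lambda>s. norm (G k s - g s))"
     by (rule bint_norm_integral_le[OF _ wLp_bint_Icc[OF Gd(1)]]) simp
    also have "\<dots> \<le> hoelder_const p \<mu> * t powr (\<mu> - 1/p) * nLW (\<lambda>s. G k s - g s)" by (rule wLp_integral_le[OF Gd(1) t])
    also have "\<dots> \<le> hoelder_const p \<mu> * t powr (\<mu> - 1/p) * ((1 + 4 * K * C) * (1/2)^k)"
     by (intro mult_left_mono Gd(2)) (auto simp: hoelder_const_def)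
    finally show ?thesis by (simp add: mult.assoc)
   qed
   then have "(\<lambda>k. U k t - u t) \<longlonglongrightarrow> 0" by (intro Lim_null_comparison[OF _ half] always_eventually allI)
   then show ?thesis by (simp add: LIM_zero_iff)
  qed
  have uj: "AE t in lebesgue_on {0<..}. u t = j (v t)"
  proof -
   have "AE t in lebesgue_on {0<..}. \<forall>k. U k t = j (V k t)"
    unfolding AE_all_countable by (intro allI AE_Ioi_if_Icc[OF lsolD(4)[OF gsolD(1)[OF S]]])
   then show ?thesis using v(3) AE_space
   proof eventually_elim
    case (elim t)
    have "(\<lambda>k. j (V k t)) \<longlonglongrightarrow> j (v t)" by (rule bounded_linear.tendsto[OF j(1) elim(2)])
    then have "(\<lambda>k. U k t) \<longlonglongrightarrow> j (v t)" using elim(1) by simp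
    moreover have "(\<lambda>k. U k t) \<longlonglongrightarrow> u t" by (rule Ulim) (use elim(3) in simp)
    ultimately show ?case by (rule LIMSEQ_unique[rotated])
   qed
  qed
  have "lsol T f g v u" for T
   unfolding lsol_def
  proof (intro conjI)
   show "prim 0 T g u" unfolding u_def using prim_integral[OF wLp_bint_Icc[OF g(1), of T], where x=0] by simp
   show "AE t in lebesgue_on {0..T}. g t + A0 (v t) = f t" by (simp add: g_def)
   show "AE t in lebesgue_on {0..T}. u t = j (v t)" by (rule AE_Icc_if_Ioi[OF uj])
  qed (simp_all add: u_def wLp_bint_Icc[OF v(1)])
  moreover have "nLW g \<le> (1 + C + K * C) * nLW f" "nLW v \<le> (1 + C + K * C) * nLW f"
  proof -
   have e: "(1 + C + K * C) * nLW f = nLW f + C * nLW f + K * (C * nLW f)" by (simp add: algebra_simps)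
   have pos: "0 \<le> nLW f" "0 \<le> C * nLW f" "0 \<le> K * (C * nLW f)" using C(1) K(1) by auto
   show "nLW g \<le> (1 + C + K * C) * nLW f" unfolding e using g(2) mult_left_mono[OF vC K(1)] pos by linarith
   show "nLW v \<le> (1 + C + K * C) * nLW f" unfolding e using vC pos by linarith
  qed
  ultimately show ?thesis using g(1) v(1) by blast
 qed
 have "1 + C + K * C > 0" using C(1) K(1) by (simp add: add_pos_nonneg)
 then show ?thesis using ex by blast
qed

end

section \<open>The K-functional and the interpolation space\<close>

context interpolation_pair
begin

abbreviation K where "K \<equiv> K_functional j"
abbreviation X where "X \<equiv> interp_space j (\<mu> - 1/p) p"
abbreviation nX where "nX \<equiv> interp_norm j (\<mu> - 1/p) p"

lemma K_set: "{norm a + t * norm b | a b. x = a + j b} \<noteq> {}" "t \<ge> 0 \<Longrightarrow> bdd_below {norm a + t * norm b | a b. x = a + j b}"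
proof -
 have "x = x + j 0" using j(1) by (simp add: linear_simps)
 then show "{norm a + t * norm b | a b. x = a + j b} \<noteq> {}" by blast
 show "t \<ge> 0 \<Longrightarrow> bdd_below {norm a + t * norm b | a b. x = a + j b}" by (rule bdd_belowI[of _ 0]) auto
qed

lemma K_nonneg [simp]: "t \<ge> 0 \<Longrightarrow> 0 \<le> K t x"
 unfolding K_functional_def by (rule cInf_greatest[OF K_set(1)]) auto

lemma K_le: "t \<ge> 0 \<Longrightarrow> x = a + j b \<Longrightarrow> K t x \<le> norm a + t * norm b"
 unfolding K_functional_def by (rule cInf_lower[OF _ K_set(2)]) auto

lemma K_approx:
 assumes "t \<ge> 0" "e > 0" obtains a b where "x = a + j b" "norm a + t * norm b < K t x + e"
proof -
 have "\<exists>z \<in> {norm a + t * norm b | a b. x = a + j b}. z < K t x + e"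
  using cInf_lessD[OF K_set(1)[of t x], of "K t x + e"] assms(2) unfolding K_functional_def by fastforce
 then show thesis using that by blast
qed

lemma K_le_norm: "t \<ge> 0 \<Longrightarrow> K t x \<le> norm x"
 using K_le[of t x x 0] j(1) by (simp add: linear_simps)

lemma K_zero [simp]: "t \<ge> 0 \<Longrightarrow> K t 0 = 0"
 by (rule order_antisym) (use K_le_norm[of t 0] in simp_all)

lemma K_mono:
 assumes "0 \<le> s" "s \<le> t" shows "K s x \<le> K t x"
proof (rule field_le_epsilon)
 have t: "t \<ge> 0" using assms by simp
 fix e :: real assume e: "e > 0"
 obtain a b where ab: "x = a + j b" "norm a + t * norm b < K t x + e" by (rule K_approx[OF t e])
 have "s * norm b \<le> t * norm b" using assms(2) by (simp add: mult_right_mono)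
 then show "K s x \<le> K t x + e" using K_le[OF assms(1) ab(1)] ab(2) by simp
qed

lemma K_add:
 assumes t: "t \<ge> 0" shows "K t (x + y) \<le> K t x + K t y"
proof (rule field_le_epsilon)
 fix e :: real assume "e > 0"
 then have e: "e/2 > 0" by simp
 obtain a b where ab: "x = a + j b" "norm a + t * norm b < K t x + e/2" by (rule K_approx[OF t e])
 obtain c d where cd: "y = c + j d" "norm c + t * norm d < K t y + e/2" by (rule K_approx[OF t e])
 have "K t (x + y) \<le> norm (a + c) + t * norm (b + d)"
  using ab(1) cd(1) j(1) by (intro K_le[OF t]) (simp add: linear_simps)
 also have "\<dots> \<le> (norm a + norm c) + t * (norm b + norm d)"
  using t by (intro add_mono mult_left_mono norm_triangle_ineq)
 finally show "K t (x + y) \<le> K t x + K t y + e" using ab(2) cd(2) by (simp add: algebra_simps)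
qed

lemma K_minus [simp]:
 assumes t: "t \<ge> 0" shows "K t (- x) = K t x"
proof -
 have le: "K t (- x) \<le> K t x" for x
 proof (rule field_le_epsilon)
  fix e :: real assume e: "e > 0"
  obtain a b where ab: "x = a + j b" "norm a + t * norm b < K t x + e" by (rule K_approx[OF t e])
  have "- x = - a + j (- b)" using ab(1) j(1) by (simp add: linear_simps)
  from K_le[OF t this] show "K t (- x) \<le> K t x + e" using ab(2) by simp
 qed
 show ?thesis using le[of x] le[of "- x"] by simp
qed

lemma K_double:
 assumes t: "t \<ge> 0" shows "K (2 * t) x \<le> 2 * K t x"
proof (rule field_le_epsilon)
 fix e :: real assume "e > 0"
 then have e: "e/2 > 0" by simp
 obtain a b where ab: "x = a + j b" "norm a + t * norm b < K t x + e/2" by (rule K_approx[OF t e])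
 have "K (2 * t) x \<le> norm a + 2 * t * norm b" by (rule K_le[OF _ ab(1)]) (use t in simp)
 then show "K (2 * t) x \<le> 2 * K t x + e" using ab(2) norm_ge_zero[of a] by linarith
qed

text \<open>Boundedness of j lets the X_1 part of any decomposition be measured in X_0. This
  separates the points of the interpolation space and makes K positive at x \<noteq> 0, so that
  decompositions optimal up to a factor 2 exist.\<close>

lemma K_lower: obtains D where "D > 0" "\<And>t x. t > 0 \<Longrightarrow> norm x \<le> (1 + D / t) * K t x"
proof -
 obtain D where D: "D > 0" "\<And>b. norm (j b) \<le> norm b * D" using bounded_linear.pos_bounded[OF j(1)] by blast
 have "norm x \<le> (1 + D / t) * K t x" if t: "t > 0" for t x
 proof -
  have c: "1 + D / t > 0" using t D(1) by (simp add: add_pos_pos)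
  have "norm x / (1 + D / t) \<le> K t x"
  proof (rule field_le_epsilon)
   fix e :: real assume e: "e > 0"
   obtain a b where ab: "x = a + j b" "norm a + t * norm b < K t x + e" by (rule K_approx[OF less_imp_le[OF t] e])
   have "norm x \<le> norm a + norm b * D" unfolding ab(1) by (rule order_trans[OF norm_triangle_ineq add_left_mono[OF D(2)]])
   also have "\<dots> \<le> (norm a + norm b * D) + (D / t * norm a + t * norm b)" using t D(1) by simp
   also have "\<dots> = (1 + D / t) * (norm a + t * norm b)" using t by (simp add: field_simps)
   also have "\<dots> \<le> (1 + D / t) * (K t x + e)" using ab(2) c by (intro mult_left_mono) auto
   finally show "norm x / (1 + D / t) \<le> K t x + e" using c by (simp add: pos_divide_le_eq mult.commute)
  qed
  then show ?thesis using c by (simp add: pos_divide_le_eq mult.commute)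
 qed
 then show thesis using that D(1) by blast
qed

text \<open>Monotonicity in t gives Borel measurability; \<open>max t 0\<close> makes the monotone
  function total.\<close>

lemma K_measurable:
 assumes J: "J \<in> sets lebesgue" "J \<subseteq> {0<..}" shows "smeas J (\<lambda>t. K t x / t)"
proof -
 have "mono (\<lambda>t. K (max t 0) x)" by (intro monoI K_mono) auto
 then have "(\<lambda>t. K (max t 0) x) \<in> borel_measurable borel" by (rule borel_measurable_mono)
 then have "(\<lambda>t. K (max t 0) x / t) \<in> borel_measurable borel" by measurable
 then have "(\<lambda>t. K (max t 0) x / t) \<in> borel_measurable lebesgue"
  by (simp add: measurable_completion)
 then have "(\<lambda>t. K (max t 0) x / t) \<in> borel_measurable (lebesgue_on J)" by (rule measurable_restrict_space1)
 then have "smeas J (\<lambda>t. K (max t 0) x / t)" using J by (simp add: sm_real_iff)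
 then show ?thesis using J(2) by (subst (asm) sm_cong[where g="\<lambda>t. K t x / t"]) (auto simp: max_def)
qed

text \<open>The exponents \<mu> - 1/p and dt/t combine to the weight t^(1-\<mu>) for K(t,x)/t.
  Through this identity the norm of the interpolation space inherits the calculus of weighted L_p
  norms.\<close>

lemma interp_integral_wint: "interp_integral j (\<mu> - 1/p) p x = wint {0<..} p \<mu> (\<lambda>t. K t x / t)"
 unfolding interp_integral_def wint_def
proof (rule nn_integral_cong)
 fix t :: real assume "t \<in> space (lebesgue_on {0<..})"
 then have t: "t > 0" by simp
 have p0: "p > 0" using p by simp
 have e: "t powr (- (\<mu> - 1/p) * p) = t powr (- \<mu> * p) * t" using t p0 powr_add[of t "- \<mu> * p" 1] by (simp add: algebra_simps)
 have "(t powr (- (\<mu> - 1/p)) * K t x) powr p / t = t powr (- (\<mu> - 1/p) * p) * K t x powr p / t"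
  using t by (simp only: powr_mult powr_powr K_nonneg powr_ge_zero less_imp_le)
 also have "\<dots> = t powr (- \<mu> * p) * K t x powr p" unfolding e using t by simp
 also have "\<dots> = (t powr (- \<mu>) * K t x) powr p" using t by (simp add: powr_mult powr_powr)
 also have "t powr (- \<mu>) * K t x = norm (t powr (1 - \<mu>) *\<^sub>R (K t x / t))"
  using t by (simp add: powr_diff powr_minus divide_inverse)
 finally show "ennreal ((t powr (- (\<mu> - 1/p)) * K t x) powr p / t) = ennreal (norm (t powr (1 - \<mu>) *\<^sub>R (K t x / t)) powr p)" by simp
qed

lemma X_iff: "x \<in> X \<longleftrightarrow> (\<lambda>t. K t x / t) \<in> LW"
 by (simp add: interp_space_def interp_integral_wint wLp_iff K_measurable[OF Ioi_sets order_refl])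

lemma nX_eq: "nX x = nLW (\<lambda>t. K t x / t)"
 by (simp add: interp_norm_def interp_integral_wint wLp_norm_wint)

lemma nX_nonneg [simp]: "0 \<le> nX x" by (simp add: nX_eq)

lemma X_zero [simp]: "0 \<in> X" "nX 0 = 0"
proof -
 have w: "wint {0<..} p \<mu> (\<lambda>t. K t 0 / t) = wint {0<..} p \<mu> (\<lambda>t. 0::real)"
  unfolding wint_def by (rule nn_integral_cong) simp
 have "(\<lambda>t. 0::real) \<in> LW" "nLW (\<lambda>t. 0::real) = 0" by (rule wLp_zero[OF p1])+
 then show "0 \<in> X" "nX 0 = 0" using w
  by (simp_all add: X_iff wLp_iff K_measurable[OF Ioi_sets order_refl] nX_eq wLp_norm_wint)
qed

lemma X_add:
 assumes x: "x \<in> X" and y: "y \<in> X" shows "x + y \<in> X" "nX (x + y) \<le> nX x + nX y"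
proof -
 note xy = x[unfolded X_iff] y[unfolded X_iff]
 note s = wLp_add[OF p1 Ioi_sets xy]
 have "AE t in lebesgue_on {0<..}. norm (K t (x + y) / t) \<le> 1 * norm (K t x / t + K t y / t)"
 proof (rule AE_I2)
  fix t :: real assume "t \<in> space (lebesgue_on {0<..})"
  then have t: "t > 0" by simp
  then show "norm (K t (x + y) / t) \<le> 1 * norm (K t x / t + K t y / t)"
   using K_add[of t x y] by (simp add: add_divide_distrib[symmetric] divide_right_mono)
 qed
 note m = wLp_mono[OF p1 Ioi_sets K_measurable[OF Ioi_sets order_refl] s(1) zero_le_one this]
 show "x + y \<in> X" using m(1) by (simp add: X_iff)
 show "nX (x + y) \<le> nX x + nX y" using m(2) s(2) by (simp add: nX_eq)
qed

lemma nX_minus [simp]: "nX (- x) = nX x" "- x \<in> X \<longleftrightarrow> x \<in> X"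
proof -
 have "interp_integral j (\<mu> - 1/p) p (- x) = interp_integral j (\<mu> - 1/p) p x"
  unfolding interp_integral_def by (rule nn_integral_cong) simp
 then show "nX (- x) = nX x" "- x \<in> X \<longleftrightarrow> x \<in> X" by (simp_all add: interp_norm_def interp_space_def)
qed

lemma nX_commute: "nX (x - y) = nX (y - x)"
 using nX_minus(1)[of "x - y"] by simp

lemma X_diff:
 assumes x: "x \<in> X" and y: "y \<in> X" shows "x - y \<in> X" "nX (x - y) \<le> nX x + nX y"
 using X_add[OF x, of "- y"] y by simp_all

text \<open>On [t,2t] the quotient K(s,x)/s is at least K(t,x)/(2t), and the integral of this
  quotient over (0,2t) is controlled by Hoelder's inequality. The positive power of t makes K(t,x)
  tend to 0, which is how the extension attains its initial value.\<close>

lemma K_interp_bound: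
 assumes x: "x \<in> X" and t: "t > 0"
 shows "K t x \<le> 2 * hoelder_const p \<mu> * (2 * t) powr (\<mu> - 1/p) * nX x"
proof -
 note xw = x[unfolded X_iff]
 have b: "(\<lambda>s. norm (K s x / s)) integrable_on {0..2*t}" by (rule bintD(2)[OF wLp_bint_Icc[OF xw]])
 have "K t x / (2 * t) * t = integral {t..2*t} (\<lambda>s. K t x / (2 * t))" using t by simp
 also have "\<dots> \<le> integral {t..2*t} (\<lambda>s. norm (K s x / s))"
 proof (intro integral_le)
  fix s assume s: "s \<in> {t..2*t}"
  then show "K t x / (2 * t) \<le> norm (K s x / s)" using t K_mono[of t s x] by (simp add: frac_le)
 qed (use integrable_subinterval_real[OF b] t in auto)
 also have "\<dots> \<le> integral {0..2*t} (\<lambda>s. norm (K s x / s))"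
  by (intro integral_subset_le) (use integrable_subinterval_real[OF b] b t in auto)
 also have "\<dots> \<le> hoelder_const p \<mu> * (2 * t) powr (\<mu> - 1/p) * nX x"
  unfolding nX_eq by (rule wLp_integral_le[OF xw]) (use t in simp)
 finally show ?thesis using t by simp
qed

lemma norm_le_nX: obtains C where "C > 0" "\<And>x. x \<in> X \<Longrightarrow> norm x \<le> C * nX x"
proof -
 obtain D where D: "D > 0" "\<And>t x. t > 0 \<Longrightarrow> norm x \<le> (1 + D / t) * K t x" using K_lower by blast
 define c where "c = 2 * hoelder_const p \<mu> * 2 powr (\<mu> - 1/p)"
 have c: "c \<ge> 0" by (simp add: c_def hoelder_const_def)
 have "norm x \<le> ((1 + D) * (1 + c)) * nX x" if x: "x \<in> X" for x
 proof -
  have "norm x \<le> (1 + D) * K 1 x" using D(2)[of 1 x] by simp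
  also have "\<dots> \<le> (1 + D) * (c * nX x)"
   using K_interp_bound[OF x, of 1] D(1) by (intro mult_left_mono) (auto simp: c_def)
  also have "\<dots> \<le> (1 + D) * ((1 + c) * nX x)" using D(1) by (intro mult_left_mono mult_right_mono) auto
  finally show ?thesis by simp
 qed
 moreover have "(1 + D) * (1 + c) > 0" using D(1) c by (intro mult_pos_pos) auto
 ultimately show thesis using that by blast
qed

lemma Metric_space_interp: "Metric_space X (\<lambda>x y. nX (x - y))"
proof
 show "nX (x - y) = nX (y - x)" for x y by (rule nX_commute)
 show "(nX (x - y) = 0) = (x = y)" if "x \<in> X" "y \<in> X" for x y
 proof
  assume 0: "nX (x - y) = 0"
  obtain C where "C > 0" "\<And>x. x \<in> X \<Longrightarrow> norm x \<le> C * nX x" using norm_le_nX by blast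
  then have "norm (x - y) \<le> C * nX (x - y)" using X_diff(1)[OF that] by blast
  then show "x = y" using 0 by simp
 qed simp
 show "nX (x - z) \<le> nX (x - y) + nX (y - z)" if "x \<in> X" "y \<in> X" "z \<in> X" for x y z
  using X_add(2)[OF X_diff(1)[OF that(1,2)] X_diff(1)[OF that(2,3)]] by simp
qed simp

lemma interp_cball_iff: "y \<in> interp_cball j (\<mu> - 1/p) p x r \<longleftrightarrow> x \<in> X \<and> y \<in> X \<and> nX (x - y) \<le> r"
 unfolding interp_cball_def by (rule Metric_space.in_mcball[OF Metric_space_interp])

lemma openin_interp:
 "openin (interp_topology j (\<mu> - 1/p) p) V \<longleftrightarrow> V \<subseteq> X \<and> (\<forall>x\<in>V. \<exists>r>0. \<forall>y\<in>X. nX (x - y) < r \<longrightarrow> y \<in> V)"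
 unfolding interp_topology_def Metric_space.openin_mtopology[OF Metric_space_interp]
  subset_iff Metric_space.in_mball[OF Metric_space_interp] by blast

lemma continuous_map_interp:
 assumes V: "V \<subseteq> X"
 shows "continuous_map (top_of_set S) (subtopology (interp_topology j (\<mu> - 1/p) p) V) u \<longleftrightarrow>
  u ` S \<subseteq> V \<and> (\<forall>t\<in>S. \<forall>e>0. \<exists>d>0. \<forall>s\<in>S. dist s t < d \<longrightarrow> nX (u t - u s) < e)"
proof -
 have "continuous_map (top_of_set S) (interp_topology j (\<mu> - 1/p) p) u \<longleftrightarrow>
   (\<forall>t\<in>S. \<forall>e>0. \<exists>d>0. \<forall>s\<in>S. dist s t < d \<longrightarrow> nX (u t - u s) < e)" if uV: "u ` S \<subseteq> V"
 proof -
  have u: "u t \<in> X" if "t \<in> S" for t using uV V that by blast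
  have "continuous_map (top_of_set S) (interp_topology j (\<mu> - 1/p) p) u \<longleftrightarrow>
   (\<forall>t\<in>S. \<forall>e>0. \<exists>U. openin (top_of_set S) U \<and> t \<in> U \<and> (\<forall>s\<in>U. u s \<in> Metric_space.mball X (\<lambda>x y. nX (x - y)) (u t) e))"
   unfolding interp_topology_def Metric_space.continuous_map_to_metric[OF Metric_space_interp] by simp
  also have "\<dots> \<longleftrightarrow> (\<forall>t\<in>S. \<forall>e>0. \<exists>d>0. \<forall>s\<in>S. dist s t < d \<longrightarrow> nX (u t - u s) < e)"
  proof (intro ball_cong refl all_cong1 imp_cong)
   fix t and e :: real assume t: "t \<in> S"
   show "(\<exists>U. openin (top_of_set S) U \<and> t \<in> U \<and> (\<forall>s\<in>U. u s \<in> Metric_space.mball X (\<lambda>x y. nX (x - y)) (u t) e)) \<longleftrightarrow>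
    (\<exists>d>0. \<forall>s\<in>S. dist s t < d \<longrightarrow> nX (u t - u s) < e)" (is "?l \<longleftrightarrow> ?r")
   proof
    assume ?l
    then obtain U where U: "openin (top_of_set S) U" "t \<in> U" "\<And>s. s \<in> U \<Longrightarrow> nX (u t - u s) < e"
     by (auto simp: Metric_space.in_mball[OF Metric_space_interp])
    then obtain d where "d > 0" "\<forall>s\<in>S. dist s t < d \<longrightarrow> s \<in> U" by (meson openin_euclidean_subtopology_iff)
    then show ?r using U(3) by blast
   next
    assume ?r
    then obtain d where d: "d > 0" "\<And>s. s \<in> S \<Longrightarrow> dist s t < d \<Longrightarrow> nX (u t - u s) < e" by blast
    show ?l
     by (rule exI[of _ "S \<inter> ball t d"])
      (use d t u in \<open>auto simp: Metric_space.in_mball[OF Metric_space_interp] dist_commute openin_open_Int\<close>)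
   qed
  qed
  finally show ?thesis .
 qed
 then show ?thesis by (auto simp: continuous_map_in_subtopology)
qed

end

section \<open>Traces and extensions\<close>

text \<open>Because \<mu> \<le> 1 the weight is nondecreasing, so restarting the clock at time a can
  only decrease it. Hence traces at later times obey the same bound as the trace at 0.\<close>

lemma wLp_unshift:
 assumes p: "p \<ge> 1" and \<mu>: "\<mu> \<le> 1" and a: "a \<ge> 0" and h: "h \<in> wLp {0<..} p \<mu>"
 shows "(\<lambda>t. h (t + a)) \<in> wLp {0<..} p \<mu>" "wLp_norm {0<..} p \<mu> (\<lambda>t. h (t + a)) \<le> wLp_norm {0<..} p \<mu> h"
proof -
 let ?w = "\<lambda>t. t powr (1 - \<mu>) *\<^sub>R h t"
 have w: "?w \<in> Lp {0<..} p" using h wLp_weight(2)[OF wLp_sm[OF h]] by blast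
 note wa = unshift_wLp[OF p a w]
 have wa_le: "wLp_norm {0<..} p 1 (\<lambda>t. ?w (t + a)) \<le> wLp_norm {0<..} p 1 ?w"
 proof -
  have "{t. t - a \<in> {0<..}} = {a<..}" by auto
  then have "wint {a<..} p 1 ?w = wint {0<..} p 1 (\<lambda>t. ?w (t + a))"
   using wint_shift[OF order_refl _ a wLp_sm[OF wa], of p] by simp
  then have "wLp_norm {0<..} p 1 (\<lambda>t. ?w (t + a)) = wLp_norm {a<..} p 1 ?w" by (simp add: wLp_norm_wint)
  also have "\<dots> \<le> wLp_norm {0<..} p 1 ?w" by (rule wLp_subset(2)[OF p _ _ _ w]) (use a in auto)
  finally show ?thesis .
 qed
 have sm: "smeas {0<..} (\<lambda>t. h (t + a))"
 proof -
  have "smeas {a<..} h" by (rule sm_subset[OF wLp_sm[OF h]]) (use a in auto)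
  from sm_shift[OF _ this, of a] show ?thesis by (simp add: greaterThan_def)
 qed
 have "AE t in lebesgue_on {0<..}. norm (t powr (1 - \<mu>) *\<^sub>R h (t + a)) \<le> 1 * norm (?w (t + a))"
  by (rule AE_I2) (use a \<mu> in \<open>auto intro!: mult_right_mono powr_mono2\<close>)
 note m = wLp_mono[OF p Ioi_sets sm_scaleR[OF sm_powr[OF Ioi_sets] sm] wa zero_le_one this]
 show "(\<lambda>t. h (t + a)) \<in> wLp {0<..} p \<mu>" using m(1) wLp_weight(2)[OF sm] by blast
 show "wLp_norm {0<..} p \<mu> (\<lambda>t. h (t + a)) \<le> wLp_norm {0<..} p \<mu> h"
  using m(2) wa_le unfolding wLp_weight(1) by simp
qed

text \<open>Integrability at infinity is \<mu> p > 1. With it a small X_0 norm yields a small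
  contribution of large t to the interpolation norm.\<close>

lemma inverse_wLp_at_infinity:
 fixes \<delta> :: real
 assumes p: "p > 1" and \<mu>: "1/p < \<mu>" and \<delta>: "\<delta> > 0"
 shows "(\<lambda>t. 1 / t) \<in> wLp {\<delta>..} p \<mu>"
proof -
 have b: "- (\<mu> * p) < -1" using \<mu> p by (simp add: field_simps)
 have int: "(\<lambda>t. t powr (- (\<mu> * p))) integrable_on {\<delta>..}"
  using has_integral_powr_to_inf[OF b \<delta>] by (rule has_integral_integrable)
 have "wint {\<delta>..} p \<mu> (\<lambda>t. 1 / t) = (\<integral>\<^sup>+t. ennreal (t powr (- (\<mu> * p))) \<partial>lebesgue_on {\<delta>..})"
  unfolding wint_def
 proof (rule nn_integral_cong)
  fix t :: real assume "t \<in> space (lebesgue_on {\<delta>..})"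
  then have t: "t > 0" using \<delta> by simp
  then have "norm (t powr (1 - \<mu>) *\<^sub>R (1 / t)) = t powr (- \<mu>)" by (simp add: powr_diff powr_minus divide_inverse)
  then show "ennreal (norm (t powr (1 - \<mu>) *\<^sub>R (1 / t)) powr p) = ennreal (t powr (- (\<mu> * p)))" by (simp add: powr_powr)
 qed
 also have "\<dots> < \<infinity>" by (subst nn_integral_eq_integral_on[OF _ _ int]) auto
 moreover have "smeas {\<delta>..} (\<lambda>t. 1 / t)"
  by (rule sm_continuous_on) (use \<delta> in \<open>auto intro!: continuous_intros\<close>)
 ultimately show ?thesis by (simp add: wLp_iff)
qed

context interpolation_pair
begin

text \<open>The counterpart of \<open>E1\<close> on the half-line, with derivative and X_1-valued
  representative carried along instead of being recovered from u.\<close>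

definition evol :: "(real \<Rightarrow> 'a) \<Rightarrow> (real \<Rightarrow> 'b) \<Rightarrow> (real \<Rightarrow> 'a) \<Rightarrow> bool" where
 "evol g v u \<longleftrightarrow> (\<forall>T. prim 0 T g u) \<and> (AE t in lebesgue_on {0<..}. u t = j (v t)) \<and>
   g \<in> LW \<and> v \<in> LW"

lemma evolD:
 assumes "evol g v u"
 shows "prim 0 T g u" "AE t in lebesgue_on {0<..}. u t = j (v t)" "g \<in> LW" "v \<in> LW"
 using assms by (auto simp: evol_def)

text \<open>The value u(s) is decomposed by means of the average b of v over [s,s+\<tau>]: the
  deviation of u(s) from j b costs the integral of |g|, and \<tau> norm b costs the integral of
  |v|.\<close>

lemma K_trace:
 assumes u: "prim s (s + \<tau>) g u" and v: "bint {s..s + \<tau>} v"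
  and uj: "AE t in lebesgue_on {s..s + \<tau>}. u t = j (v t)" and \<tau>: "\<tau> > 0"
 shows "K \<tau> (u s) \<le> integral {s..s + \<tau>} (\<lambda>r. norm (g r) + norm (v r))"
proof -
 let ?J = "{s..s + \<tau>}"
 let ?G = "integral ?J (\<lambda>r. norm (g r))"
 define b where "b = (1/\<tau>) *\<^sub>R integral ?J v"
 have J: "?J \<in> sets lebesgue" by simp
 note uc = prim_continuous_on[OF u]
 have gi: "(\<lambda>r. norm (g r)) integrable_on ?J" by (rule bintD(2)[OF prim_bint[OF u]])
 have "j (integral ?J v) = integral ?J (j \<circ> v)" by (rule integral_linear[OF bint_integrable[OF J v] j(1), symmetric])
 also have "\<dots> = integral ?J u" using integral_AE_eq[OF J uj] by (simp add: o_def)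
 finally have jb: "j b = (1/\<tau>) *\<^sub>R integral ?J u" using j(1) by (simp add: b_def linear_simps)
 have "integral ?J (\<lambda>r. u s - u r) = \<tau> *\<^sub>R u s - integral ?J u"
  using \<tau> integrable_continuous_real[OF uc] by (subst HK_integral_diff) auto
 then have a: "u s - j b = (1/\<tau>) *\<^sub>R integral ?J (\<lambda>r. u s - u r)" using \<tau> by (simp add: jb scaleR_diff_right)
 have "norm (integral ?J (\<lambda>r. u s - u r)) \<le> ?G * (s + \<tau> - s)"
 proof (rule integral_bound)
  show "continuous_on ?J (\<lambda>r. u s - u r)" by (intro continuous_intros uc)
  show "norm (u s - u r) \<le> ?G" if r: "r \<in> ?J" for r
  proof -
   have "norm (u r - u s) \<le> integral {s..r} (\<lambda>r. norm (g r))" by (rule prim_norm_diff_le[OF u]) (use r in auto)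
   also have "\<dots> \<le> ?G"
    by (rule integral_subset_le[OF _ integrable_subinterval_real[OF gi] gi]) (use r in auto)
   finally show "norm (u s - u r) \<le> ?G" by (simp add: norm_minus_commute)
  qed
 qed (use \<tau> in simp)
 then have na: "norm (u s - j b) \<le> ?G" using \<tau> by (simp add: a pos_divide_le_eq)
 have "\<tau> * norm b = norm (integral ?J v)" using \<tau> by (simp add: b_def)
 also have "\<dots> \<le> integral ?J (\<lambda>r. norm (v r))" by (rule bint_norm_integral_le[OF J v])
 finally have nb: "\<tau> * norm b \<le> integral ?J (\<lambda>r. norm (v r))" .
 have "K \<tau> (u s) \<le> norm (u s - j b) + \<tau> * norm b" by (rule K_le) (use \<tau> in auto)
 also have "\<dots> \<le> ?G + integral ?J (\<lambda>r. norm (v r))" using na nb by simp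
 also have "\<dots> = integral ?J (\<lambda>r. norm (g r) + norm (v r))"
  by (rule HK_integral_add[OF gi bintD(2)[OF v], symmetric])
 finally show ?thesis .
qed

text \<open>Localised form of the trace estimate: for \<tau> in R only the values of g and v on S
  enter. With the whole half-line it bounds the trace; with small sets it gives continuity in
  time.\<close>

lemma trace_part:
 assumes e: "evol g v u" and s: "s \<ge> 0" and R: "R \<subseteq> {0<..}" "R \<in> sets lebesgue"
  and S: "S \<subseteq> {0<..}" "S \<in> sets lebesgue" and cover: "\<And>\<tau>. \<tau> \<in> R \<Longrightarrow> {s<..<s + \<tau>} \<subseteq> S"
 shows "(\<lambda>\<tau>. K \<tau> (u s) / \<tau>) \<in> wLp R p \<mu>"
  "wLp_norm R p \<mu> (\<lambda>\<tau>. K \<tau> (u s) / \<tau>) \<le> CH * wLp_norm S p \<mu> (\<lambda>t. norm (g t) + norm (v t))"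
proof -
 let ?f = "\<lambda>t. norm (g t) + norm (v t)"
 define \<psi> where "\<psi> t = (if t \<in> S then ?f t else 0)" for t
 have f: "?f \<in> LW"
  by (rule wLp_add(1)[OF p1 Ioi_sets wLp_norm_mem[OF p1 Ioi_sets evolD(3)[OF e]] wLp_norm_mem[OF p1 Ioi_sets evolD(4)[OF e]]])
 have \<psi>: "\<psi> \<in> LW" "nLW \<psi> = wLp_norm S p \<mu> ?f"
  unfolding \<psi>_def using wLp_restrict[OF p1 S Ioi_sets, where u="?f"] wLp_subset(1)[OF p1 S Ioi_sets f] by auto
 note \<psi>s = wLp_unshift[OF p1 \<mu>(2) s \<psi>(1)]
 have nn: "\<psi> (t + s) \<ge> 0" for t by (simp add: \<psi>_def)
 note H = hardy(2,3)[OF \<psi>s(1) nn]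
 let ?H = "\<lambda>\<tau>. integral {0..\<tau>} (\<lambda>t. \<psi> (t + s)) / \<tau>"
 have "AE \<tau> in lebesgue_on R. norm (K \<tau> (u s) / \<tau>) \<le> 1 * norm (?H \<tau>)"
 proof (rule AE_I2)
  fix \<tau> assume "\<tau> \<in> space (lebesgue_on R)"
  then have \<tau>: "\<tau> \<in> R" "\<tau> > 0" using R(1) by auto
  have sub: "{s..s + \<tau>} \<subseteq> {0..s + \<tau>}" using s by auto
  have "K \<tau> (u s) \<le> integral {s..s + \<tau>} ?f"
  proof (rule K_trace)
   show "prim s (s + \<tau>) g u" by (rule prim_sub[OF evolD(1)[OF e] s order_refl])
   show "bint {s..s + \<tau>} v" by (rule bint_sub[OF wLp_bint_Icc[OF evolD(4)[OF e]] sub]) auto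
   show "AE t in lebesgue_on {s..s + \<tau>}. u t = j (v t)"
    by (rule AE_lebesgue_on_subset[OF _ _ sub AE_Icc_if_Ioi[OF evolD(2)[OF e]]]) auto
  qed (rule \<tau>)
  also have "integral {s..s + \<tau>} ?f = integral {0..\<tau>} (\<lambda>t. ?f (t + s))"
   using integral_shift_Icc[of 0 s \<tau> "\<lambda>t. ?f (t + s)"] by (simp add: add.commute)
  also have "\<dots> = integral {0..\<tau>} (\<lambda>t. \<psi> (t + s))"
   unfolding integral_interior
  proof (rule HK_integral_cong)
   fix t assume "t \<in> {0<..<\<tau>}"
   then have "t + s \<in> S" using cover[OF \<tau>(1)] by auto
   then show "?f (t + s) = \<psi> (t + s)" by (simp add: \<psi>_def)
  qed
  finally have "K \<tau> (u s) \<le> integral {0..\<tau>} (\<lambda>t. \<psi> (t + s))" .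
  moreover from this have "0 \<le> integral {0..\<tau>} (\<lambda>t. \<psi> (t + s))"
   using \<tau>(2) K_nonneg[of \<tau> "u s"] by linarith
  ultimately show "norm (K \<tau> (u s) / \<tau>) \<le> 1 * norm (?H \<tau>)" using \<tau>(2) by (simp add: divide_right_mono)
 qed
 note m = wLp_mono[OF p1 R(2) K_measurable[OF R(2,1)] wLp_subset(1)[OF p1 R Ioi_sets H(1)] zero_le_one this]
 show "(\<lambda>\<tau>. K \<tau> (u s) / \<tau>) \<in> wLp R p \<mu>" by (rule m(1))
 have "wLp_norm R p \<mu> (\<lambda>\<tau>. K \<tau> (u s) / \<tau>) \<le> wLp_norm R p \<mu> ?H" using m(2) by simp
 also have "\<dots> \<le> nLW ?H" by (rule wLp_subset(2)[OF p1 R Ioi_sets H(1)])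
 also have "\<dots> \<le> CH * nLW (\<lambda>t. \<psi> (t + s))" by (rule H(2))
 also have "\<dots> \<le> CH * wLp_norm S p \<mu> ?f" using \<psi>s(2) \<psi>(2) hardy(1) by simp
 finally show "wLp_norm R p \<mu> (\<lambda>\<tau>. K \<tau> (u s) / \<tau>) \<le> CH * wLp_norm S p \<mu> ?f" .
qed

lemma trace_bound:
 assumes e: "evol g v u" and s: "s \<ge> 0"
 shows "u s \<in> X" "nX (u s) \<le> CH * (nLW g + nLW v)"
proof -
 have "{s<..<s + \<tau>} \<subseteq> {0<..}" for \<tau> using s by auto
 note t = trace_part[OF e s order_refl Ioi_sets order_refl Ioi_sets this]
 show "u s \<in> X" using t(1) by (simp add: X_iff)
 have "nLW (\<lambda>t. norm (g t) + norm (v t)) \<le> nLW g + nLW v"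
  using wLp_add(2)[OF p1 Ioi_sets wLp_norm_mem[OF p1 Ioi_sets evolD(3)[OF e]] wLp_norm_mem[OF p1 Ioi_sets evolD(4)[OF e]]]
  by (simp add: wLp_norm_norm)
 then show "nX (u s) \<le> CH * (nLW g + nLW v)"
  using t(2) mult_left_mono[OF _ less_imp_le[OF hardy(1)]] unfolding nX_eq by (meson order_trans)
qed

text \<open>For small \<open>\<tau>\<close> both traces are controlled by the mass of the derivatives near \<open>t0\<close>, for large
 \<open>\<tau>\<close> the increment of \<open>u\<close> in \<open>X\<^sub>0\<close> suffices.\<close>

lemma trace_continuous:
 assumes e: "evol g v u" and t0: "t0 \<ge> 0" and eps: "\<epsilon> > 0"
 shows "\<exists>d>0. \<forall>t\<ge>0. \<bar>t - t0\<bar> < d \<longrightarrow> nX (u t0 - u t) < \<epsilon>"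
proof -
 let ?f = "\<lambda>t. norm (g t) + norm (v t)"
 \<comment> \<open>The window must contain [s,s+\<tau>] for all s and \<tau> with |s - t0| <
   \<delta> and \<tau> < \<delta>, where \<delta> = 1/(n+1); this explains the factor 2 on the
   right.\<close>
 define D where "D n = {0<..} \<inter> {t0 - 1 / real (Suc n)<..<t0 + 2 / real (Suc n)}" for n
 have D: "D n \<in> sets lebesgue" "D n \<subseteq> {0<..}" for n by (auto simp: D_def)
 have f: "?f \<in> LW"
  by (rule wLp_add(1)[OF p1 Ioi_sets wLp_norm_mem[OF p1 Ioi_sets evolD(3)[OF e]] wLp_norm_mem[OF p1 Ioi_sets evolD(4)[OF e]]])
 have "(\<lambda>n. wLp_norm (D n) p \<mu> ?f) \<longlonglongrightarrow> 0"
 proof (rule wLp_norm_vanish[OF p1 f D])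
  have ev: "eventually (\<lambda>n. t \<notin> D n) sequentially" if t: "t \<noteq> t0" for t
  proof -
   have "(\<lambda>n. t0 - 1 / real (Suc n)) \<longlonglongrightarrow> t0 - 0" "(\<lambda>n. t0 + 2 / real (Suc n)) \<longlonglongrightarrow> t0 + 0"
    by (intro tendsto_intros lim_const_over_n[THEN LIMSEQ_Suc])+
   then have l: "(\<lambda>n. t0 - 1 / real (Suc n)) \<longlonglongrightarrow> t0" "(\<lambda>n. t0 + 2 / real (Suc n)) \<longlonglongrightarrow> t0" by simp_all
   show ?thesis
   proof (cases "t < t0")
    case True
    show ?thesis using order_tendstoD(1)[OF l(1) True] by (rule eventually_mono) (simp add: D_def)
   next
    case False
    then have t0t: "t0 < t" using t by simp
    show ?thesis using order_tendstoD(2)[OF l(2) t0t] by (rule eventually_mono) (simp add: D_def)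
   qed
  qed
  have "negligible {t \<in> {0<..}. \<not> eventually (\<lambda>n. t \<notin> D n) sequentially}"
   by (rule negligible_subset[of "{t0}"]) (use ev in auto)
  then show "AE t in lebesgue_on {0<..}. eventually (\<lambda>n. t \<notin> D n) sequentially"
   by (simp add: AE_lebesgue_on_negligible)
 qed
 moreover have "\<epsilon> / (4 * CH) > 0" using eps hardy(1) by simp
 ultimately have "eventually (\<lambda>n. wLp_norm (D n) p \<mu> ?f < \<epsilon> / (4 * CH)) sequentially" by (rule order_tendstoD(2))
 then obtain n where "wLp_norm (D n) p \<mu> ?f < \<epsilon> / (4 * CH)" by (auto simp: eventually_sequentially)
 then have n: "CH * wLp_norm (D n) p \<mu> ?f < \<epsilon> / 4" using hardy(1) by (simp add: field_simps)
 define \<delta> where "\<delta> = 1 / real (Suc n)"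
 have \<delta>: "\<delta> > 0" "\<delta> \<le> 1" by (simp_all add: \<delta>_def)
 have Dn: "D n = {0<..} \<inter> {t0 - \<delta><..<t0 + 2 * \<delta>}" by (simp add: D_def \<delta>_def)
 define c where "c = wLp_norm {\<delta>..} p \<mu> (\<lambda>\<tau>. 1 / \<tau>)"
 have "continuous_on {0..t0 + 1} u" by (rule prim_continuous_on[OF evolD(1)[OF e]])
 then have "\<exists>d>0. \<forall>t\<in>{0..t0 + 1}. dist t t0 < d \<longrightarrow> dist (u t) (u t0) < \<epsilon> / (4 * (c + 1))"
  using t0 eps unfolding continuous_on_iff c_def by (simp add: add_nonneg_pos)
 then obtain d where d: "d > 0" "\<And>t. t \<in> {0..t0 + 1} \<Longrightarrow> dist t t0 < d \<Longrightarrow> dist (u t) (u t0) < \<epsilon> / (4 * (c + 1))" by blast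
 have "nX (u t0 - u t) < \<epsilon>" if t: "t \<ge> 0" "\<bar>t - t0\<bar> < min d \<delta>" for t
 proof -
  let ?z = "u t0 - u t"
  let ?k = "\<lambda>x \<tau>. K \<tau> x / \<tau>"
  have z: "?z \<in> X" by (intro X_diff(1) trace_bound(1)[OF e] t t0)
  have R: "{0<..<\<delta>} \<subseteq> {0<..}" "{0<..<\<delta>} \<in> sets lebesgue" by auto
  have near: "?k (u s) \<in> wLp {0<..<\<delta>} p \<mu>" "wLp_norm {0<..<\<delta>} p \<mu> (?k (u s)) < \<epsilon> / 4"
   if s: "s \<ge> 0" "\<bar>s - t0\<bar> < \<delta>" for s
  proof -
   have cover: "{s<..<s + \<tau>} \<subseteq> D n" if "\<tau> \<in> {0<..<\<delta>}" for \<tau> using that s unfolding Dn by auto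
   note tp = trace_part[OF e s(1) R D(2) D(1) cover]
   show "?k (u s) \<in> wLp {0<..<\<delta>} p \<mu>" by (rule tp(1))
   show "wLp_norm {0<..<\<delta>} p \<mu> (?k (u s)) < \<epsilon> / 4" by (rule le_less_trans[OF tp(2) n])
  qed
  have nt: "?k (u t) \<in> wLp {0<..<\<delta>} p \<mu>" "wLp_norm {0<..<\<delta>} p \<mu> (?k (u t)) < \<epsilon> / 4"
   "?k (u t0) \<in> wLp {0<..<\<delta>} p \<mu>" "wLp_norm {0<..<\<delta>} p \<mu> (?k (u t0)) < \<epsilon> / 4"
   by (rule near; use t t0 \<delta> in simp)+
  have le: "AE \<tau> in lebesgue_on {0<..<\<delta>}. norm (?k ?z \<tau>) \<le> 1 * norm (?k (u t0) \<tau> + ?k (u t) \<tau>)"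
  proof (rule AE_I2)
   fix \<tau> assume "\<tau> \<in> space (lebesgue_on {0<..<\<delta>})"
   then have \<tau>: "\<tau> > 0" by simp
   then show "norm (?k ?z \<tau>) \<le> 1 * norm (?k (u t0) \<tau> + ?k (u t) \<tau>)"
    using K_add[of \<tau> "u t0" "- u t"] by (simp add: add_divide_distrib[symmetric] divide_right_mono)
  qed
  have A: "wLp_norm {0<..<\<delta>} p \<mu> (?k ?z) < \<epsilon> / 2"
   using wLp_mono(2)[OF p1 R(2) K_measurable[OF R(2,1)] wLp_add(1)[OF p1 R(2) nt(3,1)] zero_le_one le]
    wLp_add(2)[OF p1 R(2) nt(3,1)] nt(2,4) by simp
  have R': "{\<delta>..} \<in> sets lebesgue" "{\<delta>..} \<subseteq> {0<..}" using \<delta> by auto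
  have le': "AE \<tau> in lebesgue_on {\<delta>..}. norm (?k ?z \<tau>) \<le> norm ?z * norm (1 / \<tau>)"
   by (rule AE_I2) (use \<delta> K_le_norm[of _ ?z] in \<open>simp add: divide_right_mono\<close>)
  have "wLp_norm {\<delta>..} p \<mu> (?k ?z) \<le> norm ?z * c"
   unfolding c_def by (rule wLp_mono(2)[OF p1 R'(1) K_measurable[OF R'] inverse_wLp_at_infinity[OF p \<mu>(1) \<delta>(1)] norm_ge_zero le'])
  also have "\<dots> \<le> \<epsilon> / (4 * (c + 1)) * c"
  proof (rule mult_right_mono)
   have "t \<le> t0 + 1" using t \<delta> by linarith
   then show "norm ?z \<le> \<epsilon> / (4 * (c + 1))"
    using d(2)[of t] t by (simp add: dist_norm norm_minus_commute)
  qed (simp add: c_def)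
  also have "\<dots> \<le> \<epsilon> / 4"
  proof -
   have "c \<ge> 0" by (simp add: c_def)
   then show ?thesis using eps by (simp add: field_simps)
  qed
  finally have B: "wLp_norm {\<delta>..} p \<mu> (?k ?z) \<le> \<epsilon> / 4" .
  have sets: "{0<..} \<inter> {..<\<delta>} = {0<..<\<delta>}" "{0<..} - {..<\<delta>} = {\<delta>..}" using \<delta> by auto
  have "nX ?z \<le> wLp_norm {0<..<\<delta>} p \<mu> (?k ?z) + wLp_norm {\<delta>..} p \<mu> (?k ?z)"
   using wLp_norm_split[OF p1 Ioi_sets _ z[unfolded X_iff], of "{..<\<delta>}"] unfolding sets nX_eq by simp
  then show ?thesis using A B eps by linarith
 qed
 then show ?thesis using d(1) \<delta>(1) by (intro exI[of _ "min d \<delta>"]) auto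
qed

end

section \<open>Dyadic interpolation and extension of initial values\<close>

lemma sm_Ioi_if_Icc:
 assumes "\<And>a b. 0 < a \<Longrightarrow> smeas {a..b} f"
 shows "smeas {0<..} f"
proof (rule sm_UN[of "\<lambda>n. {1 / real (Suc n)..real (Suc n)}"])
 show "{0<..} = (\<Union>n. {1 / real (Suc n)..real (Suc n)})"
 proof (intro equalityI subsetI)
  fix t :: real assume "t \<in> {0<..}"
  then have t: "t > 0" by simp
  obtain n where "max t (1 / t) \<le> real n" using real_arch_simple by blast
  then have "t \<le> real (Suc n)" "1 / t \<le> real (Suc n)" by auto
  then show "t \<in> (\<Union>n. {1 / real (Suc n)..real (Suc n)})" using t by (intro UN_I[of n]) (auto simp: field_simps)
 next
  fix t :: real assume "t \<in> (\<Union>n. {1 / real (Suc n)..real (Suc n)})"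
  then obtain n where "1 / real (Suc n) \<le> t" by auto
  then show "t \<in> {0<..}" by (simp add: less_le_trans[of 0 "1 / real (Suc n)" t])
 qed
qed (use assms in auto)

definition dyadic :: "real \<Rightarrow> real" where "dyadic t = 2 powr real_of_int \<lfloor>log 2 t\<rfloor>"

lemma dyadic_eq: "2 powr real_of_int n \<le> t \<Longrightarrow> t < 2 * 2 powr real_of_int n \<Longrightarrow> dyadic t = 2 powr real_of_int n"
proof -
 assume a: "2 powr real_of_int n \<le> t" "t < 2 * 2 powr real_of_int n"
 have t: "t > 0" by (rule less_le_trans[OF _ a(1)]) simp
 have "t < 2 powr (real_of_int n + 1)" using a(2) by (simp add: powr_add)
 then have "\<lfloor>log 2 t\<rfloor> = n" using a(1) t by (simp add: floor_eq_iff le_log_iff log_less_iff)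
 then show ?thesis by (simp add: dyadic_def)
qed

lemma dyadic_bounds: "t > 0 \<Longrightarrow> dyadic t \<le> t" "t > 0 \<Longrightarrow> t < 2 * dyadic t" "dyadic t > 0"
proof -
 show "dyadic t > 0" by (simp add: dyadic_def)
 assume t: "t > 0"
 have "2 powr real_of_int \<lfloor>log 2 t\<rfloor> \<le> 2 powr (log 2 t)" by (intro powr_mono) auto
 then show "dyadic t \<le> t" using t by (simp add: dyadic_def)
 have "2 powr (log 2 t) < 2 powr (real_of_int \<lfloor>log 2 t\<rfloor> + 1)" by (intro powr_less_mono) linarith+
 then show "t < 2 * dyadic t" using t by (simp add: dyadic_def powr_add)
qed

text \<open>Interpolating near-optimal decompositions \<open>x \<approx> j (B (2^n))\<close> linearly between the dyadic points
 gives a function with initial value \<open>x\<close> whose size and slope at \<open>t\<close> are of order \<open>K(t,x)/t\<close>.\<close>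

definition dyadic_interp :: "(real \<Rightarrow> 'x::real_normed_vector) \<Rightarrow> real \<Rightarrow> 'x" where
 "dyadic_interp B t = B (dyadic t) + (t / dyadic t - 1) *\<^sub>R (B (2 * dyadic t) - B (dyadic t))"

definition dyadic_slope :: "(real \<Rightarrow> 'x::real_normed_vector) \<Rightarrow> real \<Rightarrow> 'x" where
 "dyadic_slope B t = (1 / dyadic t) *\<^sub>R (B (2 * dyadic t) - B (dyadic t))"

text \<open>On the half-open dyadic interval the slope is constant. At the right end point
  \<open>dyadic\<close> jumps to the next power, and the values match because both formulas give the
  node B(2 c) there.\<close>

lemma dyadic_prim_step:
 fixes B :: "real \<Rightarrow> 'x::banach"
 defines "c \<equiv> \<lambda>n. 2 powr real_of_int n"
 shows "prim (c n) (c (n + 1)) (dyadic_slope B) (dyadic_interp B)"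
proof -
 let ?S = "(1 / c n) *\<^sub>R (B (2 * c n) - B (c n))"
 have c: "c n > 0" "c (n + 1) = 2 * c n" "c (n + 1 + 1) = 2 * (2 * c n)" for n by (simp_all add: c_def powr_add)
 have dy: "dyadic t = c n" if "c n \<le> t" "t < 2 * c n" for t using dyadic_eq[of n t] that by (simp add: c_def)
 have dy2: "dyadic (2 * c n) = 2 * c n" using dyadic_eq[of "n + 1" "2 * c n"] c(1,2)[of n] by (simp add: c_def)
 have "prim (c n) (2 * c n) (\<lambda>t. ?S) (\<lambda>t. B (c n) + integral {c n..t} (\<lambda>t. ?S))"
  by (rule prim_integral[OF bint_continuous]) (rule continuous_on_const)
 then have "prim (c n) (2 * c n) (dyadic_slope B) (dyadic_interp B)"
 proof (rule prim_cong)
  have "t = 2 * c n" if "t \<in> {c n..2 * c n}" "?S \<noteq> dyadic_slope B t" for t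
   using dy[of t] that by (cases "t = 2 * c n") (simp_all add: dyadic_slope_def)
  then have "{t \<in> {c n..2 * c n}. ?S \<noteq> dyadic_slope B t} \<subseteq> {2 * c n}" by blast
  then have "negligible {t \<in> {c n..2 * c n}. ?S \<noteq> dyadic_slope B t}"
   by (rule negligible_subset[OF negligible_sing])
  then show "AE t in lebesgue_on {c n..2 * c n}. ?S = dyadic_slope B t" by (simp add: AE_lebesgue_on_negligible)
  fix t assume t: "t \<in> {c n..2 * c n}"
  have int: "integral {c n..t} (\<lambda>t. ?S) = (t / c n - 1) *\<^sub>R (B (2 * c n) - B (c n))"
   using t c(1)[of n] by (simp add: diff_divide_distrib)
  show "B (c n) + integral {c n..t} (\<lambda>t. ?S) = dyadic_interp B t"
  proof (cases "t = 2 * c n")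
   case True
   then show ?thesis unfolding int using c(1)[of n] dy2 by (simp add: dyadic_interp_def)
  next
   case False
   then show ?thesis unfolding int using dy[of t] t by (simp add: dyadic_interp_def)
  qed
 qed (use c(1)[of n] in simp)
 then show ?thesis by (simp add: c(2))
qed

lemma dyadic_prim:
 fixes B :: "real \<Rightarrow> 'x::banach"
 assumes a: "0 < a"
 shows "prim a T (dyadic_slope B) (dyadic_interp B)"
proof -
 define c where "c = (\<lambda>n. 2 powr real_of_int n :: real)"
 define m where "m = \<lfloor>log 2 a\<rfloor>"
 obtain k where k: "T / c m < real k" using reals_Archimedean2 by blast
 have cm: "c m > 0" by (simp add: c_def)
 have join: "prim (c m) (c (m + int i)) (dyadic_slope B) (dyadic_interp B)" for i
 proof (induction i)
  case 0
  show ?case using integrable_on_refl[of "\<lambda>t. norm (dyadic_slope B t)" "c m"]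
   unfolding prim_def bint_def by (auto simp: sm_negligible)
 next
  case (Suc i)
  have "prim (c (m + int i)) (c (m + int (Suc i))) (dyadic_slope B) (dyadic_interp B)"
   using dyadic_prim_step[of "m + int i" B] by (simp add: c_def add.assoc add.commute[of 1])
  moreover have "c m \<le> c (m + int i)" "c (m + int i) \<le> c (m + int (Suc i))" by (auto simp: c_def)
  ultimately show ?case by (rule prim_join[OF Suc])
 qed
 have "c m \<le> a" using dyadic_bounds(1)[OF a] by (simp add: dyadic_def c_def m_def)
 moreover have "T \<le> c (m + int k)"
 proof -
  have "real k < 2 ^ k" by (rule of_nat_less_two_power)
  then have "T / c m \<le> 2 ^ k" using k by linarith
  then have "T \<le> 2 ^ k * c m" using cm by (simp add: pos_divide_le_eq)
  then show ?thesis by (simp add: c_def powr_add powr_realpow mult.commute)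
 qed
 ultimately show ?thesis by (rule prim_sub[OF join])
qed

context interpolation_pair
begin

text \<open>The estimates |u(t) - x| \<le> 4 K(t,x) and K(t,x) \<rightarrow> 0 give the initial
  value; the bounds of g and v by K(t,x)/t are norm bounds by the very form of the interpolation
  norm.\<close>

lemma extension_ex:
 assumes x: "x \<in> X"
 shows "\<exists>g v u. evol g v u \<and> u 0 = x \<and> nLW g \<le> 12 * nX x \<and> nLW v \<le> 12 * nX x"
proof -
 \<comment> \<open>The infimum need not be attained; the factor 2 leaves room as soon as K is
   positive, and x = 0 has the exact decomposition b = 0.\<close>
 have "\<exists>b. norm (x - j b) + c * norm b \<le> 2 * K c x" if c: "c > 0" for c
 proof (cases "x = 0")
  case True
  then show ?thesis using c j(1) by (intro exI[of _ 0]) (simp add: linear_simps)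
 next
  case False
  obtain D where D: "D > 0" "\<And>t x. t > 0 \<Longrightarrow> norm x \<le> (1 + D / t) * K t x" using K_lower by blast
  have "(1 + D / c) * K c x > 0" using D(2)[OF c, of x] False by (meson less_le_trans zero_less_norm_iff)
  moreover have "1 + D / c > 0" using D(1) c by (simp add: add_pos_pos)
  ultimately have Kc: "K c x > 0" by (simp add: zero_less_mult_iff)
  obtain a b where ab: "x = a + j b" "norm a + c * norm b < K c x + K c x" by (rule K_approx[OF less_imp_le[OF c] Kc])
  then have "x - j b = a" by simp
  then show ?thesis using ab(2) by (intro exI[of _ b]) simp
 qed
 then have "\<forall>c. \<exists>b. c > 0 \<longrightarrow> norm (x - j b) + c * norm b \<le> 2 * K c x" by blast
 then obtain B where "\<forall>c. c > 0 \<longrightarrow> norm (x - j (B c)) + c * norm (B c) \<le> 2 * K c x" using choice by metis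
 then have B: "\<And>c. c > 0 \<Longrightarrow> norm (x - j (B c)) + c * norm (B c) \<le> 2 * K c x" by blast
 define v where "v = dyadic_interp B"
 define g where "g = (\<lambda>t. j (dyadic_slope B t))"
 define u where "u t = (if t \<le> 0 then x else j (v t))" for t
 interpret j: bounded_linear j by (rule j(1))
 \<comment> \<open>12 = 6 * 2: consecutive decompositions differ by at most 6 K(c,x) in X_0, and
   K(c,x)/c \<le> 2 K(t,x)/t for c \<le> t < 2 c. The function v would allow 8; one constant serves
   both.\<close>
 have bounds: "norm (v t) \<le> 12 * (K t x / t)" "norm (g t) \<le> 12 * (K t x / t)" "norm (u t - x) \<le> 4 * K t x" if t: "t > 0" for t
 proof -
  define c where "c = dyadic t"
  define l where "l = t / c - 1"
  have c: "c > 0" "c \<le> t" "t < 2 * c" using dyadic_bounds[of t] t by (auto simp: c_def)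
  have l: "0 \<le> l" "l \<le> 1" using c by (auto simp: l_def field_simps)
  have K2: "K (2 * c) x \<le> 2 * K c x" using K_double[of c x] c by simp
  have Kt: "K c x \<le> K t x" using K_mono[of c t x] c by simp
  have b1: "norm (x - j (B c)) + c * norm (B c) \<le> 2 * K c x" by (rule B[OF c(1)])
  have b2: "norm (x - j (B (2 * c))) + 2 * (c * norm (B (2 * c))) \<le> 4 * K c x" using B[of "2 * c"] c(1) K2 by (simp add: mult.assoc)
  have nn: "0 \<le> c * norm (B c)" "0 \<le> c * norm (B (2 * c))" using c by auto
  have cK: "K c x / c \<le> 2 * (K t x / t)"
  proof -
   have "K c x * t \<le> K t x * (2 * c)" using Kt c t by (intro mult_mono) auto
   then show ?thesis using c t by (simp add: field_simps)
  qed
  have veq: "v t = (1 - l) *\<^sub>R B c + l *\<^sub>R B (2 * c)" 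
   unfolding v_def dyadic_interp_def c_def[symmetric] l_def[symmetric] by (simp add: algebra_simps)
  have "norm (v t) \<le> (1 - l) * norm (B c) + l * norm (B (2 * c))"
   unfolding veq using norm_triangle_ineq[of "(1 - l) *\<^sub>R B c" "l *\<^sub>R B (2 * c)"] l by simp
  also have "\<dots> \<le> 1 * norm (B c) + 1 * norm (B (2 * c))" using l by (intro add_mono mult_right_mono) auto
  finally have "c * norm (v t) \<le> c * norm (B c) + c * norm (B (2 * c))" using c(1) by (simp add: distrib_left[symmetric])
  also have "\<dots> \<le> 4 * K c x" using b1 b2 norm_ge_zero[of "x - j (B c)"] norm_ge_zero[of "x - j (B (2 * c))"] by linarith
  finally have "norm (v t) \<le> 4 * (K c x / c)" using c(1) by (simp add: field_simps)
  moreover have "0 \<le> K t x / t" using t by simp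
  ultimately show "norm (v t) \<le> 12 * (K t x / t)" using cK by linarith
  have "c * norm (g t) = norm (j (B (2 * c)) - j (B c))" using c(1) by (simp add: g_def dyadic_slope_def c_def[symmetric] j.scaleR j.diff)
  also have "\<dots> \<le> norm (x - j (B c)) + norm (x - j (B (2 * c)))"
   using norm_triangle_ineq4[of "x - j (B c)" "x - j (B (2 * c))"] by simp
  also have "\<dots> \<le> 6 * K c x" using b1 b2 nn by linarith
  finally have "norm (g t) \<le> 6 * (K c x / c)" using c(1) by (simp add: field_simps)
  then show "norm (g t) \<le> 12 * (K t x / t)" using cK by simp
  have "u t - x = - ((1 - l) *\<^sub>R (x - j (B c)) + l *\<^sub>R (x - j (B (2 * c))))"
  proof -
   have "u t = (1 - l) *\<^sub>R j (B c) + l *\<^sub>R j (B (2 * c))" using t unfolding u_def veq j.add j.scaleR by simp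
   then show ?thesis by (simp add: algebra_simps)
  qed
  then have "norm (u t - x) \<le> (1 - l) * norm (x - j (B c)) + l * norm (x - j (B (2 * c)))"
   using norm_triangle_ineq[of "(1 - l) *\<^sub>R (x - j (B c))" "l *\<^sub>R (x - j (B (2 * c)))"] l by (simp add: norm_minus_cancel del: minus_add_distrib)
  also have "\<dots> \<le> (1 - l) * (4 * K c x) + l * (4 * K c x)"
  proof (intro add_mono mult_left_mono)
   show "norm (x - j (B c)) \<le> 4 * K c x" using b1 nn K_nonneg[of c x] c(1) by linarith
   show "norm (x - j (B (2 * c))) \<le> 4 * K c x" using b2 nn by linarith
  qed (use l in auto)
  also have "\<dots> = 4 * K c x" by (simp add: algebra_simps)
  finally show "norm (u t - x) \<le> 4 * K t x" using Kt by simp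
 qed
 have pv: "prim a T (dyadic_slope B) v" if "0 < a" for a T unfolding v_def by (rule dyadic_prim[OF that])
 have vm: "smeas {0<..} v"
  by (rule sm_Ioi_if_Icc, rule sm_continuous_on[OF _ prim_continuous_on[OF pv]]) auto
 have gm: "smeas {0<..} g"
  unfolding g_def by (rule sm_linear[OF j(1)], rule sm_Ioi_if_Icc, rule bintD(1)[OF prim_bint[OF pv]])
 have ae: "AE t in lebesgue_on {0<..}. norm (v t) \<le> 12 * norm (K t x / t)" "AE t in lebesgue_on {0<..}. norm (g t) \<le> 12 * norm (K t x / t)"
  by (rule AE_I2, use bounds(1,2) in simp)+
 note vw = wLp_mono[OF p1 Ioi_sets vm x[unfolded X_iff] zero_le_numeral ae(1)] and gw = wLp_mono[OF p1 Ioi_sets gm x[unfolded X_iff] zero_le_numeral ae(2)]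
 have "prim 0 T g u" for T
 proof (rule prim_extend_0[OF _ wLp_bint_Icc[OF gw(1)]])
  show pu: "prim a T g u" if a: "0 < a" "a \<le> T" for a
  proof -
   have "prim a T g (\<lambda>t. j (v t))" unfolding g_def by (rule prim_linear[OF j(1) pv[OF a(1)]])
   then show ?thesis by (rule prim_cong) (use a in \<open>auto simp: u_def\<close>)
  qed
  show "continuous_on {0..T} u"
   unfolding continuous_on_eq_continuous_within
  proof
   fix t assume t: "t \<in> {0..T}"
   show "continuous (at t within {0..T}) u"
   proof (cases "t = 0")
    case True
    let ?h = "\<lambda>t. 4 * (2 * hoelder_const p \<mu> * (2 * t) powr (\<mu> - 1/p) * nX x)"
    have "((\<lambda>t. (2 * t) powr (\<mu> - 1/p)) \<longlongrightarrow> 0) (at 0 within {0..T})"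
    proof (rule tendsto_zero_powrI)
     show "((\<lambda>t. 2 * t) \<longlongrightarrow> 0) (at 0 within {0..T})" by (rule tendsto_mult_right_zero[OF tendsto_ident_at])
     show "((\<lambda>t. \<mu> - 1/p) \<longlongrightarrow> \<mu> - 1/p) (at 0 within {0..T})" by (rule tendsto_const)
     show "eventually (\<lambda>t. 0 \<le> 2 * t) (at 0 within {0..T})"
      unfolding eventually_at_filter by (intro always_eventually) auto
    qed (use \<mu> in simp)
    from tendsto_mult_right_zero[OF tendsto_mult_left_zero[OF tendsto_mult_right_zero[OF this]]]
    have lim: "(?h \<longlongrightarrow> 0) (at 0 within {0..T})" .
    have "((\<lambda>t. u t - x) \<longlongrightarrow> 0) (at 0 within {0..T})"
    proof (rule Lim_null_comparison[OF _ lim])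
     show "eventually (\<lambda>t. norm (u t - x) \<le> ?h t) (at 0 within {0..T})"
      unfolding eventually_at_filter
     proof (intro always_eventually allI impI)
      fix t :: real assume "t \<noteq> 0" "t \<in> {0..T}"
      then have "t > 0" by simp
      then show "norm (u t - x) \<le> ?h t" using bounds(3)[of t] K_interp_bound[OF x, of t] by linarith
     qed
    qed
    then have "(u \<longlongrightarrow> x) (at 0 within {0..T})" by (simp add: LIM_zero_iff)
    then show ?thesis unfolding True continuous_within by (simp add: u_def)
   next
    case False
    then have a: "0 < t/2" "t/2 \<le> T" using t by auto
    have "continuous (at t within {t/2..T}) u"
     using prim_continuous_on[OF pu[OF a]] t by (simp add: continuous_on_eq_continuous_within)
    moreover have "at t within {t/2..T} = at t within {0..T}"
     by (rule at_within_nhd[of _ "{t/2<..<t+1}"]) (use t a in auto)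
    ultimately show ?thesis by simp
   qed
  qed
 qed
 moreover have "AE t in lebesgue_on {0<..}. u t = j (v t)" by (rule AE_I2) (simp add: u_def)
 ultimately have "evol g v u" using vw(1) gw(1) by (simp add: evol_def)
 then show ?thesis using vw(2) gw(2) unfolding nX_eq by (intro exI[of _ g] exI[of _ v] exI[of _ u]) (auto simp: u_def)
qed

end

section \<open>The linear problem with initial values in the interpolation space\<close>

context weighted_mr
begin

definition csol :: "(real \<Rightarrow> 'a) \<Rightarrow> 'a \<Rightarrow> (real \<Rightarrow> 'a) \<Rightarrow> (real \<Rightarrow> 'b) \<Rightarrow> (real \<Rightarrow> 'a) \<Rightarrow> bool" where
 "csol f x g v u \<longleftrightarrow> evol g v u \<and> u 0 = x \<and> (AE t in lebesgue_on {0<..}. g t + A0 (v t) = f t)"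

lemma csolD:
 assumes "csol f x g v u"
 shows "evol g v u" "u 0 = x" "AE t in lebesgue_on {0<..}. g t + A0 (v t) = f t"
 using assms by (auto simp: csol_def)

lemma csol_rhs: "csol f x g v u \<Longrightarrow> f \<in> LW"
 using wLp_cong_AE(1)[OF p1 Ioi_sets wLp_add(1)[OF p1 Ioi_sets _ A0_Lp[OF _ p1 Ioi_sets]]]
  csolD(3) evolD(3,4)[OF csolD(1)] by blast

lemma csol_init: "csol f x g v u \<Longrightarrow> x \<in> X"
 using trace_bound(1)[OF csolD(1), of f x g v u 0] csolD(2)[of f x g v u] by simp

lemma csol_lincomb:
 assumes s: "csol f x g v u" and s': "csol f' x' g' v' u'"
 shows "csol (\<lambda>t. f t + c *\<^sub>R f' t) (x + c *\<^sub>R x') (\<lambda>t. g t + c *\<^sub>R g' t) (\<lambda>t. v t + c *\<^sub>R v' t) (\<lambda>t. u t + c *\<^sub>R u' t)"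
proof -
 interpret j: bounded_linear j by (rule j)
 interpret A0: bounded_linear A0 by (rule A0)
 note e = evolD[OF csolD(1)[OF s]] and e' = evolD[OF csolD(1)[OF s']]
 have "prim 0 T (\<lambda>t. g t + c *\<^sub>R g' t) (\<lambda>t. u t + c *\<^sub>R u' t)" for T
  by (rule prim_add[OF e(1) prim_scale[OF e'(1)]])
 moreover have "AE t in lebesgue_on {0<..}. u t + c *\<^sub>R u' t = j (v t + c *\<^sub>R v' t)"
  using e(2) e'(2) by eventually_elim (simp add: j.add j.scaleR)
 moreover have "(\<lambda>t. g t + c *\<^sub>R g' t) \<in> LW" "(\<lambda>t. v t + c *\<^sub>R v' t) \<in> LW"
  by (intro wLp_add(1)[OF p1 Ioi_sets] wLp_scale(1)[OF p1 Ioi_sets] e(3,4) e'(3,4))+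
 moreover have "AE t in lebesgue_on {0<..}. (g t + c *\<^sub>R g' t) + A0 (v t + c *\<^sub>R v' t) = f t + c *\<^sub>R f' t"
  using csolD(3)[OF s] csolD(3)[OF s']
 proof eventually_elim
  case (elim t)
  show ?case unfolding elim[symmetric] by (simp add: A0.add A0.scaleR scaleR_add_right)
 qed
 ultimately show ?thesis using csolD(2)[OF s] csolD(2)[OF s'] by (simp add: csol_def evol_def)
qed

lemma csol_diff:
 assumes "csol f x g v u" "csol f' x' g' v' u'"
 shows "csol (\<lambda>t. f t - f' t) (x - x') (\<lambda>t. g t - g' t) (\<lambda>t. v t - v' t) (\<lambda>t. u t - u' t)"
 using csol_lincomb[OF assms, of "-1"] by simp

text \<open>The difference solves the homogeneous problem on [0,T] with initial value 0. The second
  solution lives on a bounded interval only and its v' is merely integrable, so that solutions of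
  the quasilinear problem can be compared with half-line solutions.\<close>

lemma csol_unique_on:
 assumes s: "csol f x g v u" and u': "prim 0 T g' u'" "u' 0 = x" and v': "bint {0..T} v'"
  and uj: "AE t in lebesgue_on {0..T}. u' t = j (v' t)" and eq: "AE t in lebesgue_on {0..T}. g' t + A0 (v' t) = f t"
 shows "\<forall>t\<in>{0..T}. u' t = u t" "AE t in lebesgue_on {0..T}. v' t = v t"
proof -
 interpret j: bounded_linear j by (rule j)
 interpret A0: bounded_linear A0 by (rule A0)
 note e = evolD[OF csolD(1)[OF s]]
 have "AE t in lebesgue_on {0..T}. u' t - u t = j (v' t - v t)"
  using uj AE_Icc_if_Ioi[OF e(2)] by eventually_elim (simp add: j.diff)
 moreover have "AE t in lebesgue_on {0..T}. (g' t - g t) + A0 (v' t - v t) = 0"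
  using eq AE_Icc_if_Ioi[OF csolD(3)[OF s]]
 proof eventually_elim
  case (elim t)
  have "(g' t - g t) + A0 (v' t - v t) = (g' t + A0 (v' t)) - (g t + A0 (v t))" by (simp add: A0.diff)
  then show ?case unfolding elim by simp
 qed
 ultimately have "lsol T (\<lambda>t. 0) (\<lambda>t. g' t - g t) (\<lambda>t. v' t - v t) (\<lambda>t. u' t - u t)"
  using prim_diff[OF u'(1) e(1)] bint_diff[OF _ v' wLp_bint_Icc[OF e(4)]] u'(2) csolD(2)[OF s]
  by (simp add: lsol_def)
 note un = lsol_unique[OF this lsol_zero]
 show "\<forall>t\<in>{0..T}. u' t = u t" using un(1) by (metis atLeastAtMost_iff eq_iff_diff_eq_0)
 show "AE t in lebesgue_on {0..T}. v' t = v t" using un(2) by simp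
qed

text \<open>The extension of x solves the problem with right-hand side h = g + A0 v, of norm at most
  12 (1+K) times that of x. What remains has initial value 0 and right-hand side f - h.\<close>

lemma csol_exists_bound:
 "\<exists>C>0. \<forall>f\<in>LW. \<forall>x\<in>X. \<exists>g v u. csol f x g v u \<and>
   nLW g \<le> C * (nLW f + nX x) \<and>
   nLW v \<le> C * (nLW f + nX x)"
proof -
 obtain C where C: "C > 0" "\<And>f. f \<in> LW \<Longrightarrow> \<exists>g v u. (\<forall>T. lsol T f g v u) \<and> g \<in> LW \<and> v \<in> LW \<and>
   nLW g \<le> C * nLW f \<and> nLW v \<le> C * nLW f" using weighted_solution by blast
 obtain K where K: "K \<ge> 0" "\<And>x. norm (A0 x) \<le> K * norm x" by (rule A0_bound) (rule that)
 define c where "c = 12 * (1 + K)"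
 have c: "c \<ge> 12" using K(1) by (simp add: c_def)
 have "\<exists>g v u. csol f x g v u \<and> nLW g \<le> (12 + C + C * c) * (nLW f + nX x) \<and> nLW v \<le> (12 + C + C * c) * (nLW f + nX x)"
  if f: "f \<in> LW" and x: "x \<in> X" for f x
 proof -
  obtain g v u where e: "evol g v u" "u 0 = x" "nLW g \<le> 12 * nX x" "nLW v \<le> 12 * nX x" using extension_ex[OF x] by blast
  note gv = evolD(3,4)[OF e(1)]
  note Av = wLp_linear[OF p1 Ioi_sets gv(2) A0 K(2) K(1)]
  define h where "h t = g t + A0 (v t)" for t
  have h: "h \<in> LW" "nLW h \<le> c * nX x"
  proof -
   show "h \<in> LW" unfolding h_def by (rule wLp_add(1)[OF p1 Ioi_sets gv(1) Av(1)])
   have "nLW h \<le> nLW g + nLW (\<lambda>t. A0 (v t))" unfolding h_def by (rule wLp_add(2)[OF p1 Ioi_sets gv(1) Av(1)])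
   also have "\<dots> \<le> 12 * nX x + K * (12 * nX x)" using e(3) Av(2) mult_left_mono[OF e(4) K(1)] by linarith
   finally show "nLW h \<le> c * nX x" by (simp add: c_def algebra_simps)
  qed
  have hs: "csol h x g v u" using e(1,2) by (simp add: csol_def h_def)
  note fh = wLp_diff[OF p1 Ioi_sets f h(1)]
  obtain g' v' u' where s: "\<And>T. lsol T (\<lambda>t. f t - h t) g' v' u'" "g' \<in> LW" "v' \<in> LW"
   "nLW g' \<le> C * nLW (\<lambda>t. f t - h t)" "nLW v' \<le> C * nLW (\<lambda>t. f t - h t)" using C(2)[OF fh(1)] by blast
  have s': "csol (\<lambda>t. f t - h t) 0 g' v' u'"
   unfolding csol_def evol_def using lsolD(1,2)[OF s(1)] AE_Ioi_if_Icc[OF lsolD(4)[OF s(1)]]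
    AE_Ioi_if_Icc[OF lsolD(5)[OF s(1)]] s(2,3) by blast
  have sol: "csol f x (\<lambda>t. g' t + g t) (\<lambda>t. v' t + v t) (\<lambda>t. u' t + u t)"
   using csol_lincomb[OF s' hs, of 1] by simp
  have "C * nLW (\<lambda>t. f t - h t) \<le> C * (nLW f + c * nX x)" using fh(2) h(2) C(1) by (intro mult_left_mono) auto
  then have b: "C * nLW (\<lambda>t. f t - h t) + 12 * nX x \<le> (12 + C + C * c) * (nLW f + nX x)"
  proof -
   have "(12 + C + C * c) * (nLW f + nX x) = (C * (nLW f + c * nX x) + 12 * nX x) + (12 * nLW f + C * nX x + C * (c * nLW f))"
    by (simp add: algebra_simps)
   moreover have "0 \<le> 12 * nLW f + C * nX x + C * (c * nLW f)" using C(1) c by (intro add_nonneg_nonneg mult_nonneg_nonneg) auto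
   ultimately show ?thesis using \<open>C * nLW (\<lambda>t. f t - h t) \<le> C * (nLW f + c * nX x)\<close> by linarith
  qed
  have "nLW (\<lambda>t. g' t + g t) \<le> (12 + C + C * c) * (nLW f + nX x)"
   using wLp_add(2)[OF p1 Ioi_sets s(2) gv(1)] s(4) e(3) b by linarith
  moreover have "nLW (\<lambda>t. v' t + v t) \<le> (12 + C + C * c) * (nLW f + nX x)"
   using wLp_add(2)[OF p1 Ioi_sets s(3) gv(2)] s(5) e(4) b by linarith
  ultimately show ?thesis using sol by blast
 qed
 moreover have "12 + C + C * c > 0" using C(1) c by (intro add_pos_nonneg) auto
 ultimately show ?thesis by blast
qed

text \<open>One constant for derivative, X_1 norm and trace at all times, valid for every solution.
  It refers to the half-line, hence is independent of the short interval chosen later; C \<ge> 1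
  spares case distinctions.\<close>

definition csol_const :: "real \<Rightarrow> bool" where
 "csol_const C \<longleftrightarrow> C \<ge> 1 \<and> (\<forall>f x g v u. csol f x g v u \<longrightarrow>
   nLW g \<le> C * (nLW f + nX x) \<and>
   nLW v \<le> C * (nLW f + nX x) \<and>
   (\<forall>s\<ge>0. nX (u s) \<le> C * (nLW f + nX x)))"

text \<open>Uniqueness transfers the bounds from the constructed solution to any other one. The
  trace estimate acts on the sum of two norms, each with constant C, which explains CH * (2 *
  C).\<close>

lemma csol_const_ex: "\<exists>C. csol_const C"
proof -
 obtain C where C: "C > 0" "\<And>f x. f \<in> LW \<Longrightarrow> x \<in> X \<Longrightarrow> \<exists>g v u. csol f x g v u \<and>
   nLW g \<le> C * (nLW f + nX x) \<and> nLW v \<le> C * (nLW f + nX x)" using csol_exists_bound by blast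
 interpret A0: bounded_linear A0 by (rule A0)
 define D where "D = 1 + C + CH * (2 * C)"
 have D: "D \<ge> 1" "C \<le> D" "CH * (2 * C) \<le> D" using C(1) hardy(1) by (auto simp: D_def)
 have "nLW g \<le> D * (nLW f + nX x) \<and> nLW v \<le> D * (nLW f + nX x) \<and> (\<forall>s\<ge>0. nX (u s) \<le> D * (nLW f + nX x))"
  if s: "csol f x g v u" for f x g v u
 proof -
  obtain g' v' u' where s': "csol f x g' v' u'" "nLW g' \<le> C * (nLW f + nX x)" "nLW v' \<le> C * (nLW f + nX x)"
   using C(2)[OF csol_rhs[OF s] csol_init[OF s]] by blast
  note e = evolD[OF csolD(1)[OF s]]
  have "AE t in lebesgue_on {0..T}. v t = v' t" for T
   by (rule csol_unique_on(2)[OF s'(1) e(1) csolD(2)[OF s] wLp_bint_Icc[OF e(4)] AE_Icc_if_Ioi[OF e(2)] AE_Icc_if_Ioi[OF csolD(3)[OF s]]])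
  then have vv: "AE t in lebesgue_on {0<..}. v t = v' t" by (rule AE_Ioi_if_Icc)
  have gg: "AE t in lebesgue_on {0<..}. g t = g' t"
   using vv csolD(3)[OF s] csolD(3)[OF s'(1)] by eventually_elim (metis add_right_cancel)
  have n: "nLW g = nLW g'" "nLW v = nLW v'"
   using wLp_cong_AE(2)[OF p1 Ioi_sets e(3) gg] wLp_cong_AE(2)[OF p1 Ioi_sets e(4) vv] by auto
  have pos: "0 \<le> nLW f + nX x" by simp
  have "nX (u r) \<le> D * (nLW f + nX x)" if "r \<ge> 0" for r
  proof -
   have "nX (u r) \<le> CH * (nLW g + nLW v)" by (rule trace_bound(2)[OF csolD(1)[OF s] that])
   also have "\<dots> \<le> CH * (2 * C * (nLW f + nX x))" using n s'(2,3) hardy(1) by (intro mult_left_mono) auto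
   also have "\<dots> \<le> D * (nLW f + nX x)" using mult_right_mono[OF D(3) pos] by (simp add: mult.assoc)
   finally show ?thesis .
  qed
  moreover have "nLW g \<le> D * (nLW f + nX x)" "nLW v \<le> D * (nLW f + nX x)"
   using n s'(2,3) mult_right_mono[OF D(2) pos] by linarith+
  ultimately show ?thesis by blast
 qed
 then show ?thesis using D(1) unfolding csol_const_def by blast
qed

lemma csol_constD:
 assumes "csol_const C" "csol f x g v u"
 shows "nLW g \<le> C * (nLW f + nX x)"
  "nLW v \<le> C * (nLW f + nX x)"
  "s \<ge> 0 \<Longrightarrow> nX (u s) \<le> C * (nLW f + nX x)" "C \<ge> 1"
 using assms unfolding csol_const_def by blast+

lemma csol_exists: "f \<in> LW \<Longrightarrow> x \<in> X \<Longrightarrow> \<exists>g v u. csol f x g v u"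
 using csol_exists_bound by blast

end

section \<open>The quasilinear problem\<close>

locale quasilinear_setting = weighted_mr j p "blinfun_apply (A u0)" \<mu>
 for j :: "'b::banach \<Rightarrow> 'a::banach" and p \<mu> :: real and A :: "'a \<Rightarrow> 'b \<Rightarrow>\<^sub>L 'a" and u0 :: 'a +
 fixes F :: "'a \<Rightarrow> 'a" and r L :: real
 assumes u0: "u0 \<in> X" and L: "L \<ge> 0"
  and lipA: "\<And>x y. x \<in> X \<Longrightarrow> y \<in> X \<Longrightarrow> nX (x - u0) \<le> r \<Longrightarrow> nX (y - u0) \<le> r \<Longrightarrow> dist (A x) (A y) \<le> L * nX (x - y)"
  and lipF: "\<And>x y. x \<in> X \<Longrightarrow> y \<in> X \<Longrightarrow> nX (x - u0) \<le> r \<Longrightarrow> nX (y - u0) \<le> r \<Longrightarrow> dist (F x) (F y) \<le> L * nX (x - y)"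
begin

text \<open>Continuity into the interpolation space in \<epsilon>-\<delta> form, as X is a set with
  its own metric inside the type of X_0.\<close>

definition Xcont :: "real \<Rightarrow> (real \<Rightarrow> 'a) \<Rightarrow> bool" where
 "Xcont T u \<longleftrightarrow> u ` {0..T} \<subseteq> X \<and> (\<forall>t\<in>{0..T}. \<forall>e>0. \<exists>d>0. \<forall>s\<in>{0..T}. dist s t < d \<longrightarrow> nX (u t - u s) < e)"

lemma evol_Xcont:
 assumes e: "evol g v u" shows "Xcont T u"
 unfolding Xcont_def
proof (intro conjI ballI allI impI)
 show "u ` {0..T} \<subseteq> X" using trace_bound(1)[OF e] by auto
 fix t \<epsilon> :: real assume "t \<in> {0..T}" "\<epsilon> > 0"
 then obtain d where "d > 0" "\<forall>s\<ge>0. \<bar>s - t\<bar> < d \<longrightarrow> nX (u t - u s) < \<epsilon>" using trace_continuous[OF e, of t \<epsilon>] by auto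
 then show "\<exists>d>0. \<forall>s\<in>{0..T}. dist s t < d \<longrightarrow> nX (u t - u s) < \<epsilon>" by (auto simp: dist_real_def)
qed

lemma Xcont_sub: "Xcont T u \<Longrightarrow> T' \<le> T \<Longrightarrow> Xcont T' u"
proof -
 assume u: "Xcont T u" and T: "T' \<le> T"
 have sub: "{0..T'} \<subseteq> {0..T}" using T by auto
 show ?thesis
  unfolding Xcont_def
 proof (intro conjI ballI allI impI)
  show "u ` {0..T'} \<subseteq> X" using u sub unfolding Xcont_def by blast
  fix t e :: real assume "t \<in> {0..T'}" "e > 0"
  then obtain d where "d > 0" "\<forall>s\<in>{0..T}. dist s t < d \<longrightarrow> nX (u t - u s) < e" using u sub unfolding Xcont_def by blast
  then show "\<exists>d>0. \<forall>s\<in>{0..T'}. dist s t < d \<longrightarrow> nX (u t - u s) < e" using sub by blast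
 qed
qed

lemma Xcont_compose:
 assumes u: "Xcont T u" "\<And>t. t \<in> {0..T} \<Longrightarrow> nX (u t - u0) \<le> r"
  and G: "\<And>x y. x \<in> X \<Longrightarrow> y \<in> X \<Longrightarrow> nX (x - u0) \<le> r \<Longrightarrow> nX (y - u0) \<le> r \<Longrightarrow> dist (G x) (G y) \<le> L * nX (x - y)"
 shows "continuous_on {0..T} (\<lambda>t. G (u t))"
 unfolding continuous_on_iff
proof (intro ballI allI impI)
 fix t e :: real assume t: "t \<in> {0..T}" and e: "e > 0"
 have "e / (L + 1) > 0" using e L by simp
 then obtain d where d: "d > 0" "\<forall>s\<in>{0..T}. dist s t < d \<longrightarrow> nX (u t - u s) < e / (L + 1)"
  using u(1) t unfolding Xcont_def by blast
 have "dist (G (u s)) (G (u t)) < e" if s: "s \<in> {0..T}" "dist s t < d" for s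
 proof -
  have X: "u s \<in> X" "u t \<in> X" using u(1) s t by (auto simp: Xcont_def)
  have "dist (G (u s)) (G (u t)) \<le> L * nX (u s - u t)" by (rule G[OF X u(2)[OF s(1)] u(2)[OF t]])
  also have "\<dots> \<le> L * (e / (L + 1))" using d(2) s L nX_commute[of "u s" "u t"] by (intro mult_left_mono) auto
  also have "\<dots> < e" using e L by (simp add: field_simps)
  finally show ?thesis .
 qed
 then show "\<exists>d>0. \<forall>s\<in>{0..T}. dist s t < d \<longrightarrow> dist (G (u s)) (G (u t)) < e" using d(1) by blast
qed

definition psi :: "(real \<Rightarrow> 'a) \<Rightarrow> (real \<Rightarrow> 'b) \<Rightarrow> real \<Rightarrow> 'a" where
 "psi u v t = F (u t) + (blinfun_apply (A u0) (v t) - blinfun_apply (A (u t)) (v t))"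

abbreviation stays where "stays T u \<equiv> Xcont T u \<and> (\<forall>t\<in>{0..T}. nX (u t - u0) \<le> r)"

lemma psi_measurable:
 assumes u: "stays T u" and v: "v \<in> wLp {0<..<T} p \<mu>"
 shows "smeas {0<..<T} (psi u v)"
proof -
 have c: "continuous_on {0<..<T} (\<lambda>t. A (u t))" "continuous_on {0<..<T} (\<lambda>t. F (u t))"
 proof -
  have sub: "{0<..<T} \<subseteq> {0..T}" by auto
  have u': "Xcont T u" "\<And>t. t \<in> {0..T} \<Longrightarrow> nX (u t - u0) \<le> r" using u by auto
  show "continuous_on {0<..<T} (\<lambda>t. A (u t))" by (rule continuous_on_subset[OF Xcont_compose[OF u' lipA] sub])
  show "continuous_on {0<..<T} (\<lambda>t. F (u t))" by (rule continuous_on_subset[OF Xcont_compose[OF u' lipF] sub])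
 qed
 have "smeas {0<..<T} (\<lambda>t. F (u t) + (blinfun_apply (A u0) (v t) - blinfun_apply (A (u t)) (v t)))"
  by (intro sm_add sm_diff sm_blinfun sm_const sm_continuous_on c wLp_sm[OF v]) auto
 then show ?thesis by (simp add: psi_def[abs_def])
qed

lemma const_wLp: "(\<lambda>t. 1::real) \<in> wLp {0<..<T} p \<mu>"
proof (cases "T \<ge> 0")
 case True
 have a: "(1 - \<mu>) * p > -1" using p \<mu> by (smt (verit) mult_nonneg_nonneg)
 have "wint {0<..<T} p \<mu> (\<lambda>t. 1::real) = (\<integral>\<^sup>+t. ennreal (t powr ((1 - \<mu>) * p)) \<partial>lebesgue_on {0<..<T})"
  unfolding wint_def by (rule nn_integral_cong) (simp add: powr_powr)
 then show ?thesis using nn_integral_powr_from_0[OF True a] by (simp add: wLp_iff)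
next
 case False
 then have "{0<..<T} = {}" by auto
 then show ?thesis by (simp add: wLp_iff wint_def space_restrict_space nn_integral_empty)
qed

text \<open>The price of a bounded term on (0,T). It tends to 0 with T and pays for F, to which no
  small factor is attached.\<close>

abbreviation kap where "kap T \<equiv> wLp_norm {0<..<T} p \<mu> (\<lambda>t. 1::real)"

text \<open>The difference splits into F(u1) - F(u2), (A(u0) - A(u1)) (v1 - v2) and (A(u2) - A(u1))
  v2. The first is small for short time, the second because u1 stays near \<open>u0\<close>, the
  third because v2 has small norm on a short interval.\<close>

lemma psi_diff:
 assumes u1: "stays T u1" and v1: "v1 \<in> wLp {0<..<T} p \<mu>" and u2: "stays T u2" and v2: "v2 \<in> wLp {0<..<T} p \<mu>"
  and \<delta>: "\<And>t. t \<in> {0<..<T} \<Longrightarrow> nX (u1 t - u0) \<le> \<delta>" "\<delta> \<ge> 0"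
  and S: "\<And>t. t \<in> {0<..<T} \<Longrightarrow> nX (u1 t - u2 t) \<le> S" "S \<ge> 0"
 shows "(\<lambda>t. psi u1 v1 t - psi u2 v2 t) \<in> wLp {0<..<T} p \<mu>"
  "wLp_norm {0<..<T} p \<mu> (\<lambda>t. psi u1 v1 t - psi u2 v2 t) \<le>
   L * S * kap T + L * \<delta> * wLp_norm {0<..<T} p \<mu> (\<lambda>t. v1 t - v2 t) + L * S * wLp_norm {0<..<T} p \<mu> v2"
proof -
 let ?J = "{0<..<T}"
 let ?n = "wLp_norm ?J p \<mu>"
 have J: "?J \<in> sets lebesgue" by simp
 let ?a = "\<lambda>t. (L * S) *\<^sub>R (1::real)" and ?b = "\<lambda>t. (L * \<delta>) *\<^sub>R norm (v1 t - v2 t)" and ?c = "\<lambda>t. (L * S) *\<^sub>R norm (v2 t)"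
 note d = wLp_diff(1)[OF p1 J v1 v2]
 have a: "?a \<in> wLp ?J p \<mu>" "?n ?a \<le> L * S * kap T"
  using wLp_scale[OF p1 J const_wLp, of "L * S"] L S(2) by simp_all
 have b: "?b \<in> wLp ?J p \<mu>" "?n ?b \<le> L * \<delta> * ?n (\<lambda>t. v1 t - v2 t)"
  using wLp_scale[OF p1 J wLp_norm_mem[OF p1 J d], of "L * \<delta>"] L \<delta>(2) by (simp_all add: wLp_norm_norm)
 have c: "?c \<in> wLp ?J p \<mu>" "?n ?c \<le> L * S * ?n v2"
  using wLp_scale[OF p1 J wLp_norm_mem[OF p1 J v2], of "L * S"] L S(2) by (simp_all add: wLp_norm_norm)
 note ab = wLp_add[OF p1 J a(1) b(1)]
 note abc = wLp_add[OF p1 J ab(1) c(1)]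
 have "AE t in lebesgue_on ?J. norm (psi u1 v1 t - psi u2 v2 t) \<le> 1 * norm (?a t + ?b t + ?c t)"
 proof (rule AE_I2)
  fix t assume "t \<in> space (lebesgue_on ?J)"
  then have t: "t \<in> ?J" "t \<in> {0..T}" "0 \<in> {0..T}" by auto
  have X: "u1 t \<in> X" "u2 t \<in> X" using u1 u2 t by (auto simp: Xcont_def)
  have B: "nX (u1 t - u0) \<le> r" "nX (u2 t - u0) \<le> r" using u1 u2 t by auto
  then have B0: "nX (u0 - u0) \<le> r" using nX_nonneg[of "u1 t - u0"] by (simp del: nX_nonneg)
  let ?F = "F (u1 t) - F (u2 t)"
  let ?P = "blinfun_apply (A u0 - A (u1 t)) (v1 t - v2 t)" and ?Q = "blinfun_apply (A (u2 t) - A (u1 t)) (v2 t)"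
  have e: "psi u1 v1 t - psi u2 v2 t = ?F + ?P + ?Q"
   by (simp add: psi_def blinfun.diff_left blinfun.diff_right)
  have "norm (psi u1 v1 t - psi u2 v2 t) \<le> norm ?F + norm ?P + norm ?Q"
   unfolding e using norm_triangle_ineq[of "?F + ?P" ?Q] norm_triangle_ineq[of ?F ?P] by linarith
  also have "norm ?F \<le> L * S"
   using lipF[OF X B] S(1)[OF t(1)] L mult_left_mono[of "nX (u1 t - u2 t)" S L] by (simp add: dist_norm)
  also have "norm ?P \<le> L * \<delta> * norm (v1 t - v2 t)"
  proof -
   have "norm (A u0 - A (u1 t)) \<le> L * \<delta>"
    using lipA[OF u0 X(1) B0 B(1)] \<delta>(1)[OF t(1)] L mult_left_mono[of "nX (u0 - u1 t)" \<delta> L] nX_commute[of u0 "u1 t"] by (simp add: dist_norm)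
   then show ?thesis by (rule order_trans[OF norm_blinfun mult_right_mono]) simp
  qed
  also have "norm ?Q \<le> L * S * norm (v2 t)"
  proof -
   have "norm (A (u2 t) - A (u1 t)) \<le> L * S"
    using lipA[OF X(2,1) B(2,1)] S(1)[OF t(1)] L mult_left_mono[of "nX (u2 t - u1 t)" S L] nX_commute[of "u2 t" "u1 t"] by (simp add: dist_norm)
   then show ?thesis by (rule order_trans[OF norm_blinfun mult_right_mono]) simp
  qed
  finally show "norm (psi u1 v1 t - psi u2 v2 t) \<le> 1 * norm (?a t + ?b t + ?c t)" by simp
 qed
 note m = wLp_mono[OF p1 J sm_diff[OF psi_measurable[OF u1 v1] psi_measurable[OF u2 v2]] abc(1) zero_le_one this]
 show "(\<lambda>t. psi u1 v1 t - psi u2 v2 t) \<in> wLp ?J p \<mu>" by (rule m(1))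
 show "?n (\<lambda>t. psi u1 v1 t - psi u2 v2 t) \<le> L * S * kap T + L * \<delta> * ?n (\<lambda>t. v1 t - v2 t) + L * S * ?n v2"
  using m(2) abc(2) ab(2) a(2) b(2) c(2) by linarith
qed

text \<open>Comparison with the constant pair (u0, 0), for which \<open>psi\<close> is the constant
  F(u0).\<close>

lemma psi_bound:
 assumes u: "stays T u" and v: "v \<in> wLp {0<..<T} p \<mu>" and r: "r \<ge> 0"
  and \<delta>: "\<And>t. t \<in> {0<..<T} \<Longrightarrow> nX (u t - u0) \<le> \<delta>" "\<delta> \<ge> 0"
 shows "psi u v \<in> wLp {0<..<T} p \<mu>"
  "wLp_norm {0<..<T} p \<mu> (psi u v) \<le> kap T * (norm (F u0) + L * \<delta>) + L * \<delta> * wLp_norm {0<..<T} p \<mu> v"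
proof -
 let ?J = "{0<..<T}"
 have J: "?J \<in> sets lebesgue" by simp
 have u00: "stays T (\<lambda>t. u0)" using u0 r by (auto simp: Xcont_def intro: exI[of _ 1])
 note z = wLp_zero[OF p1]
 note d = psi_diff[OF u v u00 z(1) \<delta> \<delta>]
 have p0: "psi (\<lambda>t. u0) (\<lambda>t. 0) = (\<lambda>t. F u0)" by (simp add: psi_def[abs_def])
 have le: "AE t in lebesgue_on ?J. norm (F u0) \<le> norm (F u0) * norm (1::real)" by simp
 note F0 = wLp_mono[OF p1 J sm_const const_wLp norm_ge_zero le]
 note s = wLp_add[OF p1 J d(1)[unfolded p0] F0(1)]
 show "psi u v \<in> wLp ?J p \<mu>" using s(1) by simp
 show "wLp_norm ?J p \<mu> (psi u v) \<le> kap T * (norm (F u0) + L * \<delta>) + L * \<delta> * wLp_norm ?J p \<mu> v"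
  using s(2) d(2)[unfolded p0 z(2)] F0(2) by (simp add: algebra_simps)
qed

end

text \<open>The reference solution has data (0, u0). Data whose right-hand side and initial value
  each deviate by at most \<epsilon> change it by at most C (\<epsilon> + \<epsilon>) = 2 C
  \<epsilon>, called \<sigma> below, and the reference itself moves by at most \<sigma> on [0,T].
  The condition 3\<sigma> \<le> r keeps everything, including competing solutions, where A and F are
  Lipschitz; the bounds 1/16 and 1/4 give the contraction, and the last condition on
  \<open>kap T\<close> reserves half of \<epsilon> for F.\<close>

locale short_time = quasilinear_setting j p \<mu> A u0 F r L
 for j :: "'b::banach \<Rightarrow> 'a::banach" and p \<mu> :: real and A :: "'a \<Rightarrow> 'b \<Rightarrow>\<^sub>L 'a" and u0 :: 'a
  and F :: "'a \<Rightarrow> 'a" and r L :: real +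
 fixes C \<epsilon> T :: real and gs us :: "real \<Rightarrow> 'a" and vs :: "real \<Rightarrow> 'b"
 assumes C: "csol_const C" and eps: "\<epsilon> > 0" and T: "T > 0"
  and small: "L * C * (2 * C * \<epsilon>) \<le> 1/16" "3 * (2 * C * \<epsilon>) \<le> r"
  and ref: "csol (\<lambda>t. 0) u0 gs vs us" "\<And>t. t \<in> {0..T} \<Longrightarrow> nX (us t - u0) \<le> 2 * C * \<epsilon>"
   "wLp_norm {0<..<T} p \<mu> vs \<le> 2 * C * \<epsilon>"
  and kap: "L * C * kap T \<le> 1/4" "kap T * (norm (F u0) + L * (2 * (2 * C * \<epsilon>))) \<le> \<epsilon> / 2"
begin

abbreviation \<sigma> where "\<sigma> \<equiv> 2 * C * \<epsilon>"

lemma C1: "C \<ge> 1" using C by (simp add: csol_const_def)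
lemma sigma_pos: "\<sigma> > 0" using C1 eps by simp
lemma Ioo_lebesgue: "{0<..<t::real} \<in> sets lebesgue" by simp

lemma restrict_Ioo:
 assumes "f \<in> LW"
 shows "f \<in> wLp {0<..<t} p \<mu>" "wLp_norm {0<..<t} p \<mu> f \<le> nLW f"
 using wLp_subset[OF p1 Ioo_subset_Ioi[OF order_refl] Ioo_lebesgue Ioi_sets assms] by auto

definition good :: "'a \<Rightarrow> (real \<Rightarrow> 'a) \<Rightarrow> (real \<Rightarrow> 'a) \<Rightarrow> (real \<Rightarrow> 'b) \<Rightarrow> (real \<Rightarrow> 'a) \<Rightarrow> bool" where
 "good x f g v u \<longleftrightarrow> csol f x g v u \<and> nX (x - u0) \<le> \<epsilon> \<and> nLW f \<le> \<epsilon>"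

text \<open>The radius 2\<sigma> is \<sigma> for the distance to the reference solution, by
  linearity, plus \<sigma> for the reference solution itself.\<close>

lemma good_bounds:
 assumes "good x f g v u"
 shows "t \<in> {0..T} \<Longrightarrow> nX (u t - u0) \<le> 2 * \<sigma>" "v \<in> wLp {0<..<T} p \<mu>" "wLp_norm {0<..<T} p \<mu> v \<le> 2 * \<sigma>" "stays T u"
proof -
 have s: "csol f x g v u" and x: "nX (x - u0) \<le> \<epsilon>" and f: "nLW f \<le> \<epsilon>" using assms by (auto simp: good_def)
 have d: "csol f (x - u0) (\<lambda>t. g t - gs t) (\<lambda>t. v t - vs t) (\<lambda>t. u t - us t)" using csol_diff[OF s ref(1)] by simp
 have "C * (nLW f + nX (x - u0)) \<le> C * (\<epsilon> + \<epsilon>)" using f x C1 by (intro mult_left_mono add_mono) auto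
 then have le: "C * (nLW f + nX (x - u0)) \<le> \<sigma>" by simp
 note e = evolD[OF csolD(1)[OF s]] and es = evolD[OF csolD(1)[OF ref(1)]]
 have b: "nX (u t - u0) \<le> 2 * \<sigma>" if t: "t \<in> {0..T}" for t
 proof -
  have t0: "t \<ge> 0" using t by simp
  note X = trace_bound(1)[OF csolD(1)[OF s] t0] trace_bound(1)[OF csolD(1)[OF ref(1)] t0]
  have "nX (u t - u0) \<le> nX (u t - us t) + nX (us t - u0)"
   using X_add(2)[OF X_diff(1)[OF X] X_diff(1)[OF X(2) u0]] by simp
  then show ?thesis using csol_constD(3)[OF C d t0] le ref(2)[OF t] by linarith
 qed
 then show "t \<in> {0..T} \<Longrightarrow> nX (u t - u0) \<le> 2 * \<sigma>" .
 show v: "v \<in> wLp {0<..<T} p \<mu>" by (rule restrict_Ioo(1)[OF e(4)])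
 note vv = restrict_Ioo[OF evolD(4)[OF csolD(1)[OF d]], of T]
 have "wLp_norm {0<..<T} p \<mu> v \<le> wLp_norm {0<..<T} p \<mu> (\<lambda>t. v t - vs t) + wLp_norm {0<..<T} p \<mu> vs"
  using wLp_add(2)[OF p1 Ioo_lebesgue vv(1) restrict_Ioo(1)[OF es(4)]] by simp
 then show "wLp_norm {0<..<T} p \<mu> v \<le> 2 * \<sigma>" using vv(2) csol_constD(2)[OF C d] le ref(3) by linarith
 have "nX (u t - u0) \<le> r" if "t \<in> {0..T}" for t using b[OF that] small(2) sigma_pos by linarith
 then show "stays T u" using evol_Xcont[OF csolD(1)[OF s]] by blast
qed

definition cut :: "(real \<Rightarrow> 'a) \<Rightarrow> real \<Rightarrow> 'a" where "cut h t = (if t \<in> {0<..<T} then h t else 0)"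

lemma cut_wLp:
 "h \<in> wLp {0<..<T} p \<mu> \<Longrightarrow> cut h \<in> LW" "nLW (cut h) = wLp_norm {0<..<T} p \<mu> h"
 unfolding cut_def[abs_def] using wLp_restrict[OF p1 Ioo_subset_Ioi[OF order_refl] Ioo_lebesgue Ioi_sets, where u=h] by simp_all

text \<open>Half of \<epsilon> pays for F through \<open>kap T\<close>, the other half for (A(u0) -
  A(u)) v. The latter is quadratic: 2\<sigma> for the coefficient times 2\<sigma> for v, that is 8
  (L C \<sigma>) \<epsilon>.\<close>

lemma Phi_self:
 assumes g: "good x f g v u"
 shows "cut (psi u v) \<in> LW" "nLW (cut (psi u v)) \<le> \<epsilon>"
proof -
 note b = good_bounds[OF g]
 have r: "r \<ge> 0" using small(2) sigma_pos by linarith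
 have d: "nX (u t - u0) \<le> 2 * \<sigma>" if "t \<in> {0<..<T}" for t using b(1)[of t] that by simp
 have s2: "2 * \<sigma> \<ge> 0" using sigma_pos by simp
 note pb = psi_bound[OF b(4,2) r d s2]
 show "cut (psi u v) \<in> LW" by (rule cut_wLp(1)[OF pb(1)])
 have "L * (2 * \<sigma>) * wLp_norm {0<..<T} p \<mu> v \<le> L * (2 * \<sigma>) * (2 * \<sigma>)" using b(3) L s2 by (intro mult_left_mono) auto
 also have "\<dots> = 8 * (L * C * \<sigma>) * \<epsilon>" by (simp add: mult_ac)
 also have "\<dots> \<le> 8 * (1/16) * \<epsilon>" using small(1) eps by (intro mult_right_mono mult_left_mono) auto
 finally show "nLW (cut (psi u v)) \<le> \<epsilon>" using pb(2) kap(2) unfolding cut_wLp(2) by linarith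
qed

text \<open>The factor is 1/4 from \<open>kap T\<close> plus 4/16 from the two terms with 2\<sigma>.
  Letting the initial values differ as well makes the same inequality yield both the contraction and
  the Lipschitz dependence.\<close>

lemma Phi_diff:
 assumes g1: "good x1 f1 g1 v1 u1" and g2: "good x2 f2 g2 v2 u2"
 shows "nLW (\<lambda>t. cut (psi u1 v1) t - cut (psi u2 v2) t) \<le>
  (nLW (\<lambda>t. f1 t - f2 t) + nX (x1 - x2)) / 2"
proof -
 note b1 = good_bounds[OF g1] and b2 = good_bounds[OF g2]
 have s: "csol f1 x1 g1 v1 u1" "csol f2 x2 g2 v2 u2" using g1 g2 by (auto simp: good_def)
 define d where "d = nLW (\<lambda>t. f1 t - f2 t) + nX (x1 - x2)"
 have d0: "d \<ge> 0" "C * d \<ge> 0" using C1 by (auto simp: d_def)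
 note df = csol_diff[OF s]
 have S: "nX (u1 t - u2 t) \<le> C * d" if "t \<in> {0<..<T}" for t
  unfolding d_def by (rule csol_constD(3)[OF C df]) (use that in simp)
 have \<delta>: "nX (u1 t - u0) \<le> 2 * \<sigma>" if "t \<in> {0<..<T}" for t using b1(1)[of t] that by simp
 have s2: "2 * \<sigma> \<ge> 0" using sigma_pos by simp
 note pd = psi_diff[OF b1(4,2) b2(4,2) \<delta> s2 S d0(2)]
 have vd: "wLp_norm {0<..<T} p \<mu> (\<lambda>t. v1 t - v2 t) \<le> C * d"
  using restrict_Ioo(2)[OF evolD(4)[OF csolD(1)[OF df]], of T] csol_constD(2)[OF C df] unfolding d_def by linarith
 have "(\<lambda>t. cut (psi u1 v1) t - cut (psi u2 v2) t) = cut (\<lambda>t. psi u1 v1 t - psi u2 v2 t)"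
  by (auto simp: cut_def fun_eq_iff)
 then have "nLW (\<lambda>t. cut (psi u1 v1) t - cut (psi u2 v2) t) =
   wLp_norm {0<..<T} p \<mu> (\<lambda>t. psi u1 v1 t - psi u2 v2 t)" by (simp add: cut_wLp(2))
 also have "\<dots> \<le> L * (C * d) * kap T + L * (2 * \<sigma>) * wLp_norm {0<..<T} p \<mu> (\<lambda>t. v1 t - v2 t) + L * (C * d) * wLp_norm {0<..<T} p \<mu> v2"
  by (rule pd(2))
 also have "\<dots> \<le> L * (C * d) * kap T + L * (2 * \<sigma>) * (C * d) + L * (C * d) * (2 * \<sigma>)"
  by (intro add_mono mult_left_mono order_refl vd b2(3) mult_nonneg_nonneg[OF L s2] mult_nonneg_nonneg[OF L d0(2)])
 also have "\<dots> = (L * C * kap T + 4 * (L * C * \<sigma>)) * d" by (simp add: algebra_simps)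
 also have "\<dots> \<le> (1/4 + 4 * (1/16)) * d" using kap(1) small(1) d0 by (intro mult_right_mono add_mono mult_left_mono) auto
 finally show ?thesis by (simp add: d_def)
qed

text \<open>Banach's iteration from f = 0, for a choice of solutions G, V, U. Elements of the
  weighted space are functions and not classes, so the fixed point equation is reached only almost
  everywhere.\<close>

lemma fixed_point:
 assumes x: "x \<in> X" "nX (x - u0) \<le> \<epsilon>"
 shows "\<exists>f g v u. good x f g v u \<and> (AE t in lebesgue_on {0<..}. cut (psi u v) t = f t)"
proof -
 have ex: "\<exists>g v u. good x f g v u" if "f \<in> LW" "nLW f \<le> \<epsilon>" for f
  using csol_exists[OF that(1) x(1)] that(2) x(2) by (auto simp: good_def)
 then have "\<exists>G V U. \<forall>f. f \<in> LW \<longrightarrow> nLW f \<le> \<epsilon> \<longrightarrow> good x f (G f) (V f) (U f)" by metis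
 then obtain G V U where GVU: "\<And>f. f \<in> LW \<Longrightarrow> nLW f \<le> \<epsilon> \<Longrightarrow> good x f (G f) (V f) (U f)" by blast
 define \<Phi> where "\<Phi> f = cut (psi (U f) (V f))" for f
 define h where "h n = (\<Phi> ^^ n) (\<lambda>t. 0)" for n :: nat
 have \<Phi>: "\<Phi> f \<in> LW \<and> nLW (\<Phi> f) \<le> \<epsilon>" if "f \<in> LW \<and> nLW f \<le> \<epsilon>" for f
  using Phi_self[OF GVU, of f] that by (simp add: \<Phi>_def)
 have \<Phi>d: "nLW (\<lambda>t. \<Phi> f t - \<Phi> f' t) \<le> nLW (\<lambda>t. f t - f' t) / 2"
  if "f \<in> LW \<and> nLW f \<le> \<epsilon>" "f' \<in> LW \<and> nLW f' \<le> \<epsilon>" for f f'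
  using Phi_diff[OF GVU GVU, of f f'] that by (simp add: \<Phi>_def)
 have h: "h n \<in> LW \<and> nLW (h n) \<le> \<epsilon>" for n
 proof (induction n)
  case 0
  have "nLW (\<lambda>t. 0::'a) = 0" by (rule wLp_zero(2)[OF p1])
  then show ?case using wLp_zero(1)[OF p1] eps by (simp add: h_def)
 next
  case (Suc n)
  then show ?case using \<Phi>[of "h n"] by (simp add: h_def)
 qed
 have hS: "h (Suc n) = \<Phi> (h n)" for n by (simp add: h_def)
 have hd: "nLW (\<lambda>t. h (Suc n) t - h n t) \<le> \<epsilon> * (1/2)^n" for n
 proof (induction n)
  case 0
  have "h 0 = (\<lambda>t. 0)" by (simp add: h_def)
  then show ?case using h[of "Suc 0"] by simp
 next
  case (Suc n)
  have "nLW (\<lambda>t. h (Suc (Suc n)) t - h (Suc n) t) \<le> nLW (\<lambda>t. h (Suc n) t - h n t) / 2"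
   unfolding hS[of "Suc n"] using \<Phi>d[OF h[of "Suc n"] h[of n]] by (simp add: hS)
  then show ?case using Suc by simp
 qed
 obtain f where f: "f \<in> LW" "\<And>n. nLW (\<lambda>t. h n t - f t) \<le> 2 * \<epsilon> * (1/2)^n"
  by (rule wLp_complete[OF p1 Ioi_sets order_refl conjunct1[OF h] less_imp_le[OF eps] hd]) (rule that)
 have lim: "(\<lambda>n. c * (1/2::real)^n) \<longlonglongrightarrow> 0" for c by (rule tendsto_mult_right_zero[OF LIMSEQ_realpow_zero]) auto
 have "nLW f \<le> \<epsilon> + 2 * \<epsilon> * (1/2)^n" for n
  using wLp_diff(2)[OF p1 Ioi_sets conjunct1[OF h[of n]] wLp_diff(1)[OF p1 Ioi_sets conjunct1[OF h[of n]] f(1)]] h[of n] f(2)[of n] by simp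
 moreover have "(\<lambda>n. \<epsilon> + 2 * \<epsilon> * (1/2)^n) \<longlonglongrightarrow> \<epsilon> + 0" by (intro tendsto_intros lim)
 ultimately have fe: "nLW f \<le> \<epsilon>" by (intro LIMSEQ_le_const[of _ \<epsilon>]) auto
 have fm: "f \<in> LW \<and> nLW f \<le> \<epsilon>" using f(1) fe by simp
 have \<Phi>f: "\<Phi> f \<in> LW" using \<Phi>[OF fm] by blast
 have "nLW (\<lambda>t. \<Phi> f t - f t) \<le> 2 * \<epsilon> * (1/2)^n" for n
 proof -
  note d1 = wLp_diff(1)[OF p1 Ioi_sets conjunct1[OF h[of "Suc n"]] f(1)]
  note d2 = wLp_diff(1)[OF p1 Ioi_sets conjunct1[OF h[of "Suc n"]] \<Phi>f]
  have "nLW (\<lambda>t. \<Phi> f t - f t) \<le> nLW (\<lambda>t. h (Suc n) t - f t) + nLW (\<lambda>t. h (Suc n) t - \<Phi> f t)"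
   using wLp_diff(2)[OF p1 Ioi_sets d1 d2] by simp
  moreover have "nLW (\<lambda>t. h (Suc n) t - \<Phi> f t) \<le> nLW (\<lambda>t. h n t - f t) / 2"
   unfolding hS using \<Phi>d[OF h[of n] fm] .
  ultimately show ?thesis using f(2)[of n] f(2)[of "Suc n"] by simp
 qed
 then have "nLW (\<lambda>t. \<Phi> f t - f t) \<le> 0" by (intro LIMSEQ_le_const[OF lim]) auto
 then have "nLW (\<lambda>t. \<Phi> f t - f t) = 0" using wLp_norm_nonneg[of "{0<..}" p \<mu> "\<lambda>t. \<Phi> f t - f t"] by linarith
 from wLp_norm_zero_AE[OF p1 Ioi_sets order_refl wLp_diff(1)[OF p1 Ioi_sets \<Phi>f f(1)] this]
 have "AE t in lebesgue_on {0<..}. \<Phi> f t = f t" by eventually_elim simp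
 then show ?thesis using GVU[OF f(1) fe] unfolding \<Phi>_def by blast
qed

definition fixed :: "'a \<Rightarrow> (real \<Rightarrow> 'a) \<Rightarrow> (real \<Rightarrow> 'a) \<Rightarrow> (real \<Rightarrow> 'b) \<Rightarrow> (real \<Rightarrow> 'a) \<Rightarrow> bool" where
 "fixed x f g v u \<longleftrightarrow> good x f g v u \<and> (AE t in lebesgue_on {0<..}. cut (psi u v) t = f t)"

text \<open>At two fixed points \<open>Phi_diff\<close> bounds the distance of the right-hand sides
  by half of itself plus half of the distance of the initial values. Absorbing the former leaves a
  linear problem whose data differ by at most 2 nX (x1 - x2) in total.\<close>

lemma fixed_lipschitz:
 assumes f1: "fixed x1 f1 g1 v1 u1" and f2: "fixed x2 f2 g2 v2 u2"
 shows "nLW (\<lambda>t. g1 t - g2 t) \<le> 2 * C * nX (x1 - x2)"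
  "nLW (\<lambda>t. v1 t - v2 t) \<le> 2 * C * nX (x1 - x2)"
proof -
 have g: "good x1 f1 g1 v1 u1" "good x2 f2 g2 v2 u2"
  and ae: "AE t in lebesgue_on {0<..}. cut (psi u1 v1) t = f1 t" "AE t in lebesgue_on {0<..}. cut (psi u2 v2) t = f2 t"
  using f1 f2 by (auto simp: fixed_def)
 have s: "csol f1 x1 g1 v1 u1" "csol f2 x2 g2 v2 u2" using g by (auto simp: good_def)
 have "AE t in lebesgue_on {0<..}. cut (psi u1 v1) t - cut (psi u2 v2) t = f1 t - f2 t" using ae by eventually_elim simp
 from wLp_cong_AE(2)[OF p1 Ioi_sets wLp_diff(1)[OF p1 Ioi_sets Phi_self(1)[OF g(1)] Phi_self(1)[OF g(2)]] this]
 have "nLW (\<lambda>t. f1 t - f2 t) \<le> (nLW (\<lambda>t. f1 t - f2 t) + nX (x1 - x2)) / 2" using Phi_diff[OF g] by simp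
 then have "nLW (\<lambda>t. f1 t - f2 t) + nX (x1 - x2) \<le> 2 * nX (x1 - x2)" by simp
 from mult_left_mono[OF this, of C] have le: "C * (nLW (\<lambda>t. f1 t - f2 t) + nX (x1 - x2)) \<le> 2 * C * nX (x1 - x2)"
  using C1 by simp
 note d = csol_constD(1,2)[OF C csol_diff[OF s]]
 show "nLW (\<lambda>t. g1 t - g2 t) \<le> 2 * C * nX (x1 - x2)" "nLW (\<lambda>t. v1 t - v2 t) \<le> 2 * C * nX (x1 - x2)"
  using d le by linarith+
qed

end

lemma wLp_small_near_0:
 assumes p: "p \<ge> 1" and f: "f \<in> wLp {0<..} p \<mu>" and e: "e > 0"
 shows "\<exists>d>0. \<forall>T\<le>d. wLp_norm {0<..<T} p \<mu> f < e"
proof -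
 define S where "S n = {0<..<1 / real (Suc n)}" for n
 have S: "S n \<in> sets lebesgue" "S n \<subseteq> {0<..}" for n by (auto simp: S_def)
 have "(\<lambda>n. wLp_norm (S n) p \<mu> f) \<longlonglongrightarrow> 0"
 proof (rule wLp_norm_vanish[OF p f S])
  show "AE t in lebesgue_on {0<..}. eventually (\<lambda>n. t \<notin> S n) sequentially"
  proof (rule AE_I2)
   fix t :: real assume "t \<in> space (lebesgue_on {0<..})"
   then have t: "0 < t" by simp
   have "(\<lambda>n. 1 / real (Suc n)) \<longlonglongrightarrow> 0" by (rule lim_const_over_n[THEN LIMSEQ_Suc])
   from order_tendstoD(2)[OF this t] show "eventually (\<lambda>n. t \<notin> S n) sequentially"
    by (rule eventually_mono) (simp add: S_def)
  qed
 qed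
 from order_tendstoD(2)[OF this e] obtain n where n: "wLp_norm (S n) p \<mu> f < e" by (auto simp: eventually_sequentially)
 have "wLp_norm {0<..<T} p \<mu> f < e" if "T \<le> 1 / real (Suc n)" for T
 proof -
  have sub: "{0<..<T} \<subseteq> S n" using that by (auto simp: S_def)
  have "wLp_norm {0<..<T} p \<mu> f \<le> wLp_norm (S n) p \<mu> f"
   by (rule wLp_subset(2)[OF p sub _ S(1) wLp_subset(1)[OF p S(2) S(1) _ f]]) auto
  then show ?thesis using n by linarith
 qed
 then show ?thesis by (intro exI[of _ "1 / real (Suc n)"]) auto
qed

lemma bint_L1:
 assumes J: "J \<subseteq> {0<..}" "J \<in> sets lebesgue" and f: "bint J f"
 shows "f \<in> Lp J 1"
proof -
 have "wint J 1 1 f = (\<integral>\<^sup>+t. ennreal (norm (f t)) \<partial>lebesgue_on J)"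
  unfolding wint_def by (rule nn_integral_cong) (use J(1) in auto)
 then show ?thesis using f J(2) by (simp add: wLp_iff bint_iff_nn_integral)
qed

section \<open>The class E1 and representations by a derivative and an X_1-valued function\<close>

context interpolation_pair
begin

text \<open>The requirement W^1_1 in the definition is met through Hoelder's inequality for g and
  continuity of u. The derivative selected in \<open>weak_derivative\<close> and the point
  \<open>inv j (u t)\<close> are identified almost everywhere with g and v.\<close>

lemma E1_intro:
 assumes T: "T > 0" and u: "prim 0 T g u" and g: "g \<in> wLp {0<..<T} p \<mu>" and v: "v \<in> wLp {0<..<T} p \<mu>"
  and uj: "AE t in lebesgue_on {0<..<T}. u t = j (v t)"
 shows "u \<in> E1 j p \<mu> T" "AE t in lebesgue_on {0<..<T}. weak_derivative {0<..<T} u t = g t"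
  "AE t in lebesgue_on {0<..<T}. inv j (u t) = v t"
proof -
 let ?J = "{0<..<T}"
 have J: "?J \<subseteq> {0<..}" "?J \<in> sets lebesgue" by auto
 obtain D where D: "D > 0" "\<And>b. norm (j b) \<le> norm b * D" using bounded_linear.pos_bounded[OF j(1)] by blast
 have D': "norm (j b) \<le> D * norm b" for b using D(2)[of b] by (simp add: mult.commute)
 have uc: "continuous_on ?J u" by (rule continuous_on_subset[OF prim_continuous_on[OF u]]) auto
 have wd: "has_weak_derivative ?J u g"
 proof (rule has_weak_derivativeI_prim)
  fix a b :: real assume ab: "a \<le> b" "{a..b} \<subseteq> ?J"
  then have "a \<in> ?J" "b \<in> ?J" by (auto intro!: subsetD[OF ab(2)])
  then show "prim a b g u" by (intro prim_sub[OF u]) auto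
 next
  show "?J \<noteq> {}" using T by simp
 qed auto
 have juw: "AE t in lebesgue_on ?J. j (v t) = u t" using uj by eventually_elim simp
 have uw: "u \<in> wLp ?J p \<mu>"
  by (rule wLp_cong_AE(1)[OF p1 J(2) wLp_linear(1)[OF p1 J(2) v j(1) D' less_imp_le[OF D(1)]] juw])
 have "bint ?J g" using wLp_bint(1)[OF p \<mu> T g] by (simp add: bint_interior)
 moreover have "bint ?J u" using bint_continuous[OF prim_continuous_on[OF u]] by (simp add: bint_interior)
 ultimately have "u \<in> Lp ?J 1" "g \<in> Lp ?J 1" by (auto intro: bint_L1 J)
 then have "u \<in> wH1 ?J p \<mu>" using wd uw g unfolding wH1_def W1_def by blast
 then show "u \<in> E1 j p \<mu> T" using uj v by (auto simp: E1_def wLp_emb_def)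
 show "AE t in lebesgue_on ?J. weak_derivative ?J u t = g t"
  by (rule weak_derivative_AE_eq[OF _ _ uc has_weak_derivative_some[OF wd] wd]) auto
 show "AE t in lebesgue_on ?J. inv j (u t) = v t"
  using uj by eventually_elim (simp add: j(2))
qed

text \<open>The weak derivative sees only the open interval: u minus the integral of g is constant
  there, and continuity of u on [0,T] extends this to the closed interval.\<close>

lemma E1_elim:
 assumes T: "T > 0" and u: "u \<in> E1 j p \<mu> T" and c: "continuous_on {0..T} u"
 obtains g v where "prim 0 T g u" "g \<in> wLp {0<..<T} p \<mu>" "v \<in> wLp {0<..<T} p \<mu>"
  "AE t in lebesgue_on {0<..<T}. u t = j (v t)" "AE t in lebesgue_on {0<..<T}. weak_derivative {0<..<T} u t = g t"
proof -
 let ?J = "{0<..<T}"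
 obtain g where g: "g \<in> wLp ?J p \<mu>" "has_weak_derivative ?J u g" using u by (auto simp: E1_def wH1_def)
 obtain v where v: "v \<in> wLp ?J p \<mu>" "AE t in lebesgue_on ?J. u t = j (v t)" using u by (auto simp: E1_def wLp_emb_def)
 have cJ: "continuous_on ?J u" by (rule continuous_on_subset[OF c]) auto
 have oJ: "open ?J" "is_interval ?J" by (auto simp: is_interval_1)
 have gb: "bint {0..T} g" by (rule wLp_bint(1)[OF p \<mu> T g(1)])
 define h where "h t = u t - integral {0..t} g" for t
 have hc: "continuous_on {0..T} h"
  unfolding h_def using prim_continuous_on[OF prim_integral[OF gb, where x=0]] by (intro continuous_intros c) simp
 have h_le: "h s = h t" if st: "s \<in> ?J" "t \<in> ?J" "s \<le> t" for s t
 proof -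
  have "prim s t g u" by (rule prim_if_has_weak_derivative[OF oJ cJ g(2) st(3)]) (use st in auto)
  then have "u t - u s = integral {s..t} g" using prim_diff_eq[of s t g u s t] st(3) by simp
  moreover have "integral {0..t} g - integral {0..s} g = integral {s..t} g"
   by (rule integral_diff_Icc[OF gb]) (use st in auto)
  ultimately have "u t - u s = integral {0..t} g - integral {0..s} g" by simp
  then show ?thesis by (simp add: h_def algebra_simps)
 qed
 have mid: "T / 2 \<in> ?J" using T by simp
 have h_const: "h t = h (T/2)" if "t \<in> ?J" for t
  using h_le[OF that mid] h_le[OF mid that] by (cases "t \<le> T/2") auto
 have cl: "closure ?J = {0..T}" using T by simp
 have const: "h t = h (T/2)" if t: "t \<in> {0..T}" for t
 proof (rule continuous_constant_on_closure[of ?J h])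
  show "continuous_on (closure ?J) h" using hc cl by simp
  show "t \<in> closure ?J" using t cl by simp
 qed (rule h_const)
 have pr: "prim 0 T g u"
 proof (rule primI[OF gb])
  fix t assume "0 \<le> t" "t \<le> T"
  then have "h t = h 0" using const[of t] const[of 0] T by simp
  then show "u t = u 0 + integral {0..t} g" by (simp add: h_def algebra_simps)
 qed
 have "AE t in lebesgue_on ?J. weak_derivative ?J u t = g t"
  by (rule weak_derivative_AE_eq[OF oJ cJ has_weak_derivative_some[OF g(2)] g(2)])
 then show thesis using that[OF pr g(1) v] by blast
qed

lemma E1_norm_le:
 obtains D where "D > 0" "\<And>T g v u. T > 0 \<Longrightarrow> prim 0 T g u \<Longrightarrow> g \<in> wLp {0<..<T} p \<mu> \<Longrightarrow> v \<in> wLp {0<..<T} p \<mu> \<Longrightarrow>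
  AE t in lebesgue_on {0<..<T}. u t = j (v t) \<Longrightarrow>
  E1_norm j p \<mu> T u \<le> D * wLp_norm {0<..<T} p \<mu> v + wLp_norm {0<..<T} p \<mu> g"
proof -
 obtain D where D: "D > 0" "\<And>b. norm (j b) \<le> norm b * D" using bounded_linear.pos_bounded[OF j(1)] by blast
 have D': "norm (j b) \<le> D * norm b" for b using D(2)[of b] by (simp add: mult.commute)
 have "E1_norm j p \<mu> T u \<le> (D + 1) * wLp_norm {0<..<T} p \<mu> v + wLp_norm {0<..<T} p \<mu> g"
  if T: "T > 0" and u: "prim 0 T g u" and g: "g \<in> wLp {0<..<T} p \<mu>" and v: "v \<in> wLp {0<..<T} p \<mu>"
   and uj: "AE t in lebesgue_on {0<..<T}. u t = j (v t)" for T g v u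
 proof -
  let ?J = "{0<..<T}"
  have J: "?J \<in> sets lebesgue" by simp
  note e = E1_intro[OF T u g v uj]
  note jv = wLp_linear[OF p1 J v j(1) D' less_imp_le[OF D(1)]]
  have ju: "AE t in lebesgue_on ?J. j (v t) = u t" using uj by eventually_elim simp
  have "wLp_norm ?J p \<mu> u \<le> D * wLp_norm ?J p \<mu> v" using jv(2) unfolding wLp_cong_AE(2)[OF p1 J jv(1) ju] .
  moreover have "AE t in lebesgue_on ?J. g t = weak_derivative ?J u t" using e(2) by eventually_elim simp
  then have "wLp_norm ?J p \<mu> (weak_derivative ?J u) = wLp_norm ?J p \<mu> g" by (rule wLp_cong_AE(2)[OF p1 J g])
  moreover have "AE t in lebesgue_on ?J. v t = inv j (u t)" using e(3) by eventually_elim simp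
  then have "wLp_norm ?J p \<mu> (\<lambda>t. inv j (u t)) = wLp_norm ?J p \<mu> v" by (rule wLp_cong_AE(2)[OF p1 J v])
  ultimately show ?thesis by (simp add: E1_norm_def wH1_norm_def distrib_right)
 qed
 moreover have "D + 1 > 0" using D(1) by simp
 ultimately show thesis using that by blast
qed

end

section \<open>Uniqueness among all solutions and well-posedness\<close>

context short_time
begin

text \<open>As long as a solution stays in the larger ball of radius \<open>3 * \<sigma>\<close>, its difference to the fixed
 point solves a linear problem whose right-hand side is bounded by a fraction of itself.\<close>

lemma fixed_unique_local:
 assumes fx: "fixed x f g v u" and t1: "0 < t1" "t1 \<le> T"
  and w: "prim 0 T gw w" "w 0 = x" "gw \<in> wLp {0<..<T} p \<mu>" "vw \<in> wLp {0<..<T} p \<mu>"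
  and wj: "AE t in lebesgue_on {0<..<T}. w t = j (vw t)"
  and weq: "AE t in lebesgue_on {0<..<T}. gw t + blinfun_apply (A (w t)) (vw t) = F (w t)"
  and wX: "Xcont T w" and near: "\<And>t. t \<in> {0..t1} \<Longrightarrow> nX (w t - u0) \<le> 3 * \<sigma>" and t: "t \<in> {0..t1}"
 shows "w t = u t"
proof -
 let ?J = "{0<..<t1}"
 have JT: "?J \<subseteq> {0<..<T}" using t1 by auto
 have J: "?J \<subseteq> {0<..}" "?J \<in> sets lebesgue" by auto
 have g: "good x f g v u" and fe: "AE t in lebesgue_on {0<..}. cut (psi u v) t = f t" using fx by (auto simp: fixed_def)
 have s: "csol f x g v u" using g by (simp add: good_def)
 note e = evolD[OF csolD(1)[OF s]] and gb = good_bounds[OF g]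
 note gwJ = wLp_subset(1)[OF p1 JT J(2) Ioo_lebesgue w(3)] and vwJ = wLp_subset(1)[OF p1 JT J(2) Ioo_lebesgue w(4)]
  and vJ = wLp_subset[OF p1 JT J(2) Ioo_lebesgue gb(2)]
 have wst: "stays t1 w" using Xcont_sub[OF wX t1(2)] near small(2) by (meson order_trans)
 have ust: "stays t1 u" using Xcont_sub[OF conjunct1[OF gb(4)] t1(2)] gb(4) t1(2) by auto
 have rr: "r \<ge> 0" using small(2) sigma_pos by linarith
 \<comment> \<open>Both right-hand sides are cut off at t1 and continued by zero. The half-line
   solutions for them agree with w and u on [0,t1], so the constant C applies on this shorter
   interval too.\<close>
 define hw where "hw t = (if t \<in> ?J then gw t + blinfun_apply (A u0) (vw t) else 0)" for t
 define hu where "hu t = (if t \<in> ?J then psi u v t else 0)" for t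
 have hw: "hw \<in> LW"
  unfolding hw_def wLp_restrict(1)[OF p1 J Ioi_sets] by (rule wLp_add(1)[OF p1 J(2) gwJ A0_Lp[OF vwJ p1 J(2)]])
 have hu: "hu \<in> LW"
  unfolding hu_def wLp_restrict(1)[OF p1 J Ioi_sets]
  by (rule psi_bound(1)[OF ust vJ(1) rr, of "2 * \<sigma>"]) (use gb(1) t1 sigma_pos in auto)
 obtain g1 v1 u1 where s1: "csol hw x g1 v1 u1" using csol_exists[OF hw csol_init[OF s]] by blast
 obtain g2 v2 u2 where s2: "csol hu x g2 v2 u2" using csol_exists[OF hu csol_init[OF s]] by blast
 have eqw: "AE t in lebesgue_on {0..t1}. gw t + blinfun_apply (A u0) (vw t) = hw t"
  unfolding AE_interior by (rule AE_I2) (simp add: hw_def)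
 have equ: "AE t in lebesgue_on {0..t1}. g t + blinfun_apply (A u0) (v t) = hu t"
  unfolding AE_interior
  using AE_lebesgue_on_subset[OF Ioi_sets J(2,1) csolD(3)[OF s]] AE_lebesgue_on_subset[OF Ioi_sets J(2,1) fe] AE_space
 proof eventually_elim
  case (elim t)
  then have "t \<in> ?J" by simp
  then have "hu t = cut (psi u v) t" using JT by (auto simp: hu_def cut_def)
  then show ?case using elim by simp
 qed
 have wjJ: "AE t in lebesgue_on {0..t1}. w t = j (vw t)"
  unfolding AE_interior by (rule AE_lebesgue_on_subset[OF Ioo_lebesgue J(2) JT wj])
 note q1 = csol_unique_on[OF s1 prim_sub[OF w(1) order_refl t1(2)] w(2) wLp_bint(1)[OF p \<mu> t1(1) vwJ] wjJ eqw]
 note q2 = csol_unique_on[OF s2 e(1) csolD(2)[OF s] wLp_bint_Icc[OF e(4)] AE_Icc_if_Ioi[OF e(2)] equ]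
 note d = csol_diff[OF s1 s2]
 define N where "N = nLW (\<lambda>t. hw t - hu t)"
 have N0: "N \<ge> 0" "C * N \<ge> 0" using C1 by (auto simp: N_def)
 have S: "nX (w t - u t) \<le> C * N" if "t \<in> {0..t1}" for t
  using csol_constD(3)[OF C d, of t] q1(1) q2(1) that by (simp add: N_def)
 have vd: "wLp_norm ?J p \<mu> (\<lambda>t. vw t - v t) \<le> C * N"
 proof -
  note vv = restrict_Ioo[OF evolD(4)[OF csolD(1)[OF d]], of t1]
  have "AE t in lebesgue_on ?J. v1 t - v2 t = vw t - v t"
   using q1(2)[unfolded AE_interior] q2(2)[unfolded AE_interior] by eventually_elim simp
  from wLp_cong_AE(2)[OF p1 J(2) vv(1) this] show ?thesis
   using vv(2) csol_constD(2)[OF C d] by (simp add: N_def)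
 qed
 have \<delta>: "nX (w t - u0) \<le> 3 * \<sigma>" if "t \<in> ?J" for t using near[of t] that by simp
 have s3: "3 * \<sigma> \<ge> 0" using sigma_pos by simp
 have S': "nX (w t - u t) \<le> C * N" if "t \<in> ?J" for t using S[of t] that by simp
 note pd = psi_diff[OF wst vwJ ust vJ(1) \<delta> s3 S' N0(2)]
 have ae: "AE t in lebesgue_on ?J. psi w vw t - psi u v t = hw t - hu t"
  using AE_lebesgue_on_subset[OF Ioo_lebesgue J(2) JT weq] AE_space
 proof eventually_elim
  case (elim t)
  then have "t \<in> ?J" by simp
  then show ?case using elim(1)[symmetric] by (simp add: hw_def hu_def psi_def algebra_simps)
 qed
 have "N = nLW (\<lambda>t. if t \<in> ?J then hw t - hu t else 0)"
  unfolding N_def by (rule arg_cong[where f="nLW"]) (auto simp: hw_def hu_def fun_eq_iff)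
 also have "\<dots> = wLp_norm ?J p \<mu> (\<lambda>t. hw t - hu t)" by (rule wLp_restrict(2)[OF p1 J Ioi_sets])
 also have "\<dots> = wLp_norm ?J p \<mu> (\<lambda>t. psi w vw t - psi u v t)" by (rule wLp_cong_AE(2)[OF p1 J(2) pd(1) ae])
 also have "\<dots> \<le> L * (C * N) * kap t1 + L * (3 * \<sigma>) * wLp_norm ?J p \<mu> (\<lambda>t. vw t - v t) + L * (C * N) * wLp_norm ?J p \<mu> v"
  by (rule pd(2))
 also have "\<dots> \<le> L * (C * N) * kap T + L * (3 * \<sigma>) * (C * N) + L * (C * N) * (2 * \<sigma>)"
  by (intro add_mono mult_left_mono vd order_trans[OF vJ(2) gb(3)] wLp_subset(2)[OF p1 JT J(2) Ioo_lebesgue const_wLp]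
   mult_nonneg_nonneg[OF L s3] mult_nonneg_nonneg[OF L N0(2)])
 \<comment> \<open>5 = 3 + 2: the radius 3\<sigma> in which w is known to stay and the bound
   2\<sigma> for v. The total factor 1/4 + 5/16 is below 1, which forces N = 0.\<close>
 also have "\<dots> = (L * C * kap T + 5 * (L * C * \<sigma>)) * N" by (simp add: algebra_simps)
 also have "\<dots> \<le> (1/4 + 5 * (1/16)) * N" using kap(1) small(1) N0 by (intro mult_right_mono add_mono mult_left_mono) auto
 finally have "N = 0" using N0 by simp
 then have "nX (w t - u t) = 0" using S[OF t] nX_nonneg[of "w t - u t"] by (simp del: nX_nonneg)
 moreover have "w t \<in> X" "u t \<in> X" using wst ust t by (auto simp: Xcont_def)
 ultimately show ?thesis using Metric_space.zero[OF Metric_space_interp] by blast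
qed

text \<open>A continuity argument removes the restriction to the ball: w starts strictly inside
  radius 3\<sigma>, and at the first time when it reaches that radius local uniqueness makes it
  equal to u, which is within 2\<sigma>.\<close>

lemma fixed_unique:
 assumes fx: "fixed x f g v u"
  and w: "prim 0 T gw w" "w 0 = x" "gw \<in> wLp {0<..<T} p \<mu>" "vw \<in> wLp {0<..<T} p \<mu>"
  and wj: "AE t in lebesgue_on {0<..<T}. w t = j (vw t)"
  and weq: "AE t in lebesgue_on {0<..<T}. gw t + blinfun_apply (A (w t)) (vw t) = F (w t)"
  and wX: "Xcont T w" and t: "t \<in> {0..T}"
 shows "w t = u t"
proof -
 note loc = fixed_unique_local[OF fx _ _ w wj weq wX]
 have g: "good x f g v u" using fx by (simp add: fixed_def)
 define \<eta> where "\<eta> t = nX (w t - u0)" for t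
 have X: "w t \<in> X" if "t \<in> {0..T}" for t using wX that by (auto simp: Xcont_def)
 have cont: "continuous_on {0..T} \<eta>"
  unfolding continuous_on_iff
 proof (intro ballI allI impI)
  fix t e :: real assume t: "t \<in> {0..T}" and e: "e > 0"
  then obtain d where d: "d > 0" "\<forall>s\<in>{0..T}. dist s t < d \<longrightarrow> nX (w t - w s) < e" using wX unfolding Xcont_def by blast
  have "dist (\<eta> s) (\<eta> t) < e" if s: "s \<in> {0..T}" "dist s t < d" for s
  proof -
   have "\<eta> s \<le> nX (w s - w t) + \<eta> t" "\<eta> t \<le> nX (w t - w s) + \<eta> s"
    unfolding \<eta>_def using Metric_space.triangle[OF Metric_space_interp] X[OF s(1)] X[OF t] u0 by blast+
   moreover have "nX (w t - w s) < e" using d(2) s by blast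
   ultimately show ?thesis using nX_commute[of "w s" "w t"] by (simp add: dist_real_def)
  qed
  then show "\<exists>d>0. \<forall>s\<in>{0..T}. dist s t < d \<longrightarrow> dist (\<eta> s) (\<eta> t) < e" using d(1) by blast
 qed
 have \<eta>0: "\<eta> 0 < 3 * \<sigma>"
 proof -
  have "\<eta> 0 \<le> \<epsilon>" using g w(2) by (simp add: \<eta>_def good_def)
  moreover have "1 * \<epsilon> \<le> C * \<epsilon>" using C1 eps by (intro mult_right_mono) auto
  ultimately show ?thesis using eps by linarith
 qed
 have never: "\<eta> t \<le> 3 * \<sigma>" if t: "t \<in> {0..T}" for t
 proof (rule ccontr)
  assume "\<not> \<eta> t \<le> 3 * \<sigma>"
  define E where "E = {s \<in> {0..T}. 3 * \<sigma> \<le> \<eta> s}"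
  have "closed E"
   unfolding E_def by (intro continuous_on_closed_Collect_le continuous_on_const cont closed_atLeastAtMost)
  moreover have "{0..T} \<inter> E = E" by (auto simp: E_def)
  ultimately have "compact E" using compact_Int_closed[OF compact_Icc, of E 0 T] by simp
  moreover have "E \<noteq> {}" using t \<open>\<not> \<eta> t \<le> 3 * \<sigma>\<close> unfolding E_def by force
  ultimately obtain t1 where t1: "t1 \<in> E" "\<And>s. s \<in> E \<Longrightarrow> t1 \<le> s" by (meson compact_attains_inf)
  then have t1T: "0 \<le> t1" "t1 \<le> T" "3 * \<sigma> \<le> \<eta> t1" by (auto simp: E_def)
  \<comment> \<open>By the intermediate value theorem the radius 3\<sigma> is attained exactly at
    the first time of \<open>E\<close>, so that w stays in the closed ball on the whole closed
    interval [0,t1].\<close>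
  obtain s where s: "0 \<le> s" "s \<le> t1" "\<eta> s = 3 * \<sigma>"
   using IVT'[of \<eta> 0 "3 * \<sigma>" t1] \<eta>0 t1T continuous_on_subset[OF cont, of "{0..t1}"] by auto
  then have "s \<in> E" using t1T by (auto simp: E_def)
  then have st: "s = t1" using t1(2)[of s] s by simp
  have pos: "0 < t1" using \<eta>0 t1T by (cases "t1 = 0") auto
  have near: "nX (w r - u0) \<le> 3 * \<sigma>" if r: "r \<in> {0..t1}" for r
  proof (cases "r = t1")
   case True
   then show ?thesis using s(3) st by (simp add: \<eta>_def)
  next
   case False
   then have "r \<notin> E" using t1(2)[of r] r by auto
   then show ?thesis using r t1T by (auto simp: E_def \<eta>_def)
  qed
  have "w t1 = u t1" by (rule loc[OF pos t1T(2) near]) (use pos in auto)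
  then have "\<eta> t1 \<le> 2 * \<sigma>" using good_bounds(1)[OF g, of t1] t1T by (simp add: \<eta>_def)
  then show False using t1T(3) sigma_pos by linarith
 qed
 show ?thesis by (rule loc[OF T order_refl _ t]) (use never in \<open>simp add: \<eta>_def\<close>)
qed

lemma fixed_quasilinear_solution:
 assumes V: "\<And>y. y \<in> X \<Longrightarrow> nX (y - u0) \<le> r \<Longrightarrow> y \<in> V" "V \<subseteq> X" and fx: "fixed x f g v u"
 shows "quasilinear_solution j p \<mu> V A F T x u"
proof -
 let ?J = "{0<..<T}"
 have gd: "good x f g v u" and fe: "AE t in lebesgue_on {0<..}. cut (psi u v) t = f t" using fx by (auto simp: fixed_def)
 have s: "csol f x g v u" using gd by (simp add: good_def)
 note e = evolD[OF csolD(1)[OF s]] and gb = good_bounds[OF gd]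
 have J: "?J \<subseteq> {0<..}" by auto
 have uj: "AE t in lebesgue_on ?J. u t = j (v t)" by (rule AE_lebesgue_on_subset[OF Ioi_sets Ioo_lebesgue J e(2)])
 note E = E1_intro[OF T e(1) restrict_Ioo(1)[OF e(3)] gb(2) uj]
 have "u ` {0..T} \<subseteq> V" using V(1) gb(4) by (auto simp: Xcont_def)
 then have "continuous_map (top_of_set {0..T}) (subtopology (interp_topology j (\<mu> - 1/p) p) V) u"
  using gb(4) unfolding continuous_map_interp[OF V(2)] Xcont_def by blast
 moreover have "AE t in lebesgue_on ?J. weak_derivative ?J u t + blinfun_apply (A (u t)) (inv j (u t)) = F (u t)"
  using E(2,3) AE_lebesgue_on_subset[OF Ioi_sets Ioo_lebesgue J csolD(3)[OF s]]
   AE_lebesgue_on_subset[OF Ioi_sets Ioo_lebesgue J fe] AE_space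
 proof eventually_elim
  case (elim t)
  then have "cut (psi u v) t = psi u v t" by (simp add: cut_def)
  then have "g t + blinfun_apply (A u0) (v t) = psi u v t" using elim(3,4) by simp
  then have "g t + blinfun_apply (A (u t)) (v t) = F (u t)" by (simp add: psi_def algebra_simps)
  then show ?case using elim(1,2) by simp
 qed
 ultimately show ?thesis using E(1) csolD(2)[OF s] by (simp add: quasilinear_solution_def)
qed

lemma quasilinear_solution_unique:
 assumes V: "V \<subseteq> X" and fx: "fixed x f g v u" and w: "quasilinear_solution j p \<mu> V A F T x w" and t: "t \<in> {0..T}"
 shows "w t = u t"
proof -
 let ?J = "{0<..<T}"
 have cm: "continuous_map (top_of_set {0..T}) (subtopology (interp_topology j (\<mu> - 1/p) p) V) w"
  and wE: "w \<in> E1 j p \<mu> T" and w0: "w 0 = x"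
  and weq: "AE t in lebesgue_on ?J. weak_derivative ?J w t + blinfun_apply (A (w t)) (inv j (w t)) = F (w t)"
  using w by (auto simp: quasilinear_solution_def)
 have wX: "Xcont T w" using cm V unfolding continuous_map_interp[OF V] Xcont_def by blast
 \<comment> \<open>The definition of a solution gives continuity in the interpolation space; its
   embedding into X_0 provides the continuity on which \<open>E1_elim\<close> relies.\<close>
 have "continuous_on {0..T} w"
  unfolding continuous_on_iff
 proof (intro ballI allI impI)
  obtain K where K: "K > 0" "\<And>x. x \<in> X \<Longrightarrow> norm x \<le> K * nX x" using norm_le_nX by blast
  fix t e :: real assume t: "t \<in> {0..T}" and e: "e > 0"
  have "e / K > 0" using e K(1) by simp
  then obtain d where d: "d > 0" "\<forall>s\<in>{0..T}. dist s t < d \<longrightarrow> nX (w t - w s) < e / K" using wX t unfolding Xcont_def by blast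
  have "dist (w s) (w t) < e" if s: "s \<in> {0..T}" "dist s t < d" for s
  proof -
   have "w t - w s \<in> X" using wX s t by (intro X_diff(1)) (auto simp: Xcont_def)
   then have "norm (w t - w s) \<le> K * nX (w t - w s)" by (rule K(2))
   also have "\<dots> < K * (e / K)" using d(2) s K(1) by (intro mult_strict_left_mono) auto
   finally show ?thesis using K(1) by (simp add: dist_norm norm_minus_commute)
  qed
  then show "\<exists>d>0. \<forall>s\<in>{0..T}. dist s t < d \<longrightarrow> dist (w s) (w t) < e" using d(1) by blast
 qed
 then obtain gw vw where gv: "prim 0 T gw w" "gw \<in> wLp ?J p \<mu>" "vw \<in> wLp ?J p \<mu>"
  "AE t in lebesgue_on ?J. w t = j (vw t)" "AE t in lebesgue_on ?J. weak_derivative ?J w t = gw t"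
  using E1_elim[OF T wE] by blast
 have eq: "AE t in lebesgue_on ?J. gw t + blinfun_apply (A (w t)) (vw t) = F (w t)"
  using weq gv(4,5)
 proof eventually_elim
  case (elim t)
  have "inv j (w t) = vw t" unfolding elim(2) by (rule inv_j)
  then show ?case using elim(1,3) by simp
 qed
 show ?thesis by (rule fixed_unique[OF fx gv(1) w0 gv(2,3,4) eq wX t])
qed

lemma fixed_E1_lipschitz:
 "\<exists>c>0. \<forall>x1 f1 g1 v1 u1 x2 f2 g2 v2 u2. fixed x1 f1 g1 v1 u1 \<longrightarrow> fixed x2 f2 g2 v2 u2 \<longrightarrow>
   E1_norm j p \<mu> T (\<lambda>t. u1 t - u2 t) \<le> c * nX (x1 - x2)"
proof -
 obtain D where D: "D > 0" "\<And>T g v u. T > 0 \<Longrightarrow> prim 0 T g u \<Longrightarrow> g \<in> wLp {0<..<T} p \<mu> \<Longrightarrow> v \<in> wLp {0<..<T} p \<mu> \<Longrightarrow>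
  AE t in lebesgue_on {0<..<T}. u t = j (v t) \<Longrightarrow>
  E1_norm j p \<mu> T u \<le> D * wLp_norm {0<..<T} p \<mu> v + wLp_norm {0<..<T} p \<mu> g" using E1_norm_le by blast
 show ?thesis
 proof (intro exI[of _ "D * (2 * C) + 2 * C"] conjI allI impI)
  show "D * (2 * C) + 2 * C > 0" using D(1) C1 by (simp add: add_pos_pos)
  fix x1 f1 g1 v1 u1 x2 f2 g2 v2 u2 assume f: "fixed x1 f1 g1 v1 u1" "fixed x2 f2 g2 v2 u2"
  then have s: "csol f1 x1 g1 v1 u1" "csol f2 x2 g2 v2 u2" by (auto simp: fixed_def good_def)
  note e = evolD[OF csolD(1)[OF csol_diff[OF s]]]
  have J: "{0<..<T} \<subseteq> {0<..}" by auto
  note g = restrict_Ioo[OF e(3), of T] and v = restrict_Ioo[OF e(4), of T]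
  note l = fixed_lipschitz[OF f]
  have "E1_norm j p \<mu> T (\<lambda>t. u1 t - u2 t) \<le> D * wLp_norm {0<..<T} p \<mu> (\<lambda>t. v1 t - v2 t) + wLp_norm {0<..<T} p \<mu> (\<lambda>t. g1 t - g2 t)"
   by (rule D(2)[OF T e(1) g(1) v(1) AE_lebesgue_on_subset[OF Ioi_sets Ioo_lebesgue J e(2)]])
  also have "\<dots> \<le> D * (2 * C * nX (x1 - x2)) + 2 * C * nX (x1 - x2)"
   using g(2) v(2) l D(1) by (intro add_mono mult_left_mono) auto
  finally show "E1_norm j p \<mu> T (\<lambda>t. u1 t - u2 t) \<le> (D * (2 * C) + 2 * C) * nX (x1 - x2)"
   by (simp add: algebra_simps)
 qed
qed

lemma well_posed:
 assumes V: "\<And>y. y \<in> X \<Longrightarrow> nX (y - u0) \<le> r \<Longrightarrow> y \<in> V" "V \<subseteq> X"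
 shows "\<exists>u. (\<forall>x \<in> interp_cball j (\<mu> - 1/p) p u0 \<epsilon>. quasilinear_solution j p \<mu> V A F T x (u x) \<and>
     (\<forall>w. quasilinear_solution j p \<mu> V A F T x w \<longrightarrow> (\<forall>t\<in>{0..T}. w t = u x t))) \<and>
   (\<exists>c>0. \<forall>x1 \<in> interp_cball j (\<mu> - 1/p) p u0 \<epsilon>. \<forall>x2 \<in> interp_cball j (\<mu> - 1/p) p u0 \<epsilon>.
     E1_norm j p \<mu> T (\<lambda>t. u x1 t - u x2 t) \<le> c * nX (x1 - x2))"
proof -
 let ?B = "interp_cball j (\<mu> - 1/p) p u0 \<epsilon>"
 have "\<exists>u f g v. fixed x f g v u" if "x \<in> ?B" for x
  using fixed_point[of x] that nX_commute[of u0 x] unfolding interp_cball_iff fixed_def by metis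
 then have "\<exists>u. \<forall>x\<in>?B. \<exists>f g v. fixed x f g v (u x)" by (intro bchoice ballI)
 then obtain u where u: "\<And>x. x \<in> ?B \<Longrightarrow> \<exists>f g v. fixed x f g v (u x)" by blast
 obtain c where c: "c > 0" "\<And>x1 f1 g1 v1 u1 x2 f2 g2 v2 u2. fixed x1 f1 g1 v1 u1 \<Longrightarrow> fixed x2 f2 g2 v2 u2 \<Longrightarrow>
   E1_norm j p \<mu> T (\<lambda>t. u1 t - u2 t) \<le> c * nX (x1 - x2)" using fixed_E1_lipschitz by blast
 show ?thesis
 proof (intro exI[of _ u] conjI ballI allI impI exI[of _ c])
  fix x assume "x \<in> ?B"
  then obtain f g v where fx: "fixed x f g v (u x)" using u by blast
  show "quasilinear_solution j p \<mu> V A F T x (u x)" by (rule fixed_quasilinear_solution[OF V fx])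
  show "w t = u x t" if "quasilinear_solution j p \<mu> V A F T x w" "t \<in> {0..T}" for w t
   by (rule quasilinear_solution_unique[OF V(2) fx that])
 next
  fix x1 x2 assume "x1 \<in> ?B" "x2 \<in> ?B"
  then obtain f1 g1 v1 f2 g2 v2 where "fixed x1 f1 g1 v1 (u x1)" "fixed x2 f2 g2 v2 (u x2)" using u by meson
  then show "E1_norm j p \<mu> T (\<lambda>t. u x1 t - u x2 t) \<le> c * nX (x1 - x2)" by (rule c(2))
 qed (rule c(1))
qed

end

section \<open>The choice of the constants\<close>

context quasilinear_setting
begin

text \<open>The order of choices avoids circularity: C belongs to the linear problem, \<epsilon>
  depends on r, L and C only, and T comes last, depending on \<epsilon>, F(u0) and the reference
  solution, which lives on the half-line and does not change with T.\<close>

lemma short_time_ex: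
 assumes r: "r > 0"
 shows "\<exists>C \<epsilon> T gs us vs. \<epsilon> \<le> r \<and> short_time j p \<mu> A u0 F r L C \<epsilon> T gs us vs"
proof -
 obtain C where C: "csol_const C" using csol_const_ex by blast
 have C1: "C \<ge> 1" using C by (simp add: csol_const_def)
 \<comment> \<open>The first entry gives 3 (2 C \<epsilon>) \<le> r, the second L C (2 C \<epsilon>)
   \<le> 1/16; L + 1 instead of L because L may be 0.\<close>
 define \<epsilon> where "\<epsilon> = min (r / (6 * C)) (1 / (32 * (L + 1) * (C * C)))"
 have eps: "\<epsilon> > 0" using r C1 L by (simp add: \<epsilon>_def)
 have "\<epsilon> * (6 * C) \<le> r / (6 * C) * (6 * C)" using C1 by (intro mult_right_mono) (auto simp: \<epsilon>_def)
 then have e1: "3 * (2 * C * \<epsilon>) \<le> r" using C1 by (simp add: mult_ac)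
 have CL: "0 < 32 * (L + 1) * (C * C)" using C1 L by simp
 have "\<epsilon> \<le> 1 / (32 * (L + 1) * (C * C))" by (simp only: \<epsilon>_def min.cobounded2)
 then have "\<epsilon> * (32 * (L + 1) * (C * C)) \<le> 1" unfolding pos_le_divide_eq[OF CL] .
 moreover have "\<epsilon> * (32 * L * (C * C)) \<le> \<epsilon> * (32 * (L + 1) * (C * C))"
  using eps by (intro mult_left_mono mult_right_mono) auto
 ultimately have e2: "L * C * (2 * C * \<epsilon>) \<le> 1/16" by (simp add: mult_ac)
 have "1 * \<epsilon> \<le> C * \<epsilon>" using C1 eps by (intro mult_right_mono) auto
 then have er: "\<epsilon> \<le> r" using e1 eps by linarith
 have \<sigma>: "2 * C * \<epsilon> > 0" using C1 eps by simp
 obtain gs vs us where ref: "csol (\<lambda>t. 0) u0 gs vs us" using csol_exists[OF wLp_zero(1)[OF p1] u0] by blast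
 obtain d1 where d1: "d1 > 0" "\<forall>t\<ge>0. \<bar>t - 0\<bar> < d1 \<longrightarrow> nX (us 0 - us t) < 2 * C * \<epsilon>"
  using trace_continuous[OF csolD(1)[OF ref] order_refl \<sigma>] by blast
 obtain d2 where d2: "d2 > 0" "\<forall>T\<le>d2. wLp_norm {0<..<T} p \<mu> vs < 2 * C * \<epsilon>"
  using wLp_small_near_0[OF p1 evolD(4)[OF csolD(1)[OF ref]] \<sigma>] by blast
 \<comment> \<open>The constant 1 may fail to belong to the weighted space on the half-line. Its
   truncation to (0,1) does belong, and has the same norm on (0,T) for T \<le> 1.\<close>
 define one where "one = (\<lambda>t::real. if t \<in> {0<..<1} then 1 else 0 :: real)"
 have one: "one \<in> LW"
  unfolding one_def by (subst wLp_restrict(1)[OF p1]) (auto simp: const_wLp)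
 define M where "M = norm (F u0) + L * (2 * (2 * C * \<epsilon>))"
 have M: "M \<ge> 0" using L \<sigma> by (simp add: M_def)
 have LC: "L * C \<ge> 0" using L C1 by simp
 define k where "k = min (1 / (4 * (L * C + 1))) (\<epsilon> / (2 * (M + 1)))"
 have k: "k > 0" using LC M eps by (simp add: k_def)
 obtain d3 where d3: "d3 > 0" "\<forall>T\<le>d3. wLp_norm {0<..<T} p \<mu> one < k"
  using wLp_small_near_0[OF p1 one k] by blast
 define T where "T = min (min (d1/2) d2) (min d3 1)"
 have T: "T > 0" "T < d1" "T \<le> d2" "T \<le> d3" "T \<le> 1" using d1(1) d2(1) d3(1) by (auto simp: T_def min_def)
 have "wint {0<..<T} p \<mu> one = wint {0<..<T} p \<mu> (\<lambda>t. 1::real)"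
  unfolding wint_def by (rule nn_integral_cong) (use T(5) in \<open>simp add: one_def\<close>)
 then have "kap T = wLp_norm {0<..<T} p \<mu> one" by (simp only: wLp_norm_wint)
 also have "\<dots> < k" using d3(2) T(4) by blast
 finally have kT: "kap T \<le> k" by simp
 have "(L * C) * kap T \<le> (L * C + 1) * (1 / (4 * (L * C + 1)))"
  using kT LC by (intro mult_mono) (auto simp: k_def)
 also have "\<dots> = 1/4" using LC by simp
 finally have kap1: "L * C * kap T \<le> 1/4" .
 have "kap T * M \<le> (\<epsilon> / (2 * (M + 1))) * (M + 1)"
  using kT M eps by (intro mult_mono) (auto simp: k_def)
 also have "\<dots> = \<epsilon> / 2" using M by (simp add: field_simps)
 finally have kap2: "kap T * M \<le> \<epsilon> / 2" .
 have "short_time j p \<mu> A u0 F r L C \<epsilon> T gs us vs"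
 proof (unfold_locales)
  show "nX (us t - u0) \<le> 2 * C * \<epsilon>" if "t \<in> {0..T}" for t
  proof -
   have "nX (us 0 - us t) < 2 * C * \<epsilon>" using d1(2)[rule_format, of t] that T(2) by auto
   then show ?thesis using csolD(2)[OF ref] nX_commute[of u0 "us t"] by simp
  qed
  show "wLp_norm {0<..<T} p \<mu> vs \<le> 2 * C * \<epsilon>" using d2(2) T(3) by (simp add: less_imp_le)
 qed (use C eps T(1) e1 e2 ref kap1 kap2 in \<open>simp_all add: M_def\<close>)
 then show ?thesis using er by blast
qed

end

theorem theorem2p1:
 fixes j :: "'b::banach \<Rightarrow> 'a::banach"
  and p \<mu> :: real
  and V :: "'a set"
  and u0 :: 'a
  and A :: "'a \<Rightarrow> 'b \<Rightarrow>\<^sub>L 'a"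
  and F :: "'a \<Rightarrow> 'a"
 assumes "1 < p"
  and "1 / p < \<mu>" and "\<mu> \<le> 1"
  and "dense_embedding j"
  and "openin (interp_topology j (\<mu> - 1 / p) p) V" and "V \<noteq> {}"
  and "u0 \<in> V"
  and "locally_Lipschitz_interp j (\<mu> - 1 / p) p V (\<lambda>v. (A v, F v))"
  and "maximal_regularity j p (blinfun_apply (A u0))"
 shows "\<exists>T>0. \<exists>\<epsilon>>0.
  interp_cball j (\<mu> - 1 / p) p u0 \<epsilon> \<subseteq> V \<and>
  (\<exists>u :: 'a \<Rightarrow> real \<Rightarrow> 'a.
   (\<forall>u1 \<in> interp_cball j (\<mu> - 1 / p) p u0 \<epsilon>.
     quasilinear_solution j p \<mu> V A F T u1 (u u1) \<and>
     (\<forall>w. quasilinear_solution j p \<mu> V A F T u1 w \<longrightarrow> (\<forall>t\<in>{0..T}. w t = u u1 t))) \<and>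
   (\<exists>c>0. \<forall>u1 \<in> interp_cball j (\<mu> - 1 / p) p u0 \<epsilon>. \<forall>u2 \<in> interp_cball j (\<mu> - 1 / p) p u0 \<epsilon>.
     E1_norm j p \<mu> T (\<lambda>t. u u1 t - u u2 t) \<le> c * interp_norm j (\<mu> - 1 / p) p (u1 - u2)))"
proof -
 have dj: "bounded_linear j" "inj j" using assms(4) by (auto simp: dense_embedding_def)
 interpret weighted_mr j p "blinfun_apply (A u0)" \<mu>
  by (intro weighted_mr.intro mr_setting.intro interpolation_pair.intro assms dj blinfun.bounded_linear_right)
 have V: "V \<subseteq> X" "\<exists>r>0. \<forall>y\<in>X. nX (u0 - y) < r \<longrightarrow> y \<in> V" using assms(5,7) unfolding openin_interp by blast+
 then obtain r1 where r1: "r1 > 0" "\<And>y. y \<in> X \<Longrightarrow> nX (u0 - y) < r1 \<Longrightarrow> y \<in> V" by blast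
 have u0: "u0 \<in> X" using V(1) assms(7) by blast
 obtain r2 L where r2: "r2 > 0" and lip: "\<And>x y. x \<in> V \<inter> interp_cball j (\<mu> - 1/p) p u0 r2 \<Longrightarrow>
   y \<in> V \<inter> interp_cball j (\<mu> - 1/p) p u0 r2 \<Longrightarrow> dist (A x, F x) (A y, F y) \<le> L * nX (x - y)"
  using assms(7,8) unfolding locally_Lipschitz_interp_def by meson
 \<comment> \<open>Openness of V gives an open ball of radius r1; halving makes the closed ball of
   radius r fit, while r2 is the radius of the Lipschitz estimate.\<close>
 define r where "r = min (r1 / 2) r2"
 have r: "r > 0" using r1(1) r2 by (simp add: r_def)
 have inV: "y \<in> V" if "y \<in> X" "nX (y - u0) \<le> r" for y
  using r1(2)[OF that(1)] r1(1) that(2) nX_commute[of y u0] by (simp add: r_def)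
 \<comment> \<open>The sign of L is left open by the hypothesis; \<open>max L 0\<close> is a
   nonnegative Lipschitz constant.\<close>
 have pair: "dist (A x, F x) (A y, F y) \<le> max L 0 * nX (x - y)"
  if "x \<in> X" "y \<in> X" "nX (x - u0) \<le> r" "nX (y - u0) \<le> r" for x y
 proof -
  have "x \<in> V \<inter> interp_cball j (\<mu> - 1/p) p u0 r2" "y \<in> V \<inter> interp_cball j (\<mu> - 1/p) p u0 r2"
   using inV that u0 nX_commute[of x u0] nX_commute[of y u0] by (auto simp: interp_cball_iff r_def)
  from lip[OF this] show ?thesis by (rule order_trans) (intro mult_right_mono, auto)
 qed
 interpret quasilinear_setting j p \<mu> A u0 F r "max L 0"
 proof
  fix x y assume xy: "x \<in> X" "y \<in> X" "nX (x - u0) \<le> r" "nX (y - u0) \<le> r"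
  show "dist (A x) (A y) \<le> max L 0 * nX (x - y)"
   using dist_fst_le[of "(A x, F x)" "(A y, F y)"] pair[OF xy] by simp
  show "dist (F x) (F y) \<le> max L 0 * nX (x - y)"
   using dist_snd_le[of "(A x, F x)" "(A y, F y)"] pair[OF xy] by simp
 qed (use u0 in auto)
 obtain C \<epsilon> T gs us vs where er: "\<epsilon> \<le> r" and st: "short_time j p \<mu> A u0 F r (max L 0) C \<epsilon> T gs us vs"
  using short_time_ex[OF r] by blast
 interpret st: short_time j p \<mu> A u0 F r "max L 0" C \<epsilon> T gs us vs by (rule st)
 have "interp_cball j (\<mu> - 1 / p) p u0 \<epsilon> \<subseteq> V"
  using inV er nX_commute[of u0] by (auto simp: interp_cball_iff)
 then show ?thesis using st.well_posed[OF inV V(1)] st.T st.eps by blast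
qed

end
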